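(* Let $S$ be a closed coisotropic submanifold of a Jacobi manifold, equipped with a fat tubular neighborhood, so that the ambient Jacobi manifold is identified with $(NS,L,J\equiv\{-,-\})$, $L=L_{NS}=\pi^*\ell$. Two formal coisotropic deformations $s_0(\varepsilon),s_1(\varepsilon)\in\Gamma(NS)[[\varepsilon]]$ of $S$ are Hamiltonian equivalent if and only if $-s_0(\varepsilon)$ and $-s_1(\varepsilon)$ are gauge equivalent solutions of the Maurer-Cartan equation $MC(\xi(\varepsilon)):=\sum_{k\ge1}\frac1{k!}\mathfrak m_k(\xi(\varepsilon),\dots,\xi(\varepsilon))=0$.
   Context: Everything is smooth. **Multi-differential operators.** For a line bundle $L\to M$, a derivation of $L$ is an $\mathbb R$-linear $\Delta:\Gamma(L)\to\Gamma(L)$ with $\Delta(f\lambda)=\sigma(\Delta)(f)\lambda+f\Delta\lambda$ for a vector field $\sigma(\Delta)$, its symbol. $J^1L$ is the first jet bundle, $J_1L:=(J^1L)^*$. $\mathcal D^kL:=\Gamma(\wedge^kJ_1L\otimes L)$ is the space of alternating maps $\Gamma(L)^k\to\Gamma(L)$ that are first order differential operators in each entry, equivalently of $L$-valued alternating $k$-forms on $J^1L$; $\mathcal D^0L=\Gamma(L)$, $\mathcal D^1L=\mathcal DL$ the derivations. Elements of $\mathcal D^kL$ have degree $k-1$ in $(\mathcal D^\bullet L)[1]$. The Schouten-Jacobi bracket is $[\square,\square']^{SJ}:=(-1)^{kk'}\square\circ\square'-\square'\circ\square$ for $\square\in\mathcal D^{k+1}L$, $\square'\in\mathcal D^{k'+1}L$,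 where $(\square\circ\square')(\lambda_1,\dots,\lambda_{k+k'+1})=\sum_{\tau\in S_{k'+1,k}}(-1)^\tau\square(\square'(\lambda_{\tau(1)},\dots,\lambda_{\tau(k'+1)}),\lambda_{\tau(k'+2)},\dots,\lambda_{\tau(k+k'+1)})$ (sum over unshuffles). **Jacobi manifolds.** A Jacobi manifold $(M,L,J\equiv\{-,-\})$ is a manifold with a line bundle $L$ and a Lie bracket on $\Gamma(L)$ that is a first order differential operator in each entry; $J\in\mathcal D^2L$ denotes the bracket; $\Delta_\lambda:=\{\lambda,-\}\in\mathcal DL$, with symbol $X_\lambda$. A submanifold $S$ is coisotropic if $\Lambda_J^\#(T^0S\otimes L)\subset TS$, where $\Lambda_J^\#(df\otimes\lambda)=X_{f\lambda}-fX_\lambda$ and $T^0S$ is the annihilator of $TS$. **Normal data.** $\ell=L|_S$, $NS=TM|_S/TS$ with projection $\pi:NS\to S$, $N_\ell S=NS\otimes\ell^*$, $N_\ell{}^*S=N^*S\otimes\ell$, embedded in $J^1L|_S$ by $\gamma(df\otimes\lambda)=j^1(f\lambda)-fj^1\lambda$. $P:(\mathcal D^\bullet L)[1]\to\Gamma(\wedge^\bullet N_\ell S\otimes\ell)[1]$ sends $\square\in\mathcal D^kL$ to the restriction to $S$ of the $k$-form $\square$, pulled back along $\gamma:N_\ell{}^*S\to J^1L|_S$ (here $\Gamma(\wedge^kN_\ell S\otimes\ell)$ = $\ell$-valued alternating $k$-forms on $N_\ell{}^*S$; it is $\Gamma(\ell)$ for $k=0$ and $\Gamma(NS)$ for $k=1$).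 A fat tubular neighborhood is a line bundle embedding $\tau:L_{NS}:=\pi^*\ell\hookrightarrow L$ covering a tubular neighborhood $NS\hookrightarrow M$ and restricting to the inclusion $\ell\hookrightarrow L$ over the zero section; via $\tau$ one replaces $(M,L,J)$ by the induced Jacobi structure $(L=L_{NS},J)$ on $NS$, with $S$ the zero section. **The map $I$ and the $L_\infty$-algebra.** For $\nu\in\Gamma(NS)$, $\pi^*\nu$ is the corresponding fiberwise constant vertical vector field; $\mathbb D$ is the flat connection in $L=\pi^*\ell$ along vertical vector fields with $\mathbb D_X\pi^*\lambda=0$, $\lambda\in\Gamma(\ell)$. Put $I(\nu)=\mathbb D_{\pi^*\nu}$, $I_0(\nu\otimes\varphi)=I(\nu)\otimes\pi^*\varphi$ ($\varphi\in\Gamma(\ell^* )$), $I(\lambda)=\pi^*\lambda$, $I(\xi_1\wedge\dots\wedge\xi_k\otimes\lambda)=I_0(\xi_1)\wedge\dots\wedge I_0(\xi_k)\otimes\pi^*\lambda$. Then $\mathfrak m_k(\xi_1,\dots,\xi_k):=P[\cdots[[J,I(\xi_1)]^{SJ},I(\xi_2)]^{SJ}\cdots,I(\xi_k)]^{SJ}$, extended $\mathbb R[[\varepsilon]]$-multilinearly. **Formal deformations.** A formal deformation of $S$ is $s(\varepsilon)=\sum_{i\ge0}\varepsilon^is_i\in\Gamma(NS)[[\varepsilon]]$ with $s_0=0$; $I(s(\varepsilon))=\sum_i\varepsilon^iI(s_i)$, $\mathcal L_{\xi(\varepsilon)}=[\xi(\varepsilon),-]^{SJ}$, $\exp\mathcal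 L_{\xi(\varepsilon)}=\sum_n\frac1{n!}\mathcal L_{\xi(\varepsilon)}^n$. It is coisotropic if $P(\exp\mathcal L_{I(s(\varepsilon))}J)=0$. **Equivalences.** Formal coisotropic deformations $s_0(\varepsilon),s_1(\varepsilon)$ are Hamiltonian equivalent if they are interpolated by a smooth family of formal coisotropic deformations $s_t(\varepsilon)$, $t\in[0,1]$ (coefficients depend smoothly on $t$), and there is a smooth family $\lambda_t(\varepsilon)\in\Gamma(L)[[\varepsilon]]$ with $\frac{d}{dt}s_t(\varepsilon)=P(\exp\mathcal L_{I(s_t(\varepsilon))}\Delta_{\lambda_t(\varepsilon)})$. Solutions $\xi_0(\varepsilon),\xi_1(\varepsilon)$ of the Maurer-Cartan equation are gauge equivalent if they are interpolated by a smooth family $\xi_t(\varepsilon)\in\Gamma(NS)[[\varepsilon]]$ (with zero constant term) and there is a smooth family $\lambda_t(\varepsilon)\in\Gamma(\ell)[[\varepsilon]]$ with $\frac{d}{dt}\xi_t(\varepsilon)=\sum_{k\ge0}\frac1{k!}\mathfrak m_{k+1}(\xi_t(\varepsilon),\dots,\xi_t(\varepsilon),\lambda_t(\varepsilon))$. *)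

theory Defs
  imports "HOL-Analysis.Analysis" "HOL-Combinatorics.Permutations"
begin

section \<open>Smooth functions on subsets of \<open>\<real>\<^sup>n\<close>\<close>

text \<open>
  Dimensions are natural numbers (dimension and rank 0 are allowed): \<open>\<real>\<^sup>n\<close> is the set of real
  sequences supported in \<open>{..<n}\<close>, and its usual topology is the one induced by the product
  topology of \<^typ>\<open>nat \<Rightarrow> real\<close>.
\<close>

definition Rn :: "nat \<Rightarrow> (nat \<Rightarrow> real) set" where
  "Rn n = {x. \<forall>i\<ge>n. x i = 0}"

text \<open>
  \<open>F js\<close> is the iterated partial derivative along the list \<open>js\<close> of coordinate directions. For open
  \<open>D\<close> this is the usual notion of a smooth function. The derivatives are taken within \<open>D\<close>, so that
  \<open>D = [0,1] \<times> U\<close> is also allowed (one-sided derivatives at the two ends of \<open>[0,1]\<close>).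
\<close>

definition smooth_on :: "nat \<Rightarrow> (nat \<Rightarrow> real) set \<Rightarrow> ((nat \<Rightarrow> real) \<Rightarrow> real) \<Rightarrow> bool" where
  "smooth_on n D f \<longleftrightarrow> (\<exists>F :: nat list \<Rightarrow> (nat \<Rightarrow> real) \<Rightarrow> real.
     (\<forall>x\<in>D. F [] x = f x) \<and>
     (\<forall>js. set js \<subseteq> {..<n} \<longrightarrow> continuous_on D (F js) \<and>
        (\<forall>i<n. \<forall>x\<in>D. ((\<lambda>t. F js (x(i := t))) has_real_derivative F (i # js) x)
           (at (x i) within {t. x(i := t) \<in> D}))))"


section \<open>Manifolds and vector bundles\<close>

record 'p mfd =
  pts :: "'p set"
  mdim :: nat
  charts :: "('p set \<times> ('p \<Rightarrow> nat \<Rightarrow> real)) set"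

definition mfd_open :: "'p mfd \<Rightarrow> 'p set \<Rightarrow> bool" where
  "mfd_open M W \<longleftrightarrow> W \<subseteq> pts M \<and>
     (\<forall>(U,\<phi>)\<in>charts M. openin (top_of_set (Rn (mdim M))) (\<phi> ` (W \<inter> U)))"

definition mfd_topology :: "'p mfd \<Rightarrow> 'p topology" where
  "mfd_topology M = topology (mfd_open M)"

definition smooth_fun_on :: "'p mfd \<Rightarrow> 'p set \<Rightarrow> ('p \<Rightarrow> real) \<Rightarrow> bool" where
  "smooth_fun_on M W f \<longleftrightarrow>
     (\<forall>(U,\<phi>)\<in>charts M. smooth_on (mdim M) (\<phi> ` (U \<inter> W)) (\<lambda>y. f (inv_into U \<phi> y)))"

definition smooth_manifold :: "'p mfd \<Rightarrow> bool" where
  "smooth_manifold M \<longleftrightarrow>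
     (\<Union>(U,\<phi>)\<in>charts M. U) = pts M \<and>
     (\<forall>(U,\<phi>)\<in>charts M. inj_on \<phi> U \<and> openin (top_of_set (Rn (mdim M))) (\<phi> ` U)) \<and>
     (\<forall>(U,\<phi>)\<in>charts M. \<forall>(V,\<psi>)\<in>charts M.
        openin (top_of_set (Rn (mdim M))) (\<phi> ` (U \<inter> V)) \<and>
        (\<forall>i<mdim M. smooth_on (mdim M) (\<phi> ` (U \<inter> V)) (\<lambda>y. \<psi> (inv_into U \<phi> y) i))) \<and>
     Hausdorff_space (mfd_topology M) \<and> second_countable (mfd_topology M)"

text \<open>
  Functions and sections vanish off the manifold, so that they are equal iff they agree on it.
\<close>

definition smooth_funs :: "'p mfd \<Rightarrow> ('p \<Rightarrow> real) set" where
  "smooth_funs M = {f. smooth_fun_on M (pts M) f \<and> (\<forall>p. p \<notin> pts M \<longrightarrow> f p = 0)}"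

text \<open>
  The fibres of a vector bundle are linear subspaces of some real vector space \<^typ>\<open>'v\<close>. This is no
  restriction, since no relation between the smooth structure of the bundle (given by its local
  frames) and the ambient space \<^typ>\<open>'v\<close> is required. The norm of \<^typ>\<open>'v\<close> only serves to
  differentiate curves in a single fibre, which is finite-dimensional, so its choice is irrelevant.
\<close>

record ('p, 'v) vbun =
  fib :: "'p \<Rightarrow> 'v set"
  rk :: nat
  frames :: "('p set \<times> (nat \<Rightarrow> 'p \<Rightarrow> 'v)) set"

definition crd :: "nat \<Rightarrow> (nat \<Rightarrow> 'p \<Rightarrow> 'v::real_vector) \<Rightarrow> 'p \<Rightarrow> 'v \<Rightarrow> nat \<Rightarrow> real" where
  "crd r e x v = (THE c. c \<in> Rn r \<and> v = (\<Sum>i<r. c i *\<^sub>R e i x))"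

definition vector_bundle :: "'p mfd \<Rightarrow> ('p, 'v::real_vector) vbun \<Rightarrow> bool" where
  "vector_bundle M E \<longleftrightarrow>
     (\<forall>x\<in>pts M. subspace (fib E x)) \<and>
     (\<Union>(W,e)\<in>frames E. W) = pts M \<and>
     (\<forall>(W,e)\<in>frames E. openin (mfd_topology M) W \<and>
        (\<forall>x\<in>W. (\<forall>i<rk E. e i x \<in> fib E x) \<and>
           (\<forall>v\<in>fib E x. \<exists>!c. c \<in> Rn (rk E) \<and> v = (\<Sum>i<rk E. c i *\<^sub>R e i x)))) \<and>
     (\<forall>(W,e)\<in>frames E. \<forall>(W',e')\<in>frames E. \<forall>i<rk E. \<forall>j<rk E.
        smooth_fun_on M (W \<inter> W') (\<lambda>x. crd (rk E) e x (e' j x) i))"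

definition line_bundle :: "'p mfd \<Rightarrow> ('p, 'v::real_vector) vbun \<Rightarrow> bool" where
  "line_bundle M E \<longleftrightarrow> vector_bundle M E \<and> rk E = 1"

definition sections :: "'p mfd \<Rightarrow> ('p, 'v::real_vector) vbun \<Rightarrow> ('p \<Rightarrow> 'v) set" where
  "sections M E = {s. (\<forall>x\<in>pts M. s x \<in> fib E x) \<and> (\<forall>x. x \<notin> pts M \<longrightarrow> s x = 0) \<and>
     (\<forall>(W,e)\<in>frames E. \<forall>i<rk E. smooth_fun_on M W (\<lambda>x. crd (rk E) e x (s x) i))}"

text \<open>
  Families of sections smooth in \<open>(t,x) \<in> [0,1] \<times> M\<close>; in the local expressions the parameter is
  coordinate 0.
\<close>

definition smooth_family ::
    "'p mfd \<Rightarrow> ('p, 'v::real_vector) vbun \<Rightarrow> (real \<Rightarrow> 'p \<Rightarrow> 'v) \<Rightarrow> bool" where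
  "smooth_family M E s \<longleftrightarrow> (\<forall>t\<in>{0..1}. s t \<in> sections M E) \<and>
     (\<forall>(U,\<phi>)\<in>charts M. \<forall>(W,e)\<in>frames E. \<forall>i<rk E.
        smooth_on (Suc (mdim M))
          {z \<in> Rn (Suc (mdim M)). z 0 \<in> {0..1} \<and> (\<lambda>j. z (Suc j)) \<in> \<phi> ` (U \<inter> W)}
          (\<lambda>z. let x = inv_into U \<phi> (\<lambda>j. z (Suc j)) in crd (rk E) e x (s (z 0) x) i))"

definition total_space :: "'p mfd \<Rightarrow> ('p, 'v::real_vector) vbun \<Rightarrow> ('p \<times> 'v) mfd" where
  "total_space S N = \<lparr> pts = {(x,v). x \<in> pts S \<and> v \<in> fib N x},
     mdim = mdim S + rk N,
     charts = {({(x,v). x \<in> U \<inter> W \<and> v \<in> fib N x},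
                \<lambda>(x,v) i. if i < mdim S then \<phi> x i else crd (rk N) e x v (i - mdim S))
               | U \<phi> W e. (U,\<phi>) \<in> charts S \<and> (W,e) \<in> frames N} \<rparr>"

text \<open>The pull-back of the bundle \<open>l\<close> along the projection of the total space of \<open>N\<close>.\<close>

definition pullback ::
    "('p, 'v) vbun \<Rightarrow> ('p, 'w) vbun \<Rightarrow> ('p \<times> 'v, 'w) vbun" where
  "pullback N l = \<lparr> fib = (\<lambda>(x,v). fib l x), rk = rk l,
     frames = {({(x,v). x \<in> W \<and> v \<in> fib N x}, \<lambda>i (x,v). e i x) | W e. (W,e) \<in> frames l} \<rparr>"

text \<open>Tangent vectors are point derivations.\<close>

definition tangent_space :: "'p mfd \<Rightarrow> 'p \<Rightarrow> (('p \<Rightarrow> real) \<Rightarrow> real) set" where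
  "tangent_space M p = {v.
     (\<forall>f\<in>smooth_funs M. \<forall>g\<in>smooth_funs M. \<forall>a b.
        v (\<lambda>q. a * f q + b * g q) = a * v f + b * v g) \<and>
     (\<forall>f\<in>smooth_funs M. \<forall>g\<in>smooth_funs M. v (\<lambda>q. f q * g q) = v f * g p + f p * v g)}"


section \<open>Multi-differential operators and the Schouten-Jacobi bracket\<close>

definition first_order_op ::
    "'p mfd \<Rightarrow> ('p, 'w::real_vector) vbun \<Rightarrow> (('p \<Rightarrow> 'w) \<Rightarrow> 'p \<Rightarrow> 'w) \<Rightarrow> bool" where
  "first_order_op M L D \<longleftrightarrow>
     (\<forall>\<mu>\<in>sections M L. D \<mu> \<in> sections M L) \<and>
     (\<forall>\<mu>\<in>sections M L. \<forall>\<nu>\<in>sections M L. \<forall>a b.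
        D (\<lambda>p. a *\<^sub>R \<mu> p + b *\<^sub>R \<nu> p) = (\<lambda>p. a *\<^sub>R D \<mu> p + b *\<^sub>R D \<nu> p)) \<and>
     (\<comment> \<open>order at most one: the iterated commutator \<open>[[D,f],g]\<close> vanishes\<close>
      \<forall>f\<in>smooth_funs M. \<forall>g\<in>smooth_funs M. \<forall>\<mu>\<in>sections M L. \<forall>p.
        D (\<lambda>q. (f q * g q) *\<^sub>R \<mu> q) p - f p *\<^sub>R D (\<lambda>q. g q *\<^sub>R \<mu> q) p
          - g p *\<^sub>R D (\<lambda>q. f q *\<^sub>R \<mu> q) p + (f p * g p) *\<^sub>R D \<mu> p = 0)"

text \<open>
  Operators of arity \<open>k\<close> take a list of \<open>k\<close> sections; an operator of arity 0 is identified with its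
  value on the empty list, a section.
\<close>

type_synonym ('m, 'w) mop = "('m \<Rightarrow> 'w) list \<Rightarrow> 'm \<Rightarrow> 'w"

definition multidiff_ops ::
    "'m mfd \<Rightarrow> ('m, 'w::real_vector) vbun \<Rightarrow> nat \<Rightarrow> ('m, 'w) mop set" where
  "multidiff_ops M L k = {Q.
     \<forall>\<mu>s. length \<mu>s = k \<and> set \<mu>s \<subseteq> sections M L \<longrightarrow>
       Q \<mu>s \<in> sections M L \<and>
       (\<forall>i<k. first_order_op M L (\<lambda>\<mu>. Q (\<mu>s[i := \<mu>]))) \<and>
       (\<forall>i<k. \<forall>j<k. i \<noteq> j \<and> \<mu>s ! i = \<mu>s ! j \<longrightarrow> Q \<mu>s = (\<lambda>p. 0))}"

definition unshuffles :: "nat \<Rightarrow> nat \<Rightarrow> (nat \<Rightarrow> nat) set" where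
  "unshuffles a b = {\<tau>. \<tau> permutes {..<a+b} \<and> strict_mono_on {..<a} \<tau> \<and> strict_mono_on {a..<a+b} \<tau>}"

text \<open>
  \<open>mop_comp a b Q Q'\<close> is \<open>Q \<circ> Q'\<close> and \<open>SJ a b Q Q'\<close> is \<open>[Q,Q']\<close>, for \<open>Q\<close> of arity \<open>a\<close> and \<open>Q'\<close> of
  arity \<open>b\<close>, i.e. of degrees \<open>a - 1\<close> and \<open>b - 1\<close> (which may be \<open>-1\<close>). A section (\<open>a = 0\<close>) has no
  entry to insert \<open>Q'\<close> into.
\<close>

definition mop_comp ::
    "nat \<Rightarrow> nat \<Rightarrow> ('m, 'w::real_vector) mop \<Rightarrow> ('m, 'w) mop \<Rightarrow> ('m, 'w) mop" where
  "mop_comp a b Q Q' = (\<lambda>\<mu>s p. if a = 0 then 0 else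
     (\<Sum>\<tau>\<in>unshuffles b (a - 1). of_int (sign \<tau>) *\<^sub>R
        Q (Q' (map (\<lambda>i. \<mu>s ! \<tau> i) [0..<b]) # map (\<lambda>i. \<mu>s ! \<tau> i) [b..<b + (a - 1)]) p))"

definition SJ ::
    "nat \<Rightarrow> nat \<Rightarrow> ('m, 'w::real_vector) mop \<Rightarrow> ('m, 'w) mop \<Rightarrow> ('m, 'w) mop" where
  "SJ a b Q Q' = (\<lambda>\<mu>s p.
     ((-1) powi ((int a - 1) * (int b - 1))) *\<^sub>R mop_comp a b Q Q' \<mu>s p - mop_comp b a Q' Q \<mu>s p)"


section \<open>Jacobi structures and coisotropic zero sections\<close>

definition jacobi_structure ::
    "'m mfd \<Rightarrow> ('m, 'w::real_vector) vbun \<Rightarrow> ('m, 'w) mop \<Rightarrow> bool" where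
  "jacobi_structure M L J \<longleftrightarrow> J \<in> multidiff_ops M L 2 \<and>
     (\<forall>\<eta>\<in>sections M L. \<forall>\<mu>\<in>sections M L. \<forall>\<nu>\<in>sections M L. \<forall>p.
        J [\<eta>, J [\<mu>, \<nu>]] p + J [\<mu>, J [\<nu>, \<eta>]] p + J [\<nu>, J [\<eta>, \<mu>]] p = 0)"

definition ham_der :: "('m, 'w) mop \<Rightarrow> ('m \<Rightarrow> 'w) \<Rightarrow> ('m, 'w) mop" where
  "ham_der J \<eta> = (\<lambda>\<mu>s. J [\<eta>, hd \<mu>s])"

definition symbol_at ::
    "'m mfd \<Rightarrow> ('m, 'w::real_vector) vbun \<Rightarrow> (('m \<Rightarrow> 'w) \<Rightarrow> 'm \<Rightarrow> 'w) \<Rightarrow> 'm \<Rightarrow> ('m \<Rightarrow> real) \<Rightarrow> real"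
  where "symbol_at M L \<Delta> p f =
     (THE a. \<forall>\<mu>\<in>sections M L. \<Delta> (\<lambda>q. f q *\<^sub>R \<mu> q) p = a *\<^sub>R \<mu> p + f p *\<^sub>R \<Delta> \<mu> p)"

definition ham_vf ::
    "'m mfd \<Rightarrow> ('m, 'w::real_vector) vbun \<Rightarrow> ('m, 'w) mop \<Rightarrow> ('m \<Rightarrow> 'w) \<Rightarrow> 'm \<Rightarrow> ('m \<Rightarrow> real) \<Rightarrow> real"
  where "ham_vf M L J \<eta> = symbol_at M L (\<lambda>\<mu>. J [\<eta>, \<mu>])"

text \<open>
  From here on, \<open>S\<close> is a manifold, \<open>N\<close> a vector bundle and \<open>l\<close> a line bundle over \<open>S\<close>. The ambient
  manifold is the total space of \<open>N\<close>, with the line bundle \<open>pullback N l\<close>, and \<open>S\<close> sits in it as the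
  zero section; the normal bundle of the zero section is \<open>N\<close> itself, its fibres being identified with
  the vertical tangent spaces. \<open>tangent_zero S N x\<close> is the tangent space of the zero section, as a
  subspace of the tangent space at \<open>(x,0)\<close> of the ambient manifold.
\<close>

definition tangent_zero ::
    "'p mfd \<Rightarrow> ('p, 'v::real_vector) vbun \<Rightarrow> 'p \<Rightarrow> (('p \<times> 'v \<Rightarrow> real) \<Rightarrow> real) set" where
  "tangent_zero S N x = {v \<in> tangent_space (total_space S N) (x, 0).
     \<exists>w\<in>tangent_space S x. \<forall>g\<in>smooth_funs (total_space S N). v g = w (\<lambda>y. g (y, 0))}"

text \<open>The functions whose differential at \<open>(x,0)\<close> annihilates the tangent space of the zero section.\<close>

definition annihilating ::
    "'p mfd \<Rightarrow> ('p, 'v::real_vector) vbun \<Rightarrow> 'p \<Rightarrow> ('p \<times> 'v \<Rightarrow> real) set" where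
  "annihilating S N x =
     {f \<in> smooth_funs (total_space S N). \<forall>v\<in>tangent_zero S N x. v f = 0}"

text \<open>
  Every element of the annihilator tensor the fibre of \<open>L\<close>, at a point, is of the form
  \<open>df \<otimes> \<eta>\<close> because \<open>L\<close> has rank one.
\<close>

definition coisotropic_zero_section ::
    "'p mfd \<Rightarrow> ('p, 'v::real_vector) vbun \<Rightarrow> ('p, 'w::real_vector) vbun \<Rightarrow> ('p \<times> 'v, 'w) mop \<Rightarrow> bool"
  where "coisotropic_zero_section S N l J \<longleftrightarrow>
    (let M = total_space S N; L = pullback N l in
     \<forall>x\<in>pts S. \<forall>f\<in>annihilating S N x. \<forall>\<eta>\<in>sections M L.
       (\<lambda>g. ham_vf M L J (\<lambda>q. f q *\<^sub>R \<eta> q) (x,0) g - f (x,0) * ham_vf M L J \<eta> (x,0) g)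
         \<in> tangent_zero S N x)"


section \<open>The projection \<open>P\<close>\<close>

text \<open>One-jets of sections of \<open>L\<close> at \<open>p\<close>, as equivalence classes of global sections.\<close>

definition same_jet1 ::
    "'m mfd \<Rightarrow> ('m, 'w::real_vector) vbun \<Rightarrow> 'm \<Rightarrow> ('m \<Rightarrow> 'w) \<Rightarrow> ('m \<Rightarrow> 'w) \<Rightarrow> bool" where
  "same_jet1 M L p \<eta> \<mu> \<longleftrightarrow>
     (\<forall>(U,\<phi>)\<in>charts M. \<forall>(W,e)\<in>frames L. p \<in> U \<inter> W \<longrightarrow> (\<forall>i<rk L.
        let c = (\<lambda>y. let q = inv_into U \<phi> y in crd (rk L) e q (\<mu> q - \<eta> q) i) in
        c (\<phi> p) = 0 \<and>
        (\<forall>j<mdim M. ((\<lambda>t. c ((\<phi> p)(j := t))) has_real_derivative 0) (at (\<phi> p j)))))"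

definition jet1 ::
    "'m mfd \<Rightarrow> ('m, 'w::real_vector) vbun \<Rightarrow> 'm \<Rightarrow> ('m \<Rightarrow> 'w) \<Rightarrow> ('m \<Rightarrow> 'w) set" where
  "jet1 M L p \<eta> = {\<mu> \<in> sections M L. same_jet1 M L p \<eta> \<mu>}"

text \<open>A multi-differential operator as a multilinear form on one-jets at \<open>p\<close>.\<close>

definition mop_form :: "('m, 'w) mop \<Rightarrow> 'm \<Rightarrow> ('m \<Rightarrow> 'w) set list \<Rightarrow> 'w" where
  "mop_form Q p js = Q (map (\<lambda>j. SOME \<mu>. \<mu> \<in> j) js) p"

text \<open>
  The fibre over \<open>x\<close> of the conormal bundle tensor \<open>l\<close> is the space of linear maps from the fibre
  of \<open>N\<close> to the fibre of \<open>l\<close>. Under this identification, \<open>df \<otimes> \<eta>\<close> is the map sending \<open>v\<close> to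
  the derivative of \<open>f\<close> at \<open>(x,0)\<close> in the vertical direction \<open>v\<close>, times \<open>\<eta>(x,0)\<close>.
\<close>

definition conormal ::
    "('p, 'v::real_vector) vbun \<Rightarrow> ('p, 'w::real_vector) vbun \<Rightarrow> 'p \<Rightarrow> ('v \<Rightarrow> 'w) set" where
  "conormal N l x = {\<alpha>. (\<forall>v\<in>fib N x. \<alpha> v \<in> fib l x) \<and>
     (\<forall>u\<in>fib N x. \<forall>v\<in>fib N x. \<forall>a b. \<alpha> (a *\<^sub>R u + b *\<^sub>R v) = a *\<^sub>R \<alpha> u + b *\<^sub>R \<alpha> v)}"

text \<open>
  The embedding \<open>\<gamma>\<close> of \<open>conormal N l x\<close> into the one-jets at \<open>(x,0)\<close>. The jet below is
  \<open>j\<^sup>1(f\<eta>) - f j\<^sup>1\<eta>\<close> at \<open>(x,0)\<close>, and it depends on \<open>\<alpha> = df \<otimes> \<eta>\<close> only.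
\<close>

definition gamma ::
    "'p mfd \<Rightarrow> ('p, 'v::real_vector) vbun \<Rightarrow> ('p, 'w::real_vector) vbun \<Rightarrow> 'p \<Rightarrow> ('v \<Rightarrow> 'w)
      \<Rightarrow> ('p \<times> 'v \<Rightarrow> 'w) set" where
  "gamma S N l x \<alpha> = (let M = total_space S N; L = pullback N l in
     SOME j. \<exists>f\<in>annihilating S N x. \<exists>\<eta>\<in>sections M L.
       (\<forall>v\<in>fib N x. \<alpha> v = deriv (\<lambda>t. f (x, t *\<^sub>R v)) 0 *\<^sub>R \<eta> (x, 0)) \<and>
       j = jet1 M L (x, 0) (\<lambda>q. f q *\<^sub>R \<eta> q - f (x, 0) *\<^sub>R \<eta> q))"

text \<open>\<open>l\<close>-valued forms on the twisted conormal bundle; a form of degree \<open>k\<close> takes lists of length \<open>k\<close>.\<close>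

type_synonym ('p, 'v, 'w) nform = "'p \<Rightarrow> ('v \<Rightarrow> 'w) list \<Rightarrow> 'w"

definition form_eq ::
    "'p mfd \<Rightarrow> ('p, 'v::real_vector) vbun \<Rightarrow> ('p, 'w::real_vector) vbun \<Rightarrow> nat
      \<Rightarrow> ('p, 'v, 'w) nform \<Rightarrow> ('p, 'v, 'w) nform \<Rightarrow> bool" where
  "form_eq S N l k \<omega> \<omega>' \<longleftrightarrow> (\<forall>x\<in>pts S. \<forall>\<alpha>s.
     length \<alpha>s = k \<and> set \<alpha>s \<subseteq> conormal N l x \<longrightarrow> \<omega> x \<alpha>s = \<omega>' x \<alpha>s)"

text \<open>Sections of \<open>l\<close> and of \<open>N\<close> as forms of degree 0 and 1.\<close>

definition form0 :: "('p \<Rightarrow> 'w) \<Rightarrow> ('p, 'v, 'w) nform" where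
  "form0 \<eta> = (\<lambda>x \<alpha>s. \<eta> x)"

definition form1 :: "('p \<Rightarrow> 'v) \<Rightarrow> ('p, 'v, 'w) nform" where
  "form1 \<nu> = (\<lambda>x \<alpha>s. hd \<alpha>s (\<nu> x))"

definition P_map ::
    "'p mfd \<Rightarrow> ('p, 'v::real_vector) vbun \<Rightarrow> ('p, 'w::real_vector) vbun \<Rightarrow> ('p \<times> 'v, 'w) mop
      \<Rightarrow> ('p, 'v, 'w) nform" where
  "P_map S N l Q = (\<lambda>x \<alpha>s. mop_form Q (x, 0) (map (gamma S N l x) \<alpha>s))"


section \<open>The map \<open>I\<close> and the multibrackets\<close>

text \<open>
  The fibre of \<open>L = pullback N l\<close> at \<open>(x,v)\<close> does not depend on \<open>v\<close>, and the flat connection along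
  the vertical directions, for which the pulled back sections are constant, is differentiation along
  the fibres of \<open>N\<close>. So \<open>vert_der \<mu> (x,v) \<nu>\<close> is the covariant derivative of \<open>\<mu>\<close> at \<open>(x,v)\<close> along
  the vertical vector \<open>\<nu>\<close>.
\<close>

definition vert_der ::
    "('p \<times> 'v::real_vector \<Rightarrow> 'w::real_normed_vector) \<Rightarrow> 'p \<times> 'v \<Rightarrow> 'v \<Rightarrow> 'w" where
  "vert_der \<mu> = (\<lambda>(x,v) \<nu>. vector_derivative (\<lambda>t. \<mu> (x, v + t *\<^sub>R \<nu>)) (at 0))"

text \<open>
  On \<open>\<xi>\<^sub>1 \<and> \<dots> \<and> \<xi>\<^sub>k \<otimes> \<eta>\<close> with \<open>\<xi>\<^sub>i = \<nu>\<^sub>i \<otimes> \<phi>\<^sub>i\<close>, the following is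
  \<open>I\<^sub>0(\<xi>\<^sub>1) \<and> \<dots> \<and> I\<^sub>0(\<xi>\<^sub>k) \<otimes> \<pi>\<^sup>*\<eta>\<close>, since \<open>I\<^sub>0(\<xi>\<^sub>i)\<close> sends \<open>\<mu>\<close> to the value of \<open>\<phi>\<^sub>i\<close>
  on the derivative of \<open>\<mu>\<close> along \<open>\<pi>\<^sup>*\<nu>\<^sub>i\<close>. In particular \<open>I_map S N (form1 \<nu>)\<close> is the covariant
  derivative along \<open>\<pi>\<^sup>*\<nu>\<close>, and \<open>I_map S N (form0 \<eta>)\<close> is \<open>\<pi>\<^sup>*\<eta>\<close>.
\<close>

definition I_map ::
    "'p mfd \<Rightarrow> ('p, 'v::real_vector) vbun \<Rightarrow> ('p, 'v, 'w::real_normed_vector) nform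
      \<Rightarrow> ('p \<times> 'v, 'w) mop" where
  "I_map S N \<omega> = (\<lambda>\<mu>s p. if p \<in> pts (total_space S N)
     then \<omega> (fst p) (map (\<lambda>\<mu>. vert_der \<mu> p) \<mu>s) else 0)"

text \<open>
  Here the arguments are forms paired with their degree, and \<open>nested_bracket\<close> is the iterated
  Schouten-Jacobi bracket of \<open>J\<close> with their images under \<open>I\<close>, paired with its arity.
\<close>

definition nested_bracket ::
    "'p mfd \<Rightarrow> ('p, 'v::real_vector) vbun \<Rightarrow> ('p \<times> 'v, 'w::real_normed_vector) mop
      \<Rightarrow> (nat \<times> ('p, 'v, 'w) nform) list \<Rightarrow> nat \<times> ('p \<times> 'v, 'w) mop" where
  "nested_bracket S N J \<xi>s =
     foldl (\<lambda>(a, Q) (b, \<omega>). (a + b - 1, SJ a b Q (I_map S N \<omega>))) (2, J) \<xi>s"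

definition mbr ::
    "'p mfd \<Rightarrow> ('p, 'v::real_vector) vbun \<Rightarrow> ('p, 'w::real_normed_vector) vbun
      \<Rightarrow> ('p \<times> 'v, 'w) mop \<Rightarrow> (nat \<times> ('p, 'v, 'w) nform) list \<Rightarrow> ('p, 'v, 'w) nform" where
  "mbr S N l J \<xi>s = P_map S N l (snd (nested_bracket S N J \<xi>s))"

text \<open>
  The multilinear extension to formal power series, which are given by their sequences of
  coefficients: \<open>mbr_eps S N l J \<xi>s n\<close> is the coefficient of \<open>\<epsilon>\<^sup>n\<close>.
\<close>

definition mbr_eps ::
    "'p mfd \<Rightarrow> ('p, 'v::real_vector) vbun \<Rightarrow> ('p, 'w::real_normed_vector) vbun
      \<Rightarrow> ('p \<times> 'v, 'w) mop \<Rightarrow> (nat \<Rightarrow> nat \<times> ('p, 'v, 'w) nform) list \<Rightarrow> nat \<Rightarrow> ('p, 'v, 'w) nform"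
  where "mbr_eps S N l J \<xi>s n = (\<lambda>x \<alpha>s.
     \<Sum>js\<in>{js. length js = length \<xi>s \<and> sum_list js = n}.
       mbr S N l J (map2 (\<lambda>\<xi> j. \<xi> j) \<xi>s js) x \<alpha>s)"


section \<open>Formal deformations and equivalences\<close>

text \<open>
  All formal series \<open>\<xi>(\<epsilon>)\<close> in \<open>N\<close> below have vanishing constant term. Hence a term in which \<open>\<xi>(\<epsilon>)\<close>
  occurs \<open>n\<close> times contributes only to coefficients of order at least \<open>n\<close>, and the coefficient of
  \<open>\<epsilon>\<^sup>m\<close> of the infinite sums over \<open>n\<close> is a sum over \<open>n \<le> m\<close>.
\<close>

definition formal_deformation ::
    "'p mfd \<Rightarrow> ('p, 'v::real_vector) vbun \<Rightarrow> (nat \<Rightarrow> 'p \<Rightarrow> 'v) \<Rightarrow> bool" where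
  "formal_deformation S N s \<longleftrightarrow> (\<forall>i. s i \<in> sections S N) \<and> s 0 = (\<lambda>x. 0)"

text \<open>The operator \<open>[\<xi>(\<epsilon>), -]\<close>, for \<open>\<xi>\<close> of arity 1, acting on series of operators of arity \<open>a\<close>.\<close>

definition ad_eps ::
    "nat \<Rightarrow> (nat \<Rightarrow> ('m, 'w::real_vector) mop) \<Rightarrow> (nat \<Rightarrow> ('m, 'w) mop) \<Rightarrow> (nat \<Rightarrow> ('m, 'w) mop)" where
  "ad_eps a \<xi> Q = (\<lambda>m \<mu>s p. \<Sum>i\<le>m. SJ 1 a (\<xi> i) (Q (m - i)) \<mu>s p)"

definition exp_ad_eps ::
    "nat \<Rightarrow> (nat \<Rightarrow> ('m, 'w::real_vector) mop) \<Rightarrow> (nat \<Rightarrow> ('m, 'w) mop) \<Rightarrow> (nat \<Rightarrow> ('m, 'w) mop)" where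
  "exp_ad_eps a \<xi> Q = (\<lambda>m \<mu>s p. \<Sum>n\<le>m. (1 / fact n) *\<^sub>R ((ad_eps a \<xi> ^^ n) Q) m \<mu>s p)"

definition const_eps :: "('m, 'w::zero) mop \<Rightarrow> nat \<Rightarrow> ('m, 'w) mop" where
  "const_eps Q = (\<lambda>m. if m = 0 then Q else (\<lambda>\<mu>s p. 0))"

definition formal_coisotropic ::
    "'p mfd \<Rightarrow> ('p, 'v::real_vector) vbun \<Rightarrow> ('p, 'w::real_normed_vector) vbun
      \<Rightarrow> ('p \<times> 'v, 'w) mop \<Rightarrow> (nat \<Rightarrow> 'p \<Rightarrow> 'v) \<Rightarrow> bool" where
  "formal_coisotropic S N l J s \<longleftrightarrow> formal_deformation S N s \<and>
     (\<forall>m. form_eq S N l 2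
        (P_map S N l (exp_ad_eps 2 (\<lambda>i. I_map S N (form1 (s i))) (const_eps J) m))
        (\<lambda>x \<alpha>s. 0))"

definition hamiltonian_equivalent ::
    "'p mfd \<Rightarrow> ('p, 'v::real_normed_vector) vbun \<Rightarrow> ('p, 'w::real_normed_vector) vbun
      \<Rightarrow> ('p \<times> 'v, 'w) mop \<Rightarrow> (nat \<Rightarrow> 'p \<Rightarrow> 'v) \<Rightarrow> (nat \<Rightarrow> 'p \<Rightarrow> 'v) \<Rightarrow> bool" where
  "hamiltonian_equivalent S N l J s0 s1 \<longleftrightarrow>
     (\<exists>(s :: real \<Rightarrow> nat \<Rightarrow> 'p \<Rightarrow> 'v) (\<eta> :: real \<Rightarrow> nat \<Rightarrow> 'p \<times> 'v \<Rightarrow> 'w).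
        (\<forall>t\<in>{0..1}. formal_coisotropic S N l J (s t)) \<and>
        (\<forall>i. smooth_family S N (\<lambda>t. s t i)) \<and>
        s 0 = s0 \<and> s 1 = s1 \<and>
        (\<forall>i. smooth_family (total_space S N) (pullback N l) (\<lambda>t. \<eta> t i)) \<and>
        (\<forall>t\<in>{0..1}. \<forall>m. form_eq S N l 1
           (form1 (\<lambda>x. vector_derivative (\<lambda>t. s t m x) (at t within {0..1})))
           (P_map S N l (exp_ad_eps 1 (\<lambda>i. I_map S N (form1 (s t i)))
              (\<lambda>i. ham_der J (\<eta> t i)) m))))"

definition MC ::
    "'p mfd \<Rightarrow> ('p, 'v::real_vector) vbun \<Rightarrow> ('p, 'w::real_normed_vector) vbun
      \<Rightarrow> ('p \<times> 'v, 'w) mop \<Rightarrow> (nat \<Rightarrow> 'p \<Rightarrow> 'v) \<Rightarrow> nat \<Rightarrow> ('p, 'v, 'w) nform" where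
  "MC S N l J \<xi> m = (\<lambda>x \<alpha>s. \<Sum>k=1..m. (1 / fact k) *\<^sub>R
     mbr_eps S N l J (replicate k (\<lambda>i. (1, form1 (\<xi> i)))) m x \<alpha>s)"

definition MC_solution ::
    "'p mfd \<Rightarrow> ('p, 'v::real_vector) vbun \<Rightarrow> ('p, 'w::real_normed_vector) vbun
      \<Rightarrow> ('p \<times> 'v, 'w) mop \<Rightarrow> (nat \<Rightarrow> 'p \<Rightarrow> 'v) \<Rightarrow> bool" where
  "MC_solution S N l J \<xi> \<longleftrightarrow> formal_deformation S N \<xi> \<and>
     (\<forall>m. form_eq S N l 2 (MC S N l J \<xi> m) (\<lambda>x \<alpha>s. 0))"

definition gauge_equivalent ::
    "'p mfd \<Rightarrow> ('p, 'v::real_normed_vector) vbun \<Rightarrow> ('p, 'w::real_normed_vector) vbun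
      \<Rightarrow> ('p \<times> 'v, 'w) mop \<Rightarrow> (nat \<Rightarrow> 'p \<Rightarrow> 'v) \<Rightarrow> (nat \<Rightarrow> 'p \<Rightarrow> 'v) \<Rightarrow> bool" where
  "gauge_equivalent S N l J \<xi>0 \<xi>1 \<longleftrightarrow>
     (\<exists>(\<xi> :: real \<Rightarrow> nat \<Rightarrow> 'p \<Rightarrow> 'v) (\<eta> :: real \<Rightarrow> nat \<Rightarrow> 'p \<Rightarrow> 'w).
        (\<forall>t\<in>{0..1}. formal_deformation S N (\<xi> t)) \<and>
        (\<forall>i. smooth_family S N (\<lambda>t. \<xi> t i)) \<and>
        \<xi> 0 = \<xi>0 \<and> \<xi> 1 = \<xi>1 \<and>
        (\<forall>i. smooth_family S l (\<lambda>t. \<eta> t i)) \<and>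
        (\<forall>t\<in>{0..1}. \<forall>m. form_eq S N l 1
           (form1 (\<lambda>x. vector_derivative (\<lambda>t. \<xi> t m x) (at t within {0..1})))
           (\<lambda>x \<alpha>s. \<Sum>k\<le>m. (1 / fact k) *\<^sub>R
              mbr_eps S N l J (replicate k (\<lambda>i. (1, form1 (\<xi> t i))) @ [\<lambda>i. (0, form0 (\<eta> t i))])
                m x \<alpha>s)))"

end

theory Submission
  imports Defs "HOL-Library.Function_Algebras"
begin

text \<open>
  Along the family \<open>s\<^sub>t\<close>, the coefficients of \<open>J\<^sub>t = exp L J\<close> form a formal Lie bracket. As \<open>ad\<close>
  acts by derivations, \<open>exp L \<Delta>\<^sub>\<lambda> = J\<^sub>t(E, -)\<close> with \<open>E = exp(I(s\<^sub>t)) \<lambda>\<close>, and by coisotropy only the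
  restriction of \<open>E\<close> to \<open>S\<close> matters after applying \<open>P\<close>: it is the gauge parameter. Conversely, a gauge
  parameter is pulled back to the total space, where \<open>exp(I(s\<^sub>t))\<close> fixes it. What remains is that
  \<open>s\<^sub>t\<close> stays coisotropic. In each order of \<open>\<epsilon>\<close>, the obstruction \<open>P J\<^sub>t\<close> satisfies, by the Jacobi
  identity, a homogeneous linear transport equation on \<open>S\<close> with zero initial value, and it vanishes by
  uniqueness since \<open>S\<close> is compact.
\<close>

section \<open>Calculus of smooth functions on subsets of \<open>\<real>\<^sup>n\<close>\<close>

definition has_pd ::
  "(nat => real) set => nat => ((nat => real) => real) => ((nat => real) => real) => bool" where
 "has_pd D i f g \<longleftrightarrow>
  (\<forall>x\<in>D. ((%t. f (x(i := t))) has_real_derivative g x) (at (x i) within {t. x(i := t) : D}))"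

lemma has_pd_cong:
 assumes "has_pd D i f g" "!!x. x : D ==> f x = f' x" "!!x. x : D ==> g x = g' x"
 shows "has_pd D i f' g'"
 unfolding has_pd_def
proof
 fix x assume x: "x : D"
 have "((%t. f (x(i := t))) has_real_derivative g x) (at (x i) within {t. x(i := t) : D})"
  using assms(1) x by (auto simp: has_pd_def)
 then have "((%t. f' (x(i := t))) has_real_derivative g x) (at (x i) within {t. x(i := t) : D})"
  by (rule has_field_derivative_transform_within[where d=1]) (use x assms(2) in auto)
 then show "((%t. f' (x(i := t))) has_real_derivative g' x) (at (x i) within {t. x(i := t) : D})"
  using assms(3) x by simp
qed

lemma has_pd_mono: "has_pd D i f g ==> D' <= D ==> has_pd D' i f g"
 unfolding has_pd_def by (meson DERIV_subset Collect_mono subsetD)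

lemma smooth_on_coinduct:
 assumes "f : C" "!!g. g : C ==> continuous_on D g"
  and "!!g i. g : C ==> i < n ==> \<exists>h\<in>C. has_pd D i g h"
 shows "smooth_on n D f"
proof -
 obtain H where H: "!!g i. g : C ==> i < n ==> H g i : C \<and> has_pd D i g (H g i)"
  using assms(3) by metis
 define F where "F = rec_list f (%i _ g. H g i)"
 have F: "F [] = f" "!!i js. F (i # js) = H (F js) i" by (auto simp: F_def)
 have inC: "F js : C" if "set js <= {..<n}" for js
  using that by (induction js) (use F H assms(1) in auto)
 show ?thesis unfolding smooth_on_def
 proof (intro exI[of _ F] conjI allI impI ballI)
  fix js :: "nat list" assume js: "set js <= {..<n}"
  show "continuous_on D (F js)" using inC[OF js] assms(2) by blast
  fix i x assume "i < n" "x : D"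
  then show "((%t. F js (x(i := t))) has_real_derivative F (i # js) x) (at (x i) within {t. x(i := t) : D})"
   using H[OF inC[OF js] \<open>i < n\<close>] F by (auto simp: has_pd_def)
 qed (use F in auto)
qed

lemma smooth_on_cong:
 assumes "smooth_on n D f" "!!x. x : D ==> f x = f' x"
 shows "smooth_on n D f'"
proof -
 from assms(1) obtain F where "(\<forall>x\<in>D. F [] x = f x) \<and>
  (\<forall>js. set js <= {..<n} --> continuous_on D (F js) \<and>
    (\<forall>i<n. \<forall>x\<in>D. ((%t. F js (x(i := t))) has_real_derivative F (i # js) x)
     (at (x i) within {t. x(i := t) : D})))"
  unfolding smooth_on_def by (elim exE)
 then show ?thesis unfolding smooth_on_def using assms(2) by (intro exI[of _ F]) simp
qed

lemma smooth_on_continuous: "smooth_on n D f ==> continuous_on D f"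
 unfolding smooth_on_def
 by (metis (no_types, lifting) continuous_on_cong empty_set empty_subsetI)

lemma smooth_on_pd:
 assumes "smooth_on n D f" "i < n"
 shows "\<exists>g. smooth_on n D g \<and> has_pd D i f g"
proof -
 from assms(1) obtain F where F: "\<forall>x\<in>D. F [] x = f x"
  "!!js. set js <= {..<n} ==> continuous_on D (F js)"
  "!!js i x. set js <= {..<n} ==> i<n ==> x\<in>D ==> ((%t. F js (x(i := t))) has_real_derivative F (i # js) x)
     (at (x i) within {t. x(i := t) : D})"
  unfolding smooth_on_def by blast
 have "has_pd D i (F []) (F [i])" using F(3)[of "[]"] assms(2) by (auto simp: has_pd_def)
 then have "has_pd D i f (F [i])" by (rule has_pd_cong) (use F in auto)
 moreover have "smooth_on n D (F [i])" unfolding smooth_on_def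
  by (rule exI[of _ "%js. F (js @ [i])"]) (use F assms(2) in auto)
 ultimately show ?thesis by blast
qed

lemma smooth_on_mono:
 assumes "smooth_on n D f" "n' \<le> n" "D' <= D"
 shows "smooth_on n' D' f"
proof (rule smooth_on_coinduct[where C="{f. smooth_on n D f}"])
 show "f : {f. smooth_on n D f}" using assms by auto
next
 fix g assume "g : {f. smooth_on n D f}"
 then show "continuous_on D' g" using smooth_on_continuous assms(3) continuous_on_subset by blast
next
 fix g i assume "g : {f. smooth_on n D f}" "i < n'"
 then have "smooth_on n D g" "i < n" using assms(2) by auto
 then obtain h where "smooth_on n D h" "has_pd D i g h" using smooth_on_pd by blast
 then show "\<exists>h\<in>{f. smooth_on n D f}. has_pd D' i g h" using has_pd_mono assms(3) by blast
qed

inductive_set smooth_alg :: "nat => (nat => real) set => ((nat => real) => real) set" for n D where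
 base: "smooth_on n D f ==> f : smooth_alg n D"
| add: "f : smooth_alg n D ==> g : smooth_alg n D ==> (%x. f x + g x) : smooth_alg n D"
| mult: "f : smooth_alg n D ==> g : smooth_alg n D ==> (%x. f x * g x) : smooth_alg n D"
| inv: "f : smooth_alg n D ==> (!!x. x : D ==> f x \<noteq> 0) ==> (%x. inverse (f x)) : smooth_alg n D"

lemma smooth_on_const: "smooth_on n D (%x. c)"
 unfolding smooth_on_def by (rule exI[of _ "%js x. if js = [] then c else 0"]) auto

lemma smooth_alg_pd:
 assumes "f : smooth_alg n D" "i < n"
 shows "\<exists>h\<in>smooth_alg n D. has_pd D i f h"
 using assms(1)
proof induction
 case (base f)
 then show ?case using smooth_on_pd[OF _ assms(2)] smooth_alg.base by blast
next
 case (add f g)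
 then obtain f' g' where "f' : smooth_alg n D" "has_pd D i f f'" "g' : smooth_alg n D" "has_pd D i g g'" by blast
 then show ?case
  by (intro bexI[of _ "%x. f' x + g' x"] smooth_alg.add) (auto simp: has_pd_def intro!: derivative_eq_intros)
next
 case (mult f g)
 then obtain f' g' where *: "f' : smooth_alg n D" "has_pd D i f f'" "g' : smooth_alg n D" "has_pd D i g g'" by blast
 show ?case
 proof (intro bexI[of _ "%x. f' x * g x + g' x * f x"])
  show "has_pd D i (%x. f x * g x) (%x. f' x * g x + g' x * f x)"
   unfolding has_pd_def
  proof
   fix x assume "x : D"
   with * have "((%t. f (x(i := t))) has_real_derivative f' x) (at (x i) within {t. x(i := t) : D})"
    "((%t. g (x(i := t))) has_real_derivative g' x) (at (x i) within {t. x(i := t) : D})"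
    by (auto simp: has_pd_def)
   from DERIV_mult'[OF this]
   show "((%t. f (x(i := t)) * g (x(i := t))) has_real_derivative f' x * g x + g' x * f x) (at (x i) within {t. x(i := t) : D})"
    by (simp add: algebra_simps)
  qed
  show "(%x. f' x * g x + g' x * f x) : smooth_alg n D"
   by (intro smooth_alg.add smooth_alg.mult * mult)
 qed
next
 case (inv f)
 then obtain f' where *: "f' : smooth_alg n D" "has_pd D i f f'" by blast
 let ?h = "%x. (-1) * (f' x * (inverse (f x) * inverse (f x)))"
 show ?case
 proof (intro bexI[of _ ?h])
  show "has_pd D i (%x. inverse (f x)) ?h" unfolding has_pd_def
  proof
   fix x assume "x : D"
   with * have "((%t. f (x(i := t))) has_real_derivative f' x) (at (x i) within {t. x(i := t) : D})"
    by (auto simp: has_pd_def)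
   from DERIV_inverse'[OF this] inv.hyps(2)[OF \<open>x : D\<close>]
   show "((%t. inverse (f (x(i := t)))) has_real_derivative ?h x) (at (x i) within {t. x(i := t) : D})"
    by (simp add: algebra_simps)
  qed
  show "?h : smooth_alg n D"
   by (intro smooth_alg.mult smooth_alg.inv) (use * inv in \<open>auto intro: smooth_alg.base smooth_on_const\<close>)
 qed
qed

lemma smooth_alg_smooth: "f : smooth_alg n D ==> smooth_on n D f"
proof (rule smooth_on_coinduct[where C="smooth_alg n D"])
 fix g assume "g : smooth_alg n D"
 then show "continuous_on D g"
  by induction (auto intro: continuous_intros smooth_on_continuous)
qed (use smooth_alg_pd in auto)

lemma smooth_on_add: "smooth_on n D f ==> smooth_on n D g ==> smooth_on n D (%x. f x + g x)"
 and smooth_on_mult: "smooth_on n D f ==> smooth_on n D g ==> smooth_on n D (%x. f x * g x)"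
 and smooth_on_inverse: "smooth_on n D f ==> (!!x. x : D ==> f x \<noteq> 0) ==> smooth_on n D (%x. inverse (f x))"
 by (rule smooth_alg_smooth, rule smooth_alg.add smooth_alg.mult smooth_alg.inv;
   simp add: smooth_alg.base)+

lemma smooth_on_cmult: "smooth_on n D f ==> smooth_on n D (%x. c * f x)"
 by (intro smooth_on_mult smooth_on_const)

lemma smooth_on_minus: "smooth_on n D f ==> smooth_on n D (%x. - f x)"
 using smooth_on_cmult[of n D f "-1"] by simp

lemma smooth_on_diff: "smooth_on n D f ==> smooth_on n D g ==> smooth_on n D (%x. f x - g x)"
 using smooth_on_add[OF _ smooth_on_minus, of n D f g] by simp

lemma smooth_on_sum: "(!!i. i : I ==> smooth_on n D (f i)) ==> smooth_on n D (%x. \<Sum>i\<in>I. f i x)"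
 by (induction I rule: infinite_finite_induct) (auto intro: smooth_on_add smooth_on_const)

lemma smooth_on_coord: "smooth_on n D (%x. x j)"
proof (rule smooth_on_coinduct[where C="insert (%x. x j) (range (%c x. c))"])
 fix g i assume "g : insert (%x. x j) (range (%(c::real) (x::nat => real). c))"
 then show "\<exists>h\<in>insert (%x. x j) (range (%c x. c)). has_pd D i g h"
 proof (elim insertE imageE)
  assume "g = (%x. x j)"
  then have "has_pd D i g (%x. if i = j then 1 else 0)" by (auto simp: has_pd_def)
  then show ?thesis by auto
 next
  fix c assume "g = (%x. c)"
  then have "has_pd D i g (%x. 0)" by (auto simp: has_pd_def)
  then show ?thesis by auto
 qed
next
 fix g :: "(nat => real) => real"
 assume "g : insert (%x. x j) (range (%c x. c))"
 then show "continuous_on D g"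
  using continuous_on_subset[OF continuous_on_product_coordinates] by auto
qed auto

subsection \<open>Open subsets and the chain rule\<close>

abbreviation opn :: "nat => (nat => real) set => bool" where
 "opn n D \<equiv> openin (top_of_set (Rn n)) D"

lemma opn_iff_box:
 "opn n D \<longleftrightarrow> D <= Rn n \<and>
  (\<forall>p\<in>D. \<exists>r>0. \<forall>y\<in>Rn n. (\<forall>i<n. \<bar>y i - p i\<bar> < r) --> y : D)"
proof (intro iffI conjI ballI)
 assume D: "opn n D"
 then show "D <= Rn n" using openin_imp_subset by blast
 fix p assume p: "p : D"
 obtain T where T: "open T" "D = Rn n \<inter> T" using D by (auto simp: openin_open)
 have "openin (product_topology (%i. euclidean) UNIV) T" using T(1) by (simp add: euclidean_product_topology)
 then obtain U where U: "finite {i. U i \<noteq> UNIV}" "!!i. open (U i)" "p : PiE UNIV U" "PiE UNIV U <= T"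
  using product_topology_open_contains_basis[of "%i. euclidean" UNIV T p] p T(2) by auto
 have "\<forall>i. \<exists>e>0. \<forall>t. \<bar>t - p i\<bar> < e --> t : U i"
 proof
  fix i
  have "p i : U i" using U(3) by auto
  then show "\<exists>e>0. \<forall>t. \<bar>t - p i\<bar> < e --> t : U i"
   using U(2)[of i] unfolding open_dist dist_real_def by blast
 qed
 then obtain e where e: "!!i. e i > 0" "!!i t. \<bar>t - p i\<bar> < e i ==> t : U i" by metis
 define r where "r = Min (insert 1 (e ` {..<n}))"
 have r: "r > 0" "!!i. i < n ==> r \<le> e i" using e(1) by (auto simp: r_def)
 show "\<exists>r>0. \<forall>y\<in>Rn n. (\<forall>i<n. \<bar>y i - p i\<bar> < r) --> y : D"
 proof (intro exI[of _ r] conjI ballI impI)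
  fix y assume y: "y : Rn n" "\<forall>i<n. \<bar>y i - p i\<bar> < r"
  have "y i : U i" for i
  proof (cases "i < n")
   case True then show ?thesis using y r e(2)[of "y i" i] by fastforce
  next
   case False
   then have "y i = p i" using y(1) p T(2) by (auto simp: Rn_def)
   then show ?thesis using e by simp
  qed
  then show "y : D" using U(4) T(2) y(1) by (auto simp: PiE_def)
 qed (rule r)
next
 assume D: "D <= Rn n \<and> (\<forall>p\<in>D. \<exists>r>0. \<forall>y\<in>Rn n. (\<forall>i<n. \<bar>y i - p i\<bar> < r) --> y : D)"
 show "opn n D"
 proof (subst openin_subopen, intro ballI)
  fix p assume p: "p : D"
  then obtain r where r: "r > 0" "\<forall>y\<in>Rn n. (\<forall>i<n. \<bar>y i - p i\<bar> < r) --> y : D" using D by blast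
  define T where "T = (\<Inter>i\<in>{..<n}. (%y :: nat => real. y i) -` {p i - r<..<p i + r})"
  have "open T" unfolding T_def
   by (intro open_INT ballI finite_lessThan open_vimage open_greaterThanLessThan continuous_on_product_coordinates)
  then have "opn n (Rn n \<inter> T)" by auto
  moreover have "p : Rn n \<inter> T" using p D r(1) by (auto simp: T_def)
  moreover have "Rn n \<inter> T <= D"
  proof
   fix y assume y: "y : Rn n \<inter> T"
   then have "p i - r < y i \<and> y i < p i + r" if "i < n" for i using that by (auto simp: T_def)
   then have "\<forall>i<n. \<bar>y i - p i\<bar> < r" by (simp add: abs_less_iff algebra_simps)
   then show "y : D" using r(2) y by blast
  qed
  ultimately show "\<exists>T. opn n T \<and> p : T \<and> T <= D" by blast
 qed
qed

lemma opn_subset: "opn n D ==> D <= Rn n"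
 by (simp add: opn_iff_box)

lemma opn_box:
 assumes "opn n D" "p : D"
 shows "\<exists>r>0. \<forall>y\<in>Rn n. (\<forall>i<n. \<bar>y i - p i\<bar> < r) --> y : D"
 using assms unfolding opn_iff_box by blast

lemma continuous_box:
 assumes "opn n D" "p : D" "continuous_on D g" "e > 0"
 shows "\<exists>r>0. \<forall>y\<in>Rn n. (\<forall>i<n. \<bar>y i - p i\<bar> < r) --> y : D \<and> \<bar>g y - g p\<bar> < (e::real)"
proof -
 have "openin (top_of_set D) (D \<inter> g -` {g p - e<..<g p + e})"
  using assms(3) by (intro continuous_openin_preimage_gen) auto
 then have "opn n (D \<inter> g -` {g p - e<..<g p + e})" using assms(1) openin_trans by blast
 moreover have "p : D \<inter> g -` {g p - e<..<g p + e}" using assms by auto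
 ultimately obtain r where r: "r > 0"
  "\<forall>y\<in>Rn n. (\<forall>i<n. \<bar>y i - p i\<bar> < r) --> y : D \<inter> g -` {g p - e<..<g p + e}"
  using opn_box by blast
 have "y : D \<and> \<bar>g y - g p\<bar> < e" if "y : Rn n" "\<forall>i<n. \<bar>y i - p i\<bar> < r" for y
 proof -
  have "y : D \<inter> g -` {g p - e<..<g p + e}" using r(2) that by blast
  then show ?thesis by (auto simp: abs_less_iff)
 qed
 with r(1) show ?thesis by blast
qed

lemma mvt_segment:
 fixes h :: "real => real"
 assumes "!!u. u : closed_segment a b ==> (h has_real_derivative h' u) (at u within closed_segment a b)"
 shows "\<exists>\<xi>\<in>closed_segment a b. h b - h a = (b - a) * h' \<xi>"
proof (cases "a \<le> b")
 case True
 then have "\<exists>x\<in>{a..b}. h b - h a = (*) (h' x) (b - a)"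
  by (intro mvt_very_simple) (use assms True in \<open>auto simp: closed_segment_eq_real_ivl has_field_derivative_def\<close>)
 then show ?thesis using True by (auto simp: closed_segment_eq_real_ivl mult.commute)
next
 case False
 then have "\<exists>x\<in>{b..a}. h a - h b = (*) (h' x) (a - b)"
  by (intro mvt_very_simple) (use assms False in \<open>auto simp: closed_segment_eq_real_ivl has_field_derivative_def\<close>)
 then obtain x where "x : {b..a}" "h a - h b = h' x * (a - b)" by auto
 then show ?thesis using False by (intro bexI[of _ x]) (auto simp: closed_segment_eq_real_ivl algebra_simps)
qed

lemma chain_pd:
 assumes D: "opn n D" and \<gamma>: "!!t. t : A ==> \<gamma> t : D" and t0: "t0 : A"
  and d: "!!i. i < n ==> ((%t. \<gamma> t i) has_real_derivative d i) (at t0 within A)"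
  and f: "!!i. i < n ==> has_pd D i f (g i)" "!!i. i < n ==> continuous_on D (g i)"
 shows "((%t. f (\<gamma> t)) has_real_derivative (\<Sum>i<n. g i (\<gamma> t0) * d i)) (at t0 within A)"
proof -
 define p where "p = \<gamma> t0"
 have p: "p : D" using \<gamma> t0 by (simp add: p_def)
 have Rn: "D <= Rn n" using D by (rule opn_subset)
 define hyb where "hyb k t = (%i. if i < k then \<gamma> t i else p i)" for k t
 have small: "\<forall>\<^sub>F t in at t0 within A. t : A \<and> (\<forall>i<n. \<bar>\<gamma> t i - p i\<bar> < r)" if "r > 0" for r
 proof -
  have "\<forall>\<^sub>F t in at t0 within A. \<bar>\<gamma> t i - p i\<bar> < r" if "i < n" for i
  proof -
   have "((%t. \<gamma> t i) \<longlongrightarrow> p i) (at t0 within A)"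
    using DERIV_continuous[OF d[OF that]] by (simp add: continuous_within p_def)
   from tendstoD[OF this \<open>r > 0\<close>] show ?thesis by (simp add: dist_real_def)
  qed
  then have "\<forall>\<^sub>F t in at t0 within A. \<forall>i\<in>{..<n}. \<bar>\<gamma> t i - p i\<bar> < r"
   by (intro eventually_ball_finite) auto
  moreover have "\<forall>\<^sub>F t in at t0 within A. t : A" by (simp add: eventually_at_filter)
  ultimately show ?thesis by eventually_elim auto
 qed
 have main: "((%t. f (hyb k t)) has_real_derivative (\<Sum>i<k. g i p * d i)) (at t0 within A)" if "k \<le> n" for k
  using that
 proof (induction k)
  case 0
  then show ?case by (simp add: hyb_def)
 next
  case (Suc k)
  then have k: "k < n" by simp
  obtain r where r: "r > 0" "\<forall>y\<in>Rn n. (\<forall>i<n. \<bar>y i - p i\<bar> < r) --> y : D"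
   using opn_box[OF D p] by blast
  let ?pt = "%t u. (hyb k t)(k := u)"
  have ptR: "?pt t u : Rn n" if "t : A" for t u
   using Rn p \<gamma>[OF that] k by (auto simp: hyb_def Rn_def)
  define good where "good t \<longleftrightarrow> t : A \<and> (\<forall>i<n. \<bar>\<gamma> t i - p i\<bar> < r)" for t
  have seg: "\<bar>?pt t u i - p i\<bar> < \<rho>"
   if "\<forall>i<n. \<bar>\<gamma> t i - p i\<bar> < \<rho>" "u : closed_segment (p k) (\<gamma> t k)" "i < n" "\<rho> > 0" for t u i \<rho>
  proof -
   have "\<bar>u - p k\<bar> \<le> \<bar>\<gamma> t k - p k\<bar>"
    using that(2) by (auto simp: closed_segment_eq_real_ivl split: if_splits)
   moreover have "\<bar>\<gamma> t k - p k\<bar> < \<rho>" "\<bar>\<gamma> t i - p i\<bar> < \<rho>" using that(1) k that(3) by auto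
   ultimately show ?thesis using that(4) by (auto simp: hyb_def)
  qed
  have "\<exists>\<xi>\<in>closed_segment (p k) (\<gamma> t k). f (hyb (Suc k) t) - f (hyb k t) = (\<gamma> t k - p k) * g k (?pt t \<xi>)"
   if "good t" for t
  proof -
   have inD: "?pt t u : D" if "u : closed_segment (p k) (\<gamma> t k)" for u
    using \<open>good t\<close> that r(1)
    by (intro r(2)[rule_format] ptR seg) (auto simp: good_def)
   have e: "hyb (Suc k) t = ?pt t (\<gamma> t k)" "hyb k t = ?pt t (p k)"
    by (auto simp: hyb_def fun_eq_iff less_Suc_eq)
   have "\<exists>\<xi>\<in>closed_segment (p k) (\<gamma> t k).
     f (?pt t (\<gamma> t k)) - f (?pt t (p k)) = (\<gamma> t k - p k) * g k (?pt t \<xi>)"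
   proof (rule mvt_segment)
    fix u assume u: "u : closed_segment (p k) (\<gamma> t k)"
    have "((%v. f ((?pt t u)(k := v))) has_real_derivative g k (?pt t u))
     (at ((?pt t u) k) within {v. (?pt t u)(k := v) : D})"
     using f(1)[OF k] inD[OF u] unfolding has_pd_def by blast
    then have "((%v. f (?pt t v)) has_real_derivative g k (?pt t u)) (at u within {v. ?pt t v : D})"
     by simp
    then show "((%u. f (?pt t u)) has_real_derivative g k (?pt t u))
      (at u within closed_segment (p k) (\<gamma> t k))"
     by (rule DERIV_subset) (use inD in auto)
   qed
   then show ?thesis using e by simp
  qed
  then obtain \<xi> where \<xi>: "!!t. good t ==> \<xi> t : closed_segment (p k) (\<gamma> t k)"
   "!!t. good t ==> f (hyb (Suc k) t) - f (hyb k t) = (\<gamma> t k - p k) * g k (?pt t (\<xi> t))"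
   by metis
  have lim: "((%t. g k (?pt t (\<xi> t))) \<longlongrightarrow> g k p) (at t0 within A)"
  proof (rule tendstoI)
   fix e :: real assume "e > 0"
   then obtain r' where r': "r' > 0"
    "\<forall>y\<in>Rn n. (\<forall>i<n. \<bar>y i - p i\<bar> < r') --> y : D \<and> \<bar>g k y - g k p\<bar> < e"
    using continuous_box[OF D p f(2)[OF k] \<open>e > 0\<close>] by blast
   show "\<forall>\<^sub>F t in at t0 within A. dist (g k (?pt t (\<xi> t))) (g k p) < e"
    using small[OF r'(1)] small[OF r(1)]
   proof eventually_elim
    case (elim t)
    then have g: "good t" by (simp add: good_def)
    have "?pt t (\<xi> t) : D \<and> \<bar>g k (?pt t (\<xi> t)) - g k p\<bar> < e"
     using elim r'(1) by (intro r'(2)[rule_format] ptR seg[OF _ \<xi>(1)[OF g]]) auto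
    then show ?case by (simp add: dist_real_def)
   qed
  qed
  have "((%t. f (hyb (Suc k) t) - f (hyb k t)) has_real_derivative (d k * g k p)) (at t0 within A)"
   unfolding has_field_derivative_iff
  proof (rule Lim_transform_eventually)
   have "((%t. (\<gamma> t k - \<gamma> t0 k) / (t - t0)) \<longlongrightarrow> d k) (at t0 within A)"
    using d[OF k] by (simp add: has_field_derivative_iff)
   then show "((%t. (\<gamma> t k - \<gamma> t0 k) / (t - t0) * g k (?pt t (\<xi> t))) \<longlongrightarrow> d k * g k p) (at t0 within A)"
    by (intro tendsto_mult lim)
   have "hyb (Suc k) t0 = hyb k t0" by (auto simp: hyb_def p_def)
   then show "\<forall>\<^sub>F t in at t0 within A. (\<gamma> t k - \<gamma> t0 k) / (t - t0) * g k (?pt t (\<xi> t)) =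
     (f (hyb (Suc k) t) - f (hyb k t) - (f (hyb (Suc k) t0) - f (hyb k t0))) / (t - t0)"
    by (intro eventually_mono[OF small[OF r(1)]]) (use \<xi>(2) in \<open>simp add: good_def p_def\<close>)
  qed
  from DERIV_add[OF Suc.IH this] k show ?case by (simp add: algebra_simps)
 qed
 have "((%t. f (hyb n t)) has_real_derivative (\<Sum>i<n. g i p * d i)) (at t0 within A)" using main by simp
 then show ?thesis unfolding p_def
 proof (rule has_field_derivative_transform_within[where d=1])
  fix t assume "t : A"
  have "p i = 0" "\<gamma> t i = 0" if "\<not> i < n" for i
   using Rn p \<gamma>[OF \<open>t : A\<close>] that by (auto simp: Rn_def)
  then have "hyb n t i = \<gamma> t i" for i by (simp add: hyb_def)
  then show "f (hyb n t) = f (\<gamma> t)" by (metis ext)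
 qed (use t0 in auto)
qed

inductive_set comp_alg ::
  "nat => (nat => real) set => nat => (nat => real) set => ((nat => real) => (nat => real)) => ((nat => real) => real) set"
 for m D n D' G where
 comp: "smooth_on n D' f ==> (%x. f (G x)) : comp_alg m D n D' G"
| base: "smooth_on m D f ==> f : comp_alg m D n D' G"
| add: "f : comp_alg m D n D' G ==> g : comp_alg m D n D' G ==> (%x. f x + g x) : comp_alg m D n D' G"
| mult: "f : comp_alg m D n D' G ==> g : comp_alg m D n D' G ==> (%x. f x * g x) : comp_alg m D n D' G"

lemma comp_alg_sum:
 "(!!i. i : I ==> f i : comp_alg m D n D' G) ==> (%x. \<Sum>i\<in>I. f i x) : comp_alg m D n D' G"
 by (induction I rule: infinite_finite_induct)
  (auto intro: comp_alg.add comp_alg.base smooth_on_const)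

lemma smooth_on_compose:
 assumes D': "opn n D'" and f: "smooth_on n D' f" and G: "!!x. x : D ==> G x : D'"
  and Gs: "!!j. j < n ==> smooth_on m D (%x. G x j)"
 shows "smooth_on m D (%x. f (G x))"
proof (rule smooth_on_coinduct[where C="comp_alg m D n D' G"])
 have contG: "continuous_on D G"
 proof (rule continuous_on_coordinatewise_then_product)
  fix j show "continuous_on D (%x. G x j)"
  proof (cases "j < n")
   case True then show ?thesis using Gs smooth_on_continuous by blast
  next
   case False
   then have "G x j = 0" if "x : D" for x using G[OF that] opn_subset[OF D'] by (auto simp: Rn_def)
   then show ?thesis by (simp cong: continuous_on_cong)
  qed
 qed
 fix g assume "g : comp_alg m D n D' G"
 then show "continuous_on D g"
 proof induction
  case (comp f)
  then show ?case using G smooth_on_continuous contG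
   by (intro continuous_on_compose2[OF _ contG, of D' f]) auto
 qed (auto intro: continuous_intros smooth_on_continuous)
next
 fix g i assume "g : comp_alg m D n D' G" and i: "i < m"
 from this(1) show "\<exists>h\<in>comp_alg m D n D' G. has_pd D i g h"
 proof induction
  case (comp f)
  obtain f' where f': "!!j. j < n ==> smooth_on n D' (f' j) \<and> has_pd D' j f (f' j)"
   using smooth_on_pd[OF comp] by metis
  obtain G' where G': "!!j. j < n ==> smooth_on m D (G' j) \<and> has_pd D i (%x. G x j) (G' j)"
   using smooth_on_pd[OF Gs i] by metis
  let ?h = "%x. \<Sum>j<n. f' j (G x) * G' j x"
  have "has_pd D i (%x. f (G x)) ?h" unfolding has_pd_def
  proof
   fix x assume x: "x : D"
   have "((%t. f (G (x(i := t)))) has_real_derivative (\<Sum>j<n. f' j (G (x(i := x i))) * G' j x)) (at (x i) within {t. x(i := t) : D})"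
   proof (rule chain_pd[OF D'])
    show "((%t. G (x(i := t)) j) has_real_derivative G' j x) (at (x i) within {t. x(i := t) : D})" if "j < n" for j
     using G'[OF that] x by (auto simp: has_pd_def)
    show "has_pd D' j f (f' j)" "continuous_on D' (f' j)" if "j < n" for j
     using f'[OF that] smooth_on_continuous by blast+
    show "G (x(i := t)) : D'" if "t : {t. x(i := t) : D}" for t
     using G that by blast
   qed (use x in auto)
   then show "((%t. f (G (x(i := t)))) has_real_derivative ?h x) (at (x i) within {t. x(i := t) : D})" by simp
  qed
  moreover have "?h : comp_alg m D n D' G"
   by (intro comp_alg_sum comp_alg.mult comp_alg.comp comp_alg.base) (use f' G' in auto)
  ultimately show ?case by blast
 next
  case (base f)
  then show ?case using smooth_on_pd[OF _ i] comp_alg.base by blast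
 next
  case (add f g)
  then obtain f' g' where "f' : comp_alg m D n D' G" "has_pd D i f f'" "g' : comp_alg m D n D' G" "has_pd D i g g'" by blast
  then show ?case
   by (intro bexI[of _ "%x. f' x + g' x"] comp_alg.add) (auto simp: has_pd_def intro!: derivative_eq_intros)
 next
  case (mult f g)
  then obtain f' g' where *: "f' : comp_alg m D n D' G" "has_pd D i f f'" "g' : comp_alg m D n D' G" "has_pd D i g g'" by blast
  have "has_pd D i (%x. f x * g x) (%x. f x * g' x + f' x * g x)"
   using * DERIV_mult' unfolding has_pd_def by fastforce
  moreover have "(%x. f x * g' x + f' x * g x) : comp_alg m D n D' G"
   by (intro comp_alg.add comp_alg.mult * mult)
  ultimately show ?case by blast
 qed
qed (use f in \<open>auto intro: comp_alg.comp\<close>)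

subsection \<open>Domains on which partial derivatives are unique\<close>

text \<open>
 Each point of such a domain is a vertex of a small cube contained in the domain. Open sets and
 products of \<open>[0,1]\<close> with an open set have this property.
\<close>

definition ndom :: "nat => (nat => real) set => bool" where
 "ndom n D \<longleftrightarrow> D <= Rn n \<and> (\<forall>x\<in>D. \<exists>\<sigma> r. r > 0 \<and> (\<forall>i. \<sigma> i = 1 \<or> \<sigma> i = (-1::real)) \<and>
  (\<forall>y\<in>Rn n. (\<forall>i<n. 0 \<le> \<sigma> i * (y i - x i) \<and> \<sigma> i * (y i - x i) \<le> r) --> y : D))"

lemma ndom_cube:
 assumes "ndom n D" "x : D"
 shows "\<exists>\<sigma> r. r > 0 \<and> (\<forall>i. \<sigma> i = 1 \<or> \<sigma> i = (-1::real)) \<and>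
  (\<forall>y\<in>Rn n. (\<forall>i<n. 0 \<le> \<sigma> i * (y i - x i) \<and> \<sigma> i * (y i - x i) \<le> r) --> y : D)"
 using assms unfolding ndom_def by blast

lemma opn_ndom: assumes "opn n D" shows "ndom n D"
 unfolding ndom_def
proof (intro conjI ballI)
 show "D <= Rn n" using assms by (rule opn_subset)
 fix x assume "x : D"
 then obtain r where r: "r > 0" "\<forall>y\<in>Rn n. (\<forall>i<n. \<bar>y i - x i\<bar> < r) --> y : D"
  using opn_box[OF assms] by blast
 show "\<exists>\<sigma> r. r > 0 \<and> (\<forall>i. \<sigma> i = 1 \<or> \<sigma> i = (-1::real)) \<and>
  (\<forall>y\<in>Rn n. (\<forall>i<n. 0 \<le> \<sigma> i * (y i - x i) \<and> \<sigma> i * (y i - x i) \<le> r) --> y : D)"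
 proof (intro exI[of _ "%_. 1"] exI[of _ "r/2"] conjI ballI impI)
  fix y assume y: "y : Rn n" "\<forall>i<n. 0 \<le> 1 * (y i - x i) \<and> 1 * (y i - x i) \<le> r/2"
  have "\<bar>y i - x i\<bar> < r" if "i < n" for i using y(2)[rule_format, OF that] r(1) by auto
  then show "y : D" using r(2) y(1) by blast
 qed (use r in auto)
qed

lemma slice_not_bot:
 assumes "ndom n D" "x : D" "i < n"
 shows "at (x i) within {t. x(i := t) : D} \<noteq> bot"
proof -
 obtain \<sigma> r where \<sigma>: "r > 0" "\<forall>i. \<sigma> i = 1 \<or> \<sigma> i = (-1::real)"
  "\<forall>y\<in>Rn n. (\<forall>i<n. 0 \<le> \<sigma> i * (y i - x i) \<and> \<sigma> i * (y i - x i) \<le> r) --> y : D"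
  using ndom_cube[OF assms(1,2)] by blast
 have xR: "x : Rn n" using assms(1,2) by (auto simp: ndom_def)
 have "x i islimpt {t. x(i := t) : D}"
  unfolding islimpt_approachable
 proof (intro allI impI)
  fix e :: real assume e: "e > 0"
  define t where "t = x i + \<sigma> i * min r (e/2)"
  have s2: "\<sigma> i * \<sigma> i = 1" "\<bar>\<sigma> i\<bar> = 1" using \<sigma>(2)[rule_format, of i] by auto
  have "\<sigma> i * (t - x i) = min r (e/2)" using s2(1) by (simp add: t_def mult.assoc[symmetric])
  then have "x(i := t) : D"
   using \<sigma>(1) e xR assms(3) by (intro \<sigma>(3)[rule_format]) (auto simp: Rn_def)
  moreover have "dist t (x i) = min r (e/2)" using \<sigma>(1) e s2 by (simp add: t_def dist_real_def abs_mult)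
  then have "dist t (x i) < e" "t \<noteq> x i" using \<sigma>(1) e by auto
  ultimately show "\<exists>t\<in>{t. x(i := t) : D}. t \<noteq> x i \<and> dist t (x i) < e" by blast
 qed
 then show ?thesis by (simp add: trivial_limit_within)
qed

definition pd :: "(nat => real) set => nat => ((nat => real) => real) => (nat => real) => real" where
 "pd D i f x = (SOME d. ((%t. f (x(i := t))) has_real_derivative d) (at (x i) within {t. x(i := t) : D}))"

lemma pd_eqI:
 assumes "ndom n D" "x : D" "i < n"
  and "((%t. f (x(i := t))) has_real_derivative d) (at (x i) within {t. x(i := t) : D})"
 shows "pd D i f x = d"
proof -
 have "((%t. f (x(i := t))) has_real_derivative pd D i f x) (at (x i) within {t. x(i := t) : D})"
  unfolding pd_def using assms(4) by (rule someI)
 then show ?thesis using assms(4) slice_not_bot[OF assms(1-3)]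
  by (metis has_real_derivative_iff_has_vector_derivative vector_derivative_unique_within)
qed

lemma has_pd_unique: "ndom n D ==> i < n ==> has_pd D i f g ==> x : D ==> pd D i f x = g x"
 by (rule pd_eqI) (auto simp: has_pd_def)

lemma smooth_has_pd:
 assumes "ndom n D" "smooth_on n D f" "i < n"
 shows "has_pd D i f (pd D i f)" and smooth_on_pd': "smooth_on n D (pd D i f)"
proof -
 obtain g where g: "smooth_on n D g" "has_pd D i f g" using smooth_on_pd assms(2,3) by blast
 then have eq: "!!x. x : D ==> g x = pd D i f x" using has_pd_unique[OF assms(1,3)] by simp
 show "has_pd D i f (pd D i f)" by (rule has_pd_cong[OF g(2)]) (use eq in auto)
 show "smooth_on n D (pd D i f)" by (rule smooth_on_cong[OF g(1) eq])
qed

lemma has_pd_local: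
 assumes "open W" "x : W"
  and "((%t. f (x(i := t))) has_real_derivative d) (at (x i) within {t. x(i := t) : D \<inter> W})"
 shows "((%t. f (x(i := t))) has_real_derivative d) (at (x i) within {t. x(i := t) : D})"
proof -
 have "continuous_on UNIV (%t. x(i := t))"
 proof (rule continuous_on_coordinatewise_then_product)
  fix j show "continuous_on UNIV (%t. (x(i := t)) j)" by (cases "j = i") auto
 qed
 then have "open ((%t. x(i := t)) -` W)" using assms(1) by (simp add: open_vimage)
 moreover have "x i : (%t. x(i := t)) -` W" using assms(2) by simp
 ultimately have "at (x i) within {t. x(i := t) : D} = at (x i) within {t. x(i := t) : D \<inter> W}"
  by (intro at_within_nhd[where S="(%t. x(i := t)) -` W"]) auto
 then show ?thesis using assms(3) by simp
qed

lemma smooth_on_local: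
 assumes D: "ndom n D" and loc: "!!x. x : D ==> \<exists>W. open W \<and> x : W \<and> smooth_on n (D \<inter> W) f"
 shows "smooth_on n D f"
proof (rule smooth_on_coinduct[where C="{f. \<forall>x\<in>D. \<exists>W. open W \<and> x : W \<and> smooth_on n (D \<inter> W) f}"])
 show "f : {f. \<forall>x\<in>D. \<exists>W. open W \<and> x : W \<and> smooth_on n (D \<inter> W) f}" using loc by blast
next
 fix g assume "g : {f. \<forall>x\<in>D. \<exists>W. open W \<and> x : W \<and> smooth_on n (D \<inter> W) f}"
 then have g: "!!x. x : D ==> \<exists>W. open W \<and> x : W \<and> smooth_on n (D \<inter> W) g" by blast
 show "continuous_on D g"
  unfolding continuous_on_eq_continuous_within
 proof
  fix x assume x: "x : D"
  then obtain W where W: "open W" "x : W" "smooth_on n (D \<inter> W) g" using g by blast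
  then have "continuous (at x within D \<inter> W) g"
   using x smooth_on_continuous by (auto simp: continuous_on_eq_continuous_within)
  moreover have "at x within D \<inter> W = at x within D"
   using W by (intro at_within_nhd[where S=W]) auto
  ultimately show "continuous (at x within D) g" by simp
 qed
 fix i assume i: "i < n"
 have "has_pd D i g (pd D i g) \<and> (\<forall>x\<in>D. \<exists>W. open W \<and> x : W \<and> smooth_on n (D \<inter> W) (pd D i g))"
 proof -
  have *: "\<exists>W h. open W \<and> x : W \<and> smooth_on n (D \<inter> W) h \<and>
   (\<forall>y\<in>D \<inter> W. ((%t. g (y(i := t))) has_real_derivative h y) (at (y i) within {t. y(i := t) : D}))" if x: "x : D" for x
  proof -
   obtain W where W: "open W" "x : W" "smooth_on n (D \<inter> W) g" using g[OF x] by blast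
   obtain h where h: "smooth_on n (D \<inter> W) h" "has_pd (D \<inter> W) i g h" using smooth_on_pd[OF W(3) i] by blast
   have "((%t. g (y(i := t))) has_real_derivative h y) (at (y i) within {t. y(i := t) : D})" if "y : D \<inter> W" for y
   proof (rule has_pd_local[OF W(1)])
    show "((%t. g (y(i := t))) has_real_derivative h y) (at (y i) within {t. y(i := t) : D \<inter> W})"
     using h(2) that unfolding has_pd_def by blast
   qed (use that in auto)
   with W h show ?thesis by blast
  qed
  have "has_pd D i g (pd D i g)" unfolding has_pd_def
  proof
   fix x assume x: "x : D"
   then obtain h where "((%t. g (x(i := t))) has_real_derivative h x) (at (x i) within {t. x(i := t) : D})"
    using * by blast
   then show "((%t. g (x(i := t))) has_real_derivative pd D i g x) (at (x i) within {t. x(i := t) : D})"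
    using pd_eqI[OF D x i] by fastforce
  qed
  moreover have "\<exists>W. open W \<and> x : W \<and> smooth_on n (D \<inter> W) (pd D i g)" if x: "x : D" for x
  proof -
   obtain W h where W: "open W" "x : W" "smooth_on n (D \<inter> W) h"
   "\<forall>y\<in>D \<inter> W. ((%t. g (y(i := t))) has_real_derivative h y) (at (y i) within {t. y(i := t) : D})"
    using *[OF x] by blast
   have "smooth_on n (D \<inter> W) (pd D i g)"
   proof (rule smooth_on_cong[OF W(3)])
    fix y assume y: "y : D \<inter> W"
    then show "h y = pd D i g y" using W(4) by (intro pd_eqI[OF D _ i, symmetric]) blast+
   qed
   with W(1,2) show ?thesis by (intro exI[of _ W] conjI)
  qed
  ultimately show ?thesis by blast
 qed
 then show "\<exists>h\<in>{f. \<forall>x\<in>D. \<exists>W. open W \<and> x : W \<and> smooth_on n (D \<inter> W) f}. has_pd D i g h" by blast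
qed

lemma schwarz_rectangle:
 fixes f f1 f2 f12 f21 :: "real => real => real"
 assumes r: "r > 0"
  and f1: "!!a b. a : {0..r} ==> b : {0..r} ==> ((%a. f a b) has_real_derivative f1 a b) (at a within {0..r})"
  and f2: "!!a b. a : {0..r} ==> b : {0..r} ==> ((%b. f a b) has_real_derivative f2 a b) (at b within {0..r})"
  and f12: "!!a b. a : {0..r} ==> b : {0..r} ==> ((%b. f1 a b) has_real_derivative f12 a b) (at b within {0..r})"
  and f21: "!!a b. a : {0..r} ==> b : {0..r} ==> ((%a. f2 a b) has_real_derivative f21 a b) (at a within {0..r})"
  and c12: "continuous_on ({0..r} \<times> {0..r}) (%(a,b). f12 a b)"
  and c21: "continuous_on ({0..r} \<times> {0..r}) (%(a,b). f21 a b)"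
 shows "f12 0 0 = f21 0 0"
proof -
 have half: "\<exists>\<xi>\<in>{0..h}. \<exists>\<eta>\<in>{0..h}. f h h - f h 0 - f 0 h + f 0 0 = h * h * f12 \<xi> \<eta>"
  if h: "0 < h" "h \<le> r"
   and f1: "!!a b. a : {0..r} ==> b : {0..r} ==> ((%a. f a b) has_real_derivative f1 a b) (at a within {0..r})"
   and f12: "!!a b. a : {0..r} ==> b : {0..r} ==> ((%b. f1 a b) has_real_derivative f12 a b) (at b within {0..r})"
  for f f1 f12 :: "real => real => real" and h
 proof -
  have seg: "closed_segment 0 h = {0..h}" using h by (simp add: closed_segment_eq_real_ivl)
  have "\<exists>\<xi>\<in>closed_segment 0 h. (f h h - f h 0) - (f 0 h - f 0 0) = (h - 0) * (f1 \<xi> h - f1 \<xi> 0)"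
  proof (rule mvt_segment[of 0 h "%a. f a h - f a 0"])
   fix u assume "u : closed_segment 0 h"
   then have "u : {0..r}" using h seg by auto
   then show "((%a. f a h - f a 0) has_real_derivative (f1 u h - f1 u 0)) (at u within closed_segment 0 h)"
    using h seg by (intro DERIV_diff DERIV_subset[OF f1]) auto
  qed
  then obtain \<xi> where \<xi>: "\<xi> : {0..h}" "f h h - f h 0 - f 0 h + f 0 0 = h * (f1 \<xi> h - f1 \<xi> 0)"
   using seg by (auto simp: algebra_simps)
  have "\<exists>\<eta>\<in>closed_segment 0 h. f1 \<xi> h - f1 \<xi> 0 = (h - 0) * f12 \<xi> \<eta>"
   using \<xi>(1) h seg by (intro mvt_segment DERIV_subset[OF f12]) auto
  then obtain \<eta> where "\<eta> : {0..h}" "f1 \<xi> h - f1 \<xi> 0 = h * f12 \<xi> \<eta>" using seg by auto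
  then show ?thesis using \<xi> by (intro bexI[of _ \<xi>] bexI[of _ \<eta>]) auto
 qed
 have near: "\<exists>d>0. \<forall>a\<in>{0..r}. \<forall>b\<in>{0..r}. a < d --> b < d --> \<bar>k a b - k 0 0\<bar> < e"
  if k: "continuous_on ({0..r} \<times> {0..r}) (%(a,b). k a b)" and e: "e > 0" for k :: "real => real => real" and e
 proof -
  have "(0,0) : {0..r} \<times> {0..r}" using r by auto
  then obtain d where d: "d > 0"
   "\<forall>z\<in>{0..r} \<times> {0..r}. dist z (0,0) < d --> dist ((%(a,b). k a b) z) ((%(a,b). k a b) (0,0)) < e"
   using k e unfolding continuous_on_iff by blast
  have "\<bar>k a b - k 0 0\<bar> < e" if "a : {0..r}" "b : {0..r}" "a < d/2" "b < d/2" for a b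
  proof -
   have "dist (a,b) (0,0) \<le> \<bar>a\<bar> + \<bar>b\<bar>"
    by (simp add: dist_prod_def dist_real_def sqrt_sum_squares_le_sum_abs)
   then have "dist (a,b) (0,0) < d" using that by auto
   then show ?thesis using d(2) that by (auto simp: dist_real_def)
  qed
  then show ?thesis using d(1) by (intro exI[of _ "d/2"]) auto
 qed
 show ?thesis
 proof (rule ccontr)
  assume "f12 0 0 \<noteq> f21 0 0"
  then have e: "\<bar>f12 0 0 - f21 0 0\<bar> / 2 > 0" by simp
  obtain d1 where d1: "d1 > 0" "\<forall>a\<in>{0..r}. \<forall>b\<in>{0..r}. a < d1 --> b < d1 --> \<bar>f12 a b - f12 0 0\<bar> < \<bar>f12 0 0 - f21 0 0\<bar> / 2"
   using near[OF c12 e] by blast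
  obtain d2 where d2: "d2 > 0" "\<forall>a\<in>{0..r}. \<forall>b\<in>{0..r}. a < d2 --> b < d2 --> \<bar>f21 a b - f21 0 0\<bar> < \<bar>f12 0 0 - f21 0 0\<bar> / 2"
   using near[OF c21 e] by blast
  define h where "h = min r (min d1 d2 / 2)"
  have h: "0 < h" "h \<le> r" "h < d1" "h < d2" using r d1(1) d2(1) by (auto simp: h_def min_def)
  obtain \<xi> \<eta> where 1: "\<xi> : {0..h}" "\<eta> : {0..h}" "f h h - f h 0 - f 0 h + f 0 0 = h * h * f12 \<xi> \<eta>"
   using half[OF h(1,2) f1 f12] by blast
  obtain \<xi>' \<eta>' where 2: "\<xi>' : {0..h}" "\<eta>' : {0..h}" "f h h - f 0 h - f h 0 + f 0 0 = h * h * f21 \<eta>' \<xi>'"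
   using half[OF h(1,2), of "%a b. f b a" "%a b. f2 b a" "%a b. f21 b a"] f2 f21 by auto
  have "h * h * f12 \<xi> \<eta> = h * h * f21 \<eta>' \<xi>'" using 1(3) 2(3) by linarith
  then have "f12 \<xi> \<eta> = f21 \<eta>' \<xi>'" using h(1) by simp
  moreover have "\<bar>f12 \<xi> \<eta> - f12 0 0\<bar> < \<bar>f12 0 0 - f21 0 0\<bar> / 2" using 1 h d1(2) by auto
  moreover have "\<bar>f21 \<eta>' \<xi>' - f21 0 0\<bar> < \<bar>f12 0 0 - f21 0 0\<bar> / 2" using 2 h d2(2) by auto
  ultimately have "\<bar>f12 \<xi> \<eta> - f12 0 0\<bar> + \<bar>f12 \<xi> \<eta> - f21 0 0\<bar> < \<bar>f12 0 0 - f21 0 0\<bar>"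
   by simp
  then show False by linarith
 qed
qed

lemma pd_commute:
 assumes D: "ndom n D" and f: "smooth_on n D f" and i: "i < n" and j: "j < n" and x: "x : D"
 shows "pd D i (pd D j f) x = pd D j (pd D i f) x"
proof (cases "i = j")
 case False
 obtain \<sigma> r where \<sigma>: "r > 0" "\<forall>i. \<sigma> i = 1 \<or> \<sigma> i = (-1::real)"
  "\<forall>y\<in>Rn n. (\<forall>i<n. 0 \<le> \<sigma> i * (y i - x i) \<and> \<sigma> i * (y i - x i) \<le> r) --> y : D"
  using ndom_cube[OF D x] by blast
 have s2: "\<sigma> i * (\<sigma> i * a) = a" for i a using \<sigma>(2)[rule_format, of i] by auto
 have xR: "x : Rn n" using x D by (auto simp: ndom_def)
 define pt where "pt a b = x(i := x i + \<sigma> i * a, j := x j + \<sigma> j * b)" for a b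
 have ptD: "pt a b : D" if "a : {0..r}" "b : {0..r}" for a b
  using that xR i j False \<sigma>(1) by (intro \<sigma>(3)[rule_format]) (auto simp: Rn_def pt_def s2)
 have di: "((%a. g (pt a b)) has_real_derivative (\<sigma> i * g' (pt a b))) (at a within {0..r})"
  if "has_pd D i g g'" "a : {0..r}" "b : {0..r}" for g g' a b
 proof -
  have e: "(pt a b)(i := x i + \<sigma> i * a') = pt a' b" for a' using False by (auto simp: pt_def)
  have ai: "pt a b i = x i + \<sigma> i * a" using False by (simp add: pt_def)
  have "((%t. g ((pt a b)(i := t))) has_real_derivative g' (pt a b)) (at (x i + \<sigma> i * a) within {t. (pt a b)(i := t) : D})"
   using that(1) ptD[OF that(2,3)] ai unfolding has_pd_def by force
  then have "((%t. g ((pt a b)(i := t))) has_real_derivative g' (pt a b)) (at (x i + \<sigma> i * a) within (%a. x i + \<sigma> i * a) ` {0..r})"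
   by (rule DERIV_subset) (use e ptD that(3) in auto)
  from DERIV_image_chain[OF this, of "\<sigma> i"]
  have "((%t. g ((pt a b)(i := t))) \<circ> (%a. x i + \<sigma> i * a) has_real_derivative g' (pt a b) * \<sigma> i) (at a within {0..r})"
   by (rule meta_mp) (auto intro!: derivative_eq_intros)
  then show ?thesis unfolding o_def e by (rule DERIV_cong) (rule mult.commute)
 qed
 have dj: "((%b. g (pt a b)) has_real_derivative (\<sigma> j * g' (pt a b))) (at b within {0..r})"
  if "has_pd D j g g'" "a : {0..r}" "b : {0..r}" for g g' a b
 proof -
  have e: "(pt a b)(j := x j + \<sigma> j * b') = pt a b'" for b' using False by (auto simp: pt_def)
  have ai: "pt a b j = x j + \<sigma> j * b" using False by (simp add: pt_def)
  have "((%t. g ((pt a b)(j := t))) has_real_derivative g' (pt a b)) (at (x j + \<sigma> j * b) within {t. (pt a b)(j := t) : D})"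
   using that(1) ptD[OF that(2,3)] ai unfolding has_pd_def by force
  then have "((%t. g ((pt a b)(j := t))) has_real_derivative g' (pt a b)) (at (x j + \<sigma> j * b) within (%a. x j + \<sigma> j * a) ` {0..r})"
   by (rule DERIV_subset) (use e ptD that(2) in auto)
  from DERIV_image_chain[OF this, of "\<sigma> j"]
  have "((%t. g ((pt a b)(j := t))) \<circ> (%a. x j + \<sigma> j * a) has_real_derivative g' (pt a b) * \<sigma> j) (at b within {0..r})"
   by (rule meta_mp) (auto intro!: derivative_eq_intros)
  then show ?thesis unfolding o_def e by (rule DERIV_cong) (rule mult.commute)
 qed
 have cpt: "continuous_on UNIV (%z. pt (fst z) (snd z))"
 proof (rule continuous_on_coordinatewise_then_product)
  fix k show "continuous_on UNIV (%z. pt (fst z) (snd z) k)"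
   by (cases "k = i"; cases "k = j") (simp_all add: pt_def continuous_intros)
 qed
 have cont: "continuous_on ({0..r} \<times> {0..r}) (%(a,b). c * (c' * g (pt a b)))" if "smooth_on n D g" for g c c'
  unfolding split_beta
  by (intro continuous_intros continuous_on_compose2[OF smooth_on_continuous[OF that] continuous_on_subset[OF cpt]])
   (use ptD in auto)
 note P = smooth_has_pd[OF D] smooth_on_pd'[OF D]
 have "\<sigma> i * (\<sigma> j * pd D j (pd D i f) (pt 0 0)) = \<sigma> j * (\<sigma> i * pd D i (pd D j f) (pt 0 0))"
 proof (rule schwarz_rectangle[OF \<sigma>(1), of "%a b. f (pt a b)" "%a b. \<sigma> i * pd D i f (pt a b)" "%a b. \<sigma> j * pd D j f (pt a b)"
   "%a b. \<sigma> i * (\<sigma> j * pd D j (pd D i f) (pt a b))" "%a b. \<sigma> j * (\<sigma> i * pd D i (pd D j f) (pt a b))"])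
  fix a b assume ab: "a : {0..r}" "b : {0..r}"
  show "((%a. f (pt a b)) has_real_derivative \<sigma> i * pd D i f (pt a b)) (at a within {0..r})"
   by (intro di P f i ab)
  show "((%b. f (pt a b)) has_real_derivative \<sigma> j * pd D j f (pt a b)) (at b within {0..r})"
   by (intro dj P f j ab)
  show "((%b. \<sigma> i * pd D i f (pt a b)) has_real_derivative \<sigma> i * (\<sigma> j * pd D j (pd D i f) (pt a b))) (at b within {0..r})"
   by (intro DERIV_cmult dj P f i j ab)
  show "((%a. \<sigma> j * pd D j f (pt a b)) has_real_derivative \<sigma> j * (\<sigma> i * pd D i (pd D j f) (pt a b))) (at a within {0..r})"
   by (intro DERIV_cmult di P f i j ab)
 qed (intro cont P f i j)+
 moreover have "pt 0 0 = x" by (simp add: pt_def)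
 moreover have "\<sigma> i * \<sigma> j \<noteq> 0" using \<sigma>(2) by (metis mult_eq_0_iff zero_neq_one zero_neq_neg_one)
 ultimately show ?thesis by (simp add: mult.left_commute mult.assoc[symmetric])
qed simp

lemma smooth_on_reindex:
 assumes f: "smooth_on n D f" and \<rho>: "!!z k. \<rho> z k = (case \<sigma> k of Some j => z j | None => c k)"
  and inj: "!!k k' j. \<sigma> k = Some j ==> \<sigma> k' = Some j ==> k = k'"
  and bd: "!!k i. \<sigma> k = Some i ==> i < n' ==> k < n"
  and D': "!!z. z : D' ==> \<rho> z : D"
 shows "smooth_on n' D' (%z. f (\<rho> z))"
proof (rule smooth_on_coinduct[where C="insert (%z. 0) ((%g z. g (\<rho> z)) ` {g. smooth_on n D g})"])
 have c\<rho>: "continuous_on D' \<rho>"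
 proof (rule continuous_on_coordinatewise_then_product)
  fix k show "continuous_on D' (%z. \<rho> z k)"
   unfolding \<rho> by (cases "\<sigma> k") (auto intro: continuous_on_subset[OF continuous_on_product_coordinates])
 qed
 fix g assume g: "g : insert (%z. 0) ((%g z. g (\<rho> z)) ` {g. smooth_on n D g})"
 show "continuous_on D' g"
  using g
 proof (elim insertE imageE CollectE)
  fix h assume "g = (%z. h (\<rho> z))" "smooth_on n D h"
  then show ?thesis using continuous_on_compose2[OF smooth_on_continuous c\<rho>] D' by blast
 qed simp
 fix i assume i: "i < n'"
 consider "g = (%z. 0)" | h where "g = (%z. h (\<rho> z))" "smooth_on n D h" using g by auto
 then show "\<exists>h\<in>insert (%z. 0) ((%g z. g (\<rho> z)) ` {g. smooth_on n D g}). has_pd D' i g h"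
 proof cases
  case 1
  then have "has_pd D' i g (%z. 0)" by (auto simp: has_pd_def)
  then show ?thesis by blast
 next
  case 2
  show ?thesis
  proof (cases "\<exists>k. \<sigma> k = Some i")
   case True
   then obtain k where k: "\<sigma> k = Some i" by blast
   then have e: "\<rho> (z(i := t)) = (\<rho> z)(k := t)" for z t
    using inj by (auto simp: \<rho> fun_eq_iff split: option.split)
   obtain h' where h': "smooth_on n D h'" "has_pd D k h h'" using smooth_on_pd[OF 2(2) bd[OF k i]] by blast
   have "has_pd D' i g (%z. h' (\<rho> z))" unfolding has_pd_def
   proof
    fix z assume z: "z : D'"
    have "\<rho> z k = z i" by (simp add: \<rho> k)
    then have "((%t. h ((\<rho> z)(k := t))) has_real_derivative h' (\<rho> z)) (at (z i) within {t. (\<rho> z)(k := t) : D})"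
     using h'(2) D'[OF z] unfolding has_pd_def by metis
    then show "((%t. g (z(i := t))) has_real_derivative h' (\<rho> z)) (at (z i) within {t. z(i := t) : D'})"
     unfolding 2(1) e by (rule DERIV_subset) (auto simp flip: e intro: D')
   qed
   then show ?thesis using h'(1) by blast
  next
   case False
   then have "\<rho> (z(i := t)) = \<rho> z" for z t
    by (auto simp: \<rho> fun_eq_iff split: option.split)
   then have "has_pd D' i g (%z. 0)" by (auto simp: has_pd_def 2(1))
   then show ?thesis by blast
  qed
 qed
next
 show "(%z. f (\<rho> z)) : insert (%z. 0) ((%g z. g (\<rho> z)) ` {g. smooth_on n D g})"
  using f by blast
qed

subsection \<open>Time-dependent functions and cylinders\<close>

definition tail :: "(nat => real) => nat => real" where "tail z = (%j. z (Suc j))"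

definition famd :: "nat => (nat => real) set => (nat => real) set" where
 "famd n D = {z \<in> Rn (Suc n). z 0 : {0..1} \<and> (%j. z (Suc j)) : D}"

definition trunc :: "nat => (nat => real) => nat => real" where
 "trunc n z = (%i. if i < n then z i else 0)"

definition cyl :: "nat => nat => (nat => real) set => (nat => real) set" where
 "cyl n r D = {z \<in> Rn (n + r). trunc n z : D}"

lemma tail_case_nat [simp]: "tail (case_nat t y) = y" by (simp add: tail_def)

lemma case_nat_tail: "case_nat (z 0) (tail z) = z" by (auto simp: tail_def fun_eq_iff split: nat.split)

lemma case_nat_upd_0: "(case_nat t y)(0 := u) = case_nat u y"
 and case_nat_upd_Suc: "(case_nat t y)(Suc i := u) = case_nat t (y(i := u))"
 by (auto simp: fun_eq_iff split: nat.split)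

lemma famd_iff: "D <= Rn n ==> z : famd n D \<longleftrightarrow> z 0 : {0..1} \<and> tail z : D"
proof -
 assume D: "D <= Rn n"
 have "z : Rn (Suc n)" if "tail z : D"
 proof -
  have "z j = 0" if "j \<ge> Suc n" for j
   using \<open>tail z : D\<close> D that by (cases j) (auto simp: Rn_def tail_def dest!: subsetD)
  then show ?thesis by (auto simp: Rn_def)
 qed
 then show ?thesis by (auto simp: famd_def tail_def)
qed

lemma case_nat_famd: "D <= Rn n ==> case_nat t y : famd n D \<longleftrightarrow> t : {0..1} \<and> y : D"
 by (simp add: famd_iff)

lemma famd_mono: "D <= D' ==> famd n D <= famd n D'" by (auto simp: famd_def)

lemma ndom_famd: assumes "opn n D" shows "ndom (Suc n) (famd n D)"
 unfolding ndom_def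
proof (intro conjI ballI)
 note DR = opn_subset[OF assms]
 show "famd n D <= Rn (Suc n)" by (auto simp: famd_def)
 fix x assume x: "x : famd n D"
 then obtain r where r: "r > 0" "\<forall>y\<in>Rn n. (\<forall>i<n. \<bar>y i - tail x i\<bar> < r) --> y : D"
  using opn_box[OF assms, of "tail x"] by (auto simp: famd_def tail_def)
 have x0: "0 \<le> x 0" "x 0 \<le> 1" using x by (auto simp: famd_def)
 define \<sigma> where "\<sigma> i = (if i = 0 \<and> x 0 = 1 then -1 else 1::real)" for i :: nat
 define s where "s = min (r/2) (if x 0 = 1 then 1 else 1 - x 0)"
 show "\<exists>\<sigma> r. r > 0 \<and> (\<forall>i. \<sigma> i = 1 \<or> \<sigma> i = (-1::real)) \<and>
  (\<forall>y\<in>Rn (Suc n). (\<forall>i<Suc n. 0 \<le> \<sigma> i * (y i - x i) \<and> \<sigma> i * (y i - x i) \<le> r) --> y : famd n D)"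
 proof (intro exI[of _ \<sigma>] exI[of _ s] conjI ballI impI allI)
  show "s > 0" using r x0 by (auto simp: s_def)
  show "\<sigma> i = 1 \<or> \<sigma> i = - 1" for i by (simp add: \<sigma>_def)
  fix y assume y: "y : Rn (Suc n)" "\<forall>i<Suc n. 0 \<le> \<sigma> i * (y i - x i) \<and> \<sigma> i * (y i - x i) \<le> s"
  have "tail y : Rn n" using y(1) by (auto simp: Rn_def tail_def)
  moreover have "\<bar>tail y i - tail x i\<bar> < r" if "i < n" for i
   using y(2)[rule_format, of "Suc i"] that r(1) by (auto simp: \<sigma>_def s_def tail_def)
  ultimately have "tail y : D" using r(2) by blast
  moreover have "y 0 : {0..1}" using y(2)[rule_format, of 0] x0 by (auto simp: \<sigma>_def s_def split: if_splits)
  ultimately show "y : famd n D" by (simp add: famd_iff[OF DR])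
 qed
qed

lemma smooth_on_famd_const:
 assumes "smooth_on n D f" shows "smooth_on (Suc n) (famd n D) (%z. f (tail z))"
proof (rule smooth_on_reindex[OF assms, where \<sigma>="%k. Some (Suc k)" and c="%_. 0"])
 fix z assume "z : famd n D" then show "tail z : D" by (simp add: famd_def tail_def)
qed (auto simp: tail_def)

lemma smooth_on_famd_slice:
 assumes "smooth_on (Suc n) (famd n D) g" "t : {0..1}" "D <= Rn n"
 shows "smooth_on n D (%y. g (case_nat t y))"
proof (rule smooth_on_reindex[OF assms(1), where \<sigma>="case_nat None Some" and c="%_. t"])
 fix z assume "z : D" then show "case_nat t z : famd n D" using assms by (simp add: case_nat_famd)
qed (auto split: nat.splits)

lemma has_pd_famd_slice:
 assumes "has_pd (famd n D) (Suc i) g h" "t : {0..1}" "D <= Rn n"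
 shows "has_pd D i (%y. g (case_nat t y)) (%y. h (case_nat t y))"
 unfolding has_pd_def
proof
 fix y assume "y : D"
 then have "case_nat t y : famd n D" using assms by (simp add: case_nat_famd)
 then have "((%u. g ((case_nat t y)(Suc i := u))) has_real_derivative h (case_nat t y))
   (at (case_nat t y (Suc i)) within {u. (case_nat t y)(Suc i := u) : famd n D})"
  using assms(1) unfolding has_pd_def by blast
 then show "((%u. g (case_nat t (y(i := u)))) has_real_derivative h (case_nat t y)) (at (y i) within {u. y(i := u) : D})"
  using assms by (simp add: case_nat_upd_Suc case_nat_famd)
qed

lemma has_pd_famd_time:
 assumes "has_pd (famd n D) 0 g h" "t : {0..1}" "D <= Rn n" "y : D"
 shows "((%t. g (case_nat t y)) has_real_derivative h (case_nat t y)) (at t within {0..1})"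
proof -
 have "case_nat t y : famd n D" using assms by (simp add: case_nat_famd)
 then have "((%u. g ((case_nat t y)(0 := u))) has_real_derivative h (case_nat t y))
   (at (case_nat t y 0) within {u. (case_nat t y)(0 := u) : famd n D})"
  using assms(1) unfolding has_pd_def by blast
 moreover have "{u. (case_nat t y)(0 := u) : famd n D} = {0..1}"
  using assms(3,4) by (auto simp: case_nat_upd_0 case_nat_famd)
 ultimately show ?thesis by (simp add: case_nat_upd_0)
qed

lemma trunc_Rn: "trunc n z : Rn n" by (simp add: trunc_def Rn_def)

lemma trunc_id: "z : Rn n ==> trunc n z = z" by (auto simp: trunc_def Rn_def fun_eq_iff)

lemma cyl_sub: "D <= Rn n ==> D <= cyl n r D"
proof
 fix z assume "D <= Rn n" "z : D"
 then have z: "z : Rn n" by blast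
 then have "z : Rn (n + r)" by (simp add: Rn_def)
 then show "z : cyl n r D" using trunc_id[OF z] \<open>z : D\<close> by (simp add: cyl_def)
qed

lemma cyl_Rn: "cyl n r D <= Rn (n + r)" by (auto simp: cyl_def)

lemma opn_cyl: assumes "opn n D" shows "opn (n + r) (cyl n r D)"
 unfolding opn_iff_box
proof (intro conjI ballI)
 fix p assume "p : cyl n r D"
 then obtain s where s: "s > 0" "\<forall>y\<in>Rn n. (\<forall>i<n. \<bar>y i - trunc n p i\<bar> < s) --> y : D"
  using opn_box[OF assms, of "trunc n p"] by (auto simp: cyl_def)
 show "\<exists>s>0. \<forall>y\<in>Rn (n + r). (\<forall>i<n + r. \<bar>y i - p i\<bar> < s) --> y : cyl n r D"
 proof (intro exI[of _ s] conjI ballI impI)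
  fix y assume y: "y : Rn (n + r)" "\<forall>i<n + r. \<bar>y i - p i\<bar> < s"
  then have "trunc n y : D" by (intro s(2)[rule_format] trunc_Rn) (auto simp: trunc_def)
  then show "y : cyl n r D" using y by (simp add: cyl_def)
 qed (rule s)
qed (rule cyl_Rn)

lemma smooth_on_cyl:
 assumes "smooth_on n D f" shows "smooth_on (n + r) (cyl n r D) (%z. f (trunc n z))"
 by (rule smooth_on_reindex[OF assms, where \<sigma>="%k. if k < n then Some k else None" and c="%_. 0"])
  (auto simp: trunc_def cyl_def split: if_splits)

lemma tail_trunc: "tail (trunc (Suc n) z) = trunc n (tail z)" by (auto simp: tail_def trunc_def)

lemma famd_cyl_trunc:
 assumes "z : famd (n + r) (cyl n r D)" "D <= Rn n" shows "trunc (Suc n) z : famd n D"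
proof -
 have "tail z : cyl n r D" "z 0 : {0..1}" using assms(1) by (auto simp: famd_def tail_def)
 then have "trunc n (tail z) : D" "z 0 : {0..1}" by (auto simp: cyl_def)
 then show ?thesis by (simp add: famd_iff[OF assms(2)] tail_trunc) (simp add: trunc_def)
qed

lemma smooth_on_famd_cyl:
 assumes "smooth_on (Suc n) (famd n D) f" "D <= Rn n"
 shows "smooth_on (Suc (n + r)) (famd (n + r) (cyl n r D)) (%z. f (trunc (Suc n) z))"
 by (rule smooth_on_reindex[OF assms(1), where \<sigma>="%k. if k < Suc n then Some k else None" and c="%_. 0"])
  (use famd_cyl_trunc[OF _ assms(2)] in \<open>auto simp: trunc_def split: if_splits\<close>)

lemma famd_sub_cyl:
 assumes "D <= Rn n" shows "famd n D <= famd (n + r) (cyl n r D)"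
proof
 fix z assume "z : famd n D"
 then have "z 0 : {0..1}" "tail z : cyl n r D" using cyl_sub[OF assms] by (auto simp: famd_iff[OF assms])
 then show "z : famd (n + r) (cyl n r D)" by (simp add: famd_iff[OF cyl_Rn])
qed

subsection \<open>Hadamard's lemma\<close>

definition lerp :: "(nat => real) => real => (nat => real) => nat => real" where
 "lerp p s z = (%i. p i + s * (z i - p i))"

lemma smooth_on_lerp_integral:
 assumes D: "opn n D" and conv: "!!p z s. p : D ==> z : D ==> s : {0..1} ==> lerp p s z : D"
  and p: "p : D" and f: "smooth_on n D f"
 shows "smooth_on n D (%z. integral {0..1} (%s. f (lerp p s z)))"
proof -
 define I where "I = (%(k::nat, g) z. integral {0..1} (%s. s ^ k * g (lerp p s z)))"
 have cl: "continuous_on UNIV (%w. lerp p (snd w) (fst w))"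
 proof (rule continuous_on_coordinatewise_then_product)
  fix i
  have "continuous_on UNIV (%w :: (nat => real) \<times> real. fst w i)"
   by (rule continuous_on_compose2[OF continuous_on_product_coordinates continuous_on_fst[OF continuous_on_id]]) auto
  then show "continuous_on UNIV (%w. lerp p (snd w) (fst w) i)"
   unfolding lerp_def by (intro continuous_intros)
 qed
 have cg: "continuous_on (D \<times> cbox 0 1) (%w. snd w ^ k * g (lerp p (snd w) (fst w)))"
  if "smooth_on n D g" for g k
  by (intro continuous_intros continuous_on_compose2[OF smooth_on_continuous[OF that] continuous_on_subset[OF cl]])
   (auto intro!: conv p)
 have "smooth_on n D (I (0, f))"
 proof (rule smooth_on_coinduct[where C="I ` {(k,g). smooth_on n D g}"])
  fix g assume "g : I ` {(k,g). smooth_on n D g}"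
  then obtain k h where h: "g = I (k, h)" "smooth_on n D h" by auto
  show "continuous_on D g"
   using integral_continuous_on_param[of D 0 1 "%z s. s ^ k * h (lerp p s z)"] cg[OF h(2), of k]
   by (simp add: h(1) I_def split_beta)
  fix i assume i: "i < n"
  obtain h' where h': "smooth_on n D h'" "has_pd D i h h'" using smooth_on_pd[OF h(2) i] by blast
  have "has_pd D i g (I (Suc k, h'))" unfolding has_pd_def
  proof
   fix z assume z: "z : D"
   define U where "U = {t. z(i := t) : D}"
   have lu: "lerp p s (z(i := t)) = (lerp p s z)(i := p i + s * (t - p i))" for s t
    by (auto simp: lerp_def)
   have cu: "continuous_on UNIV (%w. (z(i := fst w), snd w))"
   proof (intro continuous_intros continuous_on_coordinatewise_then_product)
    fix j show "continuous_on UNIV (%w. (z(i := fst w)) j)"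
     by (cases "j = i") (simp_all add: continuous_intros)
   qed
   have "((%t. integral (cbox 0 1) (%s. s ^ k * h (lerp p s (z(i := t))))) has_field_derivative
    integral (cbox 0 1) (%s. s ^ Suc k * h' (lerp p s (z(i := z i))))) (at (z i) within U)"
   proof (rule leibniz_rule_field_derivative)
    fix t s :: real assume t: "t : U" and s: "s : cbox 0 1"
    then have zt: "z(i := t) : D" by (simp add: U_def)
    then have lD: "lerp p s (z(i := t)) : D" using s by (intro conv p) auto
    let ?l = "%t. p i + s * (t - p i)"
    have "((%u. h ((lerp p s (z(i := t)))(i := u))) has_real_derivative h' (lerp p s (z(i := t))))
      (at (lerp p s (z(i := t)) i) within {u. (lerp p s (z(i := t)))(i := u) : D})"
     using h'(2) lD unfolding has_pd_def by blast
    then have "((%u. h ((lerp p s z)(i := u))) has_real_derivative h' (lerp p s (z(i := t))))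
      (at (?l t) within {u. (lerp p s z)(i := u) : D})"
     unfolding lu by simp
    then have 1: "((%u. h ((lerp p s z)(i := u))) has_real_derivative h' (lerp p s (z(i := t))))
      (at (?l t) within ?l ` U)"
    proof (rule DERIV_subset)
     show "?l ` U <= {u. (lerp p s z)(i := u) : D}"
     proof clarify
      fix u assume "u : U"
      then have "lerp p s (z(i := u)) : D" using s by (intro conv p) (auto simp: U_def)
      then show "(lerp p s z)(i := ?l u) : D" by (simp add: lu)
     qed
    qed
    have "(?l has_real_derivative s) (at t within U)" by (auto intro!: derivative_eq_intros)
    from DERIV_cmult[OF DERIV_image_chain[OF 1 this], of "s ^ k"]
    show "((%t. s ^ k * h (lerp p s (z(i := t)))) has_real_derivative s ^ Suc k * h' (lerp p s (z(i := t)))) (at t within U)"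
     unfolding o_def lu by (rule DERIV_cong) (simp add: algebra_simps)
   next
    fix t assume "t : U"
    then have "z(i := t) : D" by (simp add: U_def)
    then have "continuous_on (cbox 0 1) (%s. s ^ k * h (lerp p s (z(i := t))))"
    proof -
     have "continuous_on (cbox 0 1) (%s. snd (z(i := t), s) ^ k * h (lerp p (snd (z(i := t), s)) (fst (z(i := t), s))))"
      by (rule continuous_on_compose2[OF cg[OF h(2), of k]])
       (use \<open>z(i := t) : D\<close> in \<open>auto intro!: continuous_intros\<close>)
     then show ?thesis by simp
    qed
    then show "(%s. s ^ k * h (lerp p s (z(i := t)))) integrable_on cbox 0 1" by (rule integrable_continuous)
   next
    show "continuous_on (U \<times> cbox 0 1) (%(t, s). s ^ Suc k * h' (lerp p s (z(i := t))))"
    proof -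
     have "continuous_on (U \<times> cbox 0 1) (%w. snd (z(i := fst w), snd w) ^ Suc k *
       h' (lerp p (snd (z(i := fst w), snd w)) (fst (z(i := fst w), snd w))))"
      by (rule continuous_on_compose2[OF cg[OF h'(1), of "Suc k"] continuous_on_subset[OF cu]])
       (auto simp: U_def)
     then show ?thesis by (simp add: split_beta)
    qed
    show "z i : U" using z by (simp add: U_def)
    show "convex U"
     unfolding convex_alt
    proof (intro ballI allI impI)
     fix a b u :: real assume ab: "a : U" "b : U" and u: "0 \<le> u \<and> u \<le> 1"
     have "lerp (z(i := a)) u (z(i := b)) : D" using ab u by (intro conv) (auto simp: U_def)
     moreover have "lerp (z(i := a)) u (z(i := b)) = z(i := (1 - u) *\<^sub>R a + u *\<^sub>R b)"
      by (auto simp: lerp_def algebra_simps)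
     ultimately show "(1 - u) *\<^sub>R a + u *\<^sub>R b : U" by (simp add: U_def)
    qed
   qed
   then show "((%t. g (z(i := t))) has_real_derivative I (Suc k, h') z) (at (z i) within {t. z(i := t) : D})"
    by (simp add: h(1) I_def U_def)
  qed
  then show "\<exists>h\<in>I ` {(k,g). smooth_on n D g}. has_pd D i g h" using h'(1) by blast
 qed (use f in auto)
 then show ?thesis by (simp add: I_def)
qed

lemma hadamard:
 assumes D: "opn n D" and conv: "!!p z s. p : D ==> z : D ==> s : {0..1} ==> lerp p s z : D"
  and p: "p : D" and f: "smooth_on n D f"
 obtains h where "!!i. i < n ==> smooth_on n D (h i)" "!!i. i < n ==> h i p = pd D i f p"
  "!!z. z : D ==> f z = f p + (\<Sum>i<n. (z i - p i) * h i z)"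
proof
 note nd = opn_ndom[OF D]
 let ?h = "%i z. integral {0..1} (%s. pd D i f (lerp p s z))"
 show "smooth_on n D (?h i)" if "i < n" for i
  by (intro smooth_on_lerp_integral[OF D conv p] smooth_on_pd'[OF nd f that])
 show "?h i p = pd D i f p" for i
  by (simp add: lerp_def)
 fix z assume z: "z : D"
 have der: "((%s. f (lerp p s z)) has_real_derivative (\<Sum>i<n. pd D i f (lerp p s z) * (z i - p i))) (at s within {0..1})"
  if s: "s : {0..1}" for s
 proof (rule chain_pd[OF D, where \<gamma>="%s. lerp p s z"])
  show "has_pd D i f (pd D i f)" "continuous_on D (pd D i f)" if "i < n" for i
   using smooth_has_pd[OF nd f that] smooth_on_continuous[OF smooth_on_pd'[OF nd f that]] by auto
  show "((%s. lerp p s z i) has_real_derivative z i - p i) (at s within {0..1})" for i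
   unfolding lerp_def by (auto intro!: derivative_eq_intros)
 qed (use conv p z s in auto)
 have cl: "continuous_on {0..1} (%s. lerp p s z)"
  by (rule continuous_on_coordinatewise_then_product) (auto simp: lerp_def intro!: continuous_intros)
 have int: "(%s. pd D i f (lerp p s z)) integrable_on {0..1}" if "i < n" for i
  by (intro integrable_continuous_real continuous_on_compose2[OF smooth_on_continuous[OF smooth_on_pd'[OF nd f that]] cl])
   (use conv p z in auto)
 have "((%s. \<Sum>i<n. pd D i f (lerp p s z) * (z i - p i)) has_integral f (lerp p 1 z) - f (lerp p 0 z)) {0..1}"
  by (intro fundamental_theorem_of_calculus)
   (use der in \<open>auto simp: has_real_derivative_iff_has_vector_derivative[symmetric]\<close>)
 then have "f z - f p = integral {0..1} (%s. \<Sum>i<n. pd D i f (lerp p s z) * (z i - p i))"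
  by (simp add: lerp_def integral_unique)
 also have "\<dots> = (\<Sum>i<n. integral {0..1} (%s. pd D i f (lerp p s z) * (z i - p i)))"
  by (rule integral_sum) (use int in \<open>auto intro: integrable_on_mult_left\<close>)
 also have "\<dots> = (\<Sum>i<n. (z i - p i) * ?h i z)"
  by (simp add: mult.commute)
 finally show "f z = f p + (\<Sum>i<n. (z i - p i) * ?h i z)" by simp
qed

subsection \<open>Cut-off functions\<close>

definition flat :: "real poly => real => real" where
 "flat P t = (if t > 0 then poly P (1 / t) * exp (- 1 / t) else 0)"

lemma flat_tendsto_0: "(flat P \<longlongrightarrow> 0) (at_right 0)"
proof -
 have "((%x. \<Sum>i\<le>degree P. coeff P i * (x ^ i / exp x)) \<longlongrightarrow> (\<Sum>i\<le>degree P. coeff P i * 0)) at_top"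
  by (intro tendsto_sum tendsto_mult tendsto_const tendsto_power_div_exp_0)
 then have "((%x. poly P x * exp (- x)) \<longlongrightarrow> 0) at_top"
  by (simp add: poly_altdef sum_distrib_right exp_minus divide_inverse mult.assoc)
 then have "((%t. poly P (inverse t) * exp (- inverse t)) \<longlongrightarrow> 0) (at_right 0)"
  by (rule filterlim_compose[OF _ filterlim_inverse_at_top_right])
 then show ?thesis
  by (rule Lim_transform_eventually)
   (auto simp: eventually_at_filter flat_def divide_inverse)
qed

lemma flat_derivative: "(flat P has_real_derivative flat ([:0,0,1:] * (P - pderiv P)) t) (at t)"
proof (cases t "0::real" rule: linorder_cases)
 case less
 have "((%_. 0) has_real_derivative 0) (at t)" by simp
 then have "(flat P has_real_derivative 0) (at t)"
  by (rule DERIV_cong_ev[THEN iffD1, rotated -1])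
   (use less eventually_nhds_in_open[of "{..<0}" t] in \<open>auto simp: flat_def elim!: eventually_mono\<close>)
 then show ?thesis using less by (simp add: flat_def)
next
 case equal
 have "((%h. (flat P (0 + h) - flat P 0) / h) \<longlongrightarrow> 0) (at 0)"
  unfolding filterlim_at_split
 proof
  show "((%h. (flat P (0 + h) - flat P 0) / h) \<longlongrightarrow> 0) (at_left 0)"
   by (rule tendsto_eventually) (auto simp: eventually_at_filter flat_def)
  have "((%h. flat (pCons 0 P) h) \<longlongrightarrow> 0) (at_right 0)" by (rule flat_tendsto_0)
  then show "((%h. (flat P (0 + h) - flat P 0) / h) \<longlongrightarrow> 0) (at_right 0)"
   by (rule Lim_transform_eventually) (auto simp: eventually_at_filter flat_def)
 qed
 then show ?thesis using equal by (simp add: DERIV_def flat_def)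
next
 case greater
 have "((%t. poly P (1 / t) * exp (- 1 / t)) has_real_derivative
   (poly (pderiv P) (1 / t) * (- 1 / t\<^sup>2)) * exp (- 1 / t) + poly P (1 / t) * (exp (- 1 / t) * (1 / t\<^sup>2))) (at t)"
  using greater
  by (auto intro!: derivative_eq_intros DERIV_chain2[OF poly_DERIV] simp: power2_eq_square field_simps)
 then have "(flat P has_real_derivative
   (poly (pderiv P) (1 / t) * (- 1 / t\<^sup>2)) * exp (- 1 / t) + poly P (1 / t) * (exp (- 1 / t) * (1 / t\<^sup>2))) (at t)"
  by (rule DERIV_cong_ev[THEN iffD1, rotated -1])
   (use greater eventually_nhds_in_open[of "{0<..}" t] in \<open>auto simp: flat_def elim!: eventually_mono\<close>)
 then show ?thesis
  by (rule DERIV_cong) (use greater in \<open>simp add: flat_def power2_eq_square field_simps\<close>)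
qed

lemma smooth_on_flat: "smooth_on 1 (Rn 1) (%y. flat P (y 0))"
proof (rule smooth_on_coinduct[where C="range (%P y. flat P (y 0))"])
 fix g :: "(nat => real) => real" assume "g : range (%P y. flat P (y 0))"
 then obtain Q where g: "g = (%y. flat Q (y 0))" by auto
 have "continuous_on UNIV (flat Q)"
  using flat_derivative DERIV_isCont by (blast intro: continuous_at_imp_continuous_on)
 then show "continuous_on (Rn 1) g" unfolding g
  by (rule continuous_on_compose2[OF _ continuous_on_subset[OF continuous_on_product_coordinates]]) auto
 fix i :: nat assume "i < 1"
 then have "has_pd (Rn 1) i g (%y. flat ([:0,0,1:] * (Q - pderiv Q)) (y 0))"
  unfolding has_pd_def g using has_field_derivative_at_within[OF flat_derivative] by simp
 then show "\<exists>h\<in>range (%P y. flat P (y 0)). has_pd (Rn 1) i g h" by blast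
qed auto

lemma cutoff_exists:
 assumes "r > 0"
 obtains \<beta> \<rho> where "\<rho> > 0" "\<rho> < r" "smooth_on n (Rn n) \<beta>"
  "!!y. (!!i. i < n ==> \<bar>y i - p i\<bar> < \<rho>) ==> \<beta> y = 1"
  "!!y i. i < n ==> \<bar>y i - p i\<bar> \<ge> r ==> \<beta> y = 0"
proof -
 define q where "q y = (2 / r\<^sup>2) * (\<Sum>i<n. (y i - p i)\<^sup>2)" for y
 define \<psi> where "\<psi> t = flat 1 (2 - t) * inverse (flat 1 (2 - t) + flat 1 (t - 1))" for t
 define \<beta> where "\<beta> y = \<psi> (q y)" for y
 define \<rho> where "\<rho> = r / (2 * (real n + 1))"
 have flat_pos: "flat 1 t > 0 \<longleftrightarrow> t > 0" and flat_nn: "flat 1 t \<ge> 0" for t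
  by (auto simp: flat_def)
 have pos: "flat 1 (2 - t) + flat 1 (t - 1) > 0" for t
  using flat_pos[of "2 - t"] flat_pos[of "t - 1"] flat_nn[of "2 - t"] flat_nn[of "t - 1"]
  by (cases "t < 2") auto
 have \<rho>0: "\<rho> > 0" using assms by (simp add: \<rho>_def)
 have "r * 1 < r * (2 * (real n + 1))" using assms by (intro mult_strict_left_mono) auto
 then have \<rho>r: "\<rho> < r" by (simp add: \<rho>_def pos_divide_less_eq)
 have sq: "smooth_on n (Rn n) q" unfolding q_def power2_eq_square
  by (intro smooth_on_cmult smooth_on_sum smooth_on_mult smooth_on_diff smooth_on_coord smooth_on_const)
 have comp: "smooth_on n (Rn n) (%y. flat 1 (a * q y + b))" for a b
 proof -
  define G where "G y j = (if j = 0 then a * q y + b else 0)" for y and j :: nat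
  have "smooth_on n (Rn n) (%y. flat 1 (G y 0))"
  proof (rule smooth_on_compose[OF _ smooth_on_flat, where G=G])
   show "G y : Rn 1" for y by (auto simp: Rn_def G_def)
   show "smooth_on n (Rn n) (%y. G y j)" for j
    by (cases "j = 0") (auto simp: G_def intro!: smooth_on_add smooth_on_cmult smooth_on_const sq)
  qed (simp add: openin_subtopology_self)
  then have "smooth_on n (Rn n) (%y. flat 1 (a * q y + b))" by (simp add: G_def)
  then show ?thesis by simp
 qed
 have s\<beta>: "smooth_on n (Rn n) \<beta>"
  unfolding \<beta>_def \<psi>_def
  using comp[of "-1" 2] comp[of 1 "-1"] pos
  by (intro smooth_on_mult smooth_on_inverse smooth_on_add) (auto simp: less_imp_neq[symmetric])
 have b1: "\<beta> y = 1" if "!!i. i < n ==> \<bar>y i - p i\<bar> < \<rho>" for y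
 proof -
  have "(\<Sum>i<n. (y i - p i)\<^sup>2) \<le> (\<Sum>i<n. \<rho>\<^sup>2)"
  proof (rule sum_mono)
   fix i assume "i : {..<n}"
   then have "\<bar>y i - p i\<bar> \<le> \<bar>\<rho>\<bar>" using that[of i] by auto
   then show "(y i - p i)\<^sup>2 \<le> \<rho>\<^sup>2" by (simp add: abs_le_square_iff)
  qed
  also have "\<dots> = real n * \<rho>\<^sup>2" by simp
  also have "\<dots> \<le> r\<^sup>2 / 2"
  proof -
   have "real n * 2 \<le> (2 * (real n + 1))\<^sup>2" by (simp add: power2_eq_square algebra_simps)
   then have "real n * r\<^sup>2 * 2 \<le> r\<^sup>2 * (2 * (real n + 1))\<^sup>2"
    using mult_left_mono[of "real n * 2" "(2 * (real n + 1))\<^sup>2" "r\<^sup>2"] by (simp add: algebra_simps)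
   then show ?thesis unfolding \<rho>_def power_divide
    by (subst times_divide_eq_right, subst pos_divide_le_eq) (auto simp: field_simps)
  qed
  finally have "q y \<le> 1" using assms by (simp add: q_def field_simps)
  then show ?thesis using pos[of "q y"] by (simp add: \<beta>_def \<psi>_def flat_def)
 qed
 have b0: "\<beta> y = 0" if "i < n" "\<bar>y i - p i\<bar> \<ge> r" for y i
 proof -
  have "r\<^sup>2 \<le> (y i - p i)\<^sup>2" using that(2) assms abs_le_square_iff[of r "y i - p i"] by simp
  also have "\<dots> \<le> (\<Sum>i<n. (y i - p i)\<^sup>2)"
   by (rule member_le_sum) (use that(1) in auto)
  finally have "q y \<ge> 2" using assms by (simp add: q_def field_simps)
  then show ?thesis by (simp add: \<beta>_def \<psi>_def flat_def)
 qed
 show thesis by (rule that[OF \<rho>0 \<rho>r s\<beta> b1 b0])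
qed

section \<open>Uniqueness for linear transport equations\<close>

lemma compact_box: "compact {y \<in> Rn n. \<forall>i<n. \<bar>y i - p i\<bar> \<le> r}"
proof -
 define S where "S i = (if i < n then {p i - r..p i + r} else {0::real})" for i
 have "compactin (product_topology (%i. euclidean) UNIV) (PiE UNIV S)"
  unfolding compactin_PiE by (auto simp: S_def)
 then have "compact (PiE UNIV S)" by (simp add: euclidean_product_topology)
 moreover have "PiE UNIV S = {y \<in> Rn n. \<forall>i<n. \<bar>y i - p i\<bar> \<le> r}"
 proof (intro set_eqI iffI)
  fix y assume y: "y : PiE UNIV S"
  have yS: "y i : S i" for i using y by auto
  have "\<bar>y i - p i\<bar> \<le> r" if "i < n" for i
   using yS[of i] that by (simp add: S_def abs_le_iff)
  moreover have "y i = 0" if "i \<ge> n" for i using yS[of i] that by (simp add: S_def)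
  ultimately show "y : {y \<in> Rn n. \<forall>i<n. \<bar>y i - p i\<bar> \<le> r}" by (simp add: Rn_def)
 next
  fix y assume y: "y : {y \<in> Rn n. \<forall>i<n. \<bar>y i - p i\<bar> \<le> r}"
  have "y i : S i" for i
  proof (cases "i < n")
   case True
   then have "\<bar>y i - p i\<bar> \<le> r" using y by auto
   then show ?thesis using True by (simp add: S_def abs_le_iff algebra_simps)
  next
   case False
   then show ?thesis using y by (auto simp: S_def Rn_def)
  qed
  then show "y : PiE UNIV S" by (auto simp: PiE_def)
 qed
 ultimately show ?thesis by simp
qed

lemma finite_family_bounded:
 assumes "finite F" "compact C" "!!i. i : F ==> continuous_on C (f i :: _ => real)"
 shows "\<exists>B\<ge>0. \<forall>i\<in>F. \<forall>z\<in>C. \<bar>f i z\<bar> \<le> B"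
 using assms(1,3)
proof (induction F rule: finite_induct)
 case empty
 then show ?case by auto
next
 case (insert i F)
 then obtain B where B: "B \<ge> 0" "\<forall>i\<in>F. \<forall>z\<in>C. \<bar>f i z\<bar> \<le> B" by auto
 have "bounded (f i ` C)"
  using compact_continuous_image[OF insert.prems[of i] assms(2)] compact_imp_bounded by auto
 then obtain b where b: "\<forall>z\<in>C. \<bar>f i z\<bar> \<le> b" by (auto simp: bounded_iff)
 show ?case
  by (rule exI[of _ "max B b"]) (use B b in \<open>auto simp: le_max_iff_disj\<close>)
qed

text \<open>
 Maximum principle: at a positive maximum of \<open>exp (-\<kappa> t) g |w|\<^sup>2\<close>, where \<open>g\<close> is positive inside a
 backward characteristic cone, the spatial derivatives vanish, and the equation makes the time
 derivative negative.
\<close>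

lemma transport_local_uniqueness:
 fixes w :: "'i => real => (nat => real) => real"
 assumes D: "opn n D" and p: "p : D" and I: "finite I"
  and w: "!!i. i : I ==> continuous_on ({0..1} \<times> D) (%(t,y). w i t y)"
  and Y: "!!k. k < n ==> continuous_on ({0..1} \<times> D) (%(t,y). Y k t y)"
  and A: "!!i j. i : I ==> j : I ==> continuous_on ({0..1} \<times> D) (%(t,y). A i j t y)"
  and wk: "!!i k t. i : I ==> k < n ==> t : {0..1} ==> has_pd D k (w i t) (wk i k t)"
  and eqn: "!!i t y. i : I ==> t : {0..1} ==> y : D ==>
   ((%t. w i t y) has_real_derivative (\<Sum>k<n. Y k t y * wk i k t y) + (\<Sum>j\<in>I. A i j t y * w j t y))
    (at t within {0..1})"
 shows "\<exists>\<delta>>0. \<exists>\<rho>>0. \<forall>t0\<in>{0..1}. (\<forall>i\<in>I. \<forall>y\<in>D. w i t0 y = 0) -->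
  (\<forall>t\<in>{0..1}. t0 \<le> t --> t \<le> t0 + \<delta> -->
   (\<forall>y\<in>Rn n. (\<forall>k<n. \<bar>y k - p k\<bar> < \<rho>) --> (\<forall>i\<in>I. w i t y = 0)))"
proof -
 obtain r' where r': "r' > 0" "\<forall>y\<in>Rn n. (\<forall>i<n. \<bar>y i - p i\<bar> < r') --> y : D"
  using opn_box[OF D p] by blast
 define r where "r = r' / 2"
 have r: "r > 0" "r < r'" using r'(1) by (auto simp: r_def)
 define K where "K = {y \<in> Rn n. \<forall>i<n. \<bar>y i - p i\<bar> \<le> r}"
 have K: "compact K" "K <= D"
  using compact_box r'(2) r(2) by (auto simp: K_def) (metis le_less_trans)
 have pR: "p : Rn n" using opn_subset[OF D] p by blast
 have sub: "{0..1::real} \<times> K <= {0..1} \<times> D" using K(2) by auto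
 obtain B1 where B1: "B1 \<ge> 0" "\<forall>k\<in>{..<n}. \<forall>z\<in>{0..1} \<times> K. \<bar>(%(t,y). Y k t y) z\<bar> \<le> B1"
  using finite_family_bounded[of "{..<n}" "{0..1} \<times> K" "%k (t,y). Y k t y"]
   continuous_on_subset[OF Y sub] compact_Times[OF compact_Icc K(1)] by auto
 obtain B2 where B2: "B2 \<ge> 0" "\<forall>ij\<in>I \<times> I. \<forall>z\<in>{0..1} \<times> K. \<bar>(%(t,y). A (fst ij) (snd ij) t y) z\<bar> \<le> B2"
  using finite_family_bounded[of "I \<times> I" "{0..1} \<times> K" "%ij (t,y). A (fst ij) (snd ij) t y"]
   continuous_on_subset[OF A sub] compact_Times[OF compact_Icc K(1)] I by force
 define c where "c = 2 * real n * B1 * r + 1"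
 have c: "c > 0" using B1(1) r(1) by (simp add: c_def add_nonneg_pos)
 define \<kappa> where "\<kappa> = 2 * B2 * real (card I) + 1"
 define Q where "Q y = (\<Sum>k<n. (y k - p k)\<^sup>2)" for y
 define \<phi> where "\<phi> t y = (\<Sum>i\<in>I. (w i t y)\<^sup>2)" for t y
 have vanish: "w i t y = 0"
  if t0: "t0 : {0..1}" "\<forall>i\<in>I. \<forall>y\<in>D. w i t0 y = 0" and t: "t : {0..1}" "t0 \<le> t"
   and y: "y : Rn n" and g: "r\<^sup>2 - Q y - c * (t - t0) > 0" and i: "i : I" for t0 t y i
 proof (rule ccontr)
  assume nz: "w i t y \<noteq> 0"
  define g where "g t y = r\<^sup>2 - Q y - c * (t - t0)" for t y
  define \<psi> where "\<psi> t y = exp (- \<kappa> * (t - t0)) * g t y * \<phi> t y" for t y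
  define C where "C = ({t0..1} \<times> K) \<inter> {z. 0 \<le> g (fst z) (snd z)}"
  have gc: "continuous_on S (%z. g (fst z) (snd z))" for S
  proof -
   have "continuous_on S (%z. snd z k)" for k :: nat and S :: "(real \<times> (nat => real)) set"
    by (rule continuous_on_compose2[OF continuous_on_product_coordinates continuous_on_snd[OF continuous_on_id]]) auto
   then show ?thesis unfolding g_def Q_def by (intro continuous_intros)
  qed
  have inK: "y : K" if "y : Rn n" "Q y \<le> r\<^sup>2" for y
  proof -
   have "\<bar>y k - p k\<bar> \<le> r" if "k < n" for k
   proof -
    have "(y k - p k)\<^sup>2 \<le> Q y" unfolding Q_def by (rule member_le_sum) (use that in auto)
    then have "(y k - p k)\<^sup>2 \<le> r\<^sup>2" using \<open>Q y \<le> r\<^sup>2\<close> by simp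
    then show ?thesis using r(1) abs_le_square_iff[of "y k - p k" r] by simp
   qed
   then show ?thesis using that(1) by (simp add: K_def)
  qed
  have gQ: "Q y < r\<^sup>2" if "g t y > 0" "t0 \<le> t" for t y
  proof -
   have "0 \<le> c * (t - t0)" using that(2) c by simp
   then show ?thesis using that(1) unfolding g_def by linarith
  qed
  have "closed {z. 0 \<le> g (fst z) (snd z)}"
   by (intro closed_Collect_le continuous_on_const gc)
  then have Cc: "compact C" unfolding C_def by (intro compact_Int_closed compact_Times compact_Icc K(1))
  have \<phi>c: "continuous_on C (%z. \<phi> (fst z) (snd z))" unfolding \<phi>_def
  proof (intro continuous_intros)
   fix i assume "i : I"
   have "C <= {0..1} \<times> D" using t0(1) K(2) by (force simp: C_def)
   then show "continuous_on C (%z. w i (fst z) (snd z))"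
    using continuous_on_subset[OF w[OF \<open>i : I\<close>], of C] by (simp add: split_beta)
  qed
  have \<psi>c: "continuous_on C (%z. \<psi> (fst z) (snd z))"
   unfolding \<psi>_def by (intro continuous_intros gc \<phi>c)
  have \<phi>nn: "\<phi> t y \<ge> 0" for t y by (auto simp: \<phi>_def intro: sum_nonneg)
  have gty: "g t y > 0" using g by (simp add: g_def)
  have tyC: "(t, y) : C"
   using t y gty inK[OF y less_imp_le[OF gQ[OF gty t(2)]]] by (auto simp: C_def)
  have "(w i t y)\<^sup>2 \<le> \<phi> t y" unfolding \<phi>_def by (rule member_le_sum) (use i I in auto)
  moreover have "0 < (w i t y)\<^sup>2" using nz by simp
  ultimately have "\<phi> t y > 0" by linarith
  then have pos: "\<psi> t y > 0" using gty by (simp add: \<psi>_def)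
  have "C \<noteq> {}" using tyC by blast
  then obtain z where z: "z : C" "\<forall>z'\<in>C. \<psi> (fst z') (snd z') \<le> \<psi> (fst z) (snd z)"
   using continuous_attains_sup[OF Cc _ \<psi>c] by blast
  define s x where "s = fst z" and "x = snd z"
  have sx: "s : {t0..1}" "x : K" "0 \<le> g s x" using z(1) by (auto simp: C_def s_def x_def)
  have max: "\<psi> t' y' \<le> \<psi> s x" if "t' : {t0..1}" "y' : K" "0 \<le> g t' y'" for t' y'
   using z(2)[rule_format, of "(t', y')"] that by (simp add: C_def s_def x_def)
  have \<psi>pos: "\<psi> s x > 0" using pos max[of t y] tyC by (auto simp: C_def)
  have gpos: "g s x > 0" using \<psi>pos sx(3) by (cases "g s x = 0") (auto simp: \<psi>_def)
  have \<phi>pos: "\<phi> s x > 0" using \<psi>pos \<phi>nn[of s x] by (cases "\<phi> s x = 0") (auto simp: \<psi>_def)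
  have xD: "x : D" and xR: "x : Rn n" using sx(2) K(2) by (auto simp: K_def)
  have s01: "s : {0..1}" using sx(1) t0(1) by auto
  have "s \<noteq> t0" using \<phi>pos t0(2) xD by (auto simp: \<phi>_def)
  then have st0: "t0 < s" using sx(1) by auto
  define E where "E = exp (- \<kappa> * (s - t0))"
  have E: "E > 0" by (simp add: E_def)
  define \<phi>k where "\<phi>k k = (\<Sum>i\<in>I. 2 * w i s x * wk i k s x)" for k
  define wt where "wt i = (\<Sum>k<n. Y k s x * wk i k s x) + (\<Sum>j\<in>I. A i j s x * w j s x)" for i
  define \<phi>t where "\<phi>t = (\<Sum>i\<in>I. 2 * w i s x * wt i)"
  have near: "\<forall>\<^sub>F u in nhds (x k). x(k := u) : K \<and> 0 \<le> g s (x(k := u))" if k: "k < n" for k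
  proof -
   have "continuous_on UNIV (%u. g s (x(k := u)))"
   proof -
    have "continuous_on UNIV (%u. (s, x(k := u)))"
    proof (intro continuous_intros continuous_on_coordinatewise_then_product)
     fix j show "continuous_on UNIV (%u. (x(k := u)) j)" by (cases "j = k") (simp_all add: continuous_intros)
    qed
    from continuous_on_compose2[OF gc[of UNIV] this] show ?thesis by simp
   qed
   then have "open ((%u. g s (x(k := u))) -` {0<..})" by (intro open_vimage) auto
   then have "\<forall>\<^sub>F u in nhds (x k). u : (%u. g s (x(k := u))) -` {0<..}"
    by (rule eventually_nhds_in_open) (use gpos in auto)
   then show ?thesis
   proof eventually_elim
    case (elim u)
    then have gp: "g s (x(k := u)) > 0" by simp
    moreover have "x(k := u) : Rn n" using xR k by (auto simp: Rn_def)
    ultimately show ?case using inK[OF _ less_imp_le[OF gQ[OF gp]]] st0 by auto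
   qed
  qed
  have dk: "((%u. \<psi> s (x(k := u))) has_real_derivative E * ((- 2 * (x k - p k)) * \<phi> s x + g s x * \<phi>k k))
    (at (x k) within {u. x(k := u) : D})" if k: "k < n" for k
  proof -
   have 1: "((%u. w i s (x(k := u))) has_real_derivative wk i k s x) (at (x k) within {u. x(k := u) : D})"
    if "i : I" for i
    using wk[OF that k s01] xD unfolding has_pd_def by blast
   have "((%u. \<Sum>i\<in>I. (w i s (x(k := u)))\<^sup>2) has_real_derivative (\<Sum>i\<in>I. 2 * w i s x * wk i k s x))
     (at (x k) within {u. x(k := u) : D})"
    by (rule DERIV_sum) (use DERIV_power[OF 1, of _ 2] in \<open>simp add: mult.assoc mult.commute mult.left_commute\<close>)
   then have 2: "((%u. \<phi> s (x(k := u))) has_real_derivative \<phi>k k) (at (x k) within {u. x(k := u) : D})"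
    by (simp add: \<phi>_def \<phi>k_def)
   have "((%u. \<Sum>j<n. ((x(k := u)) j - p j)\<^sup>2) has_real_derivative (\<Sum>j<n. if j = k then 2 * (x k - p k) else 0))
     (at (x k) within {u. x(k := u) : D})"
   proof (rule DERIV_sum)
    fix j show "((%u. ((x(k := u)) j - p j)\<^sup>2) has_real_derivative (if j = k then 2 * (x k - p k) else 0))
     (at (x k) within {u. x(k := u) : D})"
     by (cases "j = k") (auto intro!: derivative_eq_intros)
   qed
   then have "((%u. Q (x(k := u))) has_real_derivative 2 * (x k - p k)) (at (x k) within {u. x(k := u) : D})"
    using k by (simp add: Q_def)
   then have 3: "((%u. g s (x(k := u))) has_real_derivative - 2 * (x k - p k)) (at (x k) within {u. x(k := u) : D})"
    unfolding g_def by (auto intro!: derivative_eq_intros)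
   show ?thesis unfolding \<psi>_def mult.assoc E_def[symmetric]
    using DERIV_cmult[OF DERIV_mult'[OF 3 2], of E] by (rule DERIV_cong) (simp add: algebra_simps)
  qed
  have crit: "(- 2 * (x k - p k)) * \<phi> s x + g s x * \<phi>k k = 0" if k: "k < n" for k
  proof (rule ccontr)
   let ?d = "E * ((- 2 * (x k - p k)) * \<phi> s x + g s x * \<phi>k k)"
   assume "(- 2 * (x k - p k)) * \<phi> s x + g s x * \<phi>k k \<noteq> 0"
   then have "?d \<noteq> 0" using E by simp
   obtain e where e: "e > 0" "\<forall>u. \<bar>u - x k\<bar> < e --> x(k := u) : K \<and> 0 \<le> g s (x(k := u))"
    using near[OF k] unfolding eventually_nhds_metric dist_real_def by blast
   have le: "\<psi> s (x(k := u)) \<le> \<psi> s x" if "\<bar>u - x k\<bar> < e" for u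
    using e(2) that max sx(1) by blast
   have inD: "u : {u. x(k := u) : D}" if "\<bar>u - x k\<bar> < e" for u
    using e(2) that K(2) by blast
   consider "?d > 0" | "?d < 0" using \<open>?d \<noteq> 0\<close> by linarith
   then show False
   proof cases
    case 1
    then obtain d where d: "d > 0" "\<forall>h>0. x k + h : {u. x(k := u) : D} --> h < d --> \<psi> s (x(k := x k)) < \<psi> s (x(k := x k + h))"
     using has_real_derivative_pos_inc_right[OF dk[OF k]] by blast
    define h where "h = min d e / 2"
    have h: "0 < h" "h < d" "\<bar>x k + h - x k\<bar> < e" using d(1) e(1) by (auto simp: h_def)
    then show False using d(2) inD[OF h(3)] le[OF h(3)] by force
   next
    case 2
    then obtain d where d: "d > 0" "\<forall>h>0. x k - h : {u. x(k := u) : D} --> h < d --> \<psi> s (x(k := x k)) < \<psi> s (x(k := x k - h))"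
     using has_real_derivative_neg_dec_left[OF dk[OF k]] by blast
    define h where "h = min d e / 2"
    have h: "0 < h" "h < d" "\<bar>x k - h - x k\<bar> < e" using d(1) e(1) by (auto simp: h_def)
    then show False using d(2) inD[OF h(3)] le[OF h(3)] by force
   qed
  qed
  have dt: "((%t. \<psi> t x) has_real_derivative E * (- \<kappa> * g s x * \<phi> s x - c * \<phi> s x + g s x * \<phi>t)) (at s within {0..1})"
  proof -
   have 1: "((%t. w i t x) has_real_derivative wt i) (at s within {0..1})" if "i : I" for i
    using eqn[OF that s01 xD] by (simp add: wt_def)
   have "((%t. \<Sum>i\<in>I. (w i t x)\<^sup>2) has_real_derivative (\<Sum>i\<in>I. 2 * w i s x * wt i)) (at s within {0..1})"
    by (rule DERIV_sum) (use DERIV_power[OF 1, of _ 2] in \<open>simp add: mult.assoc mult.commute mult.left_commute\<close>)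
   then have 2: "((%t. \<phi> t x) has_real_derivative \<phi>t) (at s within {0..1})" by (simp add: \<phi>_def \<phi>t_def)
   have 3: "((%t. g t x) has_real_derivative - c) (at s within {0..1})"
    unfolding g_def by (auto intro!: derivative_eq_intros)
   have 4: "((%t. exp (- \<kappa> * (t - t0))) has_real_derivative - \<kappa> * E) (at s within {0..1})"
    unfolding E_def by (auto intro!: derivative_eq_intros)
   show ?thesis unfolding \<psi>_def
    using DERIV_mult'[OF DERIV_mult'[OF 4 3] 2] by (rule DERIV_cong) (simp add: E_def algebra_simps)
  qed
  have "E * (- \<kappa> * g s x * \<phi> s x - c * \<phi> s x + g s x * \<phi>t) \<ge> 0"
  proof (rule ccontr)
   assume "\<not> ?thesis"
   then obtain d where d: "d > 0" "\<forall>h>0. s - h : {0..1} --> h < d --> \<psi> s x < \<psi> (s - h) x"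
    using has_real_derivative_neg_dec_left[OF dt] by auto
   define h where "h = min (d / 2) (s - t0)"
   have h: "0 < h" "h < d" "s - h : {0..1}" "s - h : {t0..1}" using d(1) st0 s01 t0(1) by (auto simp: h_def)
   have "g (s - h) x = g s x + c * h" by (simp add: g_def algebra_simps)
   then have "0 \<le> g (s - h) x" using sx(3) mult_pos_pos[OF c h(1)] by linarith
   then have "\<psi> (s - h) x \<le> \<psi> s x" using max h(4) sx(2) by blast
   then show False using d(2) h(1-3) by force
  qed
  then have "- \<kappa> * g s x * \<phi> s x - c * \<phi> s x + g s x * \<phi>t \<ge> 0"
   using E by (simp add: zero_le_mult_iff)
  moreover have "g s x * \<phi>t = (\<Sum>k<n. Y k s x * (2 * (x k - p k))) * \<phi> s x + g s x * (\<Sum>i\<in>I. \<Sum>j\<in>I. 2 * w i s x * A i j s x * w j s x)"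
  proof -
   have "\<phi>t = (\<Sum>k<n. Y k s x * \<phi>k k) + (\<Sum>i\<in>I. \<Sum>j\<in>I. 2 * w i s x * A i j s x * w j s x)"
   proof -
    have "\<phi>t = (\<Sum>i\<in>I. \<Sum>k<n. Y k s x * (2 * w i s x * wk i k s x)) + (\<Sum>i\<in>I. \<Sum>j\<in>I. 2 * w i s x * A i j s x * w j s x)"
     unfolding \<phi>t_def wt_def distrib_left sum.distrib sum_distrib_left by (simp add: algebra_simps)
    also have "(\<Sum>i\<in>I. \<Sum>k<n. Y k s x * (2 * w i s x * wk i k s x)) = (\<Sum>k<n. Y k s x * \<phi>k k)"
     unfolding \<phi>k_def sum_distrib_left by (rule sum.swap)
    finally show ?thesis .
   qed
   moreover have "g s x * (\<Sum>k<n. Y k s x * \<phi>k k) = (\<Sum>k<n. Y k s x * (2 * (x k - p k))) * \<phi> s x"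
    unfolding sum_distrib_left sum_distrib_right
   proof (rule sum.cong[OF refl])
    fix k assume "k : {..<n}"
    then have "g s x * \<phi>k k = 2 * (x k - p k) * \<phi> s x" using crit[of k] by (simp add: algebra_simps)
    then show "g s x * (Y k s x * \<phi>k k) = Y k s x * (2 * (x k - p k)) * \<phi> s x"
     by (metis mult.assoc mult.left_commute)
   qed
   ultimately show ?thesis by (simp add: distrib_left)
  qed
  moreover have "(\<Sum>k<n. Y k s x * (2 * (x k - p k))) \<le> c"
  proof -
   have "(\<Sum>k<n. Y k s x * (2 * (x k - p k))) \<le> (\<Sum>k<n. B1 * (2 * r))"
   proof (rule sum_mono)
    fix k assume k: "k : {..<n}"
    have "\<bar>Y k s x\<bar> \<le> B1" using B1(2) k s01 sx(2) by auto
    moreover have "\<bar>2 * (x k - p k)\<bar> \<le> 2 * r" using sx(2) k by (auto simp: K_def abs_mult)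
    ultimately have "\<bar>Y k s x * (2 * (x k - p k))\<bar> \<le> B1 * (2 * r)" unfolding abs_mult[of "Y k s x"]
     by (intro mult_mono) (use B1(1) in auto)
    then show "Y k s x * (2 * (x k - p k)) \<le> B1 * (2 * r)" by linarith
   qed
   then show ?thesis by (simp add: c_def algebra_simps)
  qed
  then have "(\<Sum>k<n. Y k s x * (2 * (x k - p k))) * \<phi> s x \<le> c * \<phi> s x"
   using \<phi>pos by (intro mult_right_mono) auto
  moreover have "(\<Sum>i\<in>I. \<Sum>j\<in>I. 2 * w i s x * A i j s x * w j s x) \<le> 2 * B2 * real (card I) * \<phi> s x"
  proof -
   have "(\<Sum>i\<in>I. \<Sum>j\<in>I. 2 * w i s x * A i j s x * w j s x) \<le> (\<Sum>i\<in>I. \<Sum>j\<in>I. B2 * ((w i s x)\<^sup>2 + (w j s x)\<^sup>2))"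
   proof (intro sum_mono)
    fix i j assume ij: "i : I" "j : I"
    then have b: "\<bar>A i j s x\<bar> \<le> B2" using B2(2) s01 sx(2) by force
    have "2 * w i s x * A i j s x * w j s x = A i j s x * (2 * w i s x * w j s x)" by simp
    also have "\<dots> \<le> \<bar>A i j s x\<bar> * \<bar>2 * w i s x * w j s x\<bar>"
     unfolding abs_mult[symmetric] by (rule abs_ge_self)
    also have "\<dots> \<le> B2 * ((w i s x)\<^sup>2 + (w j s x)\<^sup>2)"
    proof (intro mult_mono b)
     have "0 \<le> (w i s x - w j s x)\<^sup>2" "0 \<le> (w i s x + w j s x)\<^sup>2" by auto
     then show "\<bar>2 * w i s x * w j s x\<bar> \<le> (w i s x)\<^sup>2 + (w j s x)\<^sup>2"
      by (simp add: power2_eq_square algebra_simps abs_le_iff)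
    qed (use B2 in auto)
    finally show "2 * w i s x * A i j s x * w j s x \<le> B2 * ((w i s x)\<^sup>2 + (w j s x)\<^sup>2)" .
   qed
   also have "\<dots> = (\<Sum>i\<in>I. B2 * (real (card I) * (w i s x)\<^sup>2 + \<phi> s x))"
    by (simp only: sum_distrib_left[symmetric] sum.distrib sum_constant \<phi>_def)
   also have "\<dots> = B2 * (real (card I) * \<phi> s x + real (card I) * \<phi> s x)"
    by (simp only: sum_distrib_left[symmetric] sum.distrib sum_constant \<phi>_def)
   also have "\<dots> = 2 * B2 * real (card I) * \<phi> s x" by simp
   finally show ?thesis .
  qed
  then have "g s x * (\<Sum>i\<in>I. \<Sum>j\<in>I. 2 * w i s x * A i j s x * w j s x) \<le> g s x * (2 * B2 * real (card I) * \<phi> s x)"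
   using gpos by (intro mult_left_mono) auto
  ultimately have "0 \<le> - \<kappa> * g s x * \<phi> s x + g s x * (2 * B2 * real (card I) * \<phi> s x)" by linarith
  then have "0 \<le> - (g s x * \<phi> s x)" by (simp add: \<kappa>_def algebra_simps)
  then show False using mult_pos_pos[OF gpos \<phi>pos] by linarith
 qed
 show ?thesis
 proof (rule exI[of _ "r\<^sup>2 / (2 * c)"], intro conjI, goal_cases)
  case 1 then show ?case using r(1) c by simp
 next
  case 2
  show ?case
  proof (rule exI[of _ "r / (2 * (real n + 1))"], intro conjI ballI impI)
   show "0 < r / (2 * (real n + 1))" using r(1) by simp
   fix t0 t y i
   assume a: "t0 : {0..1}" "\<forall>i\<in>I. \<forall>y\<in>D. w i t0 y = 0" "t : {0..1}" "t0 \<le> t" "t \<le> t0 + r\<^sup>2 / (2 * c)"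
    "y : Rn n" "\<forall>k<n. \<bar>y k - p k\<bar> < r / (2 * (real n + 1))" "i : I"
   let ?\<rho> = "r / (2 * (real n + 1))"
   have "Q y \<le> (\<Sum>k<n. ?\<rho>\<^sup>2)" unfolding Q_def
   proof (rule sum_mono)
    fix k assume "k : {..<n}"
    then have "\<bar>y k - p k\<bar> \<le> \<bar>?\<rho>\<bar>" using a(7) r(1) by fastforce
    then show "(y k - p k)\<^sup>2 \<le> ?\<rho>\<^sup>2" by (simp only: abs_le_square_iff)
   qed
   also have "\<dots> = (real n / (4 * (real n + 1)\<^sup>2)) * r\<^sup>2" by (simp add: power2_eq_square field_simps)
   also have "\<dots> < (1/2) * r\<^sup>2"
   proof (rule mult_strict_right_mono)
    have "4 * (real n + 1)\<^sup>2 = 4 * (real n * real n) + 8 * real n + 4"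
     by (simp add: power2_eq_square algebra_simps)
    moreover have "0 \<le> real n * real n" by simp
    ultimately have "real n * 2 < 4 * (real n + 1)\<^sup>2" by linarith
    then show "real n / (4 * (real n + 1)\<^sup>2) < 1 / 2" by (simp add: divide_less_eq)
   qed (use r(1) in simp)
   finally have "Q y < r\<^sup>2 / 2" by simp
   moreover have "c * (t - t0) \<le> r\<^sup>2 / 2"
   proof -
    have "c * (t - t0) \<le> c * (r\<^sup>2 / (2 * c))" using a(5) c by (intro mult_left_mono) auto
    then show ?thesis using c by simp
   qed
   ultimately show "w i t y = 0" by (intro vanish[OF a(1-4,6) _ a(8)]) simp
  qed
 qed
qed

section \<open>Sections and smooth families of sections\<close>

lemma crd_props:
 assumes "\<exists>!c. c : Rn r \<and> v = (\<Sum>i<r. c i *\<^sub>R e i x)"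
 shows "crd r e x v : Rn r" "(\<Sum>i<r. crd r e x v i *\<^sub>R e i x) = v"
proof -
 have "crd r e x v : Rn r \<and> v = (\<Sum>i<r. crd r e x v i *\<^sub>R e i x)"
  unfolding crd_def by (rule theI'[OF assms])
 then show "crd r e x v : Rn r" "(\<Sum>i<r. crd r e x v i *\<^sub>R e i x) = v" by simp_all
qed

lemma crd_eqI:
 assumes "\<exists>!c. c : Rn r \<and> v = (\<Sum>i<r. c i *\<^sub>R e i x)" "c : Rn r" "v = (\<Sum>i<r. c i *\<^sub>R e i x)"
 shows "crd r e x v = c"
proof -
 have "crd r e x v : Rn r \<and> v = (\<Sum>i<r. crd r e x v i *\<^sub>R e i x)"
  unfolding crd_def by (rule theI'[OF assms(1)])
 then show ?thesis using assms by blast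
qed

text \<open>
 Only the part of the notions of manifold and of vector bundle which does not involve transition
 functions; the total space of a bundle satisfies it without any further argument.
\<close>

lemma ball_pair_iff: "(\<forall>(a,b)\<in>A. P a b) \<longleftrightarrow> (\<forall>a b. (a,b) : A --> P a b)" by auto

locale chart_bundle =
 fixes M :: "'q mfd" and E :: "('q, 'u::real_normed_vector) vbun"
 assumes charts_sub: "!!U \<phi>. (U,\<phi>) : charts M ==> U <= pts M"
  and charts_cover: "!!x. x : pts M ==> \<exists>U \<phi>. (U,\<phi>) : charts M \<and> x : U"
  and charts_inj: "!!U \<phi>. (U,\<phi>) : charts M ==> inj_on \<phi> U"
  and frames_sub: "!!W e. (W,e) : frames E ==> W <= pts M"
  and frames_cover: "!!x. x : pts M ==> \<exists>W e. (W,e) : frames E \<and> x : W"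
  and charts_open: "!!U \<phi> W e. (U,\<phi>) : charts M ==> (W,e) : frames E ==> opn (mdim M) (\<phi> ` (U \<inter> W))"
  and fib_subspace: "!!x. x : pts M ==> subspace (fib E x)"
  and frame_in: "!!W e x i. (W,e) : frames E ==> x : W ==> i < rk E ==> e i x : fib E x"
  and frame_basis: "!!W e x v. (W,e) : frames E ==> x : W ==> v : fib E x ==>
   \<exists>!c. c : Rn (rk E) \<and> v = (\<Sum>i<rk E. c i *\<^sub>R e i x)"
begin

context
 fixes W e x assumes We: "(W,e) : frames E" "x : W"
begin

lemma xM: "x : pts M" using We frames_sub by blast

lemma crd_Rn: "v : fib E x ==> crd (rk E) e x v : Rn (rk E)"
 and crd_sum: "v : fib E x ==> (\<Sum>i<rk E. crd (rk E) e x v i *\<^sub>R e i x) = v"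
 by (erule crd_props[where r="rk E" and e=e and x=x, OF frame_basis[OF We]])+

lemma frame_comb_in: "(\<Sum>i<rk E. c i *\<^sub>R e i x) : fib E x"
 by (intro subspace_sum subspace_scale fib_subspace xM frame_in[OF We]) auto

lemma crd_comb: "i < rk E ==> crd (rk E) e x (\<Sum>i<rk E. c i *\<^sub>R e i x) i = c i"
proof -
 assume i: "i < rk E"
 have "crd (rk E) e x (\<Sum>i<rk E. c i *\<^sub>R e i x) = (%i. if i < rk E then c i else 0)"
  by (rule crd_eqI[where r="rk E" and e=e and x=x, OF frame_basis[OF We frame_comb_in]]) (auto simp: Rn_def)
 then show ?thesis using i by simp
qed

lemma crd_lin:
 assumes "u : fib E x" "v : fib E x"
 shows "crd (rk E) e x (a *\<^sub>R u + b *\<^sub>R v) i = a * crd (rk E) e x u i + b * crd (rk E) e x v i"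
proof -
 have "a *\<^sub>R u + b *\<^sub>R v : fib E x" using assms fib_subspace[OF xM] by (simp add: subspace_add subspace_scale)
 then have "crd (rk E) e x (a *\<^sub>R u + b *\<^sub>R v) = (%i. a * crd (rk E) e x u i + b * crd (rk E) e x v i)"
 proof (rule crd_eqI[where r="rk E" and e=e and x=x, OF frame_basis[OF We]])
  show "(%i. a * crd (rk E) e x u i + b * crd (rk E) e x v i) : Rn (rk E)"
   using crd_Rn assms by (auto simp: Rn_def)
  show "a *\<^sub>R u + b *\<^sub>R v = (\<Sum>i<rk E. (a * crd (rk E) e x u i + b * crd (rk E) e x v i) *\<^sub>R e i x)"
   using crd_sum[OF assms(1)] crd_sum[OF assms(2)]
   by (simp add: scaleR_left_distrib sum.distrib flip: scaleR_scaleR scaleR_sum_right)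
 qed
 then show ?thesis by simp
qed

lemma crd_scale: "u : fib E x ==> crd (rk E) e x (a *\<^sub>R u) i = a * crd (rk E) e x u i"
 using crd_lin[of u u a 0] by simp

lemma crd_zero: "crd (rk E) e x 0 i = 0"
 using crd_scale[of 0 0 i] fib_subspace[OF xM] by (simp add: subspace_0)

end

definition secc :: "'q set => ('q => nat => real) => (nat => 'q => 'u) => ('q => 'u) => nat => (nat => real) => real" where
 "secc U \<phi> e s i y = crd (rk E) e (inv_into U \<phi> y) (s (inv_into U \<phi> y)) i"

lemma inv_chart: "(U,\<phi>) : charts M ==> x : U ==> inv_into U \<phi> (\<phi> x) = x"
 using charts_inj by (simp add: inv_into_f_f)

lemma dom_Rn: "(U,\<phi>) : charts M ==> (W,e) : frames E ==> \<phi> ` (U \<inter> W) <= Rn (mdim M)"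
 using charts_open opn_subset by blast

lemma sections_iff: "s : sections M E \<longleftrightarrow> (\<forall>x\<in>pts M. s x : fib E x) \<and> (\<forall>x. x \<notin> pts M --> s x = 0) \<and>
 (\<forall>U \<phi> W e i. (U,\<phi>) : charts M --> (W,e) : frames E --> i < rk E -->
  smooth_on (mdim M) (\<phi> ` (U \<inter> W)) (secc U \<phi> e s i))"
 unfolding sections_def smooth_fun_on_def secc_def ball_pair_iff mem_Collect_eq by blast

lemma family_iff: "smooth_family M E s \<longleftrightarrow> (\<forall>t\<in>{0..1}. \<forall>x\<in>pts M. s t x : fib E x) \<and>
 (\<forall>t\<in>{0..1}. \<forall>x. x \<notin> pts M --> s t x = 0) \<and>
 (\<forall>U \<phi> W e i. (U,\<phi>) : charts M --> (W,e) : frames E --> i < rk E -->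
  smooth_on (Suc (mdim M)) (famd (mdim M) (\<phi> ` (U \<inter> W))) (%z. secc U \<phi> e (s (z 0)) i (tail z)))"
 (is "_ \<longleftrightarrow> ?A \<and> ?B \<and> ?C")
proof
 assume s: "smooth_family M E s"
 then have "?A \<and> ?B" by (auto simp: smooth_family_def sections_def)
 moreover have ?C using s
  unfolding smooth_family_def famd_def secc_def Let_def tail_def ball_pair_iff by blast
 ultimately show "?A \<and> ?B \<and> ?C" by blast
next
 assume s: "?A \<and> ?B \<and> ?C"
 have "s t : sections M E" if t: "t : {0..1}" for t
  unfolding sections_iff
 proof (intro conjI allI impI)
  fix U \<phi> W e i assume a: "(U,\<phi>) : charts M" "(W,e) : frames E" "i < rk E"
  have "smooth_on (Suc (mdim M)) (famd (mdim M) (\<phi> ` (U \<inter> W))) (%z. secc U \<phi> e (s (z 0)) i (tail z))"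
   using s a by blast
  from smooth_on_famd_slice[OF this t dom_Rn[OF a(1,2)]]
  show "smooth_on (mdim M) (\<phi> ` (U \<inter> W)) (secc U \<phi> e (s t) i)" by simp
 qed (use s t in auto)
 moreover have "\<forall>(U,\<phi>)\<in>charts M. \<forall>(W,e)\<in>frames E. \<forall>i<rk E.
    smooth_on (Suc (mdim M))
     {z \<in> Rn (Suc (mdim M)). z 0 : {0..1} \<and> (%j. z (Suc j)) : \<phi> ` (U \<inter> W)}
     (%z. let x = inv_into U \<phi> (%j. z (Suc j)) in crd (rk E) e x (s (z 0) x) i)"
  using s unfolding famd_def secc_def Let_def tail_def ball_pair_iff by blast
 ultimately show "smooth_family M E s" unfolding smooth_family_def by blast
qed

lemma family_fib: "smooth_family M E s ==> t : {0..1} ==> x : pts M ==> s t x : fib E x"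
 and family_off: "smooth_family M E s ==> t : {0..1} ==> x \<notin> pts M ==> s t x = 0"
 and family_smooth: "smooth_family M E s ==> (U,\<phi>) : charts M ==> (W,e) : frames E ==> i < rk E ==>
  smooth_on (Suc (mdim M)) (famd (mdim M) (\<phi> ` (U \<inter> W))) (%z. secc U \<phi> e (s (z 0)) i (tail z))"
 unfolding family_iff by blast+

lemma family_section: "smooth_family M E s ==> t : {0..1} ==> s t : sections M E"
 by (simp add: smooth_family_def)

lemma section_fib: "s : sections M E ==> x : pts M ==> s x : fib E x"
 and section_off: "s : sections M E ==> x \<notin> pts M ==> s x = 0"
 and section_smooth: "s : sections M E ==> (U,\<phi>) : charts M ==> (W,e) : frames E ==> i < rk E ==>
  smooth_on (mdim M) (\<phi> ` (U \<inter> W)) (secc U \<phi> e s i)"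
 unfolding sections_iff by blast+

lemma const_family: assumes "s : sections M E" shows "smooth_family M E (%t. s)"
 unfolding family_iff
 using assms smooth_on_famd_const by (auto simp: sections_iff)

lemma secc_lin:
 assumes "(U,\<phi>) : charts M" "(W,e) : frames E" "y : \<phi> ` (U \<inter> W)"
  and "!!x. x : pts M ==> s x : fib E x" "!!x. x : pts M ==> s' x : fib E x"
 shows "secc U \<phi> e (%x. a *\<^sub>R s x + b *\<^sub>R s' x) i y = a * secc U \<phi> e s i y + b * secc U \<phi> e s' i y"
proof -
 obtain x where x: "x : U \<inter> W" "y = \<phi> x" using assms(3) by blast
 then have "inv_into U \<phi> y = x" using inv_chart[OF assms(1)] by blast
 moreover have "x : pts M" using x charts_sub[OF assms(1)] by blast
 ultimately show ?thesis unfolding secc_def using crd_lin[OF assms(2), of x "s x" "s' x"] x assms(4,5) by simp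
qed

lemma family_lin:
 assumes "smooth_family M E s" "smooth_family M E s'"
 shows "smooth_family M E (%t x. a *\<^sub>R s t x + b *\<^sub>R s' t x)"
 unfolding family_iff
proof (intro conjI ballI allI impI)
 fix t x assume "t : {0..1::real}" "x : pts M"
 then show "a *\<^sub>R s t x + b *\<^sub>R s' t x : fib E x"
  using assms family_fib fib_subspace by (metis subspace_add subspace_scale)
next
 fix t x assume "t : {0..1::real}" "x \<notin> pts M"
 then show "a *\<^sub>R s t x + b *\<^sub>R s' t x = 0" using family_off[OF assms(1), of t x] family_off[OF assms(2), of t x] by simp
next
 fix U \<phi> W e i assume a: "(U,\<phi>) : charts M" "(W,e) : frames E" "i < rk E"
 have "smooth_on (Suc (mdim M)) (famd (mdim M) (\<phi> ` (U \<inter> W)))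
  (%z. a * secc U \<phi> e (s (z 0)) i (tail z) + b * secc U \<phi> e (s' (z 0)) i (tail z))"
  by (intro smooth_on_add smooth_on_cmult family_smooth[OF assms(1) a] family_smooth[OF assms(2) a])
 then show "smooth_on (Suc (mdim M)) (famd (mdim M) (\<phi> ` (U \<inter> W)))
  (%z. secc U \<phi> e (%x. a *\<^sub>R s (z 0) x + b *\<^sub>R s' (z 0) x) i (tail z))"
 proof (rule smooth_on_cong)
  fix z assume z: "z : famd (mdim M) (\<phi> ` (U \<inter> W))"
  then have "z 0 : {0..1}" "tail z : \<phi> ` (U \<inter> W)" by (auto simp: famd_def tail_def)
  then show "a * secc U \<phi> e (s (z 0)) i (tail z) + b * secc U \<phi> e (s' (z 0)) i (tail z) =
   secc U \<phi> e (%x. a *\<^sub>R s (z 0) x + b *\<^sub>R s' (z 0) x) i (tail z)"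
   using secc_lin[OF a(1,2) _ family_fib[OF assms(1)] family_fib[OF assms(2)]] by simp
 qed
qed

lemma section_lin:
 assumes "s : sections M E" "s' : sections M E"
 shows "(%x. a *\<^sub>R s x + b *\<^sub>R s' x) : sections M E"
 using family_section[OF family_lin[OF const_family[OF assms(1)] const_family[OF assms(2)]], of 0] by simp

lemma family_scale: "smooth_family M E s ==> smooth_family M E (%t x. a *\<^sub>R s t x)"
 using family_lin[of s s a 0] by simp

lemma family_uminus: "smooth_family M E s ==> smooth_family M E (%t x. - s t x)"
 using family_scale[of s "-1"] by simp

lemma family_add: "smooth_family M E s ==> smooth_family M E s' ==> smooth_family M E (%t x. s t x + s' t x)"
 using family_lin[of s s' 1 1] by simp

lemma section_scale: "s : sections M E ==> (%x. a *\<^sub>R s x) : sections M E"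
 using section_lin[of s s a 0] by simp

lemma section_uminus: "s : sections M E ==> (%x. - s x) : sections M E"
 using section_scale[of s "-1"] by simp

lemma section_add: "s : sections M E ==> s' : sections M E ==> (%x. s x + s' x) : sections M E"
 using section_lin[of s s' 1 1] by simp

lemma section_diff: "s : sections M E ==> s' : sections M E ==> (%x. s x - s' x) : sections M E"
 using section_lin[of s s' 1 "-1"] by simp

lemma crd_zero': "(W,e) : frames E ==> x : W ==> crd (rk E) e x 0 i = 0"
 using crd_zero by blast

lemma secc_zero:
 assumes "(U,\<phi>) : charts M" "(W,e) : frames E" "y : \<phi> ` (U \<inter> W)"
 shows "secc U \<phi> e (%x. 0) i y = 0"
proof -
 obtain x where x: "x : U \<inter> W" "y = \<phi> x" using assms(3) by blast
 then have "inv_into U \<phi> y = x" using inv_chart[OF assms(1)] by blast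
 then show ?thesis unfolding secc_def using crd_zero'[OF assms(2)] x by simp
qed

lemma section_zero: "(%x. 0) : sections M E"
 unfolding sections_iff
proof (intro conjI ballI allI impI)
 fix U \<phi> W e i assume a: "(U,\<phi>) : charts M" "(W,e) : frames E" "i < rk E"
 show "smooth_on (mdim M) (\<phi> ` (U \<inter> W)) (secc U \<phi> e (%x. 0) i)"
  by (rule smooth_on_cong[OF smooth_on_const[of _ _ 0]]) (simp add: secc_zero[OF a(1,2)])
qed (use fib_subspace subspace_0 in auto)

lemma family_zero: "smooth_family M E (%t x. 0)"
 using const_family[OF section_zero] .

lemma section_sum: "(!!i. i : I ==> f i : sections M E) ==> (%x. \<Sum>i\<in>I. f i x) : sections M E"
 by (induction I rule: infinite_finite_induct) (auto intro: section_zero section_add)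

lemma family_sum: "(!!i. i : I ==> smooth_family M E (f i)) ==> smooth_family M E (%t x. \<Sum>i\<in>I. f i t x)"
 by (induction I rule: infinite_finite_induct) (auto intro: family_zero family_add)

definition dfam :: "(real => 'q => 'u) => real => 'q => 'u" where
 "dfam s t x = vector_derivative (%t. s t x) (at t within {0..1})"

lemma vd_within_unit:
 "(f has_vector_derivative d) (at t within {0..1}) ==> t : {0..1} ==> vector_derivative f (at t within {0..1::real}) = d"
 by (rule vector_derivative_within_cbox[of 0 1, unfolded cbox_interval]) auto

lemma family_derivative_local:
 assumes s: "smooth_family M E s" and a: "(U,\<phi>) : charts M" "(W,e) : frames E" and x: "x : U" "x : W" and t: "t : {0..1}"
 shows "((%t. s t x) has_vector_derivative
  (\<Sum>i<rk E. pd (famd (mdim M) (\<phi> ` (U \<inter> W))) 0 (%z. secc U \<phi> e (s (z 0)) i (tail z)) (case_nat t (\<phi> x)) *\<^sub>R e i x))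
  (at t within {0..1})"
proof -
 let ?D = "famd (mdim M) (\<phi> ` (U \<inter> W))"
 let ?c = "%i z. secc U \<phi> e (s (z 0)) i (tail z)"
 have nd: "ndom (Suc (mdim M)) ?D" by (rule ndom_famd[OF charts_open[OF a]])
 have xM: "x : pts M" using x charts_sub[OF a(1)] by blast
 have y: "\<phi> x : \<phi> ` (U \<inter> W)" using x by blast
 have 1: "((%t. ?c i (case_nat t (\<phi> x))) has_real_derivative pd ?D 0 (?c i) (case_nat t (\<phi> x))) (at t within {0..1})"
  if i: "i < rk E" for i
  by (rule has_pd_famd_time[OF smooth_has_pd(1)[OF nd family_smooth[OF s a i]] t dom_Rn[OF a] y]) simp
 have "((%t. \<Sum>i<rk E. ?c i (case_nat t (\<phi> x)) *\<^sub>R e i x) has_vector_derivative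
  (\<Sum>i<rk E. pd ?D 0 (?c i) (case_nat t (\<phi> x)) *\<^sub>R e i x)) (at t within {0..1})"
 proof (rule has_vector_derivative_sum)
  fix i assume "i : {..<rk E}"
  then have "((%t. ?c i (case_nat t (\<phi> x))) has_vector_derivative pd ?D 0 (?c i) (case_nat t (\<phi> x))) (at t within {0..1})"
   using 1[of i] by (simp add: has_real_derivative_iff_has_vector_derivative)
  from bounded_linear.has_vector_derivative[OF bounded_linear_scaleR_left this]
  show "((%t. ?c i (case_nat t (\<phi> x)) *\<^sub>R e i x) has_vector_derivative pd ?D 0 (?c i) (case_nat t (\<phi> x)) *\<^sub>R e i x) (at t within {0..1})" .
 qed
 then show ?thesis
 proof (rule has_vector_derivative_transform_within[where d=1])
  fix u assume "u : {0..1::real}"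
  then have "s u x : fib E x" using family_fib[OF s _ xM] by blast
  then show "(\<Sum>i<rk E. ?c i (case_nat u (\<phi> x)) *\<^sub>R e i x) = s u x"
   using crd_sum[OF a(2) x(2)] by (simp add: secc_def inv_chart[OF a(1) x(1)])
 qed (use t in auto)
qed

lemma family_derivative:
 assumes s: "smooth_family M E s" and t: "t : {0..1}"
 shows "((%t. s t x) has_vector_derivative dfam s t x) (at t within {0..1})"
proof (cases "x : pts M")
 case True
 obtain U \<phi> where U: "(U,\<phi>) : charts M" "x : U" using charts_cover[OF True] by blast
 obtain W e where W: "(W,e) : frames E" "x : W" using frames_cover[OF True] by blast
 note d = family_derivative_local[OF s U(1) W(1) U(2) W(2) t]
 from d vd_within_unit[OF d t] show ?thesis unfolding dfam_def by simp
next
 case False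
 have "((%t. 0) has_vector_derivative (0::'u)) (at t within {0..1})" by simp
 then have "((%t. s t x) has_vector_derivative 0) (at t within {0..1})"
  by (rule has_vector_derivative_transform_within[where d=1]) (use family_off[OF s _ False] t in auto)
 then show ?thesis using vd_within_unit[OF _ t] unfolding dfam_def by metis
qed

lemma secc_dfam:
 assumes s: "smooth_family M E s" and a: "(U,\<phi>) : charts M" "(W,e) : frames E" "i < rk E"
  and z: "z : famd (mdim M) (\<phi> ` (U \<inter> W))"
 shows "secc U \<phi> e (dfam s (z 0)) i (tail z) = pd (famd (mdim M) (\<phi> ` (U \<inter> W))) 0 (%z. secc U \<phi> e (s (z 0)) i (tail z)) z"
proof -
 have z': "z 0 : {0..1}" "tail z : \<phi> ` (U \<inter> W)" using z by (auto simp: famd_def tail_def)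
 then obtain x where x: "x : U" "x : W" "tail z = \<phi> x" by blast
 have e: "case_nat (z 0) (\<phi> x) = z" using case_nat_tail[of z] x(3) by simp
 have "dfam s (z 0) x = (\<Sum>i<rk E. pd (famd (mdim M) (\<phi> ` (U \<inter> W))) 0 (%z. secc U \<phi> e (s (z 0)) i (tail z)) z *\<^sub>R e i x)"
  unfolding dfam_def using vd_within_unit[OF family_derivative_local[OF s a(1,2) x(1,2) z'(1)] z'(1)] e by simp
 then show ?thesis
  unfolding secc_def[of U \<phi> e "dfam s (z 0)"] x(3) inv_chart[OF a(1) x(1)] using crd_comb[OF a(2) x(2) a(3)] by simp
qed

lemma family_dfam: assumes s: "smooth_family M E s" shows "smooth_family M E (dfam s)"
 unfolding family_iff
proof (intro conjI ballI allI impI)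
 fix t x assume t: "t : {0..1::real}" and x: "x : pts M"
 obtain U \<phi> where U: "(U,\<phi>) : charts M" "x : U" using charts_cover[OF x] by blast
 obtain W e where W: "(W,e) : frames E" "x : W" using frames_cover[OF x] by blast
 show "dfam s t x : fib E x"
  unfolding dfam_def vd_within_unit[OF family_derivative_local[OF s U(1) W(1) U(2) W(2) t] t]
  by (rule frame_comb_in[OF W])
next
 fix t x assume t: "t : {0..1::real}" and x: "x \<notin> pts M"
 have "((%t. 0) has_vector_derivative (0::'u)) (at t within {0..1})" by simp
 then have "((%t. s t x) has_vector_derivative 0) (at t within {0..1})"
  by (rule has_vector_derivative_transform_within[where d=1]) (use family_off[OF s _ x] t in auto)
 from vd_within_unit[OF this t] show "dfam s t x = 0" unfolding dfam_def .
next
 fix U \<phi> W e i assume a: "(U,\<phi>) : charts M" "(W,e) : frames E" "i < rk E"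
 have nd: "ndom (Suc (mdim M)) (famd (mdim M) (\<phi> ` (U \<inter> W)))" by (rule ndom_famd[OF charts_open[OF a(1,2)]])
 show "smooth_on (Suc (mdim M)) (famd (mdim M) (\<phi> ` (U \<inter> W))) (%z. secc U \<phi> e (dfam s (z 0)) i (tail z))"
  by (rule smooth_on_cong[OF smooth_on_pd'[OF nd family_smooth[OF s a]]]) (use secc_dfam[OF s a] in auto)
qed

end

section \<open>The total space of the normal bundle\<close>

lemma smooth_on_cover:
 assumes D: "opn n D" and c: "!!x. x : D ==> \<exists>D'. opn n D' \<and> D' <= D \<and> x : D' \<and> smooth_on n D' f"
 shows "smooth_on n D f"
proof (rule smooth_on_local[OF opn_ndom[OF D]])
 fix x assume "x : D"
 then obtain D' where D': "opn n D'" "D' <= D" "x : D'" "smooth_on n D' f" using c by blast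
 then obtain T where T: "open T" "D' = Rn n \<inter> T" by (auto simp: openin_open)
 have "D \<inter> T = D'" using D'(2) T(2) opn_subset[OF D] by blast
 then show "\<exists>W. open W \<and> x : W \<and> smooth_on n (D \<inter> W) f" using T D' by auto
qed

lemma smooth_on_famd_cover:
 assumes D: "opn n D"
  and c: "!!x. x : D ==> \<exists>D'. opn n D' \<and> D' <= D \<and> x : D' \<and> smooth_on (Suc n) (famd n D') f"
 shows "smooth_on (Suc n) (famd n D) f"
proof (rule smooth_on_local[OF ndom_famd[OF D]])
 fix z assume z: "z : famd n D"
 then have "tail z : D" by (simp add: famd_def tail_def)
 then obtain D' where D': "opn n D'" "D' <= D" "tail z : D'" "smooth_on (Suc n) (famd n D') f" using c by blast
 then obtain T where T: "open T" "D' = Rn n \<inter> T" by (auto simp: openin_open)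
 have "continuous_on UNIV tail"
  by (rule continuous_on_coordinatewise_then_product) (simp add: tail_def)
 then have "open (tail -` T)" using T(1) by (simp add: open_vimage)
 moreover have "famd n D \<inter> tail -` T = famd n D'"
  using D'(2) T(2) opn_subset[OF D] by (auto simp: famd_def tail_def)
 ultimately show "\<exists>W. open W \<and> z : W \<and> smooth_on (Suc n) (famd n D \<inter> W) f"
  using D' T(2) by (intro exI[of _ "tail -` T"]) auto
qed

locale bundle_pair =
 fixes S :: "'p mfd" and N :: "('p, 'v::real_normed_vector) vbun" and l :: "('p, 'w::real_normed_vector) vbun"
 assumes SM: "smooth_manifold S" and NB: "vector_bundle S N" and LB: "line_bundle S l"
begin

abbreviation n where "n \<equiv> mdim S"
abbreviation r where "r \<equiv> rk N"
abbreviation M where "M \<equiv> total_space S N"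
abbreviation L where "L \<equiv> pullback N l"
abbreviation \<Gamma>L where "\<Gamma>L \<equiv> sections M L"
abbreviation famL where "famL \<equiv> smooth_family M L"
abbreviation chart where "chart U \<phi> \<equiv> (U,\<phi>) : charts S"
abbreviation frameN where "frameN W e \<equiv> (W,e) : frames N"
abbreviation frameL where "frameL W b \<equiv> (W,b) : frames l"

lemma rk_l: "rk l = 1" and lVB: "vector_bundle S l" using LB by (auto simp: line_bundle_def)

lemma S_charts: assumes "chart U \<phi>"
 shows "inj_on \<phi> U" "U <= pts S" "opn n (\<phi> ` U)"
  "chart V \<psi> ==> opn n (\<phi> ` (U \<inter> V))"
  "chart V \<psi> ==> i < n ==> smooth_on n (\<phi> ` (U \<inter> V)) (%y. \<psi> (inv_into U \<phi> y) i)"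
proof -
 note E = SM[unfolded smooth_manifold_def ball_pair_iff]
 note E2 = conjunct1[OF conjunct2[OF E], rule_format, OF assms]
  and E3 = conjunct1[OF conjunct2[OF conjunct2[OF E]], rule_format, OF assms]
 have un: "(\<Union>(U,\<phi>)\<in>charts S. U) = pts S" using E by (rule conjunct1)
 show "inj_on \<phi> U" "opn n (\<phi> ` U)" using E2 by simp_all
 show "U <= pts S" unfolding un[symmetric] using assms by auto
 show "opn n (\<phi> ` (U \<inter> V))" if "chart V \<psi>" using E3[OF that] by (rule conjunct1)
 show "smooth_on n (\<phi> ` (U \<inter> V)) (%y. \<psi> (inv_into U \<phi> y) i)" if "chart V \<psi>" "i < n"
  using conjunct2[OF E3[OF that(1)]] that(2) by simp
qed

lemma S_cover: "x : pts S ==> \<exists>U \<phi>. chart U \<phi> \<and> x : U"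
proof -
 assume "x : pts S"
 moreover have "(\<Union>(U,\<phi>)\<in>charts S. U) = pts S" using SM unfolding smooth_manifold_def by (rule conjunct1)
 ultimately have "x : (\<Union>(U,\<phi>)\<in>charts S. U)" by simp
 then obtain p where "p : charts S" "x : (case p of (U,\<phi>) => U)" by blast
 then show ?thesis by (cases p) auto
qed

lemma mfd_open_iff: "mfd_open S A \<longleftrightarrow> A <= pts S \<and> (\<forall>U \<phi>. chart U \<phi> --> opn n (\<phi> ` (A \<inter> U)))"
 unfolding mfd_open_def ball_pair_iff by blast

lemma istopology_S: "istopology (mfd_open S)"
 unfolding istopology_def
proof (intro conjI allI impI)
 fix A B assume AB: "mfd_open S A" "mfd_open S B"
 show "mfd_open S (A \<inter> B)" unfolding mfd_open_iff
 proof (intro conjI allI impI)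
  fix U \<phi> assume a: "chart U \<phi>"
  have "\<phi> ` (A \<inter> B \<inter> U) = \<phi> ` ((A \<inter> U) \<inter> (B \<inter> U))" by (rule arg_cong[where f="image \<phi>"]) blast
  also have "\<dots> = \<phi> ` (A \<inter> U) \<inter> \<phi> ` (B \<inter> U)"
   by (rule inj_on_image_Int[OF S_charts(1)[OF a]]) auto
  finally show "opn n (\<phi> ` (A \<inter> B \<inter> U))" using AB a by (simp add: mfd_open_iff openin_Int)
 qed (use AB in \<open>auto simp: mfd_open_iff\<close>)
next
 fix \<K> assume K: "\<forall>K\<in>\<K>. mfd_open S K"
 show "mfd_open S (\<Union>\<K>)" unfolding mfd_open_iff
 proof (intro conjI allI impI)
  fix U \<phi> assume a: "chart U \<phi>"
  have "\<phi> ` (\<Union>\<K> \<inter> U) = (\<Union>K\<in>\<K>. \<phi> ` (K \<inter> U))" by blast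
  then show "opn n (\<phi> ` (\<Union>\<K> \<inter> U))" using K a by (auto simp: mfd_open_iff intro!: openin_Union)
 qed (use K in \<open>auto simp: mfd_open_iff\<close>)
qed

lemma openin_S: "openin (mfd_topology S) A \<longleftrightarrow> mfd_open S A"
 unfolding mfd_topology_def using topology_inverse'[OF istopology_S] by simp

lemma mfd_open_Int: "mfd_open S A ==> mfd_open S B ==> mfd_open S (A \<inter> B)"
 unfolding openin_S[symmetric] by (rule openin_Int)

lemma mfd_open_chart: "chart U \<phi> ==> mfd_open S U"
 unfolding mfd_open_iff
proof (intro conjI allI impI)
 fix V \<psi> assume a: "chart U \<phi>" "chart V \<psi>"
 then show "opn n (\<psi> ` (U \<inter> V))" using S_charts(4)[OF a(2,1)] by (simp add: Int_commute)
qed (rule S_charts)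

lemma mfd_open_pts: "mfd_open S (pts S)"
 unfolding mfd_open_iff using S_charts(2,3) by (auto simp: Int_absorb1)

lemma topspace_S: "topspace (mfd_topology S) = pts S"
proof
 show "topspace (mfd_topology S) <= pts S"
  using openin_topspace[of "mfd_topology S"] unfolding openin_S by (simp add: mfd_open_iff)
 show "pts S <= topspace (mfd_topology S)"
  using mfd_open_pts unfolding openin_S[symmetric] by (rule openin_subset)
qed

lemma opn_image: "mfd_open S A ==> chart U \<phi> ==> A <= U ==> opn n (\<phi> ` A)"
 unfolding mfd_open_iff by (metis Int_absorb2)

lemma mfd_open_vimage:
 assumes U: "chart U \<phi>" and D: "opn n D" "D <= \<phi> ` U"
 shows "mfd_open S {x \<in> U. \<phi> x : D}"
 unfolding mfd_open_iff
proof (intro conjI allI impI)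
 show "{x \<in> U. \<phi> x : D} <= pts S" using S_charts(2)[OF U] by blast
 fix V \<psi> assume V: "chart V \<psi>"
 have cont: "continuous_on (\<psi> ` (V \<inter> U)) (%y. \<phi> (inv_into V \<psi> y))"
 proof (rule continuous_on_coordinatewise_then_product)
  fix i
  show "continuous_on (\<psi> ` (V \<inter> U)) (%y. \<phi> (inv_into V \<psi> y) i)"
  proof (cases "i < n")
   case True
   then show ?thesis using S_charts(5)[OF V U] smooth_on_continuous by blast
  next
   case False
   have "\<phi> (inv_into V \<psi> y) i = 0" if y: "y : \<psi> ` (V \<inter> U)" for y
   proof -
    obtain x where "x : V" "x : U" "y = \<psi> x" using y by blast
    then have "\<phi> (inv_into V \<psi> y) = \<phi> x" using S_charts(1)[OF V] by (simp add: inv_into_f_f)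
    moreover have "\<phi> x : Rn n" using \<open>x : U\<close> opn_subset[OF S_charts(3)[OF U]] by blast
    ultimately show ?thesis using False by (simp add: Rn_def)
   qed
   then show ?thesis by (simp cong: continuous_on_cong)
  qed
 qed
 obtain T where T: "open T" "D = Rn n \<inter> T" using D(1) by (auto simp: openin_open)
 have "openin (top_of_set (\<psi> ` (V \<inter> U))) (\<psi> ` (V \<inter> U) \<inter> (%y. \<phi> (inv_into V \<psi> y)) -` T)"
  by (rule continuous_openin_preimage_gen[OF cont T(1)])
 then have "opn n (\<psi> ` (V \<inter> U) \<inter> (%y. \<phi> (inv_into V \<psi> y)) -` T)"
  using S_charts(4)[OF V U] openin_trans by blast
 moreover have "\<psi> ` (V \<inter> U) \<inter> (%y. \<phi> (inv_into V \<psi> y)) -` T = \<psi> ` ({x \<in> U. \<phi> x : D} \<inter> V)"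
 proof -
  have "\<phi> x : T \<longleftrightarrow> \<phi> x : D" if "x : U" for x
   using that T(2) opn_subset[OF S_charts(3)[OF U]] by blast
  then show ?thesis using S_charts(1)[OF V] by (auto simp: inv_into_f_f)
 qed
 ultimately show "opn n (\<psi> ` ({x \<in> U. \<phi> x : D} \<inter> V))" by simp
qed

lemma closed_compact_chart:
 assumes U: "chart U \<phi>" and K: "compact K" "K <= \<phi> ` U"
 shows "mfd_open S (pts S - inv_into U \<phi> ` K)"
proof -
 have "continuous_map (top_of_set (\<phi> ` U)) (mfd_topology S) (inv_into U \<phi>)"
  unfolding continuous_map_alt
 proof (intro conjI allI impI)
  show "inv_into U \<phi> : topspace (top_of_set (\<phi> ` U)) \<rightarrow> topspace (mfd_topology S)"
   using S_charts(1,2)[OF U] by (auto simp: topspace_S inv_into_f_f)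
  fix A assume "openin (mfd_topology S) A"
  then have A: "opn n (\<phi> ` (A \<inter> U))" using U by (simp add: openin_S mfd_open_iff)
  have "inv_into U \<phi> -` A \<inter> topspace (top_of_set (\<phi> ` U)) = \<phi> ` (A \<inter> U)"
   using S_charts(1)[OF U] by (auto simp: inv_into_f_f)
  moreover have "openin (top_of_set (\<phi> ` U)) (\<phi> ` (A \<inter> U))"
   by (rule openin_subset_trans[OF A _ opn_subset[OF S_charts(3)[OF U]]]) blast
  ultimately show "openin (top_of_set (\<phi> ` U)) (inv_into U \<phi> -` A \<inter> topspace (top_of_set (\<phi> ` U)))" by simp
 qed
 moreover have "compactin (top_of_set (\<phi> ` U)) K" using K by (simp add: compactin_subtopology)
 ultimately have "compactin (mfd_topology S) (inv_into U \<phi> ` K)" by (rule image_compactin[rotated])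
 moreover have "Hausdorff_space (mfd_topology S)" using SM by (simp add: smooth_manifold_def)
 ultimately have "closedin (mfd_topology S) (inv_into U \<phi> ` K)" by (rule compactin_imp_closedin[rotated])
 then show ?thesis by (simp add: closedin_def topspace_S openin_S)
qed

lemma vector_bundle_frames:
 assumes "vector_bundle S (E :: ('p, 'u::real_normed_vector) vbun)" "(W,e) : frames E"
 shows "mfd_open S W"
  "(W2,e2) : frames E ==> i < rk E ==> j < rk E ==> smooth_fun_on S (W \<inter> W2) (%x. crd (rk E) e x (e2 j x) i)"
proof -
 note E = assms(1)[unfolded vector_bundle_def ball_pair_iff]
 note E3 = conjunct1[OF conjunct2[OF conjunct2[OF E]], rule_format]
  and E4 = conjunct2[OF conjunct2[OF conjunct2[OF E]], rule_format]
 show "mfd_open S W" using E3[OF assms(2)] openin_S by blast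
 show "smooth_fun_on S (W \<inter> W2) (%x. crd (rk E) e x (e2 j x) i)"
  if "(W2,e2) : frames E" "i < rk E" "j < rk E"
  by (rule E4[OF assms(2) that])
qed

lemma bundle_chart_bundle:
 assumes "vector_bundle S E" shows "chart_bundle S (E :: ('p, 'u::real_normed_vector) vbun)"
proof
 note E = assms[unfolded vector_bundle_def ball_pair_iff]
 note E1 = conjunct1[OF E] and E2 = conjunct1[OF conjunct2[OF E]]
  and E3 = conjunct1[OF conjunct2[OF conjunct2[OF E]], rule_format]
 note fr = vector_bundle_frames(1)[OF assms]
 show "U <= pts S" "inj_on \<phi> U" if "chart U \<phi>" for U \<phi> using S_charts that by blast+
 show "\<exists>U \<phi>. chart U \<phi> \<and> x : U" if "x : pts S" for x using S_cover that by blast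
 show "W <= pts S" if "(W,e) : frames E" for W e using fr[OF that] by (simp add: mfd_open_iff)
 show "\<exists>W e. (W,e) : frames E \<and> x : W" if "x : pts S" for x
 proof -
  have "x : (\<Union>(W,e)\<in>frames E. W)" using E2 that by simp
  then obtain p where "p : frames E" "x : (case p of (W,e) => W)" by blast
  then show ?thesis by (cases p) auto
 qed
 show "opn n (\<phi> ` (U \<inter> W))" if "chart U \<phi>" "(W,e) : frames E" for U \<phi> W e
  using fr[OF that(2)] that(1) by (simp add: mfd_open_iff Int_commute)
 show "subspace (fib E x)" if "x : pts S" for x using E1 that by blast
 show "e i x : fib E x" if "(W,e) : frames E" "x : W" "i < rk E" for W e x i
  using E3[OF that(1)] that(2,3) by blast
 show "\<exists>!c. c : Rn (rk E) \<and> v = (\<Sum>i<rk E. c i *\<^sub>R e i x)"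
  if "(W,e) : frames E" "x : W" "v : fib E x" for W e x v
  using E3[OF that(1)] that(2,3) by blast
qed

sublocale SN: chart_bundle S N by (rule bundle_chart_bundle[OF NB])
sublocale Sl: chart_bundle S l by (rule bundle_chart_bundle[OF lVB])

lemmas frame_open = vector_bundle_frames(1)[OF NB] and frame_open_l = vector_bundle_frames(1)[OF lVB]
lemmas frame_transition = vector_bundle_frames(2)[OF NB] and frame_transition_l = vector_bundle_frames(2)[OF lVB, unfolded rk_l]

definition tot :: "'p set => ('p \<times> 'v) set" where "tot A = {(x,v). x : A \<and> v : fib N x}"

definition co :: "('p => nat => real) => (nat => 'p => 'v) => 'p \<times> 'v => nat => real" where
 "co \<phi> e = (%(x,v) i. if i < n then \<phi> x i else crd r e x v (i - n))"

definition pt :: "'p set => ('p => nat => real) => (nat => 'p => 'v) => (nat => real) => 'p \<times> 'v" where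
 "pt U \<phi> e z = (inv_into U \<phi> (trunc n z), \<Sum>i<r. z (n + i) *\<^sub>R e i (inv_into U \<phi> (trunc n z)))"

lemma pts_M: "pts M = tot (pts S)" and mdim_M: "mdim M = n + r" and rk_L: "rk L = 1"
 and fib_L: "fib L p = fib l (fst p)"
 by (auto simp: total_space_def tot_def pullback_def rk_l split: prod.splits)

lemma pts_M_iff: "p : pts M \<longleftrightarrow> fst p : pts S \<and> snd p : fib N (fst p)"
 by (auto simp: pts_M tot_def)

lemma charts_M: "charts M = {(tot (U \<inter> W), co \<phi> e) | U \<phi> W e. chart U \<phi> \<and> frameN W e}"
 by (simp add: total_space_def tot_def co_def)

lemma frames_L: "frames L = {(tot W', %i (x,v). b i x) | W' b. frameL W' b}"
 by (simp add: pullback_def tot_def)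

lemma tot_Int: "tot A \<inter> tot B = tot (A \<inter> B)" by (auto simp: tot_def)

lemma zero_in_fib: "x : pts S ==> 0 : fib N x" using SN.fib_subspace subspace_0 by blast

context
 fixes U \<phi> W e assumes U: "chart U \<phi>" and W: "frameN W e"
begin

lemma chart_Rn: "x : U ==> \<phi> x : Rn n" using opn_subset[OF S_charts(3)[OF U]] by blast

lemma inv_ch: "x : U ==> inv_into U \<phi> (\<phi> x) = x" using SN.inv_chart[OF U] by blast

lemma co_in_cyl:
 assumes A: "A <= U \<inter> W" and p: "p : tot A"
 shows "co \<phi> e p : cyl n r (\<phi> ` A)" "pt U \<phi> e (co \<phi> e p) = p" "trunc n (co \<phi> e p) = \<phi> (fst p)"
proof -
 obtain x v where xv: "p = (x,v)" "x : A" "v : fib N x" using p by (auto simp: tot_def)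
 have x: "x : U" "x : W" using xv A by auto
 have t: "trunc n (co \<phi> e p) = \<phi> x"
  using chart_Rn[OF x(1)] by (auto simp: xv(1) trunc_def co_def Rn_def fun_eq_iff)
 then show "trunc n (co \<phi> e p) = \<phi> (fst p)" by (simp add: xv(1))
 have "co \<phi> e p : Rn (n + r)" using SN.crd_Rn[OF W x(2) xv(3)] by (auto simp: co_def xv(1) Rn_def)
 then show "co \<phi> e p : cyl n r (\<phi> ` A)" using t xv(2) by (auto simp: cyl_def)
 show "pt U \<phi> e (co \<phi> e p) = p"
  unfolding pt_def t inv_ch[OF x(1)] using SN.crd_sum[OF W x(2) xv(3)] by (simp add: co_def xv(1))
qed

lemma pt_in_tot:
 assumes A: "A <= U \<inter> W" and z: "z : cyl n r (\<phi> ` A)"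
 shows "pt U \<phi> e z : tot A" "co \<phi> e (pt U \<phi> e z) = z" "\<phi> (fst (pt U \<phi> e z)) = trunc n z"
proof -
 obtain x where x: "x : A" "trunc n z = \<phi> x" using z by (auto simp: cyl_def)
 have xUW: "x : U" "x : W" using x A by auto
 have p: "pt U \<phi> e z = (x, \<Sum>i<r. z (n + i) *\<^sub>R e i x)" by (simp add: pt_def x(2) inv_ch[OF xUW(1)])
 then show "\<phi> (fst (pt U \<phi> e z)) = trunc n z" using x by simp
 show "pt U \<phi> e z : tot A" using p x SN.frame_comb_in[OF W xUW(2)] by (auto simp: tot_def)
 have "co \<phi> e (pt U \<phi> e z) i = z i" for i
 proof -
  consider "i < n" | "n \<le> i" "i - n < r" | "n + r \<le> i" by linarith
  then show ?thesis
  proof cases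
   case 1
   then show ?thesis using fun_cong[OF x(2), of i] by (simp add: p co_def trunc_def)
  next
   case 2
   then show ?thesis using SN.crd_comb[OF W xUW(2) 2(2), of "%i. z (n + i)"] by (simp add: p co_def)
  next
   case 3
   then have "crd r e x (\<Sum>i<r. z (n + i) *\<^sub>R e i x) (i - n) = 0"
    using SN.crd_Rn[OF W xUW(2) SN.frame_comb_in[OF W xUW(2)]] by (simp add: Rn_def)
   then show ?thesis using 3 z by (simp add: p co_def cyl_def Rn_def)
  qed
 qed
 then show "co \<phi> e (pt U \<phi> e z) = z" by blast
qed

lemma co_image: "A <= U \<inter> W ==> co \<phi> e ` tot A = cyl n r (\<phi> ` A)"
proof
 assume A: "A <= U \<inter> W"
 show "co \<phi> e ` tot A <= cyl n r (\<phi> ` A)" by (intro image_subsetI co_in_cyl(1)[OF A])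
 show "cyl n r (\<phi> ` A) <= co \<phi> e ` tot A"
 proof
  fix z assume z: "z : cyl n r (\<phi> ` A)"
  show "z : co \<phi> e ` tot A" 
   by (metis image_eqI pt_in_tot(1)[OF A z] pt_in_tot(2)[OF A z])
 qed
qed

lemma co_inj: "inj_on (co \<phi> e) (tot (U \<inter> W))"
 by (rule inj_on_inverseI[of _ "pt U \<phi> e"]) (rule co_in_cyl(2)[OF subset_refl])

lemma inv_co: "z : cyl n r (\<phi> ` (U \<inter> W)) ==> inv_into (tot (U \<inter> W)) (co \<phi> e) z = pt U \<phi> e z"
 using inv_into_f_f[OF co_inj pt_in_tot(1)[OF subset_refl], of z] by (simp add: pt_in_tot(2)[OF subset_refl])

end

lemma chart_bundle_TL: "chart_bundle M L"
proof
 fix A \<Phi> assume "(A,\<Phi>) : charts M"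
 then obtain U \<phi> W e where a: "A = tot (U \<inter> W)" "\<Phi> = co \<phi> e" "chart U \<phi>" "frameN W e"
  unfolding charts_M by blast
 show "A <= pts M" using S_charts(2)[OF a(3)] by (auto simp: a(1) pts_M tot_def)
 show "inj_on \<Phi> A" unfolding a by (rule co_inj[OF a(3,4)])
 fix B f assume "(B,f) : frames L"
 then obtain W' b where b: "B = tot W'" "frameL W' b" unfolding frames_L by blast
 have "\<Phi> ` (A \<inter> B) = cyl n r (\<phi> ` (U \<inter> W \<inter> W'))"
  unfolding a b tot_Int by (rule co_image[OF a(3,4)]) blast
 moreover have "mfd_open S (U \<inter> W \<inter> W')"
  by (intro mfd_open_Int mfd_open_chart[OF a(3)] frame_open[OF a(4)] frame_open_l[OF b(2)])
 then have "opn n (\<phi> ` (U \<inter> W \<inter> W'))" by (rule opn_image[OF _ a(3)]) blast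
 ultimately show "opn (mdim M) (\<Phi> ` (A \<inter> B))" by (simp add: mdim_M opn_cyl)
next
 fix p assume p: "p : pts M"
 then have x: "fst p : pts S" by (simp add: pts_M_iff)
 obtain U \<phi> W e where a: "chart U \<phi>" "frameN W e" "fst p : U" "fst p : W"
  using SN.charts_cover[OF x] SN.frames_cover[OF x] by blast
 then have "p : tot (U \<inter> W)" using p by (auto simp: tot_def pts_M_iff)
 then show "\<exists>A \<Phi>. (A,\<Phi>) : charts M \<and> p : A" unfolding charts_M using a by blast
 obtain W' b where b: "frameL W' b" "fst p : W'" using Sl.frames_cover[OF x] by blast
 then have "p : tot W'" using p by (auto simp: tot_def pts_M_iff)
 then show "\<exists>B f. (B,f) : frames L \<and> p : B" unfolding frames_L using b by blast
 show "subspace (fib L p)" using Sl.fib_subspace[OF x] by (simp add: fib_L)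
next
 fix B f assume "(B,f) : frames L"
 then obtain W' b where b: "B = tot W'" "f = (%i (x,v). b i x)" "frameL W' b" unfolding frames_L by blast
 show "B <= pts M" using Sl.frames_sub[OF b(3)] by (auto simp: b(1) pts_M tot_def)
 fix p assume "p : B"
 then have x: "fst p : W'" by (auto simp: b tot_def)
 show "f i p : fib L p" if "i < rk L" for i
  using Sl.frame_in[OF b(3) x] that by (simp add: b(2) fib_L rk_L rk_l split_beta)
 show "\<exists>!c. c : Rn (rk L) \<and> v = (\<Sum>i<rk L. c i *\<^sub>R f i p)" if "v : fib L p" for v
  using Sl.frame_basis[OF b(3) x] that by (simp add: b(2) fib_L rk_L rk_l split_beta)
qed

sublocale TL: chart_bundle M L by (rule chart_bundle_TL)

definition lc :: "'p set => ('p => nat => real) => (nat => 'p => 'v) => (nat => 'p => 'w) => ('p \<times> 'v => 'w) => (nat => real) => real" where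
 "lc U \<phi> e b \<mu> z = crd 1 b (fst (pt U \<phi> e z)) (\<mu> (pt U \<phi> e z)) 0"

lemma secc_lc:
 assumes "chart U \<phi>" "frameN W e" "z : cyl n r (\<phi> ` (U \<inter> W))"
 shows "TL.secc (tot (U \<inter> W)) (co \<phi> e) (%i (x,v). b i x) \<mu> 0 z = lc U \<phi> e b \<mu> z"
 unfolding TL.secc_def inv_co[OF assms] lc_def by (simp add: crd_def rk_L split_beta)

lemma cyl_mono: "A <= B ==> cyl n r (\<phi> ` A) <= cyl n r (\<phi> ` B)" by (auto simp: cyl_def)

lemma TL_dom:
 assumes "chart U \<phi>" "frameN W e"
 shows "co \<phi> e ` (tot (U \<inter> W) \<inter> tot W') = cyl n r (\<phi> ` (U \<inter> W \<inter> W'))"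
 unfolding tot_Int by (rule co_image[OF assms]) blast

lemma secc_lc':
 assumes "chart U \<phi>" "frameN W e" "z : cyl n r (\<phi> ` (U \<inter> W \<inter> W'))"
 shows "TL.secc (tot (U \<inter> W)) (co \<phi> e) (%i (x,v). b i x) \<mu> 0 z = lc U \<phi> e b \<mu> z"
 by (rule secc_lc[OF assms(1,2)]) (use assms(3) in \<open>auto simp: cyl_def\<close>)

lemma charts_frames_M:
 "(\<forall>A \<Phi> B f i. (A,\<Phi>) : charts M --> (B,f) : frames L --> i < rk L --> Q A \<Phi> B f i) \<longleftrightarrow>
 (\<forall>U \<phi> W e W' b. chart U \<phi> --> frameN W e --> frameL W' b -->
   Q (tot (U \<inter> W)) (co \<phi> e) (tot W') (%i (x,v). b i x) 0)" (is "?A \<longleftrightarrow> ?B")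
proof (intro iffI allI impI)
 fix U \<phi> W e W' b assume A: ?A and a: "chart U \<phi>" "frameN W e" "frameL W' b"
 have "(tot (U \<inter> W), co \<phi> e) : charts M" unfolding charts_M using a by blast
 moreover have "(tot W', %i (x,v). b i x) : frames L" unfolding frames_L using a by blast
 ultimately show "Q (tot (U \<inter> W)) (co \<phi> e) (tot W') (%i (x,v). b i x) 0" using A by (simp add: rk_L)
next
 fix A \<Phi> B f i assume B: ?B and a: "(A,\<Phi>) : charts M" "(B,f) : frames L" "i < rk L"
 obtain U \<phi> W e where 1: "A = tot (U \<inter> W)" "\<Phi> = co \<phi> e" "chart U \<phi>" "frameN W e"
  using a(1) unfolding charts_M by blast
 obtain W' b where 2: "B = tot W'" "f = (%i (x,v). b i x)" "frameL W' b"
  using a(2) unfolding frames_L by blast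
 have "i = 0" using a(3) by (simp add: rk_L)
 then show "Q A \<Phi> B f i" using B 1 2 by simp
qed

lemma sections_lc: "\<mu> : \<Gamma>L \<longleftrightarrow> (\<forall>p\<in>pts M. \<mu> p : fib l (fst p)) \<and> (\<forall>p. p \<notin> pts M --> \<mu> p = 0) \<and>
 (\<forall>U \<phi> W e W' b. chart U \<phi> --> frameN W e --> frameL W' b -->
  smooth_on (n + r) (cyl n r (\<phi> ` (U \<inter> W \<inter> W'))) (lc U \<phi> e b \<mu>))"
proof -
 have eq: "smooth_on (mdim M) (co \<phi> e ` (tot (U \<inter> W) \<inter> tot W')) (TL.secc (tot (U \<inter> W)) (co \<phi> e) (%i (x,v). b i x) \<mu> 0)
  \<longleftrightarrow> smooth_on (n + r) (cyl n r (\<phi> ` (U \<inter> W \<inter> W'))) (lc U \<phi> e b \<mu>)"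
  if a: "chart U \<phi>" "frameN W e" for U \<phi> W e W' b
  unfolding TL_dom[OF a] mdim_M
  by (rule iffI; erule smooth_on_cong; simp add: secc_lc'[OF a])
 show ?thesis unfolding TL.sections_iff fib_L charts_frames_M by (simp add: eq)
qed

lemma family_lc: "famL a \<longleftrightarrow> (\<forall>t\<in>{0..1}. \<forall>p\<in>pts M. a t p : fib l (fst p)) \<and>
 (\<forall>t\<in>{0..1}. \<forall>p. p \<notin> pts M --> a t p = 0) \<and>
 (\<forall>U \<phi> W e W' b. chart U \<phi> --> frameN W e --> frameL W' b -->
  smooth_on (Suc (n + r)) (famd (n + r) (cyl n r (\<phi> ` (U \<inter> W \<inter> W')))) (%z. lc U \<phi> e b (a (z 0)) (tail z)))"
proof -
 have eq: "smooth_on (Suc (mdim M)) (famd (mdim M) (co \<phi> e ` (tot (U \<inter> W) \<inter> tot W')))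
   (%z. TL.secc (tot (U \<inter> W)) (co \<phi> e) (%i (x,v). b i x) (a (z 0)) 0 (tail z))
  \<longleftrightarrow> smooth_on (Suc (n + r)) (famd (n + r) (cyl n r (\<phi> ` (U \<inter> W \<inter> W')))) (%z. lc U \<phi> e b (a (z 0)) (tail z))"
  if a: "chart U \<phi>" "frameN W e" for U \<phi> W e W' b
 proof -
  have "TL.secc (tot (U \<inter> W)) (co \<phi> e) (%i (x,v). b i x) (a (z 0)) 0 (tail z) = lc U \<phi> e b (a (z 0)) (tail z)"
   if "z : famd (n + r) (cyl n r (\<phi> ` (U \<inter> W \<inter> W')))" for z
   by (rule secc_lc'[OF a, where W'=W']) (use that in \<open>simp add: famd_def tail_def\<close>)
  then show ?thesis unfolding TL_dom[OF a] mdim_M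
   by (intro iffI; elim smooth_on_cong) simp_all
 qed
 show ?thesis unfolding TL.family_iff fib_L charts_frames_M by (simp add: eq)
qed

lemma smooth_funs_M: "f : smooth_funs M \<longleftrightarrow> (\<forall>p. p \<notin> pts M --> f p = 0) \<and>
 (\<forall>U \<phi> W e. chart U \<phi> --> frameN W e -->
  smooth_on (n + r) (cyl n r (\<phi> ` (U \<inter> W))) (%z. f (pt U \<phi> e z)))"
proof -
 have eq: "smooth_on (mdim M) (co \<phi> e ` (tot (U \<inter> W) \<inter> pts M)) (%y. f (inv_into (tot (U \<inter> W)) (co \<phi> e) y))
  \<longleftrightarrow> smooth_on (n + r) (cyl n r (\<phi> ` (U \<inter> W))) (%z. f (pt U \<phi> e z))"
  if a: "chart U \<phi>" "frameN W e" for U \<phi> W e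
 proof -
  have "tot (U \<inter> W) \<inter> pts M = tot (U \<inter> W)" using S_charts(2)[OF a(1)] by (auto simp: pts_M tot_def)
  then have "co \<phi> e ` (tot (U \<inter> W) \<inter> pts M) = cyl n r (\<phi> ` (U \<inter> W))" using co_image[OF a subset_refl] by simp
  then show ?thesis unfolding mdim_M using inv_co[OF a] by (auto elim!: smooth_on_cong)
 qed
 have ch: "(\<forall>A \<Phi>. (A,\<Phi>) : charts M --> Q A \<Phi>) \<longleftrightarrow>
   (\<forall>U \<phi> W e. chart U \<phi> --> frameN W e --> Q (tot (U \<inter> W)) (co \<phi> e))" for Q
  unfolding charts_M by blast
 show ?thesis unfolding smooth_funs_def smooth_fun_on_def ball_pair_iff mem_Collect_eq ch by (auto simp: eq)
qed

end

lemma (in chart_bundle) crd_lsum: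
 assumes "(W,e) : frames E" "x : W" "!!k. k : K ==> u k : fib E x"
 shows "crd (rk E) e x (\<Sum>k\<in>K. c k *\<^sub>R u k) i = (\<Sum>k\<in>K. c k * crd (rk E) e x (u k) i)"
proof -
 have sub: "subspace (fib E x)" using fib_subspace xM[OF assms(1,2)] by blast
 show ?thesis using assms(3)
 proof (induction K rule: infinite_finite_induct)
  case (insert k K)
  have "(\<Sum>k\<in>K. c k *\<^sub>R u k) : fib E x"
   using insert.prems by (intro subspace_sum[OF sub] subspace_scale[OF sub]) auto
  then show ?case using insert crd_lin[OF assms(1,2), of "u k" "\<Sum>k\<in>K. c k *\<^sub>R u k" "c k" 1] by simp
 qed (auto simp: crd_zero'[OF assms(1,2)])
qed

section \<open>Cut-off functions and sections on the total space\<close>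

context bundle_pair
begin

lemma co_pt_smooth:
 assumes U: "chart U \<phi>" and W: "frameN W e" and U2: "chart U2 \<phi>2" and W2: "frameN W2 e2"
  and A: "A <= U \<inter> W" "A <= U2 \<inter> W2" and j: "j < n + r"
 shows "smooth_on (n + r) (cyl n r (\<phi>2 ` A)) (%z. co \<phi> e (pt U2 \<phi>2 e2 z) j)"
proof (cases "j < n")
 case True
 have "smooth_on n (\<phi>2 ` A) (%y. \<phi> (inv_into U2 \<phi>2 y) j)"
  by (rule smooth_on_mono[OF S_charts(5)[OF U2 U True]]) (use A in auto)
 from smooth_on_cyl[OF this, of r] show ?thesis using True by (simp add: co_def pt_def)
next
 case False
 define i where "i = j - n"
 have i: "i < r" using False j by (simp add: i_def)
 have tr: "smooth_on n (\<phi>2 ` A) (%y. crd r e (inv_into U2 \<phi>2 y) (e2 k (inv_into U2 \<phi>2 y)) i)" if "k < r" for k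
 proof (rule smooth_on_mono)
  show "smooth_on n (\<phi>2 ` (U2 \<inter> (W \<inter> W2))) (%y. crd r e (inv_into U2 \<phi>2 y) (e2 k (inv_into U2 \<phi>2 y)) i)"
   using frame_transition[OF W W2 i that] U2 unfolding smooth_fun_on_def ball_pair_iff by blast
 qed (use A in auto)
 have "smooth_on (n + r) (cyl n r (\<phi>2 ` A))
  (%z. \<Sum>k<r. z (n + k) * crd r e (inv_into U2 \<phi>2 (trunc n z)) (e2 k (inv_into U2 \<phi>2 (trunc n z))) i)"
  by (intro smooth_on_sum smooth_on_mult smooth_on_coord smooth_on_cyl tr) auto
 then show ?thesis
 proof (rule smooth_on_cong)
  fix z assume "z : cyl n r (\<phi>2 ` A)"
  then obtain x where x: "x : A" "trunc n z = \<phi>2 x" by (auto simp: cyl_def)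
  have xx: "x : W" "x : U2" "x : W2" using x A by auto
  have "inv_into U2 \<phi>2 (trunc n z) = x" unfolding x(2) by (rule inv_ch[OF U2 W2 xx(2)])
  then show "(\<Sum>k<r. z (n + k) * crd r e (inv_into U2 \<phi>2 (trunc n z)) (e2 k (inv_into U2 \<phi>2 (trunc n z))) i)
    = co \<phi> e (pt U2 \<phi>2 e2 z) j"
   using False SN.crd_lsum[OF W xx(1), of "{..<r}" "%k. e2 k x" "%k. z (n + k)" i] SN.frame_in[OF W2 xx(3)]
   by (simp add: co_def pt_def i_def)
 qed
qed

lemma opn_cyl_image: "mfd_open S A ==> chart U \<phi> ==> A <= U ==> opn (n + r) (cyl n r (\<phi> ` A))"
 by (intro opn_cyl opn_image)

lemma patch_open:
 assumes "chart U \<phi>" "frameN W e" "frameL W' b"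
 shows "mfd_open S (U \<inter> W \<inter> W')" "mfd_open S (U \<inter> W)"
 using mfd_open_chart[OF assms(1)] frame_open[OF assms(2)] frame_open_l[OF assms(3)] by (auto intro: mfd_open_Int)

lemma in_cyl_iff:
 assumes "chart U \<phi>" "frameN W e" "A <= U \<inter> W" "z : cyl n r (\<phi> ` A)" "B <= U"
 shows "z : cyl n r (\<phi> ` B) \<longleftrightarrow> fst (pt U \<phi> e z) : B"
proof -
 obtain x where x: "x : A" "trunc n z = \<phi> x" using assms(4) by (auto simp: cyl_def)
 have xU: "x : U" using x assms(3) by blast
 have p: "fst (pt U \<phi> e z) = x" unfolding pt_def x(2) using inv_ch[OF assms(1,2) xU] by simp
 have "\<phi> x : \<phi> ` B \<longleftrightarrow> x : B" using inj_on_image_mem_iff[OF S_charts(1)[OF assms(1)] xU assms(5)] .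
 then show ?thesis using assms(4) x(2) p by (auto simp: cyl_def)
qed

lemma extend_smooth:
 assumes U: "chart U \<phi>" and A: "mfd_open S A" "A <= U" and K: "compact K" "K <= \<phi> ` A"
  and U2: "chart U2 \<phi>2" and W2: "frameN W2 e2" and B: "mfd_open S B" "B <= U2 \<inter> W2"
  and g: "smooth_on (n + r) (cyl n r (\<phi>2 ` (A \<inter> B))) g"
  and g0: "!!z. z : cyl n r (\<phi>2 ` B) ==> fst (pt U2 \<phi>2 e2 z) \<notin> inv_into U \<phi> ` K ==> g z = 0"
 shows "smooth_on (n + r) (cyl n r (\<phi>2 ` B)) g"
proof (rule smooth_on_cover)
 have BU: "B <= U2" using B by blast
 show "opn (n + r) (cyl n r (\<phi>2 ` B))" by (rule opn_cyl_image[OF B(1) U2 BU])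
 fix z assume z: "z : cyl n r (\<phi>2 ` B)"
 have xB: "fst (pt U2 \<phi>2 e2 z) : B" using in_cyl_iff[OF U2 W2 B(2) z BU] z by blast
 show "\<exists>D'. opn (n + r) D' \<and> D' <= cyl n r (\<phi>2 ` B) \<and> z : D' \<and> smooth_on (n + r) D' g"
 proof (cases "fst (pt U2 \<phi>2 e2 z) : A")
  case True
  have "z : cyl n r (\<phi>2 ` (A \<inter> B))" using in_cyl_iff[OF U2 W2 B(2) z, of "A \<inter> B"] True xB BU by blast
  moreover have "opn (n + r) (cyl n r (\<phi>2 ` (A \<inter> B)))"
   by (rule opn_cyl_image[OF mfd_open_Int[OF A(1) B(1)] U2]) (use BU in blast)
  moreover have "cyl n r (\<phi>2 ` (A \<inter> B)) <= cyl n r (\<phi>2 ` B)" by (rule cyl_mono) blast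
  ultimately show ?thesis using g by blast
 next
  case False
  let ?C = "B \<inter> (pts S - inv_into U \<phi> ` K)"
  have inK: "inv_into U \<phi> ` K <= A"
  proof
   fix x assume "x : inv_into U \<phi> ` K"
   then obtain a where "a : A" "x = inv_into U \<phi> (\<phi> a)" using K(2) by auto
   then show "x : A" using SN.inv_chart[OF U] A(2) by auto
  qed
  have "K <= \<phi> ` U" using K(2) A(2) by blast
  then have C: "mfd_open S ?C" by (intro mfd_open_Int B(1) closed_compact_chart[OF U K(1)])
  have "fst (pt U2 \<phi>2 e2 z) : ?C" using False inK xB B(1) by (auto simp: mfd_open_iff)
  then have "z : cyl n r (\<phi>2 ` ?C)" using in_cyl_iff[OF U2 W2 B(2) z, of ?C] BU by blast
  moreover have "opn (n + r) (cyl n r (\<phi>2 ` ?C))" by (rule opn_cyl_image[OF C U2]) (use BU in blast)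
  moreover have sub: "cyl n r (\<phi>2 ` ?C) <= cyl n r (\<phi>2 ` B)" by (rule cyl_mono) blast
  moreover have "smooth_on (n + r) (cyl n r (\<phi>2 ` ?C)) g"
  proof (rule smooth_on_cong[OF smooth_on_const[of _ _ 0]])
   fix y assume y: "y : cyl n r (\<phi>2 ` ?C)"
   have "fst (pt U2 \<phi>2 e2 y) : ?C" using in_cyl_iff[OF U2 W2 B(2) subsetD[OF sub y], of ?C] y BU by blast
   then show "0 = g y" using g0[OF subsetD[OF sub y]] by auto
  qed
  ultimately show ?thesis by blast
 qed
qed

definition cutf :: "('p => nat => real) => (nat => 'p => 'v) => 'p set => ((nat => real) => real) => ((nat => real) => real) => 'p \<times> 'v => real" where
 "cutf \<phi> e A \<kappa> h = (%p. if p : pts M \<and> fst p : A then \<kappa> (\<phi> (fst p)) * h (co \<phi> e p) else 0)"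

definition cuts :: "('p => nat => real) => 'p set => (nat => 'p => 'w) => ((nat => real) => real) => 'p \<times> 'v => 'w" where
 "cuts \<phi> A b \<kappa> = (%p. if p : pts M \<and> fst p : A then \<kappa> (\<phi> (fst p)) *\<^sub>R b 0 (fst p) else 0)"

definition cutoff :: "(nat => real) set => (nat => real) set => ((nat => real) => real) => bool" where
 "cutoff D K \<kappa> \<longleftrightarrow> smooth_on n D \<kappa> \<and> compact K \<and> K <= D \<and> (\<forall>y\<in>D. y \<notin> K --> \<kappa> y = 0)"

lemma pt_M:
 assumes "chart U \<phi>" "frameN W e" "A <= U \<inter> W" "z : cyl n r (\<phi> ` A)"
 shows "pt U \<phi> e z : pts M" "fst (pt U \<phi> e z) : A"
proof -
 have p: "pt U \<phi> e z : tot A" by (rule pt_in_tot(1)[OF assms])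
 then show "fst (pt U \<phi> e z) : A" by (auto simp: tot_def)
 show "pt U \<phi> e z : pts M" using p assms(3) S_charts(2)[OF assms(1)] unfolding pts_M by (auto simp: tot_def)
qed

lemma M_tot: "p : pts M ==> fst p : A ==> p : tot A"
 by (auto simp: pts_M tot_def)

lemma cutf_smooth:
 assumes U: "chart U \<phi>" and W: "frameN W e" and A: "mfd_open S A" "A <= U \<inter> W"
  and \<kappa>: "cutoff (\<phi> ` A) K \<kappa>" and h: "smooth_on (n + r) (cyl n r (\<phi> ` A)) h"
 shows "cutf \<phi> e A \<kappa> h : smooth_funs M"
 unfolding smooth_funs_M
proof (intro conjI allI impI)
 show "cutf \<phi> e A \<kappa> h p = 0" if "p \<notin> pts M" for p using that by (simp add: cutf_def)
 fix U2 \<phi>2 W2 e2 assume U2: "chart U2 \<phi>2" and W2: "frameN W2 e2"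
 have AU: "A <= U" using A by blast
 have K: "compact K" "K <= \<phi> ` A" and \<kappa>s: "smooth_on n (\<phi> ` A) \<kappa>" and \<kappa>0: "!!y. y : \<phi> ` A ==> y \<notin> K ==> \<kappa> y = 0"
  using \<kappa> by (auto simp: cutoff_def)
 have B: "mfd_open S (U2 \<inter> W2)" by (intro mfd_open_Int mfd_open_chart[OF U2] frame_open[OF W2])
 show "smooth_on (n + r) (cyl n r (\<phi>2 ` (U2 \<inter> W2))) (%z. cutf \<phi> e A \<kappa> h (pt U2 \<phi>2 e2 z))"
 proof (rule extend_smooth[OF U A(1) AU K U2 W2 B subset_refl])
  have sub: "A \<inter> (U2 \<inter> W2) <= U \<inter> W" "A \<inter> (U2 \<inter> W2) <= U2 \<inter> W2" using A by auto
  have "smooth_on (n + r) (cyl n r (\<phi> ` A)) (%y. \<kappa> (trunc n y) * h y)"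
   by (intro smooth_on_mult h smooth_on_cyl \<kappa>s)
  then have "smooth_on (n + r) (cyl n r (\<phi>2 ` (A \<inter> (U2 \<inter> W2))))
    (%z. \<kappa> (trunc n (co \<phi> e (pt U2 \<phi>2 e2 z))) * h (co \<phi> e (pt U2 \<phi>2 e2 z)))"
  proof (rule smooth_on_compose[OF opn_cyl_image[OF A(1) U AU], where G="%z. co \<phi> e (pt U2 \<phi>2 e2 z)"])
   fix z assume z: "z : cyl n r (\<phi>2 ` (A \<inter> (U2 \<inter> W2)))"
   have "pt U2 \<phi>2 e2 z : tot A" using pt_M[OF U2 W2 sub(2) z] by (intro M_tot) auto
   then show "co \<phi> e (pt U2 \<phi>2 e2 z) : cyl n r (\<phi> ` A)" by (rule co_in_cyl(1)[OF U W A(2)])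
  qed (rule co_pt_smooth[OF U W U2 W2 sub])
  then show "smooth_on (n + r) (cyl n r (\<phi>2 ` (A \<inter> (U2 \<inter> W2)))) (%z. cutf \<phi> e A \<kappa> h (pt U2 \<phi>2 e2 z))"
  proof (rule smooth_on_cong)
   fix z assume z: "z : cyl n r (\<phi>2 ` (A \<inter> (U2 \<inter> W2)))"
   have p: "pt U2 \<phi>2 e2 z : pts M" "fst (pt U2 \<phi>2 e2 z) : A" using pt_M[OF U2 W2 sub(2) z] by auto
   then show "\<kappa> (trunc n (co \<phi> e (pt U2 \<phi>2 e2 z))) * h (co \<phi> e (pt U2 \<phi>2 e2 z)) = cutf \<phi> e A \<kappa> h (pt U2 \<phi>2 e2 z)"
    using co_in_cyl(3)[OF U W A(2) M_tot[OF p]] by (simp add: cutf_def)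
  qed
  fix z assume nz: "fst (pt U2 \<phi>2 e2 z) \<notin> inv_into U \<phi> ` K"
  show "cutf \<phi> e A \<kappa> h (pt U2 \<phi>2 e2 z) = 0"
  proof (cases "fst (pt U2 \<phi>2 e2 z) : A")
   case True
   have "\<phi> (fst (pt U2 \<phi>2 e2 z)) \<notin> K"
    using nz SN.inv_chart[OF U subsetD[OF AU True]] by (metis imageI)
   then show ?thesis using \<kappa>0 True by (simp add: cutf_def)
  qed (simp add: cutf_def)
 qed
qed

lemma trunc_pt: 
 assumes "chart U \<phi>" "frameN W e" "A <= U \<inter> W" "z : cyl n r (\<phi> ` A)"
 shows "inv_into U \<phi> (trunc n z) = fst (pt U \<phi> e z)"
 by (simp add: pt_def)

lemma cuts_section:
 assumes U: "chart U \<phi>" and W: "frameN W e" and W': "frameL W' b"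
  and A: "mfd_open S A" "A <= U \<inter> W \<inter> W'" and \<kappa>: "cutoff (\<phi> ` A) K \<kappa>"
 shows "cuts \<phi> A b \<kappa> : \<Gamma>L"
 unfolding sections_lc
proof (intro conjI allI impI ballI)
 show "cuts \<phi> A b \<kappa> p : fib l (fst p)" if p: "p : pts M" for p
 proof -
  have "subspace (fib l (fst p))" using p Sl.fib_subspace by (auto simp: pts_M_iff)
  then show ?thesis using Sl.frame_in[OF W', of "fst p" 0] A(2) rk_l
   by (auto simp: cuts_def subspace_0 intro!: subspace_scale)
 qed
 show "cuts \<phi> A b \<kappa> p = 0" if "p \<notin> pts M" for p using that by (simp add: cuts_def)
 fix U2 \<phi>2 W2 e2 W2' b2
 assume U2: "chart U2 \<phi>2" and W2: "frameN W2 e2" and W2': "frameL W2' b2"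
 let ?B = "U2 \<inter> W2 \<inter> W2'"
 have AU: "A <= U" "A <= U \<inter> W" using A by auto
 have K: "compact K" "K <= \<phi> ` A" and \<kappa>0: "!!y. y : \<phi> ` A ==> y \<notin> K ==> \<kappa> y = 0"
  using \<kappa> by (auto simp: cutoff_def)
 have B: "mfd_open S ?B" by (rule patch_open[OF U2 W2 W2'])
 have BU: "?B <= U2 \<inter> W2" by blast
 have sub: "A \<inter> ?B <= U2 \<inter> W2" by blast
 have cf: "cutf \<phi> e A \<kappa> (%_. 1) : smooth_funs M"
  by (rule cutf_smooth[OF U W A(1) AU(2) \<kappa> smooth_on_const])
 have lcc: "lc U2 \<phi>2 e2 b2 (cuts \<phi> A b \<kappa>) z = cutf \<phi> e A \<kappa> (%_. 1) (pt U2 \<phi>2 e2 z) * crd 1 b2 (fst (pt U2 \<phi>2 e2 z)) (b 0 (fst (pt U2 \<phi>2 e2 z))) 0"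
  if z: "z : cyl n r (\<phi>2 ` ?B)" for z
 proof -
  have p: "fst (pt U2 \<phi>2 e2 z) : W2'" and pM: "pt U2 \<phi>2 e2 z : pts M" using pt_M[OF U2 W2 BU z] by auto
  show ?thesis
  proof (cases "fst (pt U2 \<phi>2 e2 z) : A")
   case True
   have "b 0 (fst (pt U2 \<phi>2 e2 z)) : fib l (fst (pt U2 \<phi>2 e2 z))"
    using Sl.frame_in[OF W', of _ 0] True A(2) rk_l by auto
   then show ?thesis using Sl.crd_scale[OF W2' p] rk_l True pM by (simp add: lc_def cuts_def cutf_def)
  next
   case False
   then show ?thesis using Sl.crd_zero'[OF W2' p] rk_l by (simp add: lc_def cuts_def cutf_def)
  qed
 qed
 show "smooth_on (n + r) (cyl n r (\<phi>2 ` ?B)) (lc U2 \<phi>2 e2 b2 (cuts \<phi> A b \<kappa>))"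
 proof (rule extend_smooth[OF U A(1) AU(1) K U2 W2 B BU])
  have 1: "smooth_on (n + r) (cyl n r (\<phi>2 ` (A \<inter> ?B))) (%z. cutf \<phi> e A \<kappa> (%_. 1) (pt U2 \<phi>2 e2 z))"
  proof (rule smooth_on_mono)
   show "smooth_on (n + r) (cyl n r (\<phi>2 ` (U2 \<inter> W2))) (%z. cutf \<phi> e A \<kappa> (%_. 1) (pt U2 \<phi>2 e2 z))"
    using cf U2 W2 unfolding smooth_funs_M by blast
  qed (use cyl_mono[OF sub] in auto)
  have "smooth_on n (\<phi>2 ` (A \<inter> ?B)) (%y. crd 1 b2 (inv_into U2 \<phi>2 y) (b 0 (inv_into U2 \<phi>2 y)) 0)"
  proof (rule smooth_on_mono)
   show "smooth_on n (\<phi>2 ` (U2 \<inter> (W2' \<inter> W'))) (%y. crd 1 b2 (inv_into U2 \<phi>2 y) (b 0 (inv_into U2 \<phi>2 y)) 0)"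
    using frame_transition_l[OF W2' W', of 0 0] U2 unfolding smooth_fun_on_def ball_pair_iff by simp
  qed (use A in auto)
  then have 2: "smooth_on (n + r) (cyl n r (\<phi>2 ` (A \<inter> ?B))) (%z. crd 1 b2 (fst (pt U2 \<phi>2 e2 z)) (b 0 (fst (pt U2 \<phi>2 e2 z))) 0)"
   using smooth_on_cyl[of n _ _ r] by (simp add: pt_def)
  show "smooth_on (n + r) (cyl n r (\<phi>2 ` (A \<inter> ?B))) (lc U2 \<phi>2 e2 b2 (cuts \<phi> A b \<kappa>))"
   by (rule smooth_on_cong[OF smooth_on_mult[OF 1 2]]) (rule lcc[symmetric], use cyl_mono[of "A \<inter> ?B" ?B] in blast)
  fix z assume z: "z : cyl n r (\<phi>2 ` ?B)" and nz: "fst (pt U2 \<phi>2 e2 z) \<notin> inv_into U \<phi> ` K"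
  have "cutf \<phi> e A \<kappa> (%_. 1) (pt U2 \<phi>2 e2 z) = 0"
  proof (cases "fst (pt U2 \<phi>2 e2 z) : A")
   case True
   have "\<phi> (fst (pt U2 \<phi>2 e2 z)) \<notin> K"
    using nz SN.inv_chart[OF U subsetD[OF AU(1) True]] by (metis imageI)
   then show ?thesis using \<kappa>0 True by (simp add: cutf_def)
  qed (simp add: cutf_def)
  then show "lc U2 \<phi>2 e2 b2 (cuts \<phi> A b \<kappa>) z = 0" using lcc[OF z] by simp
 qed
qed

lemma lc_smult:
 assumes U: "chart U \<phi>" and W: "frameN W e" and W': "frameL W' b"
  and z: "z : cyl n r (\<phi> ` (U \<inter> W \<inter> W'))" and \<mu>: "!!p. p : pts M ==> \<mu> p : fib l (fst p)"
 shows "lc U \<phi> e b (%p. f p *\<^sub>R \<mu> p) z = f (pt U \<phi> e z) * lc U \<phi> e b \<mu> z"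
  and "lc U \<phi> e b \<mu> z *\<^sub>R b 0 (fst (pt U \<phi> e z)) = \<mu> (pt U \<phi> e z)"
proof -
 have sub: "U \<inter> W \<inter> W' <= U \<inter> W" by blast
 have p: "pt U \<phi> e z : pts M" "fst (pt U \<phi> e z) : W'" using pt_M[OF U W sub z] by auto
 show "lc U \<phi> e b (%p. f p *\<^sub>R \<mu> p) z = f (pt U \<phi> e z) * lc U \<phi> e b \<mu> z"
  unfolding lc_def using Sl.crd_scale[OF W' p(2) \<mu>[OF p(1)]] rk_l by simp
 show "lc U \<phi> e b \<mu> z *\<^sub>R b 0 (fst (pt U \<phi> e z)) = \<mu> (pt U \<phi> e z)"
  unfolding lc_def using Sl.crd_sum[OF W' p(2) \<mu>[OF p(1)]] rk_l by simp
qed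

lemma section_fibl: "\<mu> : \<Gamma>L ==> p : pts M ==> \<mu> p : fib l (fst p)"
 by (simp add: sections_lc)

lemma section_lc_smooth:
 "\<mu> : \<Gamma>L ==> chart U \<phi> ==> frameN W e ==> frameL W' b ==>
  smooth_on (n + r) (cyl n r (\<phi> ` (U \<inter> W \<inter> W'))) (lc U \<phi> e b \<mu>)"
 by (simp add: sections_lc)

lemma section_smult:
 assumes f: "f : smooth_funs M" and \<mu>: "\<mu> : \<Gamma>L"
 shows "(%p. f p *\<^sub>R \<mu> p) : \<Gamma>L"
 unfolding sections_lc
proof (intro conjI allI impI ballI)
 show "f p *\<^sub>R \<mu> p : fib l (fst p)" if "p : pts M" for p
  using section_fibl[OF \<mu> that] that Sl.fib_subspace by (auto simp: pts_M_iff intro: subspace_scale)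
 show "f p *\<^sub>R \<mu> p = 0" if "p \<notin> pts M" for p using that TL.section_off[OF \<mu>] by simp
 fix U \<phi> W e W' b assume a: "chart U \<phi>" "frameN W e" "frameL W' b"
 have "smooth_on (n + r) (cyl n r (\<phi> ` (U \<inter> W))) (%z. f (pt U \<phi> e z))"
  using f a unfolding smooth_funs_M by blast
 then have "smooth_on (n + r) (cyl n r (\<phi> ` (U \<inter> W \<inter> W'))) (%z. f (pt U \<phi> e z))"
  by (rule smooth_on_mono) (use cyl_mono[of "U \<inter> W \<inter> W'" "U \<inter> W"] in auto)
 from smooth_on_mult[OF this section_lc_smooth[OF \<mu> a]]
 show "smooth_on (n + r) (cyl n r (\<phi> ` (U \<inter> W \<inter> W'))) (lc U \<phi> e b (%p. f p *\<^sub>R \<mu> p))"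
  by (rule smooth_on_cong) (rule lc_smult(1)[OF a _ section_fibl[OF \<mu>], symmetric])
qed

lemma opn_box_set: "opn k {y \<in> Rn k. \<forall>i<k. \<bar>y i - q i\<bar> < s}" (is "opn k ?D")
 unfolding opn_iff_box
proof (intro conjI ballI)
 show "?D <= Rn k" by auto
 fix p assume p: "p : ?D"
 define t where "t = Min (insert 1 ((%i. s - \<bar>p i - q i\<bar>) ` {..<k}))"
 have t: "t > 0" "!!i. i < k ==> t \<le> s - \<bar>p i - q i\<bar>" using p by (auto simp: t_def)
 show "\<exists>r>0. \<forall>y\<in>Rn k. (\<forall>i<k. \<bar>y i - p i\<bar> < r) --> y : ?D"
 proof (intro exI[of _ t] conjI ballI impI)
  fix y assume y: "y : Rn k" "\<forall>i<k. \<bar>y i - p i\<bar> < t"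
  have "\<bar>y i - q i\<bar> < s" if "i < k" for i using y(2)[rule_format, OF that] t(2)[OF that] by linarith
  then show "y : ?D" using y(1) by simp
 qed (rule t)
qed

lemma local_box:
 assumes U: "chart U \<phi>" and A: "mfd_open S A" "A <= U" and x: "x : A"
 obtains s A0 where "s > 0" "mfd_open S A0" "A0 <= A" "x : A0"
  "\<phi> ` A0 = {y \<in> Rn n. \<forall>i<n. \<bar>y i - \<phi> x i\<bar> < s}"
proof -
 have opA: "opn n (\<phi> ` A)" by (rule opn_image[OF A(1) U A(2)])
 obtain s where s: "s > 0" "\<forall>y\<in>Rn n. (\<forall>i<n. \<bar>y i - \<phi> x i\<bar> < s) --> y : \<phi> ` A"
  using opn_box[OF opA, of "\<phi> x"] x by blast
 define D where "D = {y \<in> Rn n. \<forall>i<n. \<bar>y i - \<phi> x i\<bar> < s}"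
 have D: "D <= \<phi> ` A" using s(2) by (auto simp: D_def)
 have oD: "opn n D" unfolding D_def by (rule opn_box_set)
 define A0 where "A0 = {a \<in> U. \<phi> a : D}"
 have img: "\<phi> ` A0 = D" using D A(2) by (auto simp: A0_def)
 have "A0 <= A"
 proof
  fix a assume a: "a : A0"
  then have "\<phi> a : \<phi> ` A" "a : U" using D by (auto simp: A0_def)
  then show "a : A" using inj_on_image_mem_iff[OF S_charts(1)[OF U] _ A(2)] by blast
 qed
 moreover have "mfd_open S A0" unfolding A0_def by (rule mfd_open_vimage[OF U oD]) (use D A(2) in auto)
 moreover have "x : A0" 
  using x A(2) s(1) opn_subset[OF S_charts(3)[OF U]] by (auto simp: A0_def D_def)
 ultimately show thesis using that[OF s(1)] img by (simp add: D_def)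
qed

lemma cutoff_box:
 assumes "s > 0"
 obtains \<kappa> \<rho> K where "0 < \<rho>" "\<rho> < s" "cutoff {y \<in> Rn n. \<forall>i<n. \<bar>y i - q i\<bar> < s} K \<kappa>"
  "\<forall>y. (\<forall>i<n. \<bar>y i - q i\<bar> < \<rho>) --> \<kappa> y = 1"
proof -
 have s2: "s / 2 > 0" using assms by simp
 obtain \<kappa> \<rho> where k: "\<rho> > 0" "\<rho> < s / 2" "smooth_on n (Rn n) \<kappa>"
  "!!y. (!!i. i < n ==> \<bar>y i - q i\<bar> < \<rho>) ==> \<kappa> y = 1"
  "!!y i. i < n ==> \<bar>y i - q i\<bar> \<ge> s / 2 ==> \<kappa> y = 0"
  using cutoff_exists[OF s2, where n=n and p=q] by metis
 define K where "K = {y \<in> Rn n. \<forall>i<n. \<bar>y i - q i\<bar> \<le> s / 2}"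
 have "cutoff {y \<in> Rn n. \<forall>i<n. \<bar>y i - q i\<bar> < s} K \<kappa>"
  unfolding cutoff_def
 proof (intro conjI ballI impI)
  show "smooth_on n {y \<in> Rn n. \<forall>i<n. \<bar>y i - q i\<bar> < s} \<kappa>" by (rule smooth_on_mono[OF k(3)]) auto
  show "compact K" unfolding K_def by (rule compact_box)
  show "K <= {y \<in> Rn n. \<forall>i<n. \<bar>y i - q i\<bar> < s}"
  proof
   fix y assume "y : K"
   then have y: "y : Rn n" "!!i. i < n ==> \<bar>y i - q i\<bar> \<le> s / 2" by (auto simp: K_def)
   have "\<bar>y i - q i\<bar> < s" if "i < n" for i using y(2)[OF that] assms by linarith
   then show "y : {y \<in> Rn n. \<forall>i<n. \<bar>y i - q i\<bar> < s}" using y(1) by blast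
  qed
  fix y assume y: "y : {y \<in> Rn n. \<forall>i<n. \<bar>y i - q i\<bar> < s}" "y \<notin> K"
  then obtain i where "i < n" "\<not> \<bar>y i - q i\<bar> \<le> s / 2" by (auto simp: K_def)
  then show "\<kappa> y = 0" using k(5)[of i y] by linarith
 qed
 moreover have "\<rho> < s" using k(2) assms by linarith
 moreover have "\<forall>y. (\<forall>i<n. \<bar>y i - q i\<bar> < \<rho>) --> \<kappa> y = 1" using k(4) by blast
 ultimately show thesis using that k(1) by blast
qed

end

lemma pd_subset:
 assumes "ndom n D" "ndom n D0" "D0 <= D" "smooth_on n D f" "i < n" "z : D0"
 shows "pd D0 i f z = pd D i f z"
 by (rule has_pd_unique[OF assms(2,5) has_pd_mono[OF smooth_has_pd(1)[OF assms(1,4,5)] assms(3)] assms(6)])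

lemma abs_convex_less:
 assumes "\<bar>a\<bar> < s" "\<bar>b\<bar> < s" "t : {0..1}" shows "\<bar>a + t * (b - a)\<bar> < (s::real)"
proof -
 have "(1 - t) * a + t * b < s" by (rule convex_bound_lt) (use assms in auto)
 moreover have "(1 - t) * (- a) + t * (- b) < s" by (rule convex_bound_lt) (use assms in auto)
 ultimately show ?thesis by (simp add: abs_less_iff algebra_simps)
qed

lemma hadamard_ex:
 assumes D: "opn n D" and conv: "\<forall>p\<in>D. \<forall>z\<in>D. \<forall>s\<in>{0..1}. lerp p s z : D"
  and p: "p : D" and f: "smooth_on n D f"
 shows "\<exists>h. (\<forall>i<n. smooth_on n D (h i) \<and> h i p = pd D i f p) \<and>
  (\<forall>z\<in>D. f z = f p + (\<Sum>i<n. (z i - p i) * h i z))"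
proof (rule hadamard[of n D p f])
 fix h assume "!!i. i < n ==> smooth_on n D (h i)" "!!i. i < n ==> h i p = pd D i f p"
  "!!z. z : D ==> f z = f p + (\<Sum>i<n. (z i - p i) * h i z)"
 then show ?thesis by (intro exI[of _ h]) simp
qed (use assms in auto)

section \<open>First order operators in local coordinates\<close>

context bundle_pair
begin

abbreviation fo where "fo \<equiv> first_order_op M L"

abbreviation Om where "Om U \<phi> W W' \<equiv> cyl n r (\<phi> ` (U \<inter> W \<inter> W'))"

lemma fo_in: "fo Q ==> \<mu> : \<Gamma>L ==> Q \<mu> : \<Gamma>L"
 by (simp add: first_order_op_def)

lemma fo_lin:
 assumes "fo Q" "\<mu> : \<Gamma>L" "\<nu> : \<Gamma>L"
 shows "Q (%p. a *\<^sub>R \<mu> p + b *\<^sub>R \<nu> p) = (%p. a *\<^sub>R Q \<mu> p + b *\<^sub>R Q \<nu> p)"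
 using assms unfolding first_order_op_def by blast

lemma fo_add: "fo Q ==> \<mu> : \<Gamma>L ==> \<nu> : \<Gamma>L ==> Q (%p. \<mu> p + \<nu> p) = (%p. Q \<mu> p + Q \<nu> p)"
 using fo_lin[of Q \<mu> \<nu> 1 1] by simp

lemma fo_scale: "fo Q ==> \<mu> : \<Gamma>L ==> Q (%p. a *\<^sub>R \<mu> p) = (%p. a *\<^sub>R Q \<mu> p)"
 using fo_lin[of Q \<mu> \<mu> a 0] by simp

lemma fo_diff: "fo Q ==> \<mu> : \<Gamma>L ==> \<nu> : \<Gamma>L ==> Q (%p. \<mu> p - \<nu> p) = (%p. Q \<mu> p - Q \<nu> p)"
 using fo_lin[of Q \<mu> \<nu> 1 "-1"] by simp

lemma fo_zero: "fo Q ==> Q (%p. 0) = (%p. 0)"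
 using fo_scale[of Q "%p. 0" 0] TL.section_zero by simp

lemma fo_sum: "fo Q ==> (!!k. k : K ==> f k : \<Gamma>L) ==> Q (%p. \<Sum>k\<in>K. f k p) = (%p. \<Sum>k\<in>K. Q (f k) p)"
proof (induction K rule: infinite_finite_induct)
 case (insert k K)
 have "Q (%p. f k p + (\<Sum>k\<in>K. f k p)) = (%p. Q (f k) p + Q (%p. \<Sum>k\<in>K. f k p) p)"
  by (rule fo_add[OF insert.prems(1)]) (use insert.prems in \<open>auto intro: TL.section_sum\<close>)
 then show ?case using insert by simp
qed (auto simp: fo_zero)

lemma fo_prod:
 assumes "fo Q" "f : smooth_funs M" "g : smooth_funs M" "\<mu> : \<Gamma>L" "f p = 0" "g p = 0"
 shows "Q (%q. (f q * g q) *\<^sub>R \<mu> q) p = 0"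
proof -
 have "Q (%q. (f q * g q) *\<^sub>R \<mu> q) p - f p *\<^sub>R Q (%q. g q *\<^sub>R \<mu> q) p
     - g p *\<^sub>R Q (%q. f q *\<^sub>R \<mu> q) p + (f p * g p) *\<^sub>R Q \<mu> p = 0"
  using assms(1-4) unfolding first_order_op_def by blast
 then show ?thesis using assms(5,6) by simp
qed

lemma one_minus_smooth:
 assumes "f : smooth_funs M" shows "(%p. if p : pts M then 1 - f p else 0) : smooth_funs M"
 unfolding smooth_funs_M
proof (intro conjI allI impI)
 fix U \<phi> W e assume a: "chart U \<phi>" "frameN W e"
 have "smooth_on (n + r) (cyl n r (\<phi> ` (U \<inter> W))) (%z. f (pt U \<phi> e z))"
  using assms a unfolding smooth_funs_M by blast
 from smooth_on_diff[OF smooth_on_const[of _ _ 1] this]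
 show "smooth_on (n + r) (cyl n r (\<phi> ` (U \<inter> W))) (%z. if pt U \<phi> e z : pts M then 1 - f (pt U \<phi> e z) else 0)"
  by (rule smooth_on_cong) (simp add: pt_M(1)[OF a subset_refl])
qed simp

lemma fo_vanish:
 assumes Q: "fo Q" and U: "chart U \<phi>" and W: "frameN W e" and W': "frameL W' b"
  and p: "p : pts M" "fst p : U \<inter> W \<inter> W'" and \<mu>: "\<mu> : \<Gamma>L"
  and m0: "lc U \<phi> e b \<mu> (co \<phi> e p) = 0"
  and m1: "!!a. a < n + r ==> pd (Om U \<phi> W W') a (lc U \<phi> e b \<mu>) (co \<phi> e p) = 0"
 shows "Q \<mu> p = 0"
proof -
 let ?f = "lc U \<phi> e b \<mu>" and ?zp = "co \<phi> e p"
 have AU: "U \<inter> W \<inter> W' <= U" "U \<inter> W \<inter> W' <= U \<inter> W" by auto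
 obtain s A0 where s: "s > 0" and A0: "mfd_open S A0" "A0 <= U \<inter> W \<inter> W'" "fst p : A0"
  "\<phi> ` A0 = {y \<in> Rn n. \<forall>i<n. \<bar>y i - \<phi> (fst p) i\<bar> < s}"
  by (rule local_box[OF U patch_open(1)[OF U W W'] AU(1) p(2)], rule that)
 have A0U: "A0 <= U" "A0 <= U \<inter> W" using A0(2) by auto
 let ?D = "cyl n r (\<phi> ` A0)"
 have opD: "opn (n + r) ?D" by (rule opn_cyl_image[OF A0(1) U A0U(1)])
 obtain \<kappa> \<rho> K where \<kappa>': "0 < \<rho>" "\<rho> < s" "cutoff {y \<in> Rn n. \<forall>i<n. \<bar>y i - \<phi> (fst p) i\<bar> < s} K \<kappa>"
  "\<forall>y. (\<forall>i<n. \<bar>y i - \<phi> (fst p) i\<bar> < \<rho>) --> \<kappa> y = 1"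
  by (rule cutoff_box[OF s, of "\<phi> (fst p)"], rule that)
 note \<kappa> = \<kappa>'(1) \<kappa>'(3)[folded A0(4)] \<kappa>'(4)
 define \<kappa>2 where "\<kappa>2 y = \<kappa> y * (2 - \<kappa> y)" for y
 have \<kappa>2: "cutoff (\<phi> ` A0) K \<kappa>2"
  using \<kappa>(2) unfolding cutoff_def \<kappa>2_def by (auto intro!: smooth_on_mult smooth_on_diff smooth_on_const)
 have \<kappa>p: "\<kappa> (\<phi> (fst p)) = 1" using \<kappa>(1,3) by simp
 have DOm: "?D <= Om U \<phi> W W'" by (rule cyl_mono[OF A0(2)])
 have fs: "smooth_on (n + r) (Om U \<phi> W W') ?f" by (rule section_lc_smooth[OF \<mu> U W W'])
 have zpD: "?zp : ?D" by (rule co_in_cyl(1)[OF U W A0U(2) M_tot[OF p(1) A0(3)]])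
 have conv: "lerp u t z : ?D" if "u : ?D" "z : ?D" "t : {0..1}" for u z t
 proof -
  have u: "u : Rn (n + r)" "!!i. i < n ==> \<bar>u i - \<phi> (fst p) i\<bar> < s"
   and z: "z : Rn (n + r)" "!!i. i < n ==> \<bar>z i - \<phi> (fst p) i\<bar> < s"
   using that(1,2) unfolding A0(4) cyl_def by (auto simp: trunc_def)
  have "\<bar>lerp u t z i - \<phi> (fst p) i\<bar> < s" if "i < n" for i
   using abs_convex_less[OF u(2)[OF that] z(2)[OF that] \<open>t : {0..1}\<close>] by (simp add: lerp_def algebra_simps)
  moreover have "lerp u t z : Rn (n + r)" using u z by (auto simp: Rn_def lerp_def)
  ultimately show ?thesis unfolding A0(4) cyl_def by (simp add: trunc_Rn) (simp add: trunc_def)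
 qed
 have "\<forall>u\<in>?D. \<forall>z\<in>?D. \<forall>t\<in>{0..1}. lerp u t z : ?D" using conv by blast
 from hadamard_ex[OF opD this zpD smooth_on_mono[OF fs order_refl DOm]]
 obtain h where h: "\<forall>i<n + r. smooth_on (n + r) ?D (h i) \<and> h i ?zp = pd ?D i ?f ?zp"
  "\<forall>z\<in>?D. ?f z = ?f ?zp + (\<Sum>i<n + r. (z i - ?zp i) * h i z)"
  by (elim exE conjE)
 have h: "!!i. i < n + r ==> smooth_on (n + r) ?D (h i)"
  "!!i. i < n + r ==> h i ?zp = pd ?D i ?f ?zp"
  "!!z. z : ?D ==> ?f z = ?f ?zp + (\<Sum>i<n + r. (z i - ?zp i) * h i z)"
  using h by blast+
 have h0: "h a ?zp = 0" if "a < n + r" for a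
  using h(2)[OF that] m1[OF that] pd_subset[OF opn_ndom[OF opn_cyl_image[OF patch_open(1)[OF U W W'] U AU(1)]] opn_ndom[OF opD] DOm fs that zpD]
  by simp
 define kap where "kap = cutf \<phi> e A0 \<kappa>2 (%_. 1)"
 define F where "F a = cutf \<phi> e A0 \<kappa>2 (%z. z a - ?zp a)" for a
 define H where "H a = cutf \<phi> e A0 \<kappa>2 (h a)" for a
 define g where "g = (%q. if q : pts M then 1 - cutf \<phi> e A0 \<kappa> (%_. 1) q else 0)"
 define \<theta> where "\<theta> = cuts \<phi> A0 b \<kappa>2"
 note cf = cutf_smooth[OF U W A0(1) A0U(2)]
 have kap: "kap : smooth_funs M" and Fs: "!!a. F a : smooth_funs M" and Hs: "!!a. a < n + r ==> H a : smooth_funs M"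
  and gs: "g : smooth_funs M" and \<theta>s: "\<theta> : \<Gamma>L"
  unfolding kap_def F_def H_def g_def \<theta>_def
  by (intro cf[OF \<kappa>2] smooth_on_const smooth_on_diff smooth_on_coord h(1) one_minus_smooth cf[OF \<kappa>(2)]
    cuts_section[OF U W W' A0(1,2) \<kappa>2]; assumption)+
 have g0: "g p = 0" using p(1) A0(3) \<kappa>p by (simp add: g_def cutf_def)
 have F0: "F a p = 0" for a by (simp add: F_def cutf_def)
 have H0: "H a p = 0" if "a < n + r" for a using h0[OF that] by (simp add: H_def cutf_def)
 have step: "Q \<nu> p = Q (%q. kap q *\<^sub>R \<nu> q) p" if \<nu>: "\<nu> : \<Gamma>L" for \<nu>
 proof -
  have "\<nu> = (%q. (g q * g q) *\<^sub>R \<nu> q + kap q *\<^sub>R \<nu> q)"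
  proof
   fix q
   show "\<nu> q = (g q * g q) *\<^sub>R \<nu> q + kap q *\<^sub>R \<nu> q"
   proof (cases "q : pts M")
    case True
    then have "g q * g q + kap q = 1" by (auto simp: g_def kap_def cutf_def \<kappa>2_def algebra_simps)
    then show ?thesis by (simp flip: scaleR_left_distrib)
   next
    case False
    then show ?thesis using TL.section_off[OF \<nu>] by simp
   qed
  qed
  moreover have "Q (%q. (g q * g q) *\<^sub>R \<nu> q + kap q *\<^sub>R \<nu> q) p = Q (%q. (g q * g q) *\<^sub>R \<nu> q) p + Q (%q. kap q *\<^sub>R \<nu> q) p"
  proof -
   have "(%q. (g q * g q) *\<^sub>R \<nu> q) : \<Gamma>L"
    using section_smult[OF gs section_smult[OF gs \<nu>]] by simp
   then show ?thesis using fo_add[OF Q _ section_smult[OF kap \<nu>]] by simp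
  qed
  ultimately show ?thesis using fo_prod[OF Q gs gs \<nu> g0 g0] by simp
 qed
 have "Q \<mu> p = Q (%q. kap q *\<^sub>R (kap q *\<^sub>R (kap q *\<^sub>R \<mu> q))) p"
  using step[OF \<mu>] step[OF section_smult[OF kap \<mu>]] step[OF section_smult[OF kap section_smult[OF kap \<mu>]]] by simp
 also have "(%q. kap q *\<^sub>R (kap q *\<^sub>R (kap q *\<^sub>R \<mu> q))) = (%q. \<Sum>a<n + r. (F a q * H a q) *\<^sub>R \<theta> q)"
 proof
  fix q
  show "kap q *\<^sub>R (kap q *\<^sub>R (kap q *\<^sub>R \<mu> q)) = (\<Sum>a<n + r. (F a q * H a q) *\<^sub>R \<theta> q)"
  proof (cases "q : pts M \<and> fst q : A0")
   case True
   then have qD: "co \<phi> e q : ?D" and pq: "pt U \<phi> e (co \<phi> e q) = q"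
    using co_in_cyl(1,2)[OF U W A0U(2) M_tot] by auto
   have "\<mu> q = ?f (co \<phi> e q) *\<^sub>R b 0 (fst q)"
    using lc_smult(2)[OF U W W' subsetD[OF DOm qD] section_fibl[OF \<mu>]] pq by simp
   also have "?f (co \<phi> e q) = (\<Sum>i<n + r. (co \<phi> e q i - ?zp i) * h i (co \<phi> e q))"
    using h(3)[OF qD] m0 by simp
   finally show ?thesis using True
    by (simp add: kap_def F_def H_def \<theta>_def cutf_def cuts_def scaleR_sum_left sum_distrib_left scaleR_sum_right mult_ac)
  next
   case False
   then have "kap q = 0" "!!a. F a q = 0" by (auto simp: kap_def F_def cutf_def)
   then show ?thesis by simp
  qed
 qed
 also have "Q (%q. \<Sum>a<n + r. (F a q * H a q) *\<^sub>R \<theta> q) p = (\<Sum>a<n + r. Q (%q. (F a q * H a q) *\<^sub>R \<theta> q) p)"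
 proof -
  have "(%q. (F a q * H a q) *\<^sub>R \<theta> q) : \<Gamma>L" if "a : {..<n + r}" for a
   using section_smult[OF Fs[of a] section_smult[OF Hs[of a] \<theta>s]] that by simp
  then show ?thesis using fo_sum[OF Q, of "{..<n + r}" "%a q. (F a q * H a q) *\<^sub>R \<theta> q"] by simp
 qed
 also have "\<dots> = 0"
  by (rule sum.neutral) (use fo_prod[OF Q Fs Hs \<theta>s F0 H0] in auto)
 finally show ?thesis .
qed

lemma lc_lin:
 assumes "chart U \<phi>" "frameN W e" "frameL W' b" "z : Om U \<phi> W W'"
  and "\<mu> : \<Gamma>L" "\<nu> : \<Gamma>L"
 shows "lc U \<phi> e b (%p. c *\<^sub>R \<mu> p + d *\<^sub>R \<nu> p) z = c * lc U \<phi> e b \<mu> z + d * lc U \<phi> e b \<nu> z"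
proof -
 have sub: "U \<inter> W \<inter> W' <= U \<inter> W" by blast
 have p: "pt U \<phi> e z : pts M" "fst (pt U \<phi> e z) : W'" using pt_M[OF assms(1,2) sub assms(4)] by auto
 show ?thesis unfolding lc_def
  using Sl.crd_lin[OF assms(3) p(2) section_fibl[OF assms(5) p(1)] section_fibl[OF assms(6) p(1)]] rk_l by simp
qed

lemma lc_sum:
 assumes "chart U \<phi>" "frameN W e" "frameL W' b" "z : Om U \<phi> W W'"
  and "!!k. k : K ==> f k : \<Gamma>L"
 shows "lc U \<phi> e b (%p. \<Sum>k\<in>K. c k *\<^sub>R f k p) z = (\<Sum>k\<in>K. c k * lc U \<phi> e b (f k) z)"
proof -
 have sub: "U \<inter> W \<inter> W' <= U \<inter> W" by blast
 have p: "pt U \<phi> e z : pts M" "fst (pt U \<phi> e z) : W'" using pt_M[OF assms(1,2) sub assms(4)] by auto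
 show ?thesis unfolding lc_def
  using Sl.crd_lsum[OF assms(3) p(2), of K "%k. f k (pt U \<phi> e z)"] section_fibl[OF assms(5) p(1)] rk_l by simp
qed

lemma lc_cuts:
 assumes U: "chart U \<phi>" and W: "frameN W e" and W': "frameL W' b"
  and A: "A <= U \<inter> W \<inter> W'" and z: "z : cyl n r (\<phi> ` A)"
 shows "lc U \<phi> e b (cuts \<phi> A b \<kappa>) z = \<kappa> (trunc n z)"
  and "lc U \<phi> e b (%p. cutf \<phi> e A \<kappa>' h p *\<^sub>R cuts \<phi> A b \<kappa> p) z = \<kappa>' (trunc n z) * h z * \<kappa> (trunc n z)"
proof -
 have AU: "A <= U \<inter> W" using A by blast
 have p: "pt U \<phi> e z : pts M" "fst (pt U \<phi> e z) : A" using pt_M[OF U W AU z] by auto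
 have x: "fst (pt U \<phi> e z) : W'" using p A by blast
 note c = pt_in_tot(2,3)[OF U W AU z]
 have "b 0 (fst (pt U \<phi> e z)) : fib l (fst (pt U \<phi> e z))" using Sl.frame_in[OF W' x, of 0] rk_l by simp
 then have 1: "crd 1 b (fst (pt U \<phi> e z)) (c *\<^sub>R b 0 (fst (pt U \<phi> e z))) 0 = c" for c
  using Sl.crd_comb[OF W' x, of 0 "%_. c"] rk_l by simp
 show "lc U \<phi> e b (cuts \<phi> A b \<kappa>) z = \<kappa> (trunc n z)"
  unfolding lc_def using p c 1 by (simp add: cuts_def)
 show "lc U \<phi> e b (%p. cutf \<phi> e A \<kappa>' h p *\<^sub>R cuts \<phi> A b \<kappa> p) z = \<kappa>' (trunc n z) * h z * \<kappa> (trunc n z)"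
  unfolding lc_def using p c 1 by (simp add: cuts_def cutf_def)
qed

definition gen :: "('p => nat => real) => (nat => 'p => 'v) => 'p set => (nat => 'p => 'w) => ((nat => real) => real) => nat => 'p \<times> 'v => 'w" where
 "gen \<phi> e A b \<kappa> a = (%p. cutf \<phi> e A \<kappa> (%z. z a) p *\<^sub>R cuts \<phi> A b \<kappa> p)"

text \<open>
 Where the cut-off \<open>\<kappa>\<close> is locally constant equal to 1, the sections \<open>cuts\<close> and \<open>gen a\<close> are the
 local frame of \<open>L\<close> and its multiples by the coordinate functions.
\<close>

lemma local_formula:
 assumes Q: "fo Q" and U: "chart U \<phi>" and W: "frameN W e" and W': "frameL W' b"
  and A: "mfd_open S A" "A <= U \<inter> W \<inter> W'" and \<kappa>: "cutoff (\<phi> ` A) K \<kappa>"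
  and A1: "mfd_open S A1" "A1 <= A" "!!x. x : A1 ==> \<kappa> (\<phi> x) = 1"
  and p: "p : pts M" "fst p : A1" and \<mu>: "\<mu> : \<Gamma>L"
 shows "Q \<mu> p = lc U \<phi> e b \<mu> (co \<phi> e p) *\<^sub>R Q (cuts \<phi> A b \<kappa>) p +
  (\<Sum>a<n + r. pd (Om U \<phi> W W') a (lc U \<phi> e b \<mu>) (co \<phi> e p) *\<^sub>R
   (Q (gen \<phi> e A b \<kappa> a) p - co \<phi> e p a *\<^sub>R Q (cuts \<phi> A b \<kappa>) p))"
proof -
 let ?\<theta> = "cuts \<phi> A b \<kappa>" and ?X = "gen \<phi> e A b \<kappa>" and ?z = "co \<phi> e p" and ?m = "lc U \<phi> e b \<mu>"
 define c where "c a = pd (Om U \<phi> W W') a ?m ?z" for a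
 have AU: "A <= U \<inter> W" using A by blast
 have \<theta>s: "?\<theta> : \<Gamma>L" by (rule cuts_section[OF U W W' A \<kappa>])
 have Xs: "?X a : \<Gamma>L" for a
  unfolding gen_def by (intro section_smult cutf_smooth[OF U W A(1) AU \<kappa>] smooth_on_coord \<theta>s)
 define Y where "Y a = (%q. 1 *\<^sub>R ?X a q + (- ?z a) *\<^sub>R ?\<theta> q)" for a
 have Ys: "Y a : \<Gamma>L" for a unfolding Y_def by (rule TL.section_lin[OF Xs \<theta>s])
 define \<sigma> where "\<sigma> = (%q. \<Sum>a<n + r. c a *\<^sub>R Y a q)"
 have \<sigma>s: "\<sigma> : \<Gamma>L" unfolding \<sigma>_def by (intro TL.section_sum TL.section_scale Ys)
 define \<tau> where "\<tau> = (%q. 1 *\<^sub>R \<sigma> q + ?m ?z *\<^sub>R ?\<theta> q)"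
 have \<tau>s: "\<tau> : \<Gamma>L" unfolding \<tau>_def by (rule TL.section_lin[OF \<sigma>s \<theta>s])
 define \<nu> where "\<nu> = (%q. 1 *\<^sub>R \<mu> q + (-1) *\<^sub>R \<tau> q)"
 have \<nu>s: "\<nu> : \<Gamma>L" unfolding \<nu>_def by (rule TL.section_lin[OF \<mu> \<tau>s])
 let ?D1 = "cyl n r (\<phi> ` A1)" and ?D = "Om U \<phi> W W'"
 have A1U: "A1 <= U" "A1 <= U \<inter> W" "A1 <= U \<inter> W \<inter> W'" using A1(2) A(2) by auto
 have D1: "?D1 <= ?D" "?D1 <= cyl n r (\<phi> ` A)" using cyl_mono[OF A1U(3)] cyl_mono[OF A1(2)] by auto
 have op: "opn (n + r) ?D1" "opn (n + r) ?D"
  using opn_cyl_image[OF A1(1) U A1U(1)] opn_cyl_image[OF patch_open(1)[OF U W W'] U] by auto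
 note nd = opn_ndom[OF op(1)] opn_ndom[OF op(2)]
 have zD1: "?z : ?D1" by (rule co_in_cyl(1)[OF U W A1U(2) M_tot[OF p]])
 have lc\<nu>: "lc U \<phi> e b \<nu> z = ?m z - ((\<Sum>a<n + r. c a * (z a - ?z a)) + ?m ?z)" if z: "z : ?D1" for z
 proof -
  have zA: "z : cyl n r (\<phi> ` A)" and zO: "z : ?D" using z D1 by auto
  obtain x where "x : A1" "trunc n z = \<phi> x" using z by (auto simp: cyl_def)
  then have k1: "\<kappa> (trunc n z) = 1" using A1(3) by simp
  have l\<theta>: "lc U \<phi> e b ?\<theta> z = 1" using lc_cuts(1)[OF U W W' A(2) zA] k1 by simp
  have lX: "lc U \<phi> e b (?X a) z = z a" for a unfolding gen_def using lc_cuts(2)[OF U W W' A(2) zA] k1 by simp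
  have lY: "lc U \<phi> e b (Y a) z = z a - ?z a" for a
   unfolding Y_def using lc_lin[OF U W W' zO Xs \<theta>s, of 1 a "- ?z a"] lX l\<theta> by simp
  have l\<sigma>: "lc U \<phi> e b \<sigma> z = (\<Sum>a<n + r. c a * (z a - ?z a))"
   unfolding \<sigma>_def using lc_sum[OF U W W' zO Ys] lY by simp
  have l\<tau>: "lc U \<phi> e b \<tau> z = (\<Sum>a<n + r. c a * (z a - ?z a)) + ?m ?z"
   unfolding \<tau>_def using lc_lin[OF U W W' zO \<sigma>s \<theta>s, of 1 "?m ?z"] l\<sigma> l\<theta> by simp
  show ?thesis unfolding \<nu>_def using lc_lin[OF U W W' zO \<mu> \<tau>s, of 1 "-1"] l\<tau> by simp
 qed
 have "Q \<nu> p = 0"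
 proof (rule fo_vanish[OF Q U W W' p(1) subsetD[OF A1U(3) p(2)] \<nu>s])
  show "lc U \<phi> e b \<nu> ?z = 0" using lc\<nu>[OF zD1] by simp
  fix a assume a: "a < n + r"
  have ms: "smooth_on (n + r) ?D1 ?m" by (rule smooth_on_mono[OF section_lc_smooth[OF \<mu> U W W'] order_refl D1(1)])
  have hp: "has_pd ?D1 a (%z. ?m z - ((\<Sum>b<n + r. c b * (z b - ?z b)) + ?m ?z)) (%z. pd ?D1 a ?m z - c a)"
   unfolding has_pd_def
  proof
   fix x assume x: "x : ?D1"
   have 1: "((%t. ?m (x(a := t))) has_real_derivative pd ?D1 a ?m x) (at (x a) within {t. x(a := t) : ?D1})"
    using smooth_has_pd(1)[OF nd(1) ms a] x unfolding has_pd_def by blast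
   have 2: "((%t. \<Sum>b<n + r. c b * ((x(a := t)) b - ?z b)) has_real_derivative (\<Sum>b<n + r. if b = a then c a else 0))
     (at (x a) within {t. x(a := t) : ?D1})"
   proof (rule DERIV_sum)
    fix b show "((%t. c b * ((x(a := t)) b - ?z b)) has_real_derivative (if b = a then c a else 0))
     (at (x a) within {t. x(a := t) : ?D1})"
     by (cases "b = a") (auto intro!: derivative_eq_intros)
   qed
   from DERIV_diff[OF 1 DERIV_add[OF 2 DERIV_const[of "?m ?z"]]]
   show "((%t. ?m (x(a := t)) - ((\<Sum>b<n + r. c b * ((x(a := t)) b - ?z b)) + ?m ?z)) has_real_derivative pd ?D1 a ?m x - c a)
     (at (x a) within {t. x(a := t) : ?D1})"
    by (rule DERIV_cong) (use a in simp)
  qed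
  then have hp': "has_pd ?D1 a (lc U \<phi> e b \<nu>) (%z. pd ?D1 a ?m z - c a)"
   by (rule has_pd_cong) (simp_all add: lc\<nu>)
  have "pd ?D a (lc U \<phi> e b \<nu>) ?z = pd ?D1 a (lc U \<phi> e b \<nu>) ?z"
   by (rule pd_subset[OF nd(2,1) D1(1) section_lc_smooth[OF \<nu>s U W W'] a zD1, symmetric])
  also have "\<dots> = pd ?D1 a ?m ?z - c a" by (rule has_pd_unique[OF nd(1) a hp' zD1])
  also have "\<dots> = 0" unfolding c_def
   using pd_subset[OF nd(2,1) D1(1) section_lc_smooth[OF \<mu> U W W'] a zD1] by simp
  finally show "pd ?D a (lc U \<phi> e b \<nu>) ?z = 0" .
 qed
 moreover have "Q \<nu> p = Q \<mu> p - Q \<tau> p" unfolding \<nu>_def using fo_lin[OF Q \<mu> \<tau>s, of 1 "-1"] by simp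
 moreover have "Q \<tau> p = Q \<sigma> p + ?m ?z *\<^sub>R Q ?\<theta> p" unfolding \<tau>_def using fo_lin[OF Q \<sigma>s \<theta>s, of 1 "?m ?z"] by simp
 moreover have "Q \<sigma> p = (\<Sum>a<n + r. c a *\<^sub>R Q (Y a) p)"
  unfolding \<sigma>_def using fo_sum[OF Q, of "{..<n + r}" "%a q. c a *\<^sub>R Y a q"] fo_scale[OF Q Ys] TL.section_scale[OF Ys] by simp
 moreover have "Q (Y a) p = Q (?X a) p - ?z a *\<^sub>R Q ?\<theta> p" for a
  unfolding Y_def using fo_lin[OF Q Xs[of a] \<theta>s, of 1 "- ?z a"] by simp
 ultimately show ?thesis by (simp add: c_def)
qed

end

lemma sum_lessThan_add: "(\<Sum>j<n + r. f j) = (\<Sum>j<n. f j) + (\<Sum>i<r. f (n + i :: nat))"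
 for f :: "nat => 'a::ab_group_add"
 by (induction r) auto

lemma pd_famd_slice:
 assumes D: "opn n D" and g: "smooth_on (Suc n) (famd n D) g" and i: "i < n" and z: "z : famd n D"
 shows "pd (famd n D) (Suc i) g z = pd D i (%y. g (case_nat (z 0) y)) (tail z)"
proof -
 have z': "z 0 : {0..1}" "tail z : D" using z by (auto simp: famd_def tail_def)
 have "has_pd (famd n D) (Suc i) g (pd (famd n D) (Suc i) g)"
  by (rule smooth_has_pd(1)[OF ndom_famd[OF D] g]) (use i in simp)
 from has_pd_unique[OF opn_ndom[OF D] i has_pd_famd_slice[OF this z'(1) opn_subset[OF D]] z'(2)]
 show ?thesis by (simp add: case_nat_tail)
qed

section \<open>Differentiation along the fibres\<close>

context bundle_pair
begin

lemma opn_Om: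
 assumes "chart U \<phi>" "frameN W e" "frameL W' b"
 shows "opn (n + r) (Om U \<phi> W W')"
 by (rule opn_cyl_image[OF patch_open(1)[OF assms] assms(1)]) blast

lemma fibre_line:
 assumes U: "chart U \<phi>" and W: "frameN W e" and A: "mfd_open S A" "A <= U \<inter> W"
  and p: "p : pts M" "fst p : A" and \<nu>: "\<nu> : fib N (fst p)" and f: "smooth_on (n + r) (cyl n r (\<phi> ` A)) f"
 shows "((%t. f (co \<phi> e (fst p, snd p + t *\<^sub>R \<nu>))) has_real_derivative
   (\<Sum>i<r. pd (cyl n r (\<phi> ` A)) (n + i) f (co \<phi> e p) * crd r e (fst p) \<nu> i)) (at 0)"
  and "(fst p, snd p + t *\<^sub>R \<nu>) : pts M"
proof -
 have x: "fst p : W" "fst p : pts S" using p A S_charts(2)[OF U] by (auto simp: pts_M_iff)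
 have v: "snd p : fib N (fst p)" using p by (simp add: pts_M_iff)
 have AU: "A <= U" using A by blast
 have line: "(fst p, snd p + t *\<^sub>R \<nu>) : pts M" for t
  using x v \<nu> SN.fib_subspace[OF x(2)] by (simp add: pts_M_iff subspace_add subspace_scale)
 then show "(fst p, snd p + t *\<^sub>R \<nu>) : pts M" .
 have op: "opn (n + r) (cyl n r (\<phi> ` A))" by (rule opn_cyl_image[OF A(1) U AU])
 define d where "d j = (if j < n then 0 else crd r e (fst p) \<nu> (j - n))" for j
 have "((%t. f (co \<phi> e (fst p, snd p + t *\<^sub>R \<nu>))) has_real_derivative
  (\<Sum>j<n + r. pd (cyl n r (\<phi> ` A)) j f (co \<phi> e (fst p, snd p + 0 *\<^sub>R \<nu>)) * d j)) (at 0 within UNIV)"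
 proof (rule chain_pd[OF op, where \<gamma>="%t. co \<phi> e (fst p, snd p + t *\<^sub>R \<nu>)"])
  fix t :: real
  show "co \<phi> e (fst p, snd p + t *\<^sub>R \<nu>) : cyl n r (\<phi> ` A)"
   by (rule co_in_cyl(1)[OF U W A(2) M_tot[OF line]]) (use p in simp)
 next
  fix j
  show "((%t. co \<phi> e (fst p, snd p + t *\<^sub>R \<nu>) j) has_real_derivative d j) (at 0 within UNIV)"
  proof (cases "j < n")
   case True
   then show ?thesis by (simp add: co_def d_def)
  next
   case False
   have "co \<phi> e (fst p, snd p + t *\<^sub>R \<nu>) j = crd r e (fst p) (snd p) (j - n) + t * crd r e (fst p) \<nu> (j - n)" for t
    using SN.crd_lin[OF W x(1) v \<nu>, of 1 t] False by (simp add: co_def)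
   then show ?thesis using False by (auto simp: d_def intro!: derivative_eq_intros)
  qed
 next
  fix j assume "j < n + r"
  then show "has_pd (cyl n r (\<phi> ` A)) j f (pd (cyl n r (\<phi> ` A)) j f)"
   and "continuous_on (cyl n r (\<phi> ` A)) (pd (cyl n r (\<phi> ` A)) j f)"
   using smooth_has_pd(1)[OF opn_ndom[OF op] f] smooth_on_continuous[OF smooth_on_pd'[OF opn_ndom[OF op] f]] by blast+
 qed simp
 then show "((%t. f (co \<phi> e (fst p, snd p + t *\<^sub>R \<nu>))) has_real_derivative
   (\<Sum>i<r. pd (cyl n r (\<phi> ` A)) (n + i) f (co \<phi> e p) * crd r e (fst p) \<nu> i)) (at 0)"
  by (simp add: sum_lessThan_add d_def)
qed

lemma vert_der_local:
 assumes U: "chart U \<phi>" and W: "frameN W e" and W': "frameL W' b"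
  and p: "p : pts M" "fst p : U \<inter> W \<inter> W'" and \<nu>: "\<nu> : fib N (fst p)" and \<mu>: "\<mu> : \<Gamma>L"
 shows "((%t. \<mu> (fst p, snd p + t *\<^sub>R \<nu>)) has_vector_derivative
   (\<Sum>i<r. pd (Om U \<phi> W W') (n + i) (lc U \<phi> e b \<mu>) (co \<phi> e p) * crd r e (fst p) \<nu> i) *\<^sub>R b 0 (fst p)) (at 0)"
  and "vert_der \<mu> p \<nu> = (\<Sum>i<r. pd (Om U \<phi> W W') (n + i) (lc U \<phi> e b \<mu>) (co \<phi> e p) * crd r e (fst p) \<nu> i) *\<^sub>R b 0 (fst p)"
proof -
 have A: "mfd_open S (U \<inter> W \<inter> W')" "U \<inter> W \<inter> W' <= U \<inter> W" using patch_open(1)[OF U W W'] by auto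
 note fl = fibre_line[OF U W A p \<nu> section_lc_smooth[OF \<mu> U W W']]
 have "\<mu> (fst p, snd p + t *\<^sub>R \<nu>) = lc U \<phi> e b \<mu> (co \<phi> e (fst p, snd p + t *\<^sub>R \<nu>)) *\<^sub>R b 0 (fst p)" for t
 proof -
  have q: "(fst p, snd p + t *\<^sub>R \<nu>) : tot (U \<inter> W \<inter> W')" by (rule M_tot[OF fl(2)]) (use p in simp)
  show ?thesis using lc_smult(2)[OF U W W' co_in_cyl(1)[OF U W A(2) q] section_fibl[OF \<mu>]]
   by (simp add: co_in_cyl(2)[OF U W A(2) q])
 qed
 then show 1: "((%t. \<mu> (fst p, snd p + t *\<^sub>R \<nu>)) has_vector_derivative
   (\<Sum>i<r. pd (Om U \<phi> W W') (n + i) (lc U \<phi> e b \<mu>) (co \<phi> e p) * crd r e (fst p) \<nu> i) *\<^sub>R b 0 (fst p)) (at 0)"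
  using bounded_linear.has_vector_derivative[OF bounded_linear_scaleR_left fl(1)[unfolded has_real_derivative_iff_has_vector_derivative]]
  by simp
 show "vert_der \<mu> p \<nu> = (\<Sum>i<r. pd (Om U \<phi> W W') (n + i) (lc U \<phi> e b \<mu>) (co \<phi> e p) * crd r e (fst p) \<nu> i) *\<^sub>R b 0 (fst p)"
  unfolding vert_der_def split_beta by (rule vector_derivative_at[OF 1])
qed

lemma patch_at:
 assumes "p : pts M"
 obtains U \<phi> W e W' b where "chart U \<phi>" "frameN W e" "frameL W' b" "fst p : U \<inter> W \<inter> W'"
proof -
 have x: "fst p : pts S" using assms by (simp add: pts_M_iff)
 then show thesis using that SN.charts_cover[OF x] SN.frames_cover[OF x] Sl.frames_cover[OF x] by blast
qed

lemma vert_der_has: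
 assumes "p : pts M" "\<nu> : fib N (fst p)" "\<mu> : \<Gamma>L"
 shows "((%t. \<mu> (fst p, snd p + t *\<^sub>R \<nu>)) has_vector_derivative vert_der \<mu> p \<nu>) (at 0)"
proof -
 obtain U \<phi> W e W' b where a: "chart U \<phi>" "frameN W e" "frameL W' b" "fst p : U \<inter> W \<inter> W'"
  by (rule patch_at[OF assms(1)])
 show ?thesis using vert_der_local[OF a(1-3) assms(1) a(4) assms(2,3)] by simp
qed

lemma vert_der_eqI:
 "((%t. \<mu> (fst p, snd p + t *\<^sub>R \<nu>)) has_vector_derivative d) (at 0) ==> vert_der \<mu> p \<nu> = d"
 unfolding vert_der_def split_beta by (rule vector_derivative_at)

lemma vert_der_lin:
 assumes "p : pts M" "\<nu> : fib N (fst p)" "\<mu> : \<Gamma>L" "\<mu>' : \<Gamma>L"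
 shows "vert_der (%q. a *\<^sub>R \<mu> q + c *\<^sub>R \<mu>' q) p \<nu> = a *\<^sub>R vert_der \<mu> p \<nu> + c *\<^sub>R vert_der \<mu>' p \<nu>"
 by (rule vert_der_eqI, intro has_vector_derivative_add bounded_linear.has_vector_derivative[OF bounded_linear_scaleR_right] vert_der_has assms)

lemma vert_der_fib:
 assumes "p : pts M" "\<nu> : fib N (fst p)" "\<mu> : \<Gamma>L"
 shows "vert_der \<mu> p \<nu> : fib l (fst p)"
proof -
 obtain U \<phi> W e W' b where a: "chart U \<phi>" "frameN W e" "frameL W' b" "fst p : U \<inter> W \<inter> W'"
  by (rule patch_at[OF assms(1)])
 have "fst p : pts S" using assms(1) by (simp add: pts_M_iff)
 then show ?thesis unfolding vert_der_local(2)[OF a(1-3) assms(1) a(4) assms(2,3)]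
  using Sl.frame_in[OF a(3), of "fst p" 0] a(4) rk_l Sl.fib_subspace by (intro subspace_scale) auto
qed

lemma vert_der_lin_dir:
 assumes "p : pts M" "\<nu> : fib N (fst p)" "\<nu>' : fib N (fst p)" "\<mu> : \<Gamma>L"
 shows "vert_der \<mu> p (a *\<^sub>R \<nu> + c *\<^sub>R \<nu>') = a *\<^sub>R vert_der \<mu> p \<nu> + c *\<^sub>R vert_der \<mu> p \<nu>'"
proof -
 obtain U \<phi> W e W' b where A: "chart U \<phi>" "frameN W e" "frameL W' b" "fst p : U \<inter> W \<inter> W'"
  by (rule patch_at[OF assms(1)])
 have x: "fst p : W" "fst p : pts S" using A(4) assms(1) by (auto simp: pts_M_iff)
 have \<nu>'': "a *\<^sub>R \<nu> + c *\<^sub>R \<nu>' : fib N (fst p)"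
  using assms(2,3) SN.fib_subspace[OF x(2)] by (simp add: subspace_add subspace_scale)
 note v = vert_der_local(2)[OF A(1-3) assms(1) A(4) _ assms(4)]
 show ?thesis unfolding v[OF assms(2)] v[OF assms(3)] v[OF \<nu>''] SN.crd_lin[OF A(2) x(1) assms(2,3)]
  by (simp add: distrib_left sum.distrib scaleR_left_distrib sum_distrib_left mult.left_commute flip: scaleR_scaleR)
   (simp add: sum_distrib_left[symmetric] mult.assoc)
qed

definition Dv :: "('p => 'v) => ('p \<times> 'v => 'w) => 'p \<times> 'v => 'w" where
 "Dv \<nu> \<mu> = (%p. if p : pts M then vert_der \<mu> p (\<nu> (fst p)) else 0)"

lemma fib_at: "\<nu> : sections S N ==> p : pts M ==> \<nu> (fst p) : fib N (fst p)"
 using SN.section_fib by (simp add: pts_M_iff)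

lemma lc_Dv:
 assumes a: "chart U \<phi>" "frameN W e" "frameL W' b" and z: "z : Om U \<phi> W W'"
  and \<nu>: "\<nu> (fst (pt U \<phi> e z)) : fib N (fst (pt U \<phi> e z))" and \<mu>: "\<mu> : \<Gamma>L"
 shows "lc U \<phi> e b (Dv \<nu> \<mu>) z = (\<Sum>i<r. pd (Om U \<phi> W W') (n + i) (lc U \<phi> e b \<mu>) z * SN.secc U \<phi> e \<nu> i (trunc n z))"
proof -
 have sub: "U \<inter> W \<inter> W' <= U \<inter> W" by blast
 have p: "pt U \<phi> e z : pts M" "fst (pt U \<phi> e z) : U \<inter> W \<inter> W'" using pt_M[OF a(1,2) sub z] by auto
 have x: "fst (pt U \<phi> e z) : W'" using p by blast
 have b: "b 0 (fst (pt U \<phi> e z)) : fib l (fst (pt U \<phi> e z))" using Sl.frame_in[OF a(3) x, of 0] rk_l by simp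
 have 1: "crd 1 b (fst (pt U \<phi> e z)) (c *\<^sub>R b 0 (fst (pt U \<phi> e z))) 0 = c" for c
  using Sl.crd_comb[OF a(3) x, of 0 "%_. c"] rk_l by simp
 show ?thesis unfolding lc_def[of U \<phi> e b "Dv \<nu> \<mu>"] unfolding Dv_def if_P[OF p(1)] vert_der_local(2)[OF a p \<nu> \<mu>] 1
   SN.secc_def trunc_pt[OF a(1,2) sub z] pt_in_tot(2)[OF a(1,2) sub z] ..
qed

lemma Dv_family_const:
 assumes s: "smooth_family S N s" and \<mu>: "\<mu> : \<Gamma>L"
 shows "famL (%t. Dv (s t) \<mu>)"
 unfolding family_lc
proof (intro conjI allI impI ballI)
 fix t p assume t: "t : {0..1::real}" and p: "p : pts M"
 then show "Dv (s t) \<mu> p : fib l (fst p)"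
  using vert_der_fib[OF p fib_at[OF SN.family_section[OF s t] p] \<mu>] by (simp add: Dv_def)
next
 show "Dv (s t) \<mu> p = 0" if "p \<notin> pts M" for t p using that by (simp add: Dv_def)
 fix U \<phi> W e W' b assume a: "chart U \<phi>" "frameN W e" "frameL W' b"
 let ?F = "famd (n + r) (Om U \<phi> W W')"
 have sub: "U \<inter> W \<inter> W' <= U \<inter> W" by blast
 have 1: "smooth_on (Suc (n + r)) ?F (%z. pd (Om U \<phi> W W') (n + i) (lc U \<phi> e b \<mu>) (tail z))" if "i < r" for i
  by (rule smooth_on_famd_const, rule smooth_on_pd'[OF opn_ndom[OF opn_Om[OF a]] section_lc_smooth[OF \<mu> a]]) (use that in simp)
 have 2: "smooth_on (Suc (n + r)) ?F (%z. SN.secc U \<phi> e (s (z 0)) i (trunc n (tail z)))" if "i < r" for i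
 proof -
  have "smooth_on (Suc (n + r)) (famd (n + r) (cyl n r (\<phi> ` (U \<inter> W))))
    (%z. SN.secc U \<phi> e (s ((trunc (Suc n) z) 0)) i (tail (trunc (Suc n) z)))"
   by (rule smooth_on_famd_cyl[OF SN.family_smooth[OF s a(1,2) that] SN.dom_Rn[OF a(1,2)]])
  then have "smooth_on (Suc (n + r)) ?F (%z. SN.secc U \<phi> e (s ((trunc (Suc n) z) 0)) i (tail (trunc (Suc n) z)))"
   by (rule smooth_on_mono[OF _ order_refl famd_mono[OF cyl_mono[OF sub]]])
  then show ?thesis by (simp add: tail_trunc) (simp add: trunc_def)
 qed
 have "smooth_on (Suc (n + r)) ?F (%z. \<Sum>i<r. pd (Om U \<phi> W W') (n + i) (lc U \<phi> e b \<mu>) (tail z) * SN.secc U \<phi> e (s (z 0)) i (trunc n (tail z)))"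
  by (intro smooth_on_sum smooth_on_mult 1 2) auto
 then show "smooth_on (Suc (n + r)) ?F (%z. lc U \<phi> e b (Dv (s (z 0)) \<mu>) (tail z))"
 proof (rule smooth_on_cong)
  fix z assume "z : ?F"
  then have z: "z 0 : {0..1}" "tail z : Om U \<phi> W W'" by (auto simp: famd_def tail_def)
  show "(\<Sum>i<r. pd (Om U \<phi> W W') (n + i) (lc U \<phi> e b \<mu>) (tail z) * SN.secc U \<phi> e (s (z 0)) i (trunc n (tail z))) =
    lc U \<phi> e b (Dv (s (z 0)) \<mu>) (tail z)"
   by (rule lc_Dv[where \<nu>="s (z 0)", OF a z(2) fib_at[OF SN.family_section[OF s z(1)] pt_M(1)[OF a(1,2) sub z(2)]] \<mu>, symmetric])
 qed
qed

lemma Dv_section: "\<nu> : sections S N ==> \<mu> : \<Gamma>L ==> Dv \<nu> \<mu> : \<Gamma>L"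
 using TL.family_section[OF Dv_family_const[OF SN.const_family], of \<nu> \<mu> 0] by simp

lemma Dv_lin: "\<nu> : sections S N ==> \<mu> : \<Gamma>L ==> \<mu>' : \<Gamma>L ==>
 Dv \<nu> (%q. a *\<^sub>R \<mu> q + c *\<^sub>R \<mu>' q) = (%q. a *\<^sub>R Dv \<nu> \<mu> q + c *\<^sub>R Dv \<nu> \<mu>' q)"
 unfolding Dv_def using vert_der_lin[OF _ fib_at] by fastforce

lemma Dv_lin_dir: "\<nu> : sections S N ==> \<nu>' : sections S N ==> \<mu> : \<Gamma>L ==>
 Dv (%x. a *\<^sub>R \<nu> x + c *\<^sub>R \<nu>' x) \<mu> = (%q. a *\<^sub>R Dv \<nu> \<mu> q + c *\<^sub>R Dv \<nu>' \<mu> q)"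
 unfolding Dv_def using vert_der_lin_dir[OF _ fib_at fib_at] by fastforce

definition Dfun :: "('p => 'v) => ('p \<times> 'v => real) => 'p \<times> 'v => real" where
 "Dfun \<nu> f = (%p. if p : pts M then vector_derivative (%t. f (fst p, snd p + t *\<^sub>R \<nu> (fst p))) (at 0) else 0)"

lemma Dfun_local:
 assumes U: "chart U \<phi>" and W: "frameN W e"
  and p: "p : pts M" "fst p : U \<inter> W" and \<nu>: "\<nu> : sections S N" and f: "f : smooth_funs M"
 shows "((%t. f (fst p, snd p + t *\<^sub>R \<nu> (fst p))) has_real_derivative Dfun \<nu> f p) (at 0)"
  "Dfun \<nu> f p = (\<Sum>i<r. pd (cyl n r (\<phi> ` (U \<inter> W))) (n + i) (%z. f (pt U \<phi> e z)) (co \<phi> e p) * crd r e (fst p) (\<nu> (fst p)) i)"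
proof -
 have A: "mfd_open S (U \<inter> W)" by (intro mfd_open_Int mfd_open_chart[OF U] frame_open[OF W])
 have fs: "smooth_on (n + r) (cyl n r (\<phi> ` (U \<inter> W))) (%z. f (pt U \<phi> e z))" using f U W unfolding smooth_funs_M by blast
 note fl = fibre_line[OF U W A subset_refl p fib_at[OF \<nu> p(1)] fs]
 have "f (pt U \<phi> e (co \<phi> e (fst p, snd p + t *\<^sub>R \<nu> (fst p)))) = f (fst p, snd p + t *\<^sub>R \<nu> (fst p))" for t
 proof -
  have "(fst p, snd p + t *\<^sub>R \<nu> (fst p)) : tot (U \<inter> W)" by (rule M_tot[OF fl(2)]) (use p in simp)
  then show ?thesis by (simp add: co_in_cyl(2)[OF U W subset_refl])
 qed
 then have 1: "((%t. f (fst p, snd p + t *\<^sub>R \<nu> (fst p))) has_real_derivative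
   (\<Sum>i<r. pd (cyl n r (\<phi> ` (U \<inter> W))) (n + i) (%z. f (pt U \<phi> e z)) (co \<phi> e p) * crd r e (fst p) (\<nu> (fst p)) i)) (at 0)"
  using fl(1) by simp
 show 2: "Dfun \<nu> f p = (\<Sum>i<r. pd (cyl n r (\<phi> ` (U \<inter> W))) (n + i) (%z. f (pt U \<phi> e z)) (co \<phi> e p) * crd r e (fst p) (\<nu> (fst p)) i)"
  unfolding Dfun_def if_P[OF p(1)]
  by (rule vector_derivative_at) (use 1 in \<open>simp add: has_real_derivative_iff_has_vector_derivative\<close>)
 show "((%t. f (fst p, snd p + t *\<^sub>R \<nu> (fst p))) has_real_derivative Dfun \<nu> f p) (at 0)" using 1 2 by simp
qed

lemma Dfun_smooth:
 assumes \<nu>: "\<nu> : sections S N" and f: "f : smooth_funs M" shows "Dfun \<nu> f : smooth_funs M"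
 unfolding smooth_funs_M
proof (intro conjI allI impI)
 show "Dfun \<nu> f p = 0" if "p \<notin> pts M" for p using that by (simp add: Dfun_def)
 fix U \<phi> W e assume a: "chart U \<phi>" "frameN W e"
 let ?D = "cyl n r (\<phi> ` (U \<inter> W))"
 have fs: "smooth_on (n + r) ?D (%z. f (pt U \<phi> e z))" using f a unfolding smooth_funs_M by blast
 have op: "opn (n + r) ?D"
  by (rule opn_cyl_image[OF _ a(1)], intro mfd_open_Int mfd_open_chart[OF a(1)] frame_open[OF a(2)]) blast
 have "smooth_on (n + r) ?D (%z. \<Sum>i<r. pd ?D (n + i) (%z. f (pt U \<phi> e z)) z * SN.secc U \<phi> e \<nu> i (trunc n z))"
  by (intro smooth_on_sum smooth_on_mult smooth_on_cyl smooth_on_pd'[OF opn_ndom[OF op] fs] SN.section_smooth[OF \<nu> a]) auto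
 then show "smooth_on (n + r) ?D (%z. Dfun \<nu> f (pt U \<phi> e z))"
 proof (rule smooth_on_cong)
  fix z assume z: "z : ?D"
  show "(\<Sum>i<r. pd ?D (n + i) (%z. f (pt U \<phi> e z)) z * SN.secc U \<phi> e \<nu> i (trunc n z)) = Dfun \<nu> f (pt U \<phi> e z)"
   unfolding Dfun_local(2)[OF a pt_M[OF a subset_refl z] \<nu> f] SN.secc_def trunc_pt[OF a subset_refl z] pt_in_tot(2)[OF a subset_refl z] ..
 qed
qed

lemma Dv_leibniz:
 assumes \<nu>: "\<nu> : sections S N" and f: "f : smooth_funs M" and \<mu>: "\<mu> : \<Gamma>L"
 shows "Dv \<nu> (%q. f q *\<^sub>R \<mu> q) = (%q. Dfun \<nu> f q *\<^sub>R \<mu> q + f q *\<^sub>R Dv \<nu> \<mu> q)"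
proof
 fix p
 show "Dv \<nu> (%q. f q *\<^sub>R \<mu> q) p = Dfun \<nu> f p *\<^sub>R \<mu> p + f p *\<^sub>R Dv \<nu> \<mu> p"
 proof (cases "p : pts M")
  case True
  obtain U \<phi> W e W' b where a: "chart U \<phi>" "frameN W e" "frameL W' b" "fst p : U \<inter> W \<inter> W'"
   by (rule patch_at[OF True])
  have "((%t. f (fst p, snd p + t *\<^sub>R \<nu> (fst p)) *\<^sub>R \<mu> (fst p, snd p + t *\<^sub>R \<nu> (fst p))) has_vector_derivative
   f (fst p, snd p + 0 *\<^sub>R \<nu> (fst p)) *\<^sub>R vert_der \<mu> p (\<nu> (fst p)) + Dfun \<nu> f p *\<^sub>R \<mu> (fst p, snd p + 0 *\<^sub>R \<nu> (fst p))) (at 0)"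
   by (rule has_vector_derivative_scaleR[OF Dfun_local(1)[OF a(1,2) True _ \<nu> f] vert_der_has[OF True fib_at[OF \<nu> True] \<mu>]])
    (use a(4) in blast)
  then have "vert_der (%q. f q *\<^sub>R \<mu> q) p (\<nu> (fst p)) = f p *\<^sub>R vert_der \<mu> p (\<nu> (fst p)) + Dfun \<nu> f p *\<^sub>R \<mu> p"
   using vert_der_eqI[of "%q. f q *\<^sub>R \<mu> q" p "\<nu> (fst p)"] by simp
  then show ?thesis using True by (simp add: Dv_def)
 next
  case False
  then show ?thesis by (simp add: Dv_def Dfun_def)
 qed
qed

lemma fo_iff: "fo Q \<longleftrightarrow> (\<forall>\<mu>\<in>\<Gamma>L. Q \<mu> : \<Gamma>L) \<and>
 (\<forall>\<mu>\<in>\<Gamma>L. \<forall>\<nu>\<in>\<Gamma>L. \<forall>a b. Q (%p. a *\<^sub>R \<mu> p + b *\<^sub>R \<nu> p) = (%p. a *\<^sub>R Q \<mu> p + b *\<^sub>R Q \<nu> p)) \<and>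
 (\<forall>f\<in>smooth_funs M. \<forall>g\<in>smooth_funs M. \<forall>\<mu>\<in>\<Gamma>L.
  Q (%q. f q *\<^sub>R (g q *\<^sub>R \<mu> q)) = (%p. f p *\<^sub>R Q (%q. g q *\<^sub>R \<mu> q) p + g p *\<^sub>R Q (%q. f q *\<^sub>R \<mu> q) p - (f p * g p) *\<^sub>R Q \<mu> p))"
proof -
 have "(\<forall>p. Q (%q. (f q * g q) *\<^sub>R \<mu> q) p - f p *\<^sub>R Q (%q. g q *\<^sub>R \<mu> q) p
     - g p *\<^sub>R Q (%q. f q *\<^sub>R \<mu> q) p + (f p * g p) *\<^sub>R Q \<mu> p = 0) \<longleftrightarrow>
  Q (%q. f q *\<^sub>R (g q *\<^sub>R \<mu> q)) = (%p. f p *\<^sub>R Q (%q. g q *\<^sub>R \<mu> q) p + g p *\<^sub>R Q (%q. f q *\<^sub>R \<mu> q) p - (f p * g p) *\<^sub>R Q \<mu> p)" for f g \<mu>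
  unfolding fun_eq_iff scaleR_scaleR by (rule arg_cong[where f=All], rule ext) (auto simp: algebra_simps eq_iff_diff_eq_0[of "Q _ _"])
 then show ?thesis unfolding first_order_op_def by simp
qed

lemma fo_expand:
 assumes "fo Q" "f : smooth_funs M" "g : smooth_funs M" "\<mu> : \<Gamma>L"
 shows "Q (%q. f q *\<^sub>R (g q *\<^sub>R \<mu> q)) = (%p. f p *\<^sub>R Q (%q. g q *\<^sub>R \<mu> q) p + g p *\<^sub>R Q (%q. f q *\<^sub>R \<mu> q) p - (f p * g p) *\<^sub>R Q \<mu> p)"
 using assms fo_iff by blast

lemma fo_Dv: assumes \<nu>: "\<nu> : sections S N" shows "fo (Dv \<nu>)"
 unfolding fo_iff
proof (intro conjI ballI allI)
 show "Dv \<nu> \<mu> : \<Gamma>L" if "\<mu> : \<Gamma>L" for \<mu> by (rule Dv_section[OF \<nu> that])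
 show "Dv \<nu> (%p. a *\<^sub>R \<mu> p + b *\<^sub>R \<mu>' p) = (%p. a *\<^sub>R Dv \<nu> \<mu> p + b *\<^sub>R Dv \<nu> \<mu>' p)"
  if "\<mu> : \<Gamma>L" "\<mu>' : \<Gamma>L" for a b \<mu> \<mu>' by (rule Dv_lin[OF \<nu> that])
 fix f g \<mu> assume a: "f : smooth_funs M" "g : smooth_funs M" "\<mu> : \<Gamma>L"
 show "Dv \<nu> (%q. f q *\<^sub>R (g q *\<^sub>R \<mu> q)) = (%p. f p *\<^sub>R Dv \<nu> (%q. g q *\<^sub>R \<mu> q) p + g p *\<^sub>R Dv \<nu> (%q. f q *\<^sub>R \<mu> q) p - (f p * g p) *\<^sub>R Dv \<nu> \<mu> p)"
  unfolding Dv_leibniz[OF \<nu> a(1) section_smult[OF a(2,3)]] Dv_leibniz[OF \<nu> a(2,3)] Dv_leibniz[OF \<nu> a(1,3)]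
  by (simp add: algebra_simps fun_eq_iff)
qed

lemma fo_bracket:
 assumes \<nu>: "\<nu> : sections S N" and Q: "fo Q"
 shows "fo (%\<mu> p. Dv \<nu> (Q \<mu>) p - Q (Dv \<nu> \<mu>) p)"
 unfolding fo_iff
proof (intro conjI ballI allI)
 show "(%p. Dv \<nu> (Q \<mu>) p - Q (Dv \<nu> \<mu>) p) : \<Gamma>L" if "\<mu> : \<Gamma>L" for \<mu>
  by (intro TL.section_diff Dv_section \<nu> fo_in[OF Q] that)
 show "(%p. Dv \<nu> (Q (%p. a *\<^sub>R \<mu> p + b *\<^sub>R \<mu>' p)) p - Q (Dv \<nu> (%p. a *\<^sub>R \<mu> p + b *\<^sub>R \<mu>' p)) p) =
   (%p. a *\<^sub>R (Dv \<nu> (Q \<mu>) p - Q (Dv \<nu> \<mu>) p) + b *\<^sub>R (Dv \<nu> (Q \<mu>') p - Q (Dv \<nu> \<mu>') p))"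
  if \<mu>: "\<mu> : \<Gamma>L" "\<mu>' : \<Gamma>L" for a b \<mu> \<mu>'
  unfolding fo_lin[OF Q \<mu>] Dv_lin[OF \<nu> \<mu>] Dv_lin[OF \<nu> fo_in[OF Q \<mu>(1)] fo_in[OF Q \<mu>(2)]]
   fo_lin[OF Q Dv_section[OF \<nu> \<mu>(1)] Dv_section[OF \<nu> \<mu>(2)]]
  by (simp add: algebra_simps)
 fix f g \<mu> assume f: "f : smooth_funs M" and g: "g : smooth_funs M" and \<mu>: "\<mu> : \<Gamma>L"
 let ?D = "Dv \<nu>" and ?f' = "Dfun \<nu> f" and ?g' = "Dfun \<nu> g"
 have f': "?f' : smooth_funs M" and g': "?g' : smooth_funs M" by (intro Dfun_smooth \<nu> f g)+
 note sm = section_smult and ins = section_smult[OF f \<mu>] section_smult[OF g \<mu>] Dv_section[OF \<nu> \<mu>]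
 have D1: "?D (%q. f q *\<^sub>R (g q *\<^sub>R \<mu> q)) = (%q. (?f' q *\<^sub>R (g q *\<^sub>R \<mu> q) + f q *\<^sub>R (?g' q *\<^sub>R \<mu> q)) + f q *\<^sub>R (g q *\<^sub>R ?D \<mu> q))"
  unfolding Dv_leibniz[OF \<nu> f ins(2)] Dv_leibniz[OF \<nu> g \<mu>] by (simp add: algebra_simps)
 have Q1: "Q (?D (%q. f q *\<^sub>R (g q *\<^sub>R \<mu> q))) = (%p. Q (%q. ?f' q *\<^sub>R (g q *\<^sub>R \<mu> q)) p + Q (%q. f q *\<^sub>R (?g' q *\<^sub>R \<mu> q)) p + Q (%q. f q *\<^sub>R (g q *\<^sub>R ?D \<mu> q)) p)"
  unfolding D1
  by (subst fo_add[OF Q TL.section_add[OF sm[OF f' ins(2)] sm[OF f sm[OF g' \<mu>]]] sm[OF f sm[OF g ins(3)]]],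
    subst fo_add[OF Q sm[OF f' ins(2)] sm[OF f sm[OF g' \<mu>]]]) simp
 have Qg: "Q (?D (%q. g q *\<^sub>R \<mu> q)) = (%p. Q (%q. ?g' q *\<^sub>R \<mu> q) p + Q (%q. g q *\<^sub>R ?D \<mu> q) p)"
  unfolding Dv_leibniz[OF \<nu> g \<mu>] by (rule fo_add[OF Q sm[OF g' \<mu>] sm[OF g ins(3)]])
 have Qf: "Q (?D (%q. f q *\<^sub>R \<mu> q)) = (%p. Q (%q. ?f' q *\<^sub>R \<mu> q) p + Q (%q. f q *\<^sub>R ?D \<mu> q) p)"
  unfolding Dv_leibniz[OF \<nu> f \<mu>] by (rule fo_add[OF Q sm[OF f' \<mu>] sm[OF f ins(3)]])
 have DQ: "?D (Q (%q. f q *\<^sub>R (g q *\<^sub>R \<mu> q))) = (%p. (?f' p *\<^sub>R Q (%q. g q *\<^sub>R \<mu> q) p + f p *\<^sub>R ?D (Q (%q. g q *\<^sub>R \<mu> q)) p)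
   + (?g' p *\<^sub>R Q (%q. f q *\<^sub>R \<mu> q) p + g p *\<^sub>R ?D (Q (%q. f q *\<^sub>R \<mu> q)) p)
   - (?f' p *\<^sub>R (g p *\<^sub>R Q \<mu> p) + f p *\<^sub>R (?g' p *\<^sub>R Q \<mu> p + g p *\<^sub>R ?D (Q \<mu>) p)))"
 proof -
  note i1 = sm[OF f fo_in[OF Q ins(2)]] and i2 = sm[OF g fo_in[OF Q ins(1)]] and i3 = sm[OF f sm[OF g fo_in[OF Q \<mu>]]]
  have "Q (%q. f q *\<^sub>R (g q *\<^sub>R \<mu> q)) = (%p. (f p *\<^sub>R Q (%q. g q *\<^sub>R \<mu> q) p + g p *\<^sub>R Q (%q. f q *\<^sub>R \<mu> q) p) - f p *\<^sub>R (g p *\<^sub>R Q \<mu> p))"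
   using fo_expand[OF Q f g \<mu>] by simp
  then show ?thesis
   using fo_diff[OF fo_Dv[OF \<nu>] TL.section_add[OF i1 i2] i3] fo_add[OF fo_Dv[OF \<nu>] i1 i2]
    Dv_leibniz[OF \<nu> f fo_in[OF Q ins(2)]] Dv_leibniz[OF \<nu> g fo_in[OF Q ins(1)]]
    Dv_leibniz[OF \<nu> f sm[OF g fo_in[OF Q \<mu>]]] Dv_leibniz[OF \<nu> g fo_in[OF Q \<mu>]] by simp
 qed
 show "(%p. ?D (Q (%q. f q *\<^sub>R (g q *\<^sub>R \<mu> q))) p - Q (?D (%q. f q *\<^sub>R (g q *\<^sub>R \<mu> q))) p) =
  (%p. f p *\<^sub>R (?D (Q (%q. g q *\<^sub>R \<mu> q)) p - Q (?D (%q. g q *\<^sub>R \<mu> q)) p) +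
   g p *\<^sub>R (?D (Q (%q. f q *\<^sub>R \<mu> q)) p - Q (?D (%q. f q *\<^sub>R \<mu> q)) p) - (f p * g p) *\<^sub>R (?D (Q \<mu>) p - Q (?D \<mu>) p))"
  unfolding Q1 Qg Qf DQ fo_expand[OF Q f' g \<mu>] fo_expand[OF Q f g' \<mu>] fo_expand[OF Q f g ins(3)]
  by (simp add: algebra_simps fun_eq_iff)
qed

lemma section_eqI:
 assumes "\<mu> : \<Gamma>L" "\<mu>' : \<Gamma>L"
  and "!!U \<phi> W e W' b z. chart U \<phi> ==> frameN W e ==> frameL W' b ==> z : Om U \<phi> W W' ==>
   lc U \<phi> e b \<mu> z = lc U \<phi> e b \<mu>' z"
 shows "\<mu> = \<mu>'"
proof
 fix p
 show "\<mu> p = \<mu>' p"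
 proof (cases "p : pts M")
  case True
  obtain U \<phi> W e W' b where a: "chart U \<phi>" "frameN W e" "frameL W' b" "fst p : U \<inter> W \<inter> W'"
   by (rule patch_at[OF True])
  have sub: "U \<inter> W \<inter> W' <= U \<inter> W" by blast
  note c = co_in_cyl[OF a(1,2) sub M_tot[OF True a(4)]]
  show ?thesis using lc_smult(2)[OF a(1-3) c(1) section_fibl[OF assms(1)]] lc_smult(2)[OF a(1-3) c(1) section_fibl[OF assms(2)]]
   assms(3)[OF a(1-3) c(1)] c(2) by simp
 next
  case False
  then show ?thesis using TL.section_off assms(1,2) by metis
 qed
qed

lemma Dv_commute:
 assumes \<nu>: "\<nu> : sections S N" and \<nu>': "\<nu>' : sections S N" and \<mu>: "\<mu> : \<Gamma>L"
 shows "Dv \<nu> (Dv \<nu>' \<mu>) = Dv \<nu>' (Dv \<nu> \<mu>)"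
proof (rule section_eqI)
 show "Dv \<nu> (Dv \<nu>' \<mu>) : \<Gamma>L" "Dv \<nu>' (Dv \<nu> \<mu>) : \<Gamma>L" by (intro Dv_section \<nu> \<nu>' \<mu>)+
 fix U \<phi> W e W' b z
 assume a: "chart U \<phi>" "frameN W e" "frameL W' b" and z: "z : Om U \<phi> W W'"
 let ?D = "Om U \<phi> W W'" and ?m = "lc U \<phi> e b \<mu>"
 have sub: "U \<inter> W \<inter> W' <= U \<inter> W" by blast
 note nd = opn_ndom[OF opn_Om[OF a]]
 note ms = section_lc_smooth[OF \<mu> a]
 have two: "lc U \<phi> e b (Dv \<nu> (Dv \<nu>' \<mu>)) z = (\<Sum>i<r. (\<Sum>k<r. pd ?D (n + i) (pd ?D (n + k) ?m) z * SN.secc U \<phi> e \<nu>' k (trunc n z)) * SN.secc U \<phi> e \<nu> i (trunc n z))"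
  if \<nu>: "\<nu> : sections S N" and \<nu>': "\<nu>' : sections S N" for \<nu> \<nu>'
 proof -
  have fibs: "\<nu> (fst (pt U \<phi> e y)) : fib N (fst (pt U \<phi> e y))" "\<nu>' (fst (pt U \<phi> e y)) : fib N (fst (pt U \<phi> e y))" if "y : ?D" for y
   using fib_at[OF \<nu> pt_M(1)[OF a(1,2) sub that]] fib_at[OF \<nu>' pt_M(1)[OF a(1,2) sub that]] by auto
  have "pd ?D (n + i) (lc U \<phi> e b (Dv \<nu>' \<mu>)) z = (\<Sum>k<r. pd ?D (n + i) (pd ?D (n + k) ?m) z * SN.secc U \<phi> e \<nu>' k (trunc n z))"
   if i: "i < r" for i
  proof -
   have ni: "n + i < n + r" using i by simp
   have "has_pd ?D (n + i) (%z. \<Sum>k<r. pd ?D (n + k) ?m z * SN.secc U \<phi> e \<nu>' k (trunc n z))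
     (%z. \<Sum>k<r. pd ?D (n + i) (pd ?D (n + k) ?m) z * SN.secc U \<phi> e \<nu>' k (trunc n z))"
    unfolding has_pd_def
   proof
    fix y assume y: "y : ?D"
    have tr: "trunc n (y(n + i := t)) = trunc n y" for t by (auto simp: trunc_def)
    show "((%t. \<Sum>k<r. pd ?D (n + k) ?m (y(n + i := t)) * SN.secc U \<phi> e \<nu>' k (trunc n (y(n + i := t)))) has_real_derivative
     (\<Sum>k<r. pd ?D (n + i) (pd ?D (n + k) ?m) y * SN.secc U \<phi> e \<nu>' k (trunc n y))) (at (y (n + i)) within {t. y(n + i := t) : ?D})"
     unfolding tr
    proof (rule DERIV_sum)
     fix k assume "k : {..<r}"
     then have nk: "n + k < n + r" by simp
     have "has_pd ?D (n + i) (pd ?D (n + k) ?m) (pd ?D (n + i) (pd ?D (n + k) ?m))"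
      by (rule smooth_has_pd(1)[OF nd smooth_on_pd'[OF nd ms nk] ni])
     then have "((%t. pd ?D (n + k) ?m (y(n + i := t))) has_real_derivative pd ?D (n + i) (pd ?D (n + k) ?m) y)
       (at (y (n + i)) within {t. y(n + i := t) : ?D})"
      using y unfolding has_pd_def by blast
     then show "((%t. pd ?D (n + k) ?m (y(n + i := t)) * SN.secc U \<phi> e \<nu>' k (trunc n y)) has_real_derivative
      pd ?D (n + i) (pd ?D (n + k) ?m) y * SN.secc U \<phi> e \<nu>' k (trunc n y)) (at (y (n + i)) within {t. y(n + i := t) : ?D})"
      by (rule DERIV_cmult_right)
    qed
   qed
   then have "has_pd ?D (n + i) (lc U \<phi> e b (Dv \<nu>' \<mu>)) (%z. \<Sum>k<r. pd ?D (n + i) (pd ?D (n + k) ?m) z * SN.secc U \<phi> e \<nu>' k (trunc n z))"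
    by (rule has_pd_cong) (simp_all add: lc_Dv[where \<nu>=\<nu>', OF a _ fibs(2) \<mu>])
   from has_pd_unique[OF nd ni this z] show ?thesis .
  qed
  then show ?thesis unfolding lc_Dv[where \<nu>=\<nu>, OF a z fibs(1)[OF z] Dv_section[OF \<nu>' \<mu>]] by simp
 qed
 have sym: "pd ?D (n + i) (pd ?D (n + k) ?m) z = pd ?D (n + k) (pd ?D (n + i) ?m) z" if "i < r" "k < r" for i k
  by (rule pd_commute[OF nd ms _ _ z]) (use that in auto)
 show "lc U \<phi> e b (Dv \<nu> (Dv \<nu>' \<mu>)) z = lc U \<phi> e b (Dv \<nu>' (Dv \<nu> \<mu>)) z"
  unfolding two[OF \<nu> \<nu>'] two[OF \<nu>' \<nu>] sum_distrib_right
  by (subst sum.swap) (intro sum.cong refl, simp add: sym mult_ac)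
qed

end

lemma pd_cong:
 assumes "ndom n D" "i < n" "smooth_on n D f" "!!y. y : D ==> f y = f' y" "x : D"
 shows "pd D i f x = pd D i f' x"
proof -
 have "has_pd D i f' (pd D i f)" by (rule has_pd_cong[OF smooth_has_pd(1)[OF assms(1,3,2)]]) (use assms(4) in auto)
 from has_pd_unique[OF assms(1,2) this assms(5)] show ?thesis by simp
qed

section \<open>Operators applied to smooth families\<close>

context bundle_pair
begin

lemma plateau:
 assumes U: "chart U \<phi>" and A: "mfd_open S A" "A <= U" and x: "x : A"
 obtains A0 K \<kappa> A1 where "mfd_open S A0" "A0 <= A" "cutoff (\<phi> ` A0) K \<kappa>"
  "mfd_open S A1" "A1 <= A0" "x : A1" "\<forall>y\<in>A1. \<kappa> (\<phi> y) = 1"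
proof -
 obtain s A0 where s: "s > 0" and A0: "mfd_open S A0" "A0 <= A" "x : A0"
  "\<phi> ` A0 = {y \<in> Rn n. \<forall>i<n. \<bar>y i - \<phi> x i\<bar> < s}"
  by (rule local_box[OF U A x], rule that)
 obtain \<kappa> \<rho> K where \<kappa>: "0 < \<rho>" "\<rho> < s" "cutoff {y \<in> Rn n. \<forall>i<n. \<bar>y i - \<phi> x i\<bar> < s} K \<kappa>"
  "\<forall>y. (\<forall>i<n. \<bar>y i - \<phi> x i\<bar> < \<rho>) --> \<kappa> y = 1"
  by (rule cutoff_box[OF s, of "\<phi> x"], rule that)
 define D where "D = {y \<in> Rn n. \<forall>i<n. \<bar>y i - \<phi> x i\<bar> < \<rho>}"
 have D: "D <= \<phi> ` A0" unfolding A0(4) D_def using \<kappa>(2) by (auto intro: less_trans)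
 have A0U: "A0 <= U" using A0(2) A(2) by blast
 define A1 where "A1 = {a \<in> U. \<phi> a : D}"
 have "mfd_open S A1" unfolding A1_def
 proof (rule mfd_open_vimage[OF U])
  show "opn n D" unfolding D_def by (rule opn_box_set)
  show "D <= \<phi> ` U" using D A0U by blast
 qed
 moreover have "A1 <= A0"
 proof
  fix a assume "a : A1"
  then have "\<phi> a : \<phi> ` A0" "a : U" using D by (auto simp: A1_def)
  then show "a : A0" using inj_on_image_mem_iff[OF S_charts(1)[OF U] _ A0U] by blast
 qed
 moreover have "x : A1"
  using x A(2) \<kappa>(1) opn_subset[OF S_charts(3)[OF U]] by (auto simp: A1_def D_def)
 moreover have "\<forall>y\<in>A1. \<kappa> (\<phi> y) = 1" using \<kappa>(4) by (auto simp: A1_def D_def)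
 ultimately show thesis using that A0(1,2) \<kappa>(3)[folded A0(4)] by blast
qed

lemma fo_lc:
 assumes Q: "fo Q" and U: "chart U \<phi>" and W: "frameN W e" and W': "frameL W' b"
  and A: "mfd_open S A" "A <= U \<inter> W \<inter> W'" and \<kappa>: "cutoff (\<phi> ` A) K \<kappa>"
  and A1: "mfd_open S A1" "A1 <= A" "\<forall>x\<in>A1. \<kappa> (\<phi> x) = 1"
  and z: "z : cyl n r (\<phi> ` A1)" and \<mu>: "\<mu> : \<Gamma>L"
 shows "lc U \<phi> e b (Q \<mu>) z = lc U \<phi> e b \<mu> z * lc U \<phi> e b (Q (cuts \<phi> A b \<kappa>)) z +
  (\<Sum>a<n + r. pd (Om U \<phi> W W') a (lc U \<phi> e b \<mu>) z *
   (lc U \<phi> e b (Q (gen \<phi> e A b \<kappa> a)) z - z a * lc U \<phi> e b (Q (cuts \<phi> A b \<kappa>)) z))"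
proof -
 let ?\<theta> = "cuts \<phi> A b \<kappa>" and ?X = "gen \<phi> e A b \<kappa>" and ?p = "pt U \<phi> e z"
 have AU: "A <= U \<inter> W" "A1 <= U \<inter> W" using A A1 by auto
 have p: "?p : pts M" "fst ?p : A1" using pt_M[OF U W AU(2) z] by auto
 have x: "fst ?p : W'" using p A1 A by blast
 have c: "co \<phi> e ?p = z" by (rule pt_in_tot(2)[OF U W AU(2) z])
 have \<theta>s: "?\<theta> : \<Gamma>L" by (rule cuts_section[OF U W W' A \<kappa>])
 have Xs: "?X a : \<Gamma>L" for a
  unfolding gen_def by (intro section_smult cutf_smooth[OF U W A(1) AU(1) \<kappa>] smooth_on_coord \<theta>s)
 have F\<theta>: "Q ?\<theta> ?p : fib l (fst ?p)" and FX: "!!a. Q (?X a) ?p : fib l (fst ?p)"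
  using section_fibl[OF fo_in[OF Q \<theta>s] p(1)] section_fibl[OF fo_in[OF Q Xs] p(1)] by auto
 let ?Y = "%a. 1 *\<^sub>R Q (?X a) ?p + (- z a) *\<^sub>R Q ?\<theta> ?p"
 have sub: "subspace (fib l (fst ?p))" using Sl.fib_subspace p(1) by (simp add: pts_M_iff)
 have FY: "?Y a : fib l (fst ?p)" for a using F\<theta> FX by (intro subspace_add[OF sub] subspace_scale[OF sub])
 have cY: "crd 1 b (fst ?p) (?Y a) 0 = lc U \<phi> e b (Q (?X a)) z - z a * lc U \<phi> e b (Q ?\<theta>) z" for a
  using Sl.crd_lin[OF W' x FX F\<theta>, of 1 a "- z a" 0] rk_l by (simp add: lc_def)
 let ?c = "%a. pd (Om U \<phi> W W') a (lc U \<phi> e b \<mu>) z"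
 have FS: "(\<Sum>a<n + r. ?c a *\<^sub>R ?Y a) : fib l (fst ?p)"
  by (intro subspace_sum[OF sub] subspace_scale[OF sub] FY)
 have "Q \<mu> ?p = lc U \<phi> e b \<mu> z *\<^sub>R Q ?\<theta> ?p + 1 *\<^sub>R (\<Sum>a<n + r. ?c a *\<^sub>R ?Y a)"
  using local_formula[OF Q U W W' A \<kappa> A1(1,2) _ p \<mu>] A1(3) unfolding c by simp
 then have "lc U \<phi> e b (Q \<mu>) z = crd 1 b (fst ?p) (lc U \<phi> e b \<mu> z *\<^sub>R Q ?\<theta> ?p + 1 *\<^sub>R (\<Sum>a<n + r. ?c a *\<^sub>R ?Y a)) 0"
  by (simp add: lc_def)
 also have "\<dots> = lc U \<phi> e b \<mu> z * lc U \<phi> e b (Q ?\<theta>) z + crd 1 b (fst ?p) (\<Sum>a<n + r. ?c a *\<^sub>R ?Y a) 0"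
  using Sl.crd_lin[OF W' x F\<theta> FS, of "lc U \<phi> e b \<mu> z" 1 0] rk_l by (simp add: lc_def)
 also have "crd 1 b (fst ?p) (\<Sum>a<n + r. ?c a *\<^sub>R ?Y a) 0 = (\<Sum>a<n + r. ?c a * crd 1 b (fst ?p) (?Y a) 0)"
  using Sl.crd_lsum[OF W' x, of "{..<n + r}" ?Y ?c 0] FY rk_l by simp
 finally show ?thesis unfolding cY .
qed

lemma family_lc_smooth:
 "famL a ==> chart U \<phi> ==> frameN W e ==> frameL W' b ==>
  smooth_on (Suc (n + r)) (famd (n + r) (Om U \<phi> W W')) (%z. lc U \<phi> e b (a (z 0)) (tail z))"
 by (simp add: family_lc)

lemma pd_family:
 assumes a: "famL a" and P: "chart U \<phi>" "frameN W e" "frameL W' b"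
  and j: "j < n + r" and z: "z : famd (n + r) (Om U \<phi> W W')"
 shows "pd (famd (n + r) (Om U \<phi> W W')) (Suc j) (%z. lc U \<phi> e b (a (z 0)) (tail z)) z =
  pd (Om U \<phi> W W') j (lc U \<phi> e b (a (z 0))) (tail z)"
 using pd_famd_slice[OF opn_Om[OF P] family_lc_smooth[OF a P] j z] by simp

lemma fo_family:
 assumes Q: "!!t. t : {0..1} ==> fo (Q t)"
  and Qf: "!!\<theta>. \<theta> : \<Gamma>L ==> famL (%t. Q t \<theta>)" and a: "famL a"
 shows "famL (%t. Q t (a t))"
 unfolding family_lc
proof (intro conjI allI impI ballI)
 fix t p assume t: "t : {0..1::real}"
 have "Q t (a t) : \<Gamma>L" by (rule fo_in[OF Q[OF t] TL.family_section[OF a t]])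
 then show "p : pts M ==> Q t (a t) p : fib l (fst p)" "p \<notin> pts M ==> Q t (a t) p = 0"
  using section_fibl TL.section_off by blast+
next
 fix U \<phi> W e W' b assume P: "chart U \<phi>" "frameN W e" "frameL W' b"
 let ?D = "Om U \<phi> W W'" and ?A = "U \<inter> W \<inter> W'"
 have sub: "?A <= U" "?A <= U \<inter> W" by auto
 show "smooth_on (Suc (n + r)) (famd (n + r) ?D) (%z. lc U \<phi> e b (Q (z 0) (a (z 0))) (tail z))"
 proof (rule smooth_on_famd_cover[OF opn_Om[OF P]])
  fix z0 assume z0: "z0 : ?D"
  have x0: "fst (pt U \<phi> e z0) : ?A" by (rule pt_M(2)[OF P(1,2) sub(2) z0])
  obtain A0 K \<kappa> A1 where A: "mfd_open S A0" "A0 <= ?A" "cutoff (\<phi> ` A0) K \<kappa>"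
   "mfd_open S A1" "A1 <= A0" "fst (pt U \<phi> e z0) : A1" "\<forall>y\<in>A1. \<kappa> (\<phi> y) = 1"
   by (rule plateau[OF P(1) patch_open(1)[OF P] sub(1) x0], rule that)
  let ?D' = "cyl n r (\<phi> ` A1)" and ?\<theta> = "cuts \<phi> A0 b \<kappa>" and ?X = "gen \<phi> e A0 b \<kappa>"
  let ?F = "famd (n + r) ?D" and ?F' = "famd (n + r) ?D'"
  have A1U: "A1 <= U" "A1 <= ?A" and A0U: "A0 <= U \<inter> W" using A by auto
  have D': "?D' <= ?D" by (rule cyl_mono[OF A1U(2)])
  have F': "?F' <= ?F" by (rule famd_mono[OF D'])
  have \<theta>s: "?\<theta> : \<Gamma>L" by (rule cuts_section[OF P A(1-3)])
  have Xs: "?X j : \<Gamma>L" for j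
   unfolding gen_def by (intro section_smult cutf_smooth[OF P(1,2) A(1) A0U A(3)] smooth_on_coord \<theta>s)
  note sm = smooth_on_mono[OF family_lc_smooth[OF _ P] order_refl F']
  note pdsm = smooth_on_mono[OF smooth_on_pd'[OF ndom_famd[OF opn_Om[OF P]] family_lc_smooth[OF a P]] order_refl F']
  have tl: "smooth_on (Suc (n + r)) ?F' (%z. tail z j)" for j unfolding tail_def by (rule smooth_on_coord)
  have "smooth_on (Suc (n + r)) ?F' (%z. lc U \<phi> e b (a (z 0)) (tail z) * lc U \<phi> e b (Q (z 0) ?\<theta>) (tail z) +
   (\<Sum>j<n + r. pd ?F (Suc j) (%z. lc U \<phi> e b (a (z 0)) (tail z)) z *
     (lc U \<phi> e b (Q (z 0) (?X j)) (tail z) - tail z j * lc U \<phi> e b (Q (z 0) ?\<theta>) (tail z))))"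
   by (intro smooth_on_add smooth_on_mult smooth_on_sum smooth_on_diff sm[OF a] sm[OF Qf[OF \<theta>s]] sm[OF Qf[OF Xs]] tl pdsm) auto
  then have "smooth_on (Suc (n + r)) ?F' (%z. lc U \<phi> e b (Q (z 0) (a (z 0))) (tail z))"
  proof (rule smooth_on_cong)
   fix z assume z: "z : ?F'"
   then have z': "z 0 : {0..1}" "tail z : ?D'" by (auto simp: famd_def tail_def)
   show "lc U \<phi> e b (a (z 0)) (tail z) * lc U \<phi> e b (Q (z 0) ?\<theta>) (tail z) +
   (\<Sum>j<n + r. pd ?F (Suc j) (%z. lc U \<phi> e b (a (z 0)) (tail z)) z *
     (lc U \<phi> e b (Q (z 0) (?X j)) (tail z) - tail z j * lc U \<phi> e b (Q (z 0) ?\<theta>) (tail z))) =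
    lc U \<phi> e b (Q (z 0) (a (z 0))) (tail z)"
    unfolding fo_lc[OF Q[OF z'(1)] P A(1-5,7) z'(2) TL.family_section[OF a z'(1)]]
    using pd_family[OF a P _ subsetD[OF F' z]] by simp
  qed
  moreover have "opn (n + r) ?D'" by (rule opn_cyl_image[OF A(4) P(1) A1U(1)])
  moreover have "z0 : ?D'" using in_cyl_iff[OF P(1,2) sub(2) z0 A1U(1)] A(6) by blast
  ultimately show "\<exists>D'. opn (n + r) D' \<and> D' <= ?D \<and> z0 : D' \<and>
    smooth_on (Suc (n + r)) (famd (n + r) D') (%z. lc U \<phi> e b (Q (z 0) (a (z 0))) (tail z))"
   using D' by blast
 qed
qed

lemma lc_co:
 assumes P: "chart U \<phi>" "frameN W e" "frameL W' b" and p: "p : pts M" "fst p : U \<inter> W \<inter> W'"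
 shows "co \<phi> e p : Om U \<phi> W W'" "lc U \<phi> e b F (co \<phi> e p) = crd 1 b (fst p) (F p) 0"
proof -
 have sub: "U \<inter> W \<inter> W' <= U \<inter> W" by blast
 note c = co_in_cyl[OF P(1,2) sub M_tot[OF p]]
 show "co \<phi> e p : Om U \<phi> W W'" by (rule c(1))
 show "lc U \<phi> e b F (co \<phi> e p) = crd 1 b (fst p) (F p) 0" unfolding lc_def c(2) ..
qed

lemma lc_dfam:
 assumes a: "famL a" and P: "chart U \<phi>" "frameN W e" "frameL W' b"
  and z: "z : Om U \<phi> W W'" and t: "t : {0..1}"
 shows "((%t. lc U \<phi> e b (a t) z) has_real_derivative lc U \<phi> e b (TL.dfam a t) z) (at t within {0..1})"
  "lc U \<phi> e b (TL.dfam a t) z = pd (famd (n + r) (Om U \<phi> W W')) 0 (%z. lc U \<phi> e b (a (z 0)) (tail z)) (case_nat t z)"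
proof -
 let ?g = "%z. lc U \<phi> e b (a (z 0)) (tail z)" and ?F = "famd (n + r) (Om U \<phi> W W')" and ?p = "pt U \<phi> e z"
 have sub: "U \<inter> W \<inter> W' <= U \<inter> W" by blast
 have p: "?p : pts M" "fst ?p : W'" using pt_M[OF P(1,2) sub z] by auto
 have "((%t. ?g (case_nat t z)) has_real_derivative pd ?F 0 ?g (case_nat t z)) (at t within {0..1})"
  by (rule has_pd_famd_time[OF smooth_has_pd(1)[OF ndom_famd[OF opn_Om[OF P]] family_lc_smooth[OF a P]] t cyl_Rn z]) simp
 then have 1: "((%t. lc U \<phi> e b (a t) z) has_real_derivative pd ?F 0 ?g (case_nat t z)) (at t within {0..1})" by simp
 have "((%t. lc U \<phi> e b (a t) z *\<^sub>R b 0 (fst ?p)) has_vector_derivative pd ?F 0 ?g (case_nat t z) *\<^sub>R b 0 (fst ?p)) (at t within {0..1})"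
  by (rule bounded_linear.has_vector_derivative[OF bounded_linear_scaleR_left 1[unfolded has_real_derivative_iff_has_vector_derivative]])
 then have "((%t. a t ?p) has_vector_derivative pd ?F 0 ?g (case_nat t z) *\<^sub>R b 0 (fst ?p)) (at t within {0..1})"
  by (rule has_vector_derivative_transform_within[where d=1])
   (use t lc_smult(2)[OF P z section_fibl[OF TL.family_section[OF a]]] in auto)
 then have "TL.dfam a t ?p = pd ?F 0 ?g (case_nat t z) *\<^sub>R b 0 (fst ?p)"
  unfolding TL.dfam_def by (rule TL.vd_within_unit[OF _ t])
 then show 2: "lc U \<phi> e b (TL.dfam a t) z = pd ?F 0 ?g (case_nat t z)"
  unfolding lc_def[of U \<phi> e b "TL.dfam a t"] using Sl.crd_comb[OF P(3) p(2), of 0 "%_. pd ?F 0 ?g (case_nat t z)"] rk_l by simp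
 show "((%t. lc U \<phi> e b (a t) z) has_real_derivative lc U \<phi> e b (TL.dfam a t) z) (at t within {0..1})"
  using 1 unfolding 2 .
qed

lemma pd_lc_dfam:
 assumes a: "famL a" and P: "chart U \<phi>" "frameN W e" "frameL W' b"
  and z: "z : Om U \<phi> W W'" and t: "t : {0..1}" and j: "j < n + r"
 shows "((%t. pd (Om U \<phi> W W') j (lc U \<phi> e b (a t)) z) has_real_derivative pd (Om U \<phi> W W') j (lc U \<phi> e b (TL.dfam a t)) z) (at t within {0..1})"
proof -
 let ?g = "%z. lc U \<phi> e b (a (z 0)) (tail z)" and ?D = "Om U \<phi> W W'"
 let ?F = "famd (n + r) ?D"
 note op = opn_Om[OF P] and nF = ndom_famd[OF opn_Om[OF P]] and gs = family_lc_smooth[OF a P]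
 have zF: "case_nat u z : ?F" if "u : {0..1}" for u using that z by (simp add: case_nat_famd[OF cyl_Rn])
 have "((%t. pd ?F (Suc j) ?g (case_nat t z)) has_real_derivative pd ?F 0 (pd ?F (Suc j) ?g) (case_nat t z)) (at t within {0..1})"
  by (rule has_pd_famd_time[OF smooth_has_pd(1)[OF nF smooth_on_pd'[OF nF gs]] t cyl_Rn z]) (use j in auto)
 then have 1: "((%t. pd ?D j (lc U \<phi> e b (a t)) z) has_real_derivative pd ?F 0 (pd ?F (Suc j) ?g) (case_nat t z)) (at t within {0..1})"
  by (rule has_field_derivative_transform_within[where d=1]) (use pd_family[OF a P j zF] t in auto)
 have "pd ?F 0 (pd ?F (Suc j) ?g) (case_nat t z) = pd ?F (Suc j) (pd ?F 0 ?g) (case_nat t z)"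
  by (rule pd_commute[OF nF gs _ _ zF[OF t]]) (use j in auto)
 also have "\<dots> = pd ?D j (%y. pd ?F 0 ?g (case_nat t y)) z"
  using pd_famd_slice[OF op smooth_on_pd'[OF nF gs] j zF[OF t]] by simp
 also have "\<dots> = pd ?D j (lc U \<phi> e b (TL.dfam a t)) z"
  by (rule pd_cong[OF opn_ndom[OF op] j _ _ z, symmetric])
   (use section_lc_smooth[OF TL.family_section[OF TL.family_dfam[OF a] t] P] lc_dfam(2)[OF a P _ t] in auto)
 finally show ?thesis using 1 by simp
qed

lemma fo_family_derivative:
 assumes Q: "!!t. t : {0..1} ==> fo (Q t)" and Q': "!!t. t : {0..1} ==> fo (Q' t)"
  and der: "!!\<theta> t p. \<theta> : \<Gamma>L ==> t : {0..1} ==> p : pts M ==>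
   ((%t. Q t \<theta> p) has_vector_derivative Q' t \<theta> p) (at t within {0..1})"
  and a: "famL a" and t: "t : {0..1}"
 shows "((%t. Q t (a t) p) has_vector_derivative Q' t (a t) p + Q t (TL.dfam a t) p) (at t within {0..1})"
proof (cases "p : pts M")
 case False
 have "((%t. 0) has_vector_derivative (0::'w)) (at t within {0..1})" by simp
 then have "((%t. Q t (a t) p) has_vector_derivative 0) (at t within {0..1})"
  by (rule has_vector_derivative_transform_within[where d=1])
   (use t TL.section_off[OF fo_in[OF Q TL.family_section[OF a]] False] in auto)
 moreover have "Q' t (a t) p = 0" "Q t (TL.dfam a t) p = 0"
  using TL.section_off[OF fo_in[OF Q'[OF t] TL.family_section[OF a t]] False]
   TL.section_off[OF fo_in[OF Q[OF t] TL.family_section[OF TL.family_dfam[OF a] t]] False] by auto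
 ultimately show ?thesis by simp
next
 case True
 obtain U \<phi> W e W' b where P: "chart U \<phi>" "frameN W e" "frameL W' b" and x: "fst p : U \<inter> W \<inter> W'"
  by (rule patch_at[OF True], rule that)
 let ?D = "Om U \<phi> W W'" and ?A = "U \<inter> W \<inter> W'" and ?z = "co \<phi> e p"
 have sub: "?A <= U" by auto
 obtain A0 K \<kappa> A1 where A: "mfd_open S A0" "A0 <= ?A" "cutoff (\<phi> ` A0) K \<kappa>"
   "mfd_open S A1" "A1 <= A0" "fst p : A1" "\<forall>y\<in>A1. \<kappa> (\<phi> y) = 1"
  by (rule plateau[OF P(1) patch_open(1)[OF P] sub x], rule that)
 let ?\<theta> = "cuts \<phi> A0 b \<kappa>" and ?X = "gen \<phi> e A0 b \<kappa>"
 have A0U: "A0 <= U \<inter> W" using A by auto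
 have \<theta>s: "?\<theta> : \<Gamma>L" by (rule cuts_section[OF P A(1-3)])
 have Xs: "?X j : \<Gamma>L" for j
  unfolding gen_def by (intro section_smult cutf_smooth[OF P(1,2) A(1) A0U A(3)] smooth_on_coord \<theta>s)
 have z: "?z : ?D" by (rule lc_co(1)[OF P True x])
 have lf: "R \<mu> p = lc U \<phi> e b \<mu> ?z *\<^sub>R R ?\<theta> p + (\<Sum>j<n + r. pd ?D j (lc U \<phi> e b \<mu>) ?z *\<^sub>R (R (?X j) p - ?z j *\<^sub>R R ?\<theta> p))"
  if "fo R" "\<mu> : \<Gamma>L" for R \<mu>
  using local_formula[OF that(1) P A(1-5) _ True A(6) that(2)] A(7) by blast
 note at = TL.family_section[OF a] and dat = TL.family_section[OF TL.family_dfam[OF a] t]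
 let ?f = "%t. lc U \<phi> e b (a t) ?z *\<^sub>R Q t ?\<theta> p + (\<Sum>j<n + r. pd ?D j (lc U \<phi> e b (a t)) ?z *\<^sub>R (Q t (?X j) p - ?z j *\<^sub>R Q t ?\<theta> p))"
 have "(?f has_vector_derivative
   (lc U \<phi> e b (a t) ?z *\<^sub>R Q' t ?\<theta> p + lc U \<phi> e b (TL.dfam a t) ?z *\<^sub>R Q t ?\<theta> p) +
   (\<Sum>j<n + r. pd ?D j (lc U \<phi> e b (a t)) ?z *\<^sub>R (Q' t (?X j) p - ?z j *\<^sub>R Q' t ?\<theta> p) +
    pd ?D j (lc U \<phi> e b (TL.dfam a t)) ?z *\<^sub>R (Q t (?X j) p - ?z j *\<^sub>R Q t ?\<theta> p))) (at t within {0..1})"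
  by (intro has_vector_derivative_add has_vector_derivative_scaleR has_vector_derivative_sum has_vector_derivative_diff
    bounded_linear.has_vector_derivative[OF bounded_linear_scaleR_right] der[OF _ t True] \<theta>s Xs
    lc_dfam(1)[OF a P z t] pd_lc_dfam[OF a P z t]) auto
 then have "((%t. Q t (a t) p) has_vector_derivative
   (lc U \<phi> e b (a t) ?z *\<^sub>R Q' t ?\<theta> p + lc U \<phi> e b (TL.dfam a t) ?z *\<^sub>R Q t ?\<theta> p) +
   (\<Sum>j<n + r. pd ?D j (lc U \<phi> e b (a t)) ?z *\<^sub>R (Q' t (?X j) p - ?z j *\<^sub>R Q' t ?\<theta> p) +
    pd ?D j (lc U \<phi> e b (TL.dfam a t)) ?z *\<^sub>R (Q t (?X j) p - ?z j *\<^sub>R Q t ?\<theta> p))) (at t within {0..1})"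
  by (rule has_vector_derivative_transform_within[where d=1]) (use t lf[OF Q at] in auto)
 then show ?thesis unfolding lf[OF Q'[OF t] at[OF t]] lf[OF Q[OF t] dat] by (simp add: sum.distrib add_ac)
qed

lemma Dv_family: "smooth_family S N s ==> famL a ==> famL (%t. Dv (s t) (a t))"
 by (rule fo_family[where Q="%t. Dv (s t)"]) (rule fo_Dv, erule (1) SN.family_section, erule (1) Dv_family_const, assumption)

lemma Dv_derivative:
 assumes s: "smooth_family S N s" and a: "famL a" and t: "t : {0..1}"
 shows "((%t. Dv (s t) (a t) p) has_vector_derivative Dv (SN.dfam s t) (a t) p + Dv (s t) (TL.dfam a t) p) (at t within {0..1})"
proof (rule fo_family_derivative[where Q="%t. Dv (s t)" and Q'="%t. Dv (SN.dfam s t)", OF _ _ _ a t])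
 show "fo (Dv (s t))" "fo (Dv (SN.dfam s t))" if "t : {0..1}" for t
  by (intro fo_Dv SN.family_section[OF _ that] SN.family_dfam s)+
 fix \<theta> t p assume \<theta>: "\<theta> : \<Gamma>L" and t: "t : {0..1::real}" and p: "p : pts M"
 obtain U \<phi> W e W' b where P: "chart U \<phi>" "frameN W e" "frameL W' b" and x: "fst p : U \<inter> W \<inter> W'"
  by (rule patch_at[OF p], rule that)
 let ?D = "Om U \<phi> W W'" and ?x = "fst p"
 have xx: "?x : U" "?x : W" using x by auto
 let ?c = "%\<nu>. (\<Sum>i<r. pd ?D (n + i) (lc U \<phi> e b \<theta>) (co \<phi> e p) * crd r e ?x (\<nu> ?x) i) *\<^sub>R b 0 ?x"
 have val: "Dv \<nu> \<theta> p = ?c \<nu>" if "\<nu> : sections S N" for \<nu>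
  using vert_der_local(2)[OF P p x fib_at[OF that p] \<theta>] p by (simp add: Dv_def)
 have crd': "((%t. crd r e ?x (s t ?x) i) has_real_derivative crd r e ?x (SN.dfam s t ?x) i) (at t within {0..1})" if i: "i < r" for i
 proof -
  let ?F = "famd n (\<phi> ` (U \<inter> W))" and ?g = "%z. SN.secc U \<phi> e (s (z 0)) i (tail z)"
  have y: "\<phi> ?x : \<phi> ` (U \<inter> W)" using xx by blast
  have "((%t. ?g (case_nat t (\<phi> ?x))) has_real_derivative pd ?F 0 ?g (case_nat t (\<phi> ?x))) (at t within {0..1})"
   by (rule has_pd_famd_time[OF smooth_has_pd(1)[OF ndom_famd[OF SN.charts_open[OF P(1,2)]] SN.family_smooth[OF s P(1,2) i]] t SN.dom_Rn[OF P(1,2)] y]) simp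
  moreover have "case_nat t (\<phi> ?x) : ?F" using t y by (simp add: case_nat_famd[OF SN.dom_Rn[OF P(1,2)]])
  ultimately show ?thesis
   using SN.secc_dfam[OF s P(1,2) i, of "case_nat t (\<phi> ?x)"] by (simp add: SN.secc_def SN.inv_chart[OF P(1) xx(1)])
 qed
 have "((%t. \<Sum>i<r. pd ?D (n + i) (lc U \<phi> e b \<theta>) (co \<phi> e p) * crd r e ?x (s t ?x) i) has_real_derivative
   (\<Sum>i<r. pd ?D (n + i) (lc U \<phi> e b \<theta>) (co \<phi> e p) * crd r e ?x (SN.dfam s t ?x) i)) (at t within {0..1})"
  by (intro DERIV_sum DERIV_cmult crd') auto
 then have "((%t. ?c (s t)) has_vector_derivative ?c (SN.dfam s t)) (at t within {0..1})"
  unfolding has_real_derivative_iff_has_vector_derivative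
  by (rule bounded_linear.has_vector_derivative[OF bounded_linear_scaleR_left])
 then show "((%t. Dv (s t) \<theta> p) has_vector_derivative Dv (SN.dfam s t) \<theta> p) (at t within {0..1})"
  unfolding val[OF SN.family_section[OF SN.family_dfam[OF s] t]]
  by (rule has_vector_derivative_transform_within[where d=1]) (use t val[OF SN.family_section[OF s]] in auto)
qed

lemma fo_0: "fo (%\<mu> p. 0)"
 unfolding fo_iff using TL.section_zero by auto

end

locale jacobi_bundle = bundle_pair S N l
 for S :: "'p mfd" and N :: "('p, 'v::real_normed_vector) vbun" and l :: "('p, 'w::real_normed_vector) vbun" +
 fixes J :: "('p \<times> 'v, 'w) mop"
 assumes JJ: "jacobi_structure M L J"
begin

lemma J_ops:
 assumes "\<mu> : \<Gamma>L" "\<nu> : \<Gamma>L"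
 shows "J [\<mu>, \<nu>] : \<Gamma>L" "fo (%\<mu>. J [\<mu>, \<nu>])" "fo (%\<nu>. J [\<mu>, \<nu>])" "J [\<mu>, \<mu>] = (%p. 0)"
proof -
 have J: "!!\<mu>s. length \<mu>s = 2 ==> set \<mu>s <= \<Gamma>L ==> J \<mu>s : \<Gamma>L \<and>
   (\<forall>i<2. fo (%\<mu>. J (\<mu>s[i := \<mu>]))) \<and> (\<forall>i<2. \<forall>j<2. i \<noteq> j \<and> \<mu>s ! i = \<mu>s ! j --> J \<mu>s = (%p. 0))"
  using JJ unfolding jacobi_structure_def multidiff_ops_def by blast
 have 1: "J [\<mu>, \<nu>] : \<Gamma>L \<and> (\<forall>i<2. fo (%\<mu>'. J ([\<mu>, \<nu>][i := \<mu>'])))" using J[of "[\<mu>, \<nu>]"] assms by simp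
 then show "J [\<mu>, \<nu>] : \<Gamma>L" by blast
 show "fo (%\<mu>. J [\<mu>, \<nu>])" using 1[THEN conjunct2, rule_format, of 0] by simp
 show "fo (%\<nu>. J [\<mu>, \<nu>])" using 1[THEN conjunct2, rule_format, of 1] by simp
 have "length [\<mu>, \<mu>] = 2" "set [\<mu>, \<mu>] <= \<Gamma>L" using assms by auto
 from J[OF this] have "\<forall>i<2. \<forall>j<2. i \<noteq> j \<and> [\<mu>, \<mu>] ! i = [\<mu>, \<mu>] ! j --> J [\<mu>, \<mu>] = (%p. 0)" by blast
 from this[rule_format, of 0 1] show "J [\<mu>, \<mu>] = (%p. 0)" by simp
qed

lemma J_antisym:
 assumes \<mu>: "\<mu> : \<Gamma>L" and \<nu>: "\<nu> : \<Gamma>L"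
 shows "J [\<mu>, \<nu>] p = - J [\<nu>, \<mu>] p"
proof -
 let ?s = "%p. \<mu> p + \<nu> p"
 have s: "?s : \<Gamma>L" by (rule TL.section_add[OF \<mu> \<nu>])
 have "J [?s, ?s] p = J [\<mu>, ?s] p + J [\<nu>, ?s] p" using fo_add[OF J_ops(2)[OF s s] \<mu> \<nu>] by simp
 also have "\<dots> = (J [\<mu>, \<mu>] p + J [\<mu>, \<nu>] p) + (J [\<nu>, \<mu>] p + J [\<nu>, \<nu>] p)"
  using fo_add[OF J_ops(3)[OF \<mu> \<mu>] \<mu> \<nu>] fo_add[OF J_ops(3)[OF \<nu> \<nu>] \<mu> \<nu>] by simp
 finally have "J [\<mu>, \<nu>] p + J [\<nu>, \<mu>] p = 0"
  using J_ops(4)[OF s s] J_ops(4)[OF \<mu> \<mu>] J_ops(4)[OF \<nu> \<nu>] by simp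
 then show ?thesis by (simp add: add_eq_0_iff2)
qed

lemma J_jacobi:
 assumes "\<eta> : \<Gamma>L" "\<mu> : \<Gamma>L" "\<nu> : \<Gamma>L"
 shows "J [\<eta>, J [\<mu>, \<nu>]] p + J [\<mu>, J [\<nu>, \<eta>]] p + J [\<nu>, J [\<eta>, \<mu>]] p = 0"
 using JJ assms unfolding jacobi_structure_def by blast

lemma J_family_left:
 assumes a: "famL a" and \<theta>: "\<theta> : \<Gamma>L"
 shows "famL (%t. J [\<theta>, a t])"
 by (rule fo_family[where Q="%t \<nu>. J [\<theta>, \<nu>]", OF J_ops(3)[OF \<theta> \<theta>] _ a]) (intro TL.const_family J_ops(1) \<theta>)

lemma J_family:
 assumes a: "famL a" and b: "famL b"
 shows "famL (%t. J [a t, b t])"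
proof (rule fo_family[where Q="%t \<mu>. J [\<mu>, b t]", OF _ _ a])
 show "fo (%\<mu>. J [\<mu>, b t])" if "t : {0..1}" for t using J_ops(2) TL.family_section[OF b that] by blast
qed (rule J_family_left[OF b])

lemma J_derivative:
 assumes a: "famL a" and b: "famL b" and t: "t : {0..1}"
 shows "((%t. J [a t, b t] p) has_vector_derivative J [TL.dfam a t, b t] p + J [a t, TL.dfam b t] p) (at t within {0..1})"
proof -
 have f: "fo (%\<mu>. J [\<mu>, c t])" if "famL c" "t : {0..1}" for c t
  using J_ops(2) TL.family_section[OF that] by blast
 have "((%t. J [a t, b t] p) has_vector_derivative J [a t, TL.dfam b t] p + J [TL.dfam a t, b t] p) (at t within {0..1})"
 proof (rule fo_family_derivative[where Q="%t \<mu>. J [\<mu>, b t]" and Q'="%t \<mu>. J [\<mu>, TL.dfam b t]", OF f[OF b] f[OF TL.family_dfam[OF b]] _ a t])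
  fix \<theta> t p assume \<theta>: "\<theta> : \<Gamma>L" and t: "t : {0..1::real}"
  have "((%t. J [\<theta>, b t] p) has_vector_derivative 0 + J [\<theta>, TL.dfam b t] p) (at t within {0..1})"
   by (rule fo_family_derivative[where Q="%t \<nu>. J [\<theta>, \<nu>]" and Q'="%t \<nu> p. 0", OF J_ops(3)[OF \<theta> \<theta>] fo_0 _ b t]) simp
  then show "((%t. J [\<theta>, b t] p) has_vector_derivative J [\<theta>, TL.dfam b t] p) (at t within {0..1})" by simp
 qed
 then show ?thesis by (simp add: add.commute)
qed

end

section \<open>Formal exponentials of derivations\<close>

instantiation "fun" :: (type, real_vector) real_vector
begin

definition scaleR_fun_def: "r *\<^sub>R f = (%x. r *\<^sub>R f x)"

instance
 by standard (auto simp: scaleR_fun_def fun_eq_iff scaleR_add_right scaleR_add_left)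

end

lemma sum_fun_apply: "(\<Sum>i\<in>I. f i) x = (\<Sum>i\<in>I. f i x)"
 by (induction I rule: infinite_finite_induct) auto

lemma sum_triples_split_first:
 "(\<Sum>j\<le>m. \<Sum>i\<le>j. f i (j - i) (m - j)) = (\<Sum>i\<le>m. \<Sum>p\<le>m - i. f i p (m - i - p :: nat) :: 'a::comm_monoid_add)"
proof -
 have "(\<Sum>j\<le>m. \<Sum>i\<le>j. f i (j - i) (m - j)) = (\<Sum>(j,i)\<in>(SIGMA j:{..m}. {..j}). f i (j - i) (m - j))"
  by (simp add: sum.Sigma)
 also have "\<dots> = (\<Sum>(i,p)\<in>(SIGMA i:{..m}. {..m - i}). f i p (m - i - p))"
  by (rule sum.reindex_bij_witness[where i="%(i,p). (i + p, i)" and j="%(j,i). (i, j - i)"]) auto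
 also have "\<dots> = (\<Sum>i\<le>m. \<Sum>p\<le>m - i. f i p (m - i - p))" by (simp add: sum.Sigma)
 finally show ?thesis .
qed

lemma sum_triples_swap:
 "(\<Sum>j\<le>m. \<Sum>i\<le>m - j. f i j (m - j - i)) = (\<Sum>i\<le>m. \<Sum>p\<le>m - i. f i p (m - i - p :: nat) :: 'a::comm_monoid_add)"
proof -
 have "(\<Sum>j\<le>m. \<Sum>i\<le>m - j. f i j (m - j - i)) = (\<Sum>(j,i)\<in>(SIGMA j:{..m}. {..m - j}). f i j (m - j - i))"
  by (simp add: sum.Sigma)
 also have "\<dots> = (\<Sum>(i,p)\<in>(SIGMA i:{..m}. {..m - i}). f i p (m - i - p))"
  by (rule sum.reindex_bij_witness[where i="%(i,p). (p, i)" and j="%(j,i). (i, j)"]) (auto simp: diff_commute add.commute)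
 also have "\<dots> = (\<Sum>i\<le>m. \<Sum>p\<le>m - i. f i p (m - i - p))" by (simp add: sum.Sigma)
 finally show ?thesis .
qed

text \<open>
 \<open>B\<close> is a bracket, \<open>D i\<close> are commuting operators, and \<open>J m\<close> is the coefficient of \<open>\<epsilon>\<^sup>m\<close> in
 \<open>exp (ad D) B\<close> with \<open>D = \<Sum> \<epsilon>\<^sup>i D i\<close>. Since the \<open>D i\<close> commute, applying \<open>\<epsilon> d/d\<epsilon>\<close> gives the
 recursion \<open>J_rec\<close>, which is all that is used.
\<close>

locale formal_bracket =
 fixes V :: "'f::real_vector set" and B :: "'f => 'f => 'f" and D :: "nat => 'f => 'f"
  and J :: "nat => 'f => 'f => 'f"
 assumes V: "subspace V"
  and B_in: "!!a b. a : V ==> b : V ==> B a b : V"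
  and B_add: "!!a b c. a : V ==> b : V ==> c : V ==> B (a + b) c = B a c + B b c"
  and B_scale: "!!r a c. a : V ==> c : V ==> B (r *\<^sub>R a) c = r *\<^sub>R B a c"
  and B_anti: "!!a b. a : V ==> b : V ==> B a b = - B b a"
  and D_in: "!!i a. a : V ==> D i a : V"
  and D_add: "!!i a b. a : V ==> b : V ==> D i (a + b) = D i a + D i b"
  and D_scale: "!!i r a. a : V ==> D i (r *\<^sub>R a) = r *\<^sub>R D i a"
  and D_comm: "!!i j a. a : V ==> D i (D j a) = D j (D i a)"
  and J_0: "!!a b. a : V ==> b : V ==> J 0 a b = B a b"
  and J_rec: "!!m a b. a : V ==> b : V ==> real m *\<^sub>R J m a b =
   (\<Sum>i\<le>m. real i *\<^sub>R (D i (J (m - i) a b) - J (m - i) (D i a) b - J (m - i) a (D i b)))"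
begin

lemma V_ops: "0 : V" "a : V ==> b : V ==> a + b : V" "a : V ==> r *\<^sub>R a : V"
 "a : V ==> b : V ==> a - b : V" "(!!i. i : I ==> f i : V) ==> sum f I : V"
 using V by (auto intro: subspace_0 subspace_add subspace_scale subspace_diff subspace_sum)

lemma J_step:
 assumes "m > 0" "a : V" "b : V"
 shows "J m a b = (1 / real m) *\<^sub>R
  (\<Sum>i\<in>{1..m}. real i *\<^sub>R (D i (J (m - i) a b) - J (m - i) (D i a) b - J (m - i) a (D i b)))"
proof -
 have "J m a b = (1 / real m) *\<^sub>R (real m *\<^sub>R J m a b)" using assms(1) by simp
 also have "real m *\<^sub>R J m a b =
   (\<Sum>i\<in>{1..m}. real i *\<^sub>R (D i (J (m - i) a b) - J (m - i) (D i a) b - J (m - i) a (D i b)))"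
  unfolding J_rec[OF assms(2,3)] by (rule sum.mono_neutral_right) (auto simp: not_le)
 finally show ?thesis .
qed

lemma J_in: "a : V ==> b : V ==> J m a b : V"
proof (induction m arbitrary: a b rule: less_induct)
 case (less m)
 show ?case
 proof (cases "m = 0")
  case True
  then show ?thesis using less B_in J_0 by simp
 next
  case False
  then have "m > 0" by simp
  show ?thesis unfolding J_step[OF \<open>m > 0\<close> less.prems]
   by (intro V_ops D_in less.IH) (use less.prems D_in in auto)
 qed
qed

lemma D_0: "D i 0 = 0" using D_scale[OF V_ops(1), of i 0] by simp

lemma D_diff: "a : V ==> b : V ==> D i (a - b) = D i a - D i b"
 using D_add[of a "(-1) *\<^sub>R b" i] D_scale[of b i "-1"] V_ops(3)[of b "-1"] by simp

lemma D_sum: "(!!k. k : I ==> f k : V) ==> D i (\<Sum>k\<in>I. f k) = (\<Sum>k\<in>I. D i (f k))"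
 by (induction I rule: infinite_finite_induct) (auto simp: D_0 D_add V_ops(5))

lemma J_add: "a : V ==> b : V ==> c : V ==> J m (a + b) c = J m a c + J m b c"
proof (induction m arbitrary: a b c rule: less_induct)
 case (less m)
 show ?case
 proof (cases "m = 0")
  case True
  then show ?thesis using less B_add J_0 V_ops by simp
 next
  case False
  then have m: "m > 0" by simp
  have "real i *\<^sub>R (D i (J (m - i) (a + b) c) - J (m - i) (D i (a + b)) c - J (m - i) (a + b) (D i c))
   = real i *\<^sub>R (D i (J (m - i) a c) - J (m - i) (D i a) c - J (m - i) a (D i c)) +
    real i *\<^sub>R (D i (J (m - i) b c) - J (m - i) (D i b) c - J (m - i) b (D i c))" if "i : {1..m}" for i
  proof -
   have "m - i < m" using that m by auto
   then show ?thesis using less.prems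
    by (simp add: less.IH D_add D_in J_in scaleR_right_diff_distrib scaleR_right_distrib)
  qed
  then show ?thesis
   using less.prems by (simp add: J_step[OF m] V_ops(2) sum.distrib scaleR_right_distrib)
 qed
qed

lemma J_scale: "a : V ==> c : V ==> J m (r *\<^sub>R a) c = r *\<^sub>R J m a c"
proof (induction m arbitrary: a c rule: less_induct)
 case (less m)
 show ?case
 proof (cases "m = 0")
  case True
  then show ?thesis using less B_scale J_0 V_ops by simp
 next
  case False
  then have m: "m > 0" by simp
  have "real i *\<^sub>R (D i (J (m - i) (r *\<^sub>R a) c) - J (m - i) (D i (r *\<^sub>R a)) c - J (m - i) (r *\<^sub>R a) (D i c))
   = r *\<^sub>R (real i *\<^sub>R (D i (J (m - i) a c) - J (m - i) (D i a) c - J (m - i) a (D i c)))" if "i : {1..m}" for i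
  proof -
   have "m - i < m" using that m by auto
   then show ?thesis using less.prems
    by (simp add: less.IH D_scale D_in J_in scaleR_right_diff_distrib mult.commute)
  qed
  then have "(\<Sum>i\<in>{1..m}. real i *\<^sub>R (D i (J (m - i) (r *\<^sub>R a) c) - J (m - i) (D i (r *\<^sub>R a)) c - J (m - i) (r *\<^sub>R a) (D i c)))
   = r *\<^sub>R (\<Sum>i\<in>{1..m}. real i *\<^sub>R (D i (J (m - i) a c) - J (m - i) (D i a) c - J (m - i) a (D i c)))"
   unfolding scaleR_sum_right by (intro sum.cong) auto
  then show ?thesis
   using less.prems by (simp add: J_step[OF m] V_ops(3) mult.commute del: sum.cl_ivl_Suc)
 qed
qed

lemma J_anti: "a : V ==> b : V ==> J m a b = - J m b a"
proof (induction m arbitrary: a b rule: less_induct)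
 case (less m)
 show ?case
 proof (cases "m = 0")
  case True
  then show ?thesis using less.prems B_anti J_0 by metis
 next
  case False
  then have m: "m > 0" by simp
  have "real i *\<^sub>R (D i (J (m - i) a b) - J (m - i) (D i a) b - J (m - i) a (D i b))
   = - (real i *\<^sub>R (D i (J (m - i) b a) - J (m - i) (D i b) a - J (m - i) b (D i a)))" if "i : {1..m}" for i
  proof -
   have lt: "m - i < m" using that m by auto
   have "D i (J (m - i) a b) = - D i (J (m - i) b a)"
    using less.IH[OF lt less.prems] D_scale[of "J (m - i) b a" i "-1"] J_in[OF less.prems(2,1)] by simp
   moreover have "J (m - i) (D i a) b = - J (m - i) b (D i a)" "J (m - i) a (D i b) = - J (m - i) (D i b) a"
    using less.IH[OF lt] less.prems D_in by blast+
   ultimately show ?thesis by (simp add: scaleR_right_diff_distrib scaleR_right_distrib)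
  qed
  then have "(\<Sum>i\<in>{1..m}. real i *\<^sub>R (D i (J (m - i) a b) - J (m - i) (D i a) b - J (m - i) a (D i b)))
   = - (\<Sum>i\<in>{1..m}. real i *\<^sub>R (D i (J (m - i) b a) - J (m - i) (D i b) a - J (m - i) b (D i a)))"
   by (simp add: sum_negf)
  then show ?thesis
   unfolding J_step[OF m less.prems] J_step[OF m less.prems(2,1)] by (simp only: scaleR_minus_right)
 qed
qed

lemma J_0_left: "b : V ==> J m 0 b = 0" using J_scale[OF V_ops(1), of b m 0] by simp
lemma J_minus_left: "a : V ==> b : V ==> J m (- a) b = - J m a b" using J_scale[of a b m "-1"] by simp
lemma V_minus: "a : V ==> - a : V" using V_ops(3)[of a "-1"] by simp
lemma J_diff_left: "a : V ==> b : V ==> c : V ==> J m (a - b) c = J m a c - J m b c"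
 using J_add[of a "- b" c m] J_minus_left[of b c m] V_minus by simp
lemma J_sum_left: "(!!k. k : I ==> f k : V) ==> c : V ==> J m (\<Sum>k\<in>I. f k) c = (\<Sum>k\<in>I. J m (f k) c)"
 by (induction I rule: infinite_finite_induct) (auto simp: J_0_left J_add V_ops(5))
lemma J_add_right: "a : V ==> b : V ==> c : V ==> J m c (a + b) = J m c a + J m c b"
 using J_anti[of c "a + b" m] J_anti[of c a m] J_anti[of c b m] J_add[of a b c m] V_ops(2) by simp
lemma J_scale_right: "a : V ==> c : V ==> J m c (r *\<^sub>R a) = r *\<^sub>R J m c a"
 using J_anti[of c "r *\<^sub>R a" m] J_anti[of c a m] J_scale[of a c m r] V_ops(3) by simp
lemma J_minus_right: "a : V ==> b : V ==> J m b (- a) = - J m b a" using J_scale_right[of a b m "-1"] by simp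
lemma J_diff_right: "a : V ==> b : V ==> c : V ==> J m c (a - b) = J m c a - J m c b"
 using J_add_right[of a "- b" c m] J_minus_right[of b c m] V_minus by simp
lemma J_sum_right: "(!!k. k : I ==> f k : V) ==> c : V ==> J m c (\<Sum>k\<in>I. f k) = (\<Sum>k\<in>I. J m c (f k))"
proof -
 assume f: "!!k. k : I ==> f k : V" and c: "c : V"
 have "J m c (\<Sum>k\<in>I. f k) = - (\<Sum>k\<in>I. J m (f k) c)"
  using J_anti[OF c V_ops(5)[of I f]] J_sum_left[of I f c m] f c by simp
 also have "\<dots> = (\<Sum>k\<in>I. J m c (f k))"
  unfolding sum_negf[symmetric] by (intro sum.cong refl) (simp add: J_anti[OF c f])
 finally show ?thesis .
qed

lemmas in_rules = V_ops D_in J_in V_minus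

definition G :: "nat => 'f => 'f => 'f => 'f" where
 "G m a b c = (\<Sum>j\<le>m. J j a (J (m - j) b c))"

lemma G_in: "a : V ==> b : V ==> c : V ==> G m a b c : V"
 unfolding G_def by (intro in_rules)

lemma G_rec:
 assumes a: "a : V" and b: "b : V" and c: "c : V"
 shows "real m *\<^sub>R G m a b c = (\<Sum>i\<le>m. real i *\<^sub>R (D i (G (m - i) a b c) - G (m - i) (D i a) b c
  - G (m - i) a (D i b) c - G (m - i) a b (D i c)))"
proof -
 let ?X = "%k. J k b c"
 have "real m *\<^sub>R G m a b c = (\<Sum>j\<le>m. real j *\<^sub>R J j a (?X (m - j)) + J j a (real (m - j) *\<^sub>R ?X (m - j)))"
  unfolding G_def scaleR_sum_right
 proof (rule sum.cong[OF refl])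
  fix j assume "j : {..m}"
  then have "real m = real j + real (m - j)" by simp
  then show "real m *\<^sub>R J j a (?X (m - j)) = real j *\<^sub>R J j a (?X (m - j)) + J j a (real (m - j) *\<^sub>R ?X (m - j))"
   using a b c by (simp only: J_scale_right J_in scaleR_left_distrib)
 qed
 also have "\<dots> = (\<Sum>j\<le>m. \<Sum>i\<le>j. real i *\<^sub>R (D i (J (j - i) a (?X (m - j))) - J (j - i) (D i a) (?X (m - j)) - J (j - i) a (D i (?X (m - j)))))
   + (\<Sum>j\<le>m. \<Sum>i\<le>m - j. real i *\<^sub>R (J j a (D i (?X (m - j - i))) - J j a (J (m - j - i) (D i b) c) - J j a (J (m - j - i) b (D i c))))"
  unfolding sum.distrib
 proof (intro arg_cong2[where f="(+)"] sum.cong refl)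
  fix j
  show "real j *\<^sub>R J j a (?X (m - j)) = (\<Sum>i\<le>j. real i *\<^sub>R (D i (J (j - i) a (?X (m - j))) - J (j - i) (D i a) (?X (m - j)) - J (j - i) a (D i (?X (m - j)))))"
   by (rule J_rec) (use a b c in \<open>auto intro: in_rules\<close>)
  show "J j a (real (m - j) *\<^sub>R ?X (m - j)) = (\<Sum>i\<le>m - j. real i *\<^sub>R (J j a (D i (?X (m - j - i))) - J j a (J (m - j - i) (D i b) c) - J j a (J (m - j - i) b (D i c))))"
   unfolding J_rec[OF b c] using a b c
   by (subst J_sum_right) (auto intro!: in_rules sum.cong simp: J_scale_right J_diff_right in_rules)
 qed
 also have "\<dots> = (\<Sum>i\<le>m. \<Sum>p\<le>m - i. real i *\<^sub>R (D i (J p a (?X (m - i - p))) - J p (D i a) (?X (m - i - p)) - J p a (D i (?X (m - i - p)))))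
   + (\<Sum>i\<le>m. \<Sum>p\<le>m - i. real i *\<^sub>R (J p a (D i (?X (m - i - p))) - J p a (J (m - i - p) (D i b) c) - J p a (J (m - i - p) b (D i c))))"
  using sum_triples_split_first[of "%i p q. real i *\<^sub>R (D i (J p a (?X q)) - J p (D i a) (?X q) - J p a (D i (?X q)))" m]
   sum_triples_swap[of "%i p q. real i *\<^sub>R (J p a (D i (?X q)) - J p a (J q (D i b) c) - J p a (J q b (D i c)))" m]
  by simp
 also have "\<dots> = (\<Sum>i\<le>m. real i *\<^sub>R (\<Sum>p\<le>m - i. D i (J p a (?X (m - i - p))) - J p (D i a) (?X (m - i - p))
   - J p a (J (m - i - p) (D i b) c) - J p a (J (m - i - p) b (D i c))))"
  unfolding sum.distrib[symmetric] scaleR_sum_right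
  by (intro sum.cong refl) (simp add: scaleR_right_diff_distrib)
 also have "\<dots> = (\<Sum>i\<le>m. real i *\<^sub>R (D i (G (m - i) a b c) - G (m - i) (D i a) b c
  - G (m - i) a (D i b) c - G (m - i) a b (D i c)))"
  unfolding G_def using a b c by (simp add: D_sum in_rules sum_subtractf)
 finally show ?thesis .
qed

lemma jacobi:
 assumes "!!a b c. a : V ==> b : V ==> c : V ==> B a (B b c) + B b (B c a) + B c (B a b) = 0"
 shows "a : V ==> b : V ==> c : V ==> G m a b c + G m b c a + G m c a b = 0"
proof (induction m arbitrary: a b c rule: less_induct)
 case (less m)
 show ?case
 proof (cases "m = 0")
  case True
  then show ?thesis using assms less.prems by (simp add: G_def J_0 B_in)
 next
  case False
  have "real m *\<^sub>R (G m a b c + G m b c a + G m c a b) =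
   (\<Sum>i\<le>m. real i *\<^sub>R (D i (G (m - i) a b c + G (m - i) b c a + G (m - i) c a b)
    - (G (m - i) (D i a) b c + G (m - i) b c (D i a) + G (m - i) c (D i a) b)
    - (G (m - i) a (D i b) c + G (m - i) (D i b) c a + G (m - i) c a (D i b))
    - (G (m - i) a b (D i c) + G (m - i) b (D i c) a + G (m - i) (D i c) a b)))"
   unfolding scaleR_right_distrib G_rec[OF less.prems] G_rec[OF less.prems(2,3,1)] G_rec[OF less.prems(3,1,2)]
    sum.distrib[symmetric]
   by (intro sum.cong refl) (use less.prems in \<open>simp add: D_add G_in V_ops algebra_simps\<close>)
  also have "\<dots> = 0"
  proof (rule sum.neutral, intro ballI)
   fix i assume i: "i : {..m}"
   show "real i *\<^sub>R (D i (G (m - i) a b c + G (m - i) b c a + G (m - i) c a b)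
    - (G (m - i) (D i a) b c + G (m - i) b c (D i a) + G (m - i) c (D i a) b)
    - (G (m - i) a (D i b) c + G (m - i) (D i b) c a + G (m - i) c a (D i b))
    - (G (m - i) a b (D i c) + G (m - i) b (D i c) a + G (m - i) (D i c) a b)) = 0"
   proof (cases "i = 0")
    case False
    then have "m - i < m" using i by auto
    note IH = less.IH[OF this]
    show ?thesis
     using IH[OF less.prems] IH[of "D i a" b c] IH[of a "D i b" c] IH[of a b "D i c"] less.prems D_in D_0
     by (simp add: add.commute add.left_commute)
   qed simp
  qed
  finally show ?thesis using False by simp
 qed
qed

lemma exp_derivation:
 fixes E :: "nat => 'f" and R :: "nat => 'f => 'f"
 assumes E_in: "!!m. E m : V"
  and E_rec: "!!m. real m *\<^sub>R E m = (\<Sum>i\<le>m. real i *\<^sub>R D i (E (m - i)))"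
  and R_0: "!!b. b : V ==> R 0 b = B (E 0) b"
  and R_rec: "!!m b. b : V ==> real m *\<^sub>R R m b = (\<Sum>i\<le>m. real i *\<^sub>R (D i (R (m - i) b) - R (m - i) (D i b)))"
 shows "b : V ==> R m b = (\<Sum>j\<le>m. J (m - j) (E j) b)"
proof (induction m arbitrary: b rule: less_induct)
 case (less m)
 note b = less.prems
 show ?case
 proof (cases "m = 0")
  case True
  then show ?thesis using b R_0 J_0 E_in by simp
 next
  case False
  have "real m *\<^sub>R (\<Sum>j\<le>m. J (m - j) (E j) b) = (\<Sum>j\<le>m. J (m - j) (real j *\<^sub>R E j) b + real (m - j) *\<^sub>R J (m - j) (E j) b)"
   unfolding scaleR_sum_right
  proof (rule sum.cong[OF refl])
   fix j assume "j : {..m}"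
   then have "real m = real j + real (m - j)" by simp
   then show "real m *\<^sub>R J (m - j) (E j) b = J (m - j) (real j *\<^sub>R E j) b + real (m - j) *\<^sub>R J (m - j) (E j) b"
    using b E_in by (simp only: J_scale scaleR_left_distrib)
  qed
  also have "\<dots> = (\<Sum>j\<le>m. \<Sum>i\<le>j. real i *\<^sub>R J (m - j) (D i (E (j - i))) b)
    + (\<Sum>j\<le>m. \<Sum>i\<le>m - j. real i *\<^sub>R (D i (J (m - j - i) (E j) b) - J (m - j - i) (D i (E j)) b - J (m - j - i) (E j) (D i b)))"
   unfolding sum.distrib
  proof (intro arg_cong2[where f="(+)"] sum.cong refl)
   fix j
   show "J (m - j) (real j *\<^sub>R E j) b = (\<Sum>i\<le>j. real i *\<^sub>R J (m - j) (D i (E (j - i))) b)"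
    unfolding E_rec using b E_in by (subst J_sum_left) (auto intro!: in_rules sum.cong simp: J_scale in_rules)
  qed (rule J_rec[OF E_in b])
  also have "\<dots> = (\<Sum>i\<le>m. \<Sum>p\<le>m - i. real i *\<^sub>R J (m - i - p) (D i (E p)) b)
    + (\<Sum>i\<le>m. \<Sum>p\<le>m - i. real i *\<^sub>R (D i (J (m - i - p) (E p) b) - J (m - i - p) (D i (E p)) b - J (m - i - p) (E p) (D i b)))"
   using sum_triples_split_first[of "%i p q. real i *\<^sub>R J q (D i (E p)) b" m]
    sum_triples_swap[of "%i p q. real i *\<^sub>R (D i (J q (E p) b) - J q (D i (E p)) b - J q (E p) (D i b))" m]
   by simp
  also have "\<dots> = (\<Sum>i\<le>m. real i *\<^sub>R (D i (\<Sum>p\<le>m - i. J (m - i - p) (E p) b) - (\<Sum>p\<le>m - i. J (m - i - p) (E p) (D i b))))"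
   unfolding sum.distrib[symmetric] scaleR_right_distrib[symmetric] scaleR_sum_right[symmetric]
   using b E_in by (simp add: D_sum in_rules sum_subtractf)
  also have "\<dots> = (\<Sum>i\<le>m. real i *\<^sub>R (D i (R (m - i) b) - R (m - i) (D i b)))"
  proof (rule sum.cong[OF refl])
   fix i assume i: "i : {..m}"
   show "real i *\<^sub>R (D i (\<Sum>p\<le>m - i. J (m - i - p) (E p) b) - (\<Sum>p\<le>m - i. J (m - i - p) (E p) (D i b)))
    = real i *\<^sub>R (D i (R (m - i) b) - R (m - i) (D i b))"
   proof (cases "i = 0")
    case False
    then have "m - i < m" using i by auto
    then show ?thesis using less.IH[of "m - i"] b D_in by simp
   qed simp
  qed
  also have "\<dots> = real m *\<^sub>R R m b" using R_rec[OF b] by simp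
  finally show ?thesis using False by simp
 qed
qed

lemma time_derivative:
 fixes T :: "'f => 'f" and D' :: "nat => 'f => 'f"
 assumes T_in: "!!a. a : V ==> T a : V"
  and T_add: "!!a b. a : V ==> b : V ==> T (a + b) = T a + T b"
  and T_scale: "!!r a. a : V ==> T (r *\<^sub>R a) = r *\<^sub>R T a"
  and D'_in: "!!i a. a : V ==> D' i a : V"
  and D'_add: "!!i a b. a : V ==> b : V ==> D' i (a + b) = D' i a + D' i b"
  and D'_scale: "!!i r a. a : V ==> D' i (r *\<^sub>R a) = r *\<^sub>R D' i a"
  and D'_comm: "!!i j a. a : V ==> D i (D' j a) = D' j (D i a)"
  and D'_0: "!!a. a : V ==> D' 0 a = 0"
  and T_D: "!!i a. a : V ==> T (D i a) = D' i a + D i (T a)"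
  and T_B: "!!a b. a : V ==> b : V ==> T (B a b) = B (T a) b + B a (T b)"
 shows "a : V ==> b : V ==> T (J m a b) = J m (T a) b + J m a (T b) +
  (\<Sum>i\<le>m. D' i (J (m - i) a b) - J (m - i) (D' i a) b - J (m - i) a (D' i b))"
proof (induction m arbitrary: a b rule: less_induct)
 case (less m)
 have D'00: "D' i 0 = 0" for i using D'_scale[OF V_ops(1), of i 0] by simp
 have D'_diff: "D' i (x - y) = D' i x - D' i y" if "x : V" "y : V" for i x y
  using D'_add[of x "(-1) *\<^sub>R y" i] D'_scale[of y i "-1"] V_ops(3)[of y "-1"] that by simp
 have D'_sum: "D' i (\<Sum>k\<in>I. f k) = (\<Sum>k\<in>I. D' i (f k))" if "!!k. k : I ==> f k : V" for i f and I :: "nat set"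
  using that by (induction I rule: infinite_finite_induct) (auto simp: D'00 D'_add V_ops(5))
 have T0: "T 0 = 0" using T_scale[OF V_ops(1), of 0] by simp
 have T_diff: "T (x - y) = T x - T y" if "x : V" "y : V" for x y
  using T_add[of x "(-1) *\<^sub>R y"] T_scale[of y "-1"] V_ops(3)[of y "-1"] that by simp
 have T_sum: "T (\<Sum>k\<in>I. f k) = (\<Sum>k\<in>I. T (f k))" if "!!k. k : I ==> f k : V" for f and I :: "nat set"
  using that by (induction I rule: infinite_finite_induct) (auto simp: T0 T_add V_ops(5))
 define L where "L m a b = T (J m a b) - J m (T a) b - J m a (T b)" for m a b
 define ad' where "ad' i k a b = D' i (J k a b) - J k (D' i a) b - J k a (D' i b)" for i k a b
 define C where "C i k q = D i (ad' k q a b) - ad' k q (D i a) b - ad' k q a (D i b)" for i k q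
 have IH: "L k x y = (\<Sum>i\<le>k. ad' i (k - i) x y)" if "k < m" "x : V" "y : V" for k x y
  using less.IH[OF that] by (simp add: L_def ad'_def)
 note ins = in_rules D'_in T_in
 have ad'_in: "ad' i k x y : V" if "x : V" "y : V" for i k x y
  unfolding ad'_def using that by (intro ins)
 note a = less.prems(1) and b = less.prems(2)
 have "L m a b = (\<Sum>i\<le>m. ad' i (m - i) a b)"
 proof (cases "m = 0")
  case True
  have "J 0 a (0 :: 'f) = 0" using J_scale_right[OF V_ops(1) a, of 0 0] by simp
  moreover have "D' 0 (J 0 a b) = 0" by (intro D'_0 J_in a b)
  moreover have "L 0 a b = 0" using a b by (simp add: L_def J_0 T_B T_in)
  ultimately show ?thesis using a b True by (simp add: ad'_def D'_0 J_0_left)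
 next
  case False
  have "real m *\<^sub>R L m a b = (\<Sum>i\<le>m. real i *\<^sub>R (ad' i (m - i) a b
    + (D i (L (m - i) a b) - L (m - i) (D i a) b - L (m - i) a (D i b))))"
  proof -
   have "real m *\<^sub>R L m a b = T (real m *\<^sub>R J m a b) - real m *\<^sub>R J m (T a) b - real m *\<^sub>R J m a (T b)"
    using a b by (simp add: L_def scaleR_right_diff_distrib T_scale ins)
   also have "T (real m *\<^sub>R J m a b) = (\<Sum>i\<le>m. real i *\<^sub>R (D' i (J (m - i) a b) + D i (T (J (m - i) a b))
     - T (J (m - i) (D i a) b) - T (J (m - i) a (D i b))))"
    unfolding J_rec[OF a b]
    by (subst T_sum) (use a b in \<open>auto intro!: ins sum.cong simp: T_scale T_diff T_D ins\<close>)
   finally show ?thesis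
    unfolding J_rec[OF T_in[OF a] b] J_rec[OF a T_in[OF b]] sum_subtractf[symmetric]
    by (simp only:) (intro sum.cong refl, use a b in \<open>simp add: L_def ad'_def T_D D_diff D_add J_add J_add_right ins algebra_simps\<close>)
  qed
  also have "\<dots> = (\<Sum>i\<le>m. real i *\<^sub>R ad' i (m - i) a b) + (\<Sum>i\<le>m. \<Sum>k\<le>m - i. real i *\<^sub>R C i k (m - i - k))"
   unfolding sum.distrib[symmetric]
  proof (intro sum.cong refl)
   fix i assume i: "i : {..m}"
   show "real i *\<^sub>R (ad' i (m - i) a b + (D i (L (m - i) a b) - L (m - i) (D i a) b - L (m - i) a (D i b))) =
    real i *\<^sub>R ad' i (m - i) a b + (\<Sum>k\<le>m - i. real i *\<^sub>R C i k (m - i - k))"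
   proof (cases "i = 0")
    case False
    then have lt: "m - i < m" using i by auto
    show ?thesis using a b unfolding C_def scaleR_sum_right[symmetric] scaleR_right_distrib[symmetric]
     by (simp add: IH[OF lt] D_in D_sum ad'_in sum_subtractf)
   qed simp
  qed
  also have "(\<Sum>i\<le>m. \<Sum>k\<le>m - i. real i *\<^sub>R C i k (m - i - k)) = (\<Sum>k\<le>m. \<Sum>i\<le>m - k. real i *\<^sub>R C i k (m - k - i))"
   using sum_triples_swap[of "%i k q. real i *\<^sub>R C i k q" m] by simp
  also have "\<dots> = (\<Sum>k\<le>m. real (m - k) *\<^sub>R ad' k (m - k) a b)"
  proof (intro sum.cong refl)
   fix k
   let ?q = "m - k"
   have "real ?q *\<^sub>R ad' k ?q a b = D' k (real ?q *\<^sub>R J ?q a b) - real ?q *\<^sub>R J ?q (D' k a) b - real ?q *\<^sub>R J ?q a (D' k b)"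
    using a b by (simp add: ad'_def scaleR_right_diff_distrib D'_scale ins)
   also have "D' k (real ?q *\<^sub>R J ?q a b) = (\<Sum>i\<le>?q. real i *\<^sub>R (D' k (D i (J (?q - i) a b)) - D' k (J (?q - i) (D i a) b) - D' k (J (?q - i) a (D i b))))"
    unfolding J_rec[OF a b]
    by (subst D'_sum) (use a b in \<open>auto intro!: ins sum.cong simp: D'_scale D'_diff ins\<close>)
   finally show "(\<Sum>i\<le>?q. real i *\<^sub>R C i k (?q - i)) = real ?q *\<^sub>R ad' k ?q a b"
    unfolding J_rec[OF D'_in[OF a] b] J_rec[OF a D'_in[OF b]] sum_subtractf[symmetric]
    by (simp only:) (intro sum.cong refl, use a b in \<open>simp add: C_def ad'_def D_diff D_add D'_comm ins algebra_simps\<close>)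
  qed
  also have "(\<Sum>i\<le>m. real i *\<^sub>R ad' i (m - i) a b) + (\<Sum>k\<le>m. real (m - k) *\<^sub>R ad' k (m - k) a b) =
    real m *\<^sub>R (\<Sum>i\<le>m. ad' i (m - i) a b)"
   unfolding sum.distrib[symmetric] scaleR_sum_right scaleR_left_distrib[symmetric]
   by (intro sum.cong refl) simp
  finally show ?thesis using False by simp
 qed
 then show ?case by (simp add: L_def ad'_def algebra_simps)
qed

end

lemma sum_triangle_swap: "(\<Sum>j\<le>m. \<Sum>i\<le>m - j. f i j) = (\<Sum>i\<le>m. \<Sum>j\<le>m - i. f i j :: 'a::comm_monoid_add)" for m :: nat
 using sum_triples_swap[where m=m and f="%i j k. f i j"] by simp

primrec adp :: "(nat => 'f => 'f::real_vector) => (nat => 'f) => nat => nat => 'f" where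
 "adp A Q 0 = Q"
| "adp A Q (Suc n) = (%m. \<Sum>i\<le>m. A i (adp A Q n (m - i)))"

definition expo :: "(nat => 'f => 'f::real_vector) => (nat => 'f) => nat => 'f" where
 "expo A Q m = (\<Sum>n\<le>m. (1 / fact n) *\<^sub>R adp A Q n m)"

definition single :: "'f::zero => nat => 'f" where
 "single q m = (if m = 0 then q else 0)"

locale commuting_ops =
 fixes V :: "'f::real_vector set" and A :: "nat => 'f => 'f"
 assumes V: "subspace V"
  and A_in: "!!i a. a : V ==> A i a : V"
  and A_add: "!!i a b. a : V ==> b : V ==> A i (a + b) = A i a + A i b"
  and A_scale: "!!i r a. a : V ==> A i (r *\<^sub>R a) = r *\<^sub>R A i a"
  and A_comm: "!!i j a. a : V ==> A i (A j a) = A j (A i a)"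
  and A_0: "!!a. a : V ==> A 0 a = 0"
begin

lemma V_ops: "0 : V" "a : V ==> b : V ==> a + b : V" "a : V ==> r *\<^sub>R a : V"
 "(!!i. i : I ==> f i : V) ==> sum f I : V"
 using V by (auto intro: subspace_0 subspace_add subspace_scale subspace_sum)

lemma A_zero: "A i 0 = 0" using A_scale[OF V_ops(1), of i 0] by simp

lemma A_sum: "(!!k. k : I ==> f k : V) ==> A i (\<Sum>k\<in>I. f k) = (\<Sum>k\<in>I. A i (f k))"
 by (induction I rule: infinite_finite_induct) (auto simp: A_zero A_add V_ops)

lemma adp_in: "(!!m. Q m : V) ==> adp A Q n m : V"
 by (induction n arbitrary: m) (auto intro: V_ops A_in)

lemma single_in: "q : V ==> single q m : V" by (simp add: single_def V_ops)

lemma adp_split: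
 assumes Q: "!!m. Q m : V"
 shows "adp A Q n m = (\<Sum>j\<le>m. adp A (single (Q j)) n (m - j))"
proof (induction n arbitrary: m)
 case 0
 have "(\<Sum>j\<le>m. single (Q j) (m - j)) = (\<Sum>j\<le>m. if j = m then Q j else 0)"
  by (rule sum.cong) (auto simp: single_def)
 then show ?case by simp
next
 case (Suc n)
 have "adp A Q (Suc n) m = (\<Sum>i\<le>m. \<Sum>j\<le>m - i. A i (adp A (single (Q j)) n (m - i - j)))"
  by (simp add: Suc A_sum adp_in single_in Q)
 also have "\<dots> = (\<Sum>j\<le>m. \<Sum>i\<le>m - j. A i (adp A (single (Q j)) n (m - i - j)))" by (rule sum_triangle_swap)
 finally show ?case by (simp add: add.commute)
qed

context
 fixes q assumes q: "q : V"
begin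

abbreviation "a n m \<equiv> adp A (single q) n m"

lemma a_in: "a n m : V" by (rule adp_in[OF single_in[OF q]])

lemma adp_vanish: "n > m ==> a n m = 0"
proof (induction n arbitrary: m)
 case (Suc n)
 have "A i (a n (m - i)) = 0" if "i \<le> m" for i
 proof (cases "i = 0")
  case True then show ?thesis by (simp add: A_0 a_in)
 next
  case False
  then have "a n (m - i) = 0" using Suc that by auto
  then show ?thesis by (simp add: A_zero)
 qed
 then show ?case by simp
qed simp

lemma adp_rec: "real m *\<^sub>R a (Suc n) m = real (Suc n) *\<^sub>R (\<Sum>i\<le>m. real i *\<^sub>R A i (a n (m - i)))"
proof (induction n arbitrary: m)
 case 0
 have "real m *\<^sub>R A i (single q (m - i)) = real i *\<^sub>R A i (single q (m - i))" if "i \<le> m" for i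
  using that by (cases "i = m") (simp_all add: single_def A_zero)
 then have "(\<Sum>i\<le>m. real m *\<^sub>R A i (single q (m - i))) = (\<Sum>i\<le>m. real i *\<^sub>R A i (single q (m - i)))"
  by (intro sum.cong) auto
 then show ?case by (simp add: scaleR_right.sum)
next
 case (Suc n)
 have "real m *\<^sub>R a (Suc (Suc n)) m = (\<Sum>i\<le>m. real i *\<^sub>R A i (a (Suc n) (m - i)) + A i (real (m - i) *\<^sub>R a (Suc n) (m - i)))"
  unfolding adp.simps(2)[of A _ "Suc n"] scaleR_right.sum
 proof (rule sum.cong[OF refl])
  fix i assume "i : {..m}"
  then have "real m = real i + real (m - i)" by simp
  then show "real m *\<^sub>R A i (a (Suc n) (m - i)) = real i *\<^sub>R A i (a (Suc n) (m - i)) + A i (real (m - i) *\<^sub>R a (Suc n) (m - i))"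
   by (simp only: A_scale[OF a_in] scaleR_add_left)
 qed
 also have "\<dots> = (\<Sum>i\<le>m. real i *\<^sub>R A i (a (Suc n) (m - i))) + (\<Sum>i\<le>m. A i (real (Suc n) *\<^sub>R (\<Sum>k\<le>m - i. real k *\<^sub>R A k (a n (m - i - k)))))"
  by (simp only: sum.distrib Suc)
 also have "(\<Sum>i\<le>m. A i (real (Suc n) *\<^sub>R (\<Sum>k\<le>m - i. real k *\<^sub>R A k (a n (m - i - k))))) =
   real (Suc n) *\<^sub>R (\<Sum>i\<le>m. \<Sum>k\<le>m - i. real k *\<^sub>R A k (A i (a n (m - k - i))))"
 proof -
  have "A i (real (Suc n) *\<^sub>R (\<Sum>k\<le>m - i. real k *\<^sub>R A k (a n (m - i - k)))) =
    real (Suc n) *\<^sub>R (\<Sum>k\<le>m - i. real k *\<^sub>R A k (A i (a n (m - k - i))))" for i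
   by (simp add: A_scale A_sum V_ops A_in a_in A_comm[of _ i] diff_commute[of m i] del: diff_diff_left adp.simps of_nat_Suc)
  then show ?thesis by (simp only: scaleR_right.sum)
 qed
 also have "(\<Sum>i\<le>m. \<Sum>k\<le>m - i. real k *\<^sub>R A k (A i (a n (m - k - i)))) = (\<Sum>k\<le>m. \<Sum>i\<le>m - k. real k *\<^sub>R A k (A i (a n (m - k - i))))"
  by (rule sum_triangle_swap)
 also have "\<dots> = (\<Sum>k\<le>m. real k *\<^sub>R A k (a (Suc n) (m - k)))"
  by (simp add: A_sum A_in a_in scaleR_right.sum del: diff_diff_left)
 also have "(\<Sum>i\<le>m. real i *\<^sub>R A i (a (Suc n) (m - i))) + real (Suc n) *\<^sub>R (\<Sum>k\<le>m. real k *\<^sub>R A k (a (Suc n) (m - k))) =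
   real (Suc (Suc n)) *\<^sub>R (\<Sum>i\<le>m. real i *\<^sub>R A i (a (Suc n) (m - i)))"
  by (simp only: of_nat_Suc[of "Suc n"] scaleR_add_left scaleR_one)
 finally show ?case .
qed

lemma expo_in: "expo A (single q) m : V"
 unfolding expo_def by (intro V_ops a_in)

lemma expo_0: "expo A (single q) 0 = q" by (simp add: expo_def single_def)

lemma expo_rec: "real m *\<^sub>R expo A (single q) m = (\<Sum>i\<le>m. real i *\<^sub>R A i (expo A (single q) (m - i)))"
proof -
 have "real m *\<^sub>R expo A (single q) m = (\<Sum>n\<le>m. (1 / fact n) *\<^sub>R (real m *\<^sub>R a n m))"
  by (simp add: expo_def scaleR_right.sum mult.commute)
 also have "\<dots> = (\<Sum>n<m. (1 / fact (Suc n)) *\<^sub>R (real m *\<^sub>R a (Suc n) m))"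
 proof -
  have "real m *\<^sub>R a 0 m = 0" by (simp add: single_def)
  then show ?thesis by (simp only: sum.lessThan_Suc_shift[of _ m] lessThan_Suc_atMost[symmetric]) simp
 qed
 also have "\<dots> = (\<Sum>n<m. (1 / fact n) *\<^sub>R (\<Sum>i\<le>m. real i *\<^sub>R A i (a n (m - i))))"
 proof (rule sum.cong[OF refl])
  fix n
  have "(1 / fact (Suc n)) * real (Suc n) = 1 / fact n" by (simp add: divide_simps del: of_nat_Suc)
  then show "(1 / fact (Suc n)) *\<^sub>R (real m *\<^sub>R a (Suc n) m) = (1 / fact n) *\<^sub>R (\<Sum>i\<le>m. real i *\<^sub>R A i (a n (m - i)))"
   by (simp only: adp_rec scaleR_scaleR)
 qed
 also have "\<dots> = (\<Sum>i\<le>m. \<Sum>n<m. (1 / fact n) *\<^sub>R (real i *\<^sub>R A i (a n (m - i))))"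
  unfolding scaleR_right.sum by (rule sum.swap)
 also have "\<dots> = (\<Sum>i\<le>m. real i *\<^sub>R A i (expo A (single q) (m - i)))"
 proof (rule sum.cong[OF refl])
  fix i assume "i : {..m}"
  then have i: "i \<le> m" by simp
  show "(\<Sum>n<m. (1 / fact n) *\<^sub>R (real i *\<^sub>R A i (a n (m - i)))) = real i *\<^sub>R A i (expo A (single q) (m - i))"
  proof (cases "i = 0")
   case False
   have "(\<Sum>n<m. (1 / fact n) *\<^sub>R (real i *\<^sub>R A i (a n (m - i)))) = (\<Sum>n\<le>m - i. (1 / fact n) *\<^sub>R (real i *\<^sub>R A i (a n (m - i))))"
    by (rule sum.mono_neutral_right) (use i False in \<open>auto simp: adp_vanish A_zero\<close>)
   then show ?thesis by (simp add: expo_def A_sum V_ops a_in A_scale scaleR_right.sum mult.commute)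
  qed simp
 qed
 finally show ?thesis .
qed

end

lemma expo_split:
 assumes Q: "!!m. Q m : V"
 shows "expo A Q m = (\<Sum>j\<le>m. expo A (single (Q j)) (m - j))"
proof -
 have "expo A Q m = (\<Sum>j\<le>m. \<Sum>n\<le>m. (1 / fact n) *\<^sub>R adp A (single (Q j)) n (m - j))"
  unfolding expo_def adp_split[OF Q] scaleR_right.sum by (rule sum.swap)
 also have "\<dots> = (\<Sum>j\<le>m. expo A (single (Q j)) (m - j))"
  unfolding expo_def by (rule sum.cong[OF refl], rule sum.mono_neutral_right) (auto simp: adp_vanish Q)
 finally show ?thesis .
qed

end

locale commuting_derivations =
 fixes C :: "'f::real_vector set" and D :: "nat => 'f => 'f"
 assumes C: "subspace C"
  and D_in: "!!i a. a : C ==> D i a : C"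
  and D_add: "!!i a b. a : C ==> b : C ==> D i (a + b) = D i a + D i b"
  and D_scale: "!!i r a. a : C ==> D i (r *\<^sub>R a) = r *\<^sub>R D i a"
  and D_comm: "!!i j a. a : C ==> D i (D j a) = D j (D i a)"
  and D_zero: "!!a. a : C ==> D 0 a = 0"
begin

lemma C_ops: "0 : C" "a : C ==> b : C ==> a + b : C" "a : C ==> r *\<^sub>R a : C" "a : C ==> b : C ==> a - b : C" "a : C ==> - a : C"
 using C by (auto intro: subspace_0 subspace_add subspace_scale subspace_diff subspace_neg)

lemma D_minus: "a : C ==> D i (- a) = - D i a" using D_scale[of a i "-1"] by simp

lemma D_0: "D i 0 = 0" using D_scale[OF C_ops(1), of i 0] by simp

lemma D_diff: "a : C ==> b : C ==> D i (a - b) = D i a - D i b"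
 using D_add[of a "- b" i] C_ops(5)[of b] by (simp add: D_minus)

definition V1 :: "('f => 'f) set" where
 "V1 = {f. (\<forall>a. a : C --> f a : C) \<and> (\<forall>a. a \<notin> C --> f a = 0) \<and> f 0 = 0}"

definition A1 :: "nat => ('f => 'f) => 'f => 'f" where
 "A1 i f = (%a. if a : C then D i (f a) - f (D i a) else 0)"

definition V2 :: "('f => 'f => 'f) set" where
 "V2 = {f. (\<forall>a b. a : C --> b : C --> f a b : C) \<and> (\<forall>a b. a \<notin> C \<or> b \<notin> C --> f a b = 0) \<and>
  (\<forall>a b. f a b = - f b a) \<and> (\<forall>a b. f (- a) b = - f a b)}"

definition A2 :: "nat => ('f => 'f => 'f) => 'f => 'f => 'f" where
 "A2 i f = (%a b. if a : C \<and> b : C then D i (f a b) - f (D i a) b - f a (D i b) else 0)"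

lemma A1_app: "A1 i f a = (if a : C then D i (f a) - f (D i a) else 0)"
 and A2_app: "A2 i g a b = (if a : C \<and> b : C then D i (g a b) - g (D i a) b - g a (D i b) else 0)"
 by (simp_all add: A1_def A2_def)

lemma V1_D: "f : V1 ==> a : C ==> f a : C" "f : V1 ==> a \<notin> C ==> f a = 0" "f : V1 ==> f 0 = 0"
 by (auto simp: V1_def)

lemma V2_D: "f : V2 ==> a : C ==> b : C ==> f a b : C" "f : V2 ==> a \<notin> C \<or> b \<notin> C ==> f a b = 0"
 "f : V2 ==> f a b = - f b a" "f : V2 ==> f (- a) b = - f a b"
 unfolding V2_def by blast+

lemma V2I:
 assumes "!!a b. a : C ==> b : C ==> f a b : C" "!!a b. a \<notin> C \<or> b \<notin> C ==> f a b = 0"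
  "!!a b. f a b = - f b a" "!!a b. f (- a) b = - f a b"
 shows "f : V2"
 using assms unfolding V2_def by blast

lemma V2_0: "f : V2 ==> f 0 b = 0" "f : V2 ==> f a 0 = 0"
 using V2_D(4)[of f 0] V2_D(3)[of f a 0] by (auto simp: eq_neg_iff_add_eq_0 simp flip: scaleR_2)

lemma V2_right_minus: "f : V2 ==> f a (- b) = - f a b"
 using V2_D(3)[of f a "- b"] V2_D(3)[of f a b] V2_D(4)[of f b a] by simp

lemma C_minus_iff: "- a : C \<longleftrightarrow> a : C"
 using C_ops(5)[of a] C_ops(5)[of "- a"] by auto

sublocale ops1: commuting_ops V1 A1
proof
 show "subspace V1" by (auto simp: V1_def subspace_def scaleR_fun_def C_ops)
 show "A1 i f : V1" if "f : V1" for i f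
  unfolding V1_def by (auto simp: A1_def C_ops D_in D_0 V1_D[OF that])
 show "A1 i (f + g) = A1 i f + A1 i g" if "f : V1" "g : V1" for i f g
  using that by (auto simp: A1_def fun_eq_iff D_add V1_D)
 show "A1 i (r *\<^sub>R f) = r *\<^sub>R A1 i f" if "f : V1" for i r f
  using that by (auto simp: A1_def fun_eq_iff D_scale V1_D scaleR_fun_def scaleR_diff_right)
 show "A1 i (A1 j f) = A1 j (A1 i f)" if f: "f : V1" for i j f
 proof
  fix a show "A1 i (A1 j f) a = A1 j (A1 i f) a"
   using D_comm[of "f a" i j] D_comm[of a i j]
   by (cases "a : C") (simp_all add: A1_def D_in D_diff V1_D[OF f])
 qed
 show "A1 0 f = 0" if f: "f : V1" for f
  by (simp add: A1_def fun_eq_iff D_zero V1_D[OF f])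
qed

sublocale ops2: commuting_ops V2 A2
proof
 show "subspace V2"
  unfolding subspace_def
 proof (intro conjI ballI allI)
  fix f g and r :: real assume f: "f : V2" and g: "g : V2"
  show "f + g : V2"
  proof (rule V2I)
   show "(f + g) a b = - (f + g) b a" for a b using V2_D(3)[OF f, of a b] V2_D(3)[OF g, of a b] by simp
  qed (auto simp: C_ops V2_D(1,2,4)[OF f] V2_D(1,2,4)[OF g])
  show "r *\<^sub>R f : V2"
  proof (rule V2I)
   show "(r *\<^sub>R f) a b = - (r *\<^sub>R f) b a" for a b using V2_D(3)[OF f, of a b] by (simp add: scaleR_fun_def)
  qed (auto simp: C_ops scaleR_fun_def V2_D(1,2,4)[OF f])
 qed (auto simp: V2_def C_ops)
 show "A2 i f : V2" if f: "f : V2" for i f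
 proof (rule V2I)
  fix a b
  have "D i (f a b) = - D i (f b a)" if "a : C" "b : C"
   using D_minus[OF V2_D(1)[OF f that(2,1)], of i] V2_D(3)[OF f, of a b] by simp
  then show "A2 i f a b = - A2 i f b a"
   using V2_D(3)[OF f, of "D i a" b] V2_D(3)[OF f, of a "D i b"] by (simp add: A2_def)
 qed (auto simp: A2_def C_ops D_in D_minus C_minus_iff V2_D(1,2,4)[OF f] V2_right_minus[OF f])
 show "A2 i (f + g) = A2 i f + A2 i g" if "f : V2" "g : V2" for i f g
  using that by (auto simp: A2_def fun_eq_iff D_add V2_D(1))
 show "A2 i (r *\<^sub>R f) = r *\<^sub>R A2 i f" if "f : V2" for i r f
  using that by (auto simp: A2_def fun_eq_iff D_scale V2_D(1) scaleR_fun_def scaleR_diff_right)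
 show "A2 i (A2 j f) = A2 j (A2 i f)" if f: "f : V2" for i j f
 proof (intro ext)
  fix a b show "A2 i (A2 j f) a b = A2 j (A2 i f) a b"
   using D_comm[of "f a b" i j] D_comm[of a i j] D_comm[of b i j]
   by (cases "a : C \<and> b : C") (auto simp: A2_def D_in D_diff V2_D(1)[OF f] C_ops)
 qed
 show "A2 0 f = 0" if f: "f : V2" for f
  by (simp add: A2_def fun_eq_iff D_zero V2_D(1)[OF f] V2_0[OF f])
qed

end

lemma unshuffles_small:
 "unshuffles 0 0 = {id}" "unshuffles (Suc 0) 0 = {id}" "unshuffles 0 (Suc 0) = {id}" "unshuffles 2 0 = {id}"
 "unshuffles (Suc 0) (Suc 0) = {id, Transposition.transpose 0 1}"
proof -
 have 0: "{..<0} = ({} :: nat set)" "{..<Suc 0} = {0}" "{..<2} = {0, Suc 0}" "{..<Suc (Suc 0)} = {0, Suc 0}" by auto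
 have 1: "\<tau> permutes {0, Suc 0} \<longleftrightarrow> \<tau> = id \<or> \<tau> = Transposition.transpose 0 1" for \<tau> :: "nat => nat"
  by (simp add: permutes_doubleton_iff)
 have 2: "\<tau> permutes {0} \<longleftrightarrow> \<tau> = id" for \<tau> :: "nat => nat" by (simp add: permutes_sing)
 show "unshuffles 0 0 = {id}" by (auto simp: unshuffles_def 0 strict_mono_on_def)
 show "unshuffles (Suc 0) 0 = {id}" "unshuffles 0 (Suc 0) = {id}" by (auto simp: unshuffles_def 0 2 strict_mono_on_def)
 have 4: "\<not> strict_mono_on {0, Suc 0} (Transposition.transpose 0 (Suc 0))"
  using strict_mono_onD[of "{0, Suc 0}" "Transposition.transpose 0 (Suc 0)" 0 "Suc 0"] by auto
 have 3: "\<tau> permutes {0, Suc 0} \<and> strict_mono_on {0, Suc 0} \<tau> \<longleftrightarrow> \<tau> = id" for \<tau> :: "nat => nat"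
  using 4 unfolding 1 by (auto simp: strict_mono_on_def)
 show "unshuffles 2 0 = {id}" by (auto simp: unshuffles_def 0 3 strict_mono_on_def[of "{}"])
 show "unshuffles (Suc 0) (Suc 0) = {id, Transposition.transpose 0 1}"
  by (auto simp: unshuffles_def 0 1 strict_mono_on_def)
qed

lemma SJ_1_2: "SJ (Suc 0) 2 X Q [\<mu>, \<nu>] p = X [Q [\<mu>, \<nu>]] p - (Q [X [\<mu>], \<nu>] p - Q [X [\<nu>], \<mu>] p)"
proof -
 have "id \<noteq> Transposition.transpose 0 (Suc 0)" by (metis id_apply transpose_apply_first nat.distinct(1))
 then show ?thesis
  using unshuffles_small by (simp add: SJ_def mop_comp_def sign_swap_id numeral_2_eq_2)
qed

lemma SJ_1_1: "SJ (Suc 0) (Suc 0) X Q [\<mu>] p = X [Q [\<mu>]] p - Q [X [\<mu>]] p"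
 using unshuffles_small by (simp add: SJ_def mop_comp_def)

lemma SJ_2_1: "SJ 2 (Suc 0) Q X \<mu>s p = - SJ (Suc 0) 2 X Q \<mu>s p"
 by (simp add: SJ_def)

lemma SJ_2_0: "SJ 2 0 Q \<Lambda> [\<mu>] p = - Q [\<Lambda> [], \<mu>] p"
 using unshuffles_small by (simp add: SJ_def mop_comp_def numeral_2_eq_2)

lemma finite_lists_sum: "finite {js :: nat list. length js = k \<and> sum_list js = m}"
proof (rule finite_subset)
 show "{js. length js = k \<and> sum_list js = m} <= {js. set js <= {..m} \<and> length js = k}"
  using member_le_sum_list by fastforce
 show "finite {js. set js <= {..m} \<and> length js = k}" by (rule finite_lists_length_eq) simp
qed

lemma sum_lists_snoc:
 fixes F :: "nat list => 'a::comm_monoid_add"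
 shows "(\<Sum>js\<in>{js. length js = Suc k \<and> sum_list js = m}. F js) =
  (\<Sum>j\<le>m. \<Sum>js\<in>{js. length js = k \<and> sum_list js = m - j}. F (js @ [j]))"
proof -
 have "(\<Sum>j\<le>m. \<Sum>js\<in>{js. length js = k \<and> sum_list js = m - j}. F (js @ [j])) =
   (\<Sum>(j,js)\<in>(SIGMA j:{..m}. {js. length js = k \<and> sum_list js = m - j}). F (js @ [j]))"
  by (rule sum.Sigma) (auto simp: finite_lists_sum)
 also have "\<dots> = (\<Sum>js\<in>{js. length js = Suc k \<and> sum_list js = m}. F js)"
 proof (rule sum.reindex_bij_witness[where i="%js. (last js, butlast js)" and j="%(j,js). js @ [j]"])
  fix js assume js: "js : {js. length js = Suc k \<and> sum_list js = m}"
  then have e: "butlast js @ [last js] = js" by (cases js rule: rev_cases) auto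
  then show "(%(j, js). js @ [j]) (last js, butlast js) = js" by simp
  have "sum_list (butlast js) + last js = m" using js arg_cong[OF e, of sum_list] by simp
  then show "(last js, butlast js) : (SIGMA j:{..m}. {js. length js = k \<and> sum_list js = m - j})"
   using js by auto
 qed auto
 finally show ?thesis by simp
qed

context bundle_pair
begin

lemma sections_subspace: "subspace (\<Gamma>L)"
 unfolding subspace_def
 using TL.section_zero TL.section_add TL.section_scale by (simp add: zero_fun_def plus_fun_def scaleR_fun_def)

lemma I_form1: "I_map S N (form1 \<nu>) [\<mu>] = Dv \<nu> \<mu>"
 by (simp add: fun_eq_iff I_map_def form1_def Dv_def)

definition pb :: "('p => 'w) => 'p \<times> 'v => 'w" where
 "pb \<zeta> = (%p. if p : pts M then \<zeta> (fst p) else 0)"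

lemma I_form0: "I_map S N (form0 \<zeta>) [] = pb \<zeta>"
 by (simp add: fun_eq_iff I_map_def form0_def pb_def)

lemma Dv_minus: "\<nu> : sections S N ==> \<mu> : \<Gamma>L ==> Dv (%x. - \<nu> x) \<mu> = - Dv \<nu> \<mu>"
 using Dv_lin_dir[of \<nu> \<nu> \<mu> "-1" 0] by (simp add: fun_eq_iff)

lemma fo_comb:
 assumes Q: "fo Q" and Q': "fo Q'"
 shows "fo (%\<mu> p. a *\<^sub>R Q \<mu> p + c *\<^sub>R Q' \<mu> p)"
 unfolding fo_iff
proof (intro conjI ballI allI)
 fix \<mu> assume \<mu>: "\<mu> : \<Gamma>L"
 show "(%p. a *\<^sub>R Q \<mu> p + c *\<^sub>R Q' \<mu> p) : \<Gamma>L" by (intro TL.section_lin fo_in[OF Q \<mu>] fo_in[OF Q' \<mu>])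
 show "(%p. a *\<^sub>R Q (%p. a' *\<^sub>R \<mu> p + b' *\<^sub>R \<nu> p) p + c *\<^sub>R Q' (%p. a' *\<^sub>R \<mu> p + b' *\<^sub>R \<nu> p) p) =
  (%p. a' *\<^sub>R (a *\<^sub>R Q \<mu> p + c *\<^sub>R Q' \<mu> p) + b' *\<^sub>R (a *\<^sub>R Q \<nu> p + c *\<^sub>R Q' \<nu> p))" if "\<nu> : \<Gamma>L" for \<nu> a' b'
  using fo_lin[OF Q \<mu> that, of a' b'] fo_lin[OF Q' \<mu> that, of a' b'] by (simp add: fun_eq_iff algebra_simps)
 fix f g assume fg: "f : smooth_funs M" "g : smooth_funs M"
 show "(%p. a *\<^sub>R Q (%q. f q *\<^sub>R g q *\<^sub>R \<mu> q) p + c *\<^sub>R Q' (%q. f q *\<^sub>R g q *\<^sub>R \<mu> q) p) =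
  (%p. f p *\<^sub>R (a *\<^sub>R Q (%q. g q *\<^sub>R \<mu> q) p + c *\<^sub>R Q' (%q. g q *\<^sub>R \<mu> q) p) +
    g p *\<^sub>R (a *\<^sub>R Q (%q. f q *\<^sub>R \<mu> q) p + c *\<^sub>R Q' (%q. f q *\<^sub>R \<mu> q) p) - (f p * g p) *\<^sub>R (a *\<^sub>R Q \<mu> p + c *\<^sub>R Q' \<mu> p))"
  unfolding fo_expand[OF Q fg \<mu>] fo_expand[OF Q' fg \<mu>] by (simp add: fun_eq_iff algebra_simps)
qed

lemma fo_cong:
 assumes Q: "fo Q" and e: "!!\<mu>. \<mu> : \<Gamma>L ==> Q' \<mu> = Q \<mu>"
 shows "fo Q'"
 unfolding fo_iff
proof (intro conjI ballI allI)
 fix \<mu> assume \<mu>: "\<mu> : \<Gamma>L"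
 show "Q' \<mu> : \<Gamma>L" using fo_in[OF Q \<mu>] e[OF \<mu>] by simp
 show "Q' (%p. a *\<^sub>R \<mu> p + b *\<^sub>R \<nu> p) = (%p. a *\<^sub>R Q' \<mu> p + b *\<^sub>R Q' \<nu> p)" if "\<nu> : \<Gamma>L" for \<nu> a b
  unfolding e[OF TL.section_lin[OF \<mu> that]] e[OF \<mu>] e[OF that] by (rule fo_lin[OF Q \<mu> that])
 fix f g assume fg: "f : smooth_funs M" "g : smooth_funs M"
 note sm = section_smult[OF fg(1) \<mu>] section_smult[OF fg(2) \<mu>]
 show "Q' (%q. f q *\<^sub>R g q *\<^sub>R \<mu> q) = (%p. f p *\<^sub>R Q' (%q. g q *\<^sub>R \<mu> q) p + g p *\<^sub>R Q' (%q. f q *\<^sub>R \<mu> q) p - (f p * g p) *\<^sub>R Q' \<mu> p)"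
  unfolding e[OF section_smult[OF fg(1) sm(2)]] e[OF sm(1)] e[OF sm(2)] e[OF \<mu>] by (rule fo_expand[OF Q fg \<mu>])
qed

lemma fo_sum_ops: "(!!i. i : I ==> fo (Q i)) ==> fo (%\<mu> p. \<Sum>i\<in>I. c i *\<^sub>R Q i \<mu> p)"
proof (induction I rule: infinite_finite_induct)
 case (insert i I)
 then have "fo (Q i)" "fo (%\<mu> p. \<Sum>i\<in>I. c i *\<^sub>R Q i \<mu> p)" by simp_all
 from fo_comb[OF this, of "c i" 1] show ?case using insert(1,2) by simp
qed (simp_all add: fo_0)

end

locale deformed = jacobi_bundle S N l J
 for S :: "'p mfd" and N :: "('p, 'v::real_normed_vector) vbun" and l :: "('p, 'w::real_normed_vector) vbun"
  and J :: "('p \<times> 'v, 'w) mop" +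
 fixes s :: "nat => 'p => 'v"
 assumes fd: "formal_deformation S N s"
begin

lemma s_sec: "s i : sections S N" using fd by (simp add: formal_deformation_def)

lemma Dv_0: "\<mu> : \<Gamma>L ==> Dv (s 0) \<mu> = 0"
proof -
 have "s 0 = (%x. 0)" using fd by (simp add: formal_deformation_def)
 then show "\<mu> : \<Gamma>L ==> Dv (s 0) \<mu> = 0"
  using Dv_lin_dir[OF s_sec[of 0] s_sec[of 0], of \<mu> 0 0] by (simp add: zero_fun_def)
qed

sublocale cd: commuting_derivations "\<Gamma>L" "%i. Dv (s i)"
proof
 show "Dv (s i) (a + b) = Dv (s i) a + Dv (s i) b" if "a : \<Gamma>L" "b : \<Gamma>L" for i a b
  using Dv_lin[OF s_sec that, of i 1 1] by (simp add: plus_fun_def)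
 show "Dv (s i) (c *\<^sub>R a) = c *\<^sub>R Dv (s i) a" if "a : \<Gamma>L" for i c a
  using Dv_lin[OF s_sec that that, of i c 0] by (simp add: scaleR_fun_def)
qed (simp_all add: sections_subspace Dv_section s_sec Dv_0 Dv_commute)

sublocale ops0: commuting_ops "\<Gamma>L" "%i. Dv (s i)"
 by standard (simp_all add: sections_subspace Dv_section s_sec Dv_0 cd.D_add cd.D_scale Dv_commute)

abbreviation X where "X \<equiv> %i. I_map S N (form1 (s i))"

definition r1 :: "('p \<times> 'v, 'w) mop => ('p \<times> 'v => 'w) => 'p \<times> 'v => 'w" where
 "r1 Q = (%\<mu>. if \<mu> : \<Gamma>L then Q [\<mu>] else 0)"

definition r2 :: "('p \<times> 'v, 'w) mop => ('p \<times> 'v => 'w) => ('p \<times> 'v => 'w) => 'p \<times> 'v => 'w" where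
 "r2 Q = (%\<mu> \<nu>. if \<mu> : \<Gamma>L \<and> \<nu> : \<Gamma>L then Q [\<mu>, \<nu>] else 0)"

lemma ad_2:
 assumes Q: "!!m. r2 (Q m) : cd.V2" and "\<mu> : \<Gamma>L" "\<nu> : \<Gamma>L"
 shows "((ad_eps 2 X ^^ k) Q) m [\<mu>, \<nu>] = adp cd.A2 (%m. r2 (Q m)) k m \<mu> \<nu>"
 using assms(2,3)
proof (induction k arbitrary: m \<mu> \<nu>)
 case 0 then show ?case by (simp add: r2_def)
next
 case (Suc k)
 let ?a = "adp cd.A2 (%m. r2 (Q m)) k"
 have V: "?a m : cd.V2" for m by (rule cd.ops2.adp_in[OF Q])
 show ?case
 proof
  fix p
  have "((ad_eps 2 X ^^ Suc k) Q) m [\<mu>, \<nu>] p = (\<Sum>i\<le>m. Dv (s i) (?a (m - i) \<mu> \<nu>) p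
    - (?a (m - i) (Dv (s i) \<mu>) \<nu> p - ?a (m - i) (Dv (s i) \<nu>) \<mu> p))"
   unfolding funpow.simps comp_apply ad_eps_def[of 2 X "(ad_eps 2 X ^^ k) Q"] One_nat_def SJ_1_2 I_form1
   by (simp add: Suc Dv_section s_sec)
  also have "\<dots> = (\<Sum>i\<le>m. cd.A2 i (?a (m - i)) \<mu> \<nu> p)"
  proof (rule sum.cong[OF refl])
   fix i
   have "?a (m - i) \<mu> (Dv (s i) \<nu>) p = - ?a (m - i) (Dv (s i) \<nu>) \<mu> p"
    using fun_cong[OF cd.V2_D(3)[OF V[of "m - i"], of \<mu> "Dv (s i) \<nu>"], of p] by simp
   then show "Dv (s i) (?a (m - i) \<mu> \<nu>) p - (?a (m - i) (Dv (s i) \<mu>) \<nu> p - ?a (m - i) (Dv (s i) \<nu>) \<mu> p) =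
     cd.A2 i (?a (m - i)) \<mu> \<nu> p"
    using Suc.prems by (simp add: cd.A2_app)
  qed
  finally show "((ad_eps 2 X ^^ Suc k) Q) m [\<mu>, \<nu>] p = adp cd.A2 (%m. r2 (Q m)) (Suc k) m \<mu> \<nu> p"
   by (simp add: sum_fun_apply)
 qed
qed

lemma ad_1:
 assumes Q: "!!m. r1 (Q m) : cd.V1" and "\<mu> : \<Gamma>L"
 shows "((ad_eps 1 X ^^ k) Q) m [\<mu>] = adp cd.A1 (%m. r1 (Q m)) k m \<mu>"
 using assms(2)
proof (induction k arbitrary: m \<mu>)
 case 0 then show ?case by (simp add: r1_def)
next
 case (Suc k)
 let ?a = "adp cd.A1 (%m. r1 (Q m)) k"
 show ?case
 proof
  fix p
  have "((ad_eps 1 X ^^ Suc k) Q) m [\<mu>] p = (\<Sum>i\<le>m. Dv (s i) (?a (m - i) \<mu>) p - ?a (m - i) (Dv (s i) \<mu>) p)"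
   unfolding One_nat_def funpow.simps comp_apply ad_eps_def[of "Suc 0" X "(ad_eps (Suc 0) X ^^ k) Q"] SJ_1_1 I_form1
   using Suc by (simp add: Dv_section s_sec)
  also have "\<dots> = (\<Sum>i\<le>m. cd.A1 i (?a (m - i)) \<mu> p)"
   using Suc.prems by (simp add: cd.A1_app)
  finally show "((ad_eps 1 X ^^ Suc k) Q) m [\<mu>] p = adp cd.A1 (%m. r1 (Q m)) (Suc k) m \<mu> p"
   by (simp add: sum_fun_apply)
 qed
qed

definition B2 where "B2 = r2 J"

lemma B2_in: "B2 : cd.V2"
proof (rule cd.V2I)
 show "B2 \<mu> \<nu> = - B2 \<nu> \<mu>" for \<mu> \<nu> using J_antisym[of \<mu> \<nu>] by (auto simp: B2_def r2_def fun_eq_iff)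
 show "B2 (- \<mu>) \<nu> = - B2 \<mu> \<nu>" for \<mu> \<nu>
 proof -
  have "J [- \<mu>, \<nu>] = - J [\<mu>, \<nu>]" if "\<mu> : \<Gamma>L" "\<nu> : \<Gamma>L"
   using fo_scale[OF J_ops(2)[OF that(2,2)] that(1), of "-1"] by (simp add: fun_Compl_def)
  then show ?thesis using cd.C_minus_iff[of \<mu>] by (simp add: B2_def r2_def)
 qed
qed (auto simp: B2_def r2_def J_ops(1))

lemma r2_const: "r2 (const_eps J m) = single B2 m"
 by (auto simp: const_eps_def single_def B2_def r2_def fun_eq_iff)

definition Js :: "nat => ('p \<times> 'v => 'w) => ('p \<times> 'v => 'w) => 'p \<times> 'v => 'w" where
 "Js m \<mu> \<nu> = exp_ad_eps 2 X (const_eps J) m [\<mu>, \<nu>]"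

lemma Js_expo: "\<mu> : \<Gamma>L ==> \<nu> : \<Gamma>L ==> Js m \<mu> \<nu> = expo cd.A2 (single B2) m \<mu> \<nu>"
 using ad_2[of "const_eps J"] r2_const cd.ops2.single_in[OF B2_in]
 by (simp add: Js_def exp_ad_eps_def expo_def fun_eq_iff sum_fun_apply scaleR_fun_def)

sublocale fb: formal_bracket "\<Gamma>L" "%\<mu> \<nu>. J [\<mu>, \<nu>]" "%i. Dv (s i)" Js
proof
 fix a b c :: "'p \<times> 'v => 'w" assume ab: "a : \<Gamma>L" "b : \<Gamma>L"
 show "J [a, b] : \<Gamma>L" by (rule J_ops(1)[OF ab])
 show "J [a + b, c] = J [a, c] + J [b, c]" if "c : \<Gamma>L"
  using fo_add[OF J_ops(2)[OF that that] ab] by (simp add: plus_fun_def)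
 show "J [a, b] = - J [b, a]" using J_antisym[OF ab] by (simp add: fun_eq_iff)
 show "Js 0 a b = J [a, b]" using cd.ops2.expo_0[OF B2_in] ab by (simp add: Js_expo B2_def r2_def)
 show "J [c *\<^sub>R a, b] = c *\<^sub>R J [a, b]" for c
  using fo_scale[OF J_ops(2)[OF ab(2,2)] ab(1)] by (simp add: scaleR_fun_def)
 show "real m *\<^sub>R Js m a b = (\<Sum>i\<le>m. real i *\<^sub>R (Dv (s i) (Js (m - i) a b) - Js (m - i) (Dv (s i) a) b - Js (m - i) a (Dv (s i) b)))" for m
  using fun_cong[OF fun_cong[OF cd.ops2.expo_rec[OF B2_in, of m], of a], of b] ab
  by (simp add: Js_expo Dv_section s_sec sum_fun_apply scaleR_fun_def cd.A2_app)
qed (simp_all add: sections_subspace Dv_section s_sec cd.D_add cd.D_scale Dv_commute)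

lemma fo_Js: "\<nu> : \<Gamma>L ==> fo (%\<mu>. Js m \<mu> \<nu>)"
proof (induction m arbitrary: \<nu> rule: less_induct)
 case (less m)
 note \<nu> = less.prems
 show ?case
 proof (cases "m = 0")
  case True
  show ?thesis by (rule fo_cong[OF J_ops(2)[OF \<nu> \<nu>]]) (simp add: True fb.J_0 \<nu>)
 next
  case False
  let ?R = "%i \<mu> p. Dv (s i) (Js (m - i) \<mu> \<nu>) p - Js (m - i) (Dv (s i) \<mu>) \<nu> p"
  let ?Q = "%i \<mu> p. 1 *\<^sub>R ?R i \<mu> p + (-1) *\<^sub>R Js (m - i) \<mu> (Dv (s i) \<nu>) p"
  have Q: "fo (?Q i)" if "i : {1..m}" for i
  proof (intro fo_comb)
   have "m - i < m" using that by auto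
   note IH = less.IH[OF this]
   show "fo (%\<mu>. ?R i \<mu>)" by (rule fo_bracket[OF s_sec IH[OF \<nu>]])
   show "fo (%\<mu>. Js (m - i) \<mu> (Dv (s i) \<nu>))" by (rule IH[OF Dv_section[OF s_sec \<nu>]])
  qed
  have "fo (%\<mu> p. \<Sum>i\<in>{1..m}. (real i / real m) *\<^sub>R ?Q i \<mu> p)" by (rule fo_sum_ops) (rule Q)
  then show ?thesis
  proof (rule fo_cong)
   fix \<mu> assume \<mu>: "\<mu> : \<Gamma>L"
   have "(\<Sum>i\<le>m. (real i / real m) *\<^sub>R ?Q i \<mu> p) = (\<Sum>i\<in>{1..m}. (real i / real m) *\<^sub>R ?Q i \<mu> p)" for p
    by (rule sum.mono_neutral_right) (auto simp: Suc_le_eq)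
   then show "Js m \<mu> \<nu> = (%p. \<Sum>i\<in>{1..m}. (real i / real m) *\<^sub>R ?Q i \<mu> p)"
    using fb.J_step[of m \<mu> \<nu>] False \<mu> \<nu>
    by (simp add: fun_eq_iff sum_fun_apply scaleR_fun_def scaleR_right.sum)
  qed
 qed
qed

lemma ham_in: "\<eta> : \<Gamma>L ==> r1 (ham_der J \<eta>) : cd.V1"
 using J_ops(1)[of \<eta>] fo_zero[OF J_ops(3)[of \<eta> \<eta>]]
 by (auto simp: cd.V1_def r1_def ham_der_def zero_fun_def TL.section_zero)

lemma exp_ham:
 assumes \<eta>: "!!i. \<eta> i : \<Gamma>L" and \<mu>: "\<mu> : \<Gamma>L"
 shows "exp_ad_eps 1 X (%i. ham_der J (\<eta> i)) m [\<mu>] = (\<Sum>i\<le>m. Js (m - i) (expo (%i. Dv (s i)) \<eta> i) \<mu>)"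
proof -
 let ?E = "%j. expo (%i. Dv (s i)) (single (\<eta> j))" and ?R = "%j. expo cd.A1 (single (r1 (ham_der J (\<eta> j))))"
 have R: "?R j k b = (\<Sum>i\<le>k. Js (k - i) (?E j i) b)" if "b : \<Gamma>L" for j k b
 proof (rule fb.exp_derivation[OF _ _ _ _ that])
  show "?E j m : \<Gamma>L" for m by (rule ops0.expo_in[OF \<eta>])
  show "real m *\<^sub>R ?E j m = (\<Sum>i\<le>m. real i *\<^sub>R Dv (s i) (?E j (m - i)))" for m by (rule ops0.expo_rec[OF \<eta>])
  fix b assume b: "b : \<Gamma>L"
  show "?R j 0 b = J [?E j 0, b]"
   unfolding cd.ops1.expo_0[OF ham_in[OF \<eta>]] ops0.expo_0[OF \<eta>] using b by (simp add: r1_def ham_der_def)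
  show "real m *\<^sub>R ?R j m b = (\<Sum>i\<le>m. real i *\<^sub>R (Dv (s i) (?R j (m - i) b) - ?R j (m - i) (Dv (s i) b)))" for m
   using fun_cong[OF cd.ops1.expo_rec[OF ham_in[OF \<eta>], of m j], of b] b
   by (simp add: sum_fun_apply scaleR_fun_def cd.A1_app)
 qed
 have "exp_ad_eps 1 X (%i. ham_der J (\<eta> i)) m [\<mu>] = expo cd.A1 (%j. r1 (ham_der J (\<eta> j))) m \<mu>"
  using ad_1[of "%i. ham_der J (\<eta> i)", OF ham_in[OF \<eta>] \<mu>]
  by (simp add: exp_ad_eps_def expo_def fun_eq_iff sum_fun_apply scaleR_fun_def)
 also have "\<dots> = (\<Sum>j\<le>m. ?R j (m - j) \<mu>)"
  unfolding cd.ops1.expo_split[of "%j. r1 (ham_der J (\<eta> j))", OF ham_in[OF \<eta>]] sum_fun_apply ..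
 also have "\<dots> = (\<Sum>j\<le>m. \<Sum>k\<le>m - j. Js (m - j - k) (?E j k) \<mu>)" by (simp add: R[OF \<mu>])
 also have "\<dots> = (\<Sum>i\<le>m. \<Sum>j\<le>i. Js (m - i) (?E j (i - j)) \<mu>)"
  by (rule sum_triples_split_first[where f="%j i k. Js k (?E j i) \<mu>", symmetric])
 also have "\<dots> = (\<Sum>i\<le>m. Js (m - i) (expo (%i. Dv (s i)) \<eta> i) \<mu>)"
  by (simp add: ops0.expo_split[OF \<eta>] fb.J_sum_left[OF ops0.expo_in[OF \<eta>] \<mu>])
 finally show ?thesis .
qed

definition NBr :: "nat list => ('p \<times> 'v, 'w) mop" where
 "NBr js = snd (nested_bracket S N J (map (%j. (1, form1 (%x. - s j x))) js))"

lemma nested_fst: "fst (nested_bracket S N J (map (%j. (1, form1 (%x. - s j x))) js)) = 2"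
 by (induction js rule: rev_induct) (auto simp: nested_bracket_def split: prod.splits)

lemma NBr_snoc: "NBr (js @ [j]) = SJ 2 1 (NBr js) (I_map S N (form1 (%x. - s j x)))"
 using nested_fst[of js] by (auto simp: NBr_def nested_bracket_def split: prod.splits)

lemma nested_snoc_0: "snd (nested_bracket S N J (map (%j. (1, form1 (%x. - s j x))) js @ [(0, form0 \<zeta>)])) [\<mu>] p
  = - NBr js [pb \<zeta>, \<mu>] p"
 using nested_fst[of js] SJ_2_0[of _ "I_map S N (form0 \<zeta>)" \<mu> p]
 by (auto simp: NBr_def nested_bracket_def I_form0 split: prod.splits)

definition Wb where "Wb js = foldl (%f j. cd.A2 j f) B2 js"

lemma Wb_in: "Wb js : cd.V2"
 by (induction js rule: rev_induct) (auto simp: Wb_def B2_in cd.ops2.A_in)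

lemma NBr_Wb: "\<mu> : \<Gamma>L ==> \<nu> : \<Gamma>L ==> NBr js [\<mu>, \<nu>] = Wb js \<mu> \<nu>"
proof (induction js arbitrary: \<mu> \<nu> rule: rev_induct)
 case Nil then show ?case by (simp add: NBr_def nested_bracket_def Wb_def B2_def r2_def)
next
 case (snoc j js)
 note V = Wb_in[of js]
 have s: "Dv (s j) \<mu> : \<Gamma>L" "Dv (s j) \<nu> : \<Gamma>L" "Wb js \<mu> \<nu> : \<Gamma>L"
  using snoc.prems by (auto simp: Dv_section s_sec cd.V2_D(1)[OF V])
 have m: "- Dv (s j) \<mu> : \<Gamma>L" "- Dv (s j) \<nu> : \<Gamma>L" using s by (simp_all only: cd.C_minus_iff)
 note IH = snoc.IH[OF m(1) snoc.prems(2)] snoc.IH[OF m(2) snoc.prems(1)] snoc.IH[OF snoc.prems]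
 have W: "Wb (js @ [j]) = cd.A2 j (Wb js)" by (simp add: Wb_def)
 have "NBr (js @ [j]) [\<mu>, \<nu>] p = Wb (js @ [j]) \<mu> \<nu> p" for p
  unfolding NBr_snoc One_nat_def SJ_2_1 SJ_1_2 I_form1
  using fun_cong[OF cd.V2_D(3)[OF V, of \<mu> "Dv (s j) \<nu>"], of p]
  by (simp add: Dv_minus s_sec IH snoc.prems s cd.V2_D(4)[OF V, unfolded fun_Compl_def] W cd.A2_app)
 then show ?case by blast
qed

lemma sum_Wb: "(\<Sum>js\<in>{js. length js = k \<and> sum_list js = m}. Wb js) = adp cd.A2 (single B2) k m"
proof (induction k arbitrary: m)
 case 0
 have "{js :: nat list. length js = 0 \<and> sum_list js = m} = (if m = 0 then {[]} else {})" by auto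
 then show ?case by (auto simp: single_def Wb_def fun_eq_iff)
next
 case (Suc k)
 have "(\<Sum>js\<in>{js. length js = Suc k \<and> sum_list js = m}. Wb js) =
   (\<Sum>j\<le>m. \<Sum>js\<in>{js. length js = k \<and> sum_list js = m - j}. cd.A2 j (Wb js))"
  unfolding sum_lists_snoc by (simp add: Wb_def)
 also have "\<dots> = (\<Sum>j\<le>m. cd.A2 j (\<Sum>js\<in>{js. length js = k \<and> sum_list js = m - j}. Wb js))"
  by (simp add: cd.ops2.A_sum Wb_in)
 finally show ?case by (simp add: Suc)
qed

lemma MC_series:
 assumes "\<mu> : \<Gamma>L" "\<nu> : \<Gamma>L" "m > 0"
 shows "(\<Sum>k=1..m. (1 / fact k) *\<^sub>R (\<Sum>js\<in>{js. length js = k \<and> sum_list js = m}. NBr js [\<mu>, \<nu>] p)) = Js m \<mu> \<nu> p"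
proof -
 have "(\<Sum>js\<in>{js. length js = k \<and> sum_list js = m}. NBr js [\<mu>, \<nu>] p) = adp cd.A2 (single B2) k m \<mu> \<nu> p" for k
  using fun_cong[OF fun_cong[OF fun_cong[OF sum_Wb[of k m], of \<mu>], of \<nu>], of p]
  by (simp add: sum_fun_apply NBr_Wb assms)
 then have "(\<Sum>k=1..m. (1 / fact k) *\<^sub>R (\<Sum>js\<in>{js. length js = k \<and> sum_list js = m}. NBr js [\<mu>, \<nu>] p)) =
   (\<Sum>k=1..m. (1 / fact k) *\<^sub>R adp cd.A2 (single B2) k m \<mu> \<nu> p)" by simp
 also have "\<dots> = (\<Sum>k\<le>m. (1 / fact k) *\<^sub>R adp cd.A2 (single B2) k m \<mu> \<nu> p)"
  by (rule sum.mono_neutral_left) (use assms(3) in \<open>auto simp: single_def Suc_le_eq\<close>)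
 finally show ?thesis using assms(1,2) by (simp add: Js_expo expo_def sum_fun_apply scaleR_fun_def)
qed

lemma gauge_series:
 assumes \<eta>: "!!j. pb (\<eta> j) : \<Gamma>L" and \<mu>: "\<mu> : \<Gamma>L"
 shows "(\<Sum>k\<le>m. (1 / fact k) *\<^sub>R (\<Sum>j\<le>m. \<Sum>js\<in>{js. length js = k \<and> sum_list js = m - j}. - NBr js [pb (\<eta> j), \<mu>] p)) =
  - (\<Sum>j\<le>m. Js (m - j) (pb (\<eta> j)) \<mu> p)"
proof -
 let ?a = "adp cd.A2 (single B2)"
 have a: "(\<Sum>js\<in>{js. length js = k \<and> sum_list js = i}. NBr js [pb (\<eta> j), \<mu>] p) = ?a k i (pb (\<eta> j)) \<mu> p" for k i j
  using fun_cong[OF fun_cong[OF fun_cong[OF sum_Wb[of k i], of "pb (\<eta> j)"], of \<mu>], of p]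
  by (simp add: sum_fun_apply NBr_Wb \<eta> \<mu>)
 have "(\<Sum>k\<le>m. (1 / fact k) *\<^sub>R (\<Sum>j\<le>m. ?a k (m - j) (pb (\<eta> j)) \<mu> p)) =
   (\<Sum>j\<le>m. \<Sum>k\<le>m. (1 / fact k) *\<^sub>R ?a k (m - j) (pb (\<eta> j)) \<mu> p)"
  unfolding scaleR_right.sum by (rule sum.swap)
 also have "\<dots> = (\<Sum>j\<le>m. \<Sum>k\<le>m - j. (1 / fact k) *\<^sub>R ?a k (m - j) (pb (\<eta> j)) \<mu> p)"
  by (rule sum.cong[OF refl], rule sum.mono_neutral_right) (auto simp: cd.ops2.adp_vanish[OF B2_in])
 also have "\<dots> = (\<Sum>j\<le>m. Js (m - j) (pb (\<eta> j)) \<mu> p)"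
  by (simp add: Js_expo \<eta> \<mu> expo_def sum_fun_apply scaleR_fun_def)
 finally show ?thesis by (simp add: sum_negf a)
qed

end

lemma opn_line:
 assumes "opn k D" "z : D" "j < k"
 shows "z j : interior {t. z(j := t) : D}"
proof -
 obtain \<delta> where \<delta>: "\<delta> > 0" "\<forall>y\<in>Rn k. (\<forall>i<k. \<bar>y i - z i\<bar> < \<delta>) --> y : D" using opn_box[OF assms(1,2)] by blast
 have "z : Rn k" using opn_subset[OF assms(1)] assms(2) by blast
 then have "z(j := t) : Rn k" for t using assms(3) by (auto simp: Rn_def)
 then have "z(j := t) : D" if "\<bar>t - z j\<bar> < \<delta>" for t using \<delta> that by simp
 then have "ball (z j) \<delta> <= {t. z(j := t) : D}" by (auto simp: dist_real_def abs_minus_commute)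
 then show ?thesis using \<delta>(1) mem_interior by blast
qed

lemma pd_at:
 assumes "opn k D" "z : D" "j < k" "smooth_on k D g"
 shows "((%t. g (z(j := t))) has_real_derivative pd D j g z) (at (z j))"
 using smooth_has_pd(1)[OF opn_ndom[OF assms(1)] assms(4,3)] assms(2) at_within_interior[OF opn_line[OF assms(1-3)]]
 unfolding has_pd_def by metis

section \<open>One-jets along the zero section\<close>

context bundle_pair
begin

lemma lc_zero:
 assumes "chart U \<phi>" "frameN W e" "frameL W' b" "z : Om U \<phi> W W'"
 shows "lc U \<phi> e b (%p. 0) z = 0"
 using lc_lin[OF assms TL.section_zero TL.section_zero, of 0 0] by simp

lemma same_jet1_local:
 assumes P: "chart U \<phi>" "frameN W e" "frameL W' b" and p: "p : pts M" "fst p : U \<inter> W \<inter> W'"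
  and j: "same_jet1 M L p \<theta> \<mu>"
 shows "lc U \<phi> e b (%q. \<mu> q - \<theta> q) (co \<phi> e p) = 0"
  "a < n + r ==> pd (Om U \<phi> W W') a (lc U \<phi> e b (%q. \<mu> q - \<theta> q)) (co \<phi> e p) = 0"
proof -
 let ?c = "TL.secc (tot (U \<inter> W)) (co \<phi> e) (%i (x,v). b i x) (%q. \<mu> q - \<theta> q) 0" and ?z = "co \<phi> e p" and ?D = "Om U \<phi> W W'"
 have cM: "(tot (U \<inter> W), co \<phi> e) : charts M" unfolding charts_M using P by blast
 have fL: "(tot W', %i (x,v). b i x) : frames L" unfolding frames_L using P by blast
 have pt: "p : tot (U \<inter> W) \<inter> tot W'" using M_tot[OF p] by (auto simp: tot_def)
 have z: "?z : ?D" by (rule lc_co(1)[OF P p])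
 have cl: "?c y = lc U \<phi> e b (%q. \<mu> q - \<theta> q) y" if "y : ?D" for y by (rule secc_lc'[OF P(1,2) that])
 have "0 < rk L" by (simp add: rk_L)
 then have c: "?c ?z = 0 \<and> (\<forall>j<mdim M. ((%t. ?c (?z(j := t))) has_real_derivative 0) (at (?z j)))"
  using j cM fL pt unfolding same_jet1_def Let_def TL.secc_def by blast
 then show "lc U \<phi> e b (%q. \<mu> q - \<theta> q) ?z = 0" using cl[OF z] by simp
 assume a: "a < n + r"
 have "((%t. ?c (?z(a := t))) has_real_derivative 0) (at (?z a) within {t. ?z(a := t) : ?D})"
  using c a by (simp add: mdim_M has_field_derivative_at_within)
 then have "((%t. lc U \<phi> e b (%q. \<mu> q - \<theta> q) (?z(a := t))) has_real_derivative 0) (at (?z a) within {t. ?z(a := t) : ?D})"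
  by (rule has_field_derivative_transform_within[where d=1]) (use z cl in auto)
 then show "pd ?D a (lc U \<phi> e b (%q. \<mu> q - \<theta> q)) ?z = 0"
  by (rule pd_eqI[OF opn_ndom[OF opn_Om[OF P]] z a])
qed

lemma jet1_refl: assumes \<theta>: "\<theta> : \<Gamma>L" and p: "p : pts M" shows "\<theta> : jet1 M L p \<theta>"
proof -
 have "same_jet1 M L p \<theta> \<theta>"
  unfolding same_jet1_def
 proof (clarify)
  fix A \<Phi> B f i assume a: "(A,\<Phi>) : charts M" "(B,f) : frames L" "p : A" "p : B" "i < rk L"
  obtain U \<phi> W e W' b where P: "chart U \<phi>" "frameN W e" "frameL W' b"
   and e: "A = tot (U \<inter> W)" "\<Phi> = co \<phi> e" "B = tot W'" "f = (%i (x,v). b i x)"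
   using a(1,2) unfolding charts_M frames_L by blast
  have x: "fst p : U \<inter> W \<inter> W'" using a(3,4) unfolding e tot_def by auto
  let ?D = "Om U \<phi> W W'" and ?z = "co \<phi> e p"
  let ?c = "%y. let q = inv_into A \<Phi> y in crd (rk L) f q (\<theta> q - \<theta> q) i"
  have z: "?z : ?D" by (rule lc_co(1)[OF P p x])
  have c0: "?c y = 0" if "y : ?D" for y
   using secc_lc'[OF P(1,2) that, of b "%p. 0"] lc_zero[OF P that] a(5)
   by (simp add: e TL.secc_def rk_L Let_def)
  have "((%t. ?c (?z(j := t))) has_real_derivative 0) (at (?z j))" if j: "j < mdim M" for j
  proof -
   have j': "j < n + r" using j by (simp add: mdim_M)
   have "((%t. 0) has_real_derivative 0) (at (?z j) within {t. ?z(j := t) : ?D})" by simp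
   then have "((%t. ?c (?z(j := t))) has_real_derivative 0) (at (?z j) within {t. ?z(j := t) : ?D})"
    by (rule has_field_derivative_transform_within[where d=1]) (use z c0 in auto)
   then show ?thesis using at_within_interior[OF opn_line[OF opn_Om[OF P] z j']] by simp
  qed
  then show "let c = ?c in c (\<Phi> p) = 0 \<and> (\<forall>j<mdim M. ((%t. c ((\<Phi> p)(j := t))) has_real_derivative 0) (at (\<Phi> p j)))"
   unfolding Let_def using c0[OF z] by (simp add: e Let_def)
 qed
 then show ?thesis using \<theta> by (simp add: jet1_def)
qed

lemma fo_same_jet1:
 assumes Q: "fo Q" and \<theta>: "\<theta> : \<Gamma>L" and \<mu>: "\<mu> : \<Gamma>L" and p: "p : pts M" and j: "same_jet1 M L p \<theta> \<mu>"
 shows "Q \<mu> p = Q \<theta> p"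
proof -
 obtain U \<phi> W e W' b where P: "chart U \<phi>" "frameN W e" "frameL W' b" and x: "fst p : U \<inter> W \<inter> W'"
  by (rule patch_at[OF p], rule that)
 have "Q (%q. \<mu> q - \<theta> q) p = 0"
  by (rule fo_vanish[OF Q P p x TL.section_diff[OF \<mu> \<theta>]]) (rule same_jet1_local[OF P p x j], assumption?)+
 then show ?thesis using fo_diff[OF Q \<mu> \<theta>] by simp
qed

definition Z :: "('p \<times> 'v => 'w) set" where
 "Z = {\<mu> \<in> \<Gamma>L. \<forall>x\<in>pts S. \<mu> (x, 0) = 0}"

lemma Z_sec: "\<mu> : Z ==> \<mu> : \<Gamma>L" by (simp add: Z_def)

lemma zero_M: "x : pts S ==> (x, 0) : pts M" by (simp add: pts_M_iff zero_in_fib)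

lemma horizontal:
 assumes U: "chart U \<phi>" and W: "frameN W e" and x: "x : U" "x : W" and k: "k < n"
 shows "pt U \<phi> e ((co \<phi> e (x, 0))(k := t)) = (inv_into U \<phi> ((\<phi> x)(k := t)), 0)" "co \<phi> e (x, 0) k = \<phi> x k"
proof -
 have c: "co \<phi> e (x, 0) = (%i. if i < n then \<phi> x i else 0)"
  using SN.crd_zero'[OF W x(2)] by (auto simp: co_def fun_eq_iff)
 have "trunc n ((co \<phi> e (x, 0))(k := t)) = (\<phi> x)(k := t)"
  using chart_Rn[OF U W x(1)] k by (auto simp: c trunc_def fun_eq_iff Rn_def)
 then show "pt U \<phi> e ((co \<phi> e (x, 0))(k := t)) = (inv_into U \<phi> ((\<phi> x)(k := t)), 0)"
  unfolding pt_def using k by (simp add: c)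
 show "co \<phi> e (x, 0) k = \<phi> x k" using k by (simp add: c)
qed

lemma annihilating_horizontal:
 assumes f: "f : annihilating S N x" and U: "chart U \<phi>" and W: "frameN W e" and x: "x : U" "x : W" and k: "k < n"
 shows "((%t. f (pt U \<phi> e ((co \<phi> e (x, 0))(k := t)))) has_real_derivative 0) (at (\<phi> x k))"
proof -
 let ?z = "co \<phi> e (x, 0)" and ?D = "cyl n r (\<phi> ` (U \<inter> W))"
 have xS: "x : pts S" using x S_charts(2)[OF U] by blast
 have A: "mfd_open S (U \<inter> W)" by (intro mfd_open_Int mfd_open_chart[OF U] frame_open[OF W])
 have op: "opn (n + r) ?D" by (rule opn_cyl_image[OF A U]) blast
 have p: "(x, 0) : tot (U \<inter> W)" using x zero_in_fib[OF xS] by (simp add: tot_def)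
 have z: "?z : ?D" "pt U \<phi> e ?z = (x, 0)" using co_in_cyl[OF U W subset_refl p] by auto
 have fx: "(?z)(k := \<phi> x k) = ?z" using horizontal(2)[OF U W x k] by auto
 have hx: "inv_into U \<phi> ((\<phi> x)(k := \<phi> x k)) = x" using inv_ch[OF U W x(1)] by simp
 have dv: "((%t. g (pt U \<phi> e (?z(k := t)))) has_real_derivative pd ?D k (%z. g (pt U \<phi> e z)) ?z) (at (\<phi> x k))"
  if "g : smooth_funs M" for g
  using pd_at[OF op z(1), of k "%z. g (pt U \<phi> e z)"] that U W k horizontal(2)[OF U W x k] unfolding smooth_funs_M by simp
 have dw: "\<exists>d. ((%t. h (inv_into U \<phi> ((\<phi> x)(k := t)))) has_real_derivative d) (at (\<phi> x k))" if "h : smooth_funs S" for h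
 proof -
  have "smooth_on n (\<phi> ` (U \<inter> pts S)) (%y. h (inv_into U \<phi> y))"
   using that U unfolding smooth_funs_def smooth_fun_on_def by blast
  moreover have "U \<inter> pts S = U" using S_charts(2)[OF U] by blast
  ultimately have "smooth_on n (\<phi> ` U) (%y. h (inv_into U \<phi> y))" by simp
  from pd_at[OF S_charts(3)[OF U] imageI[OF x(1)] k this] show ?thesis by blast
 qed
 define v where "v g = deriv (%t. g (pt U \<phi> e (?z(k := t)))) (\<phi> x k)" for g :: "'p \<times> 'v => real"
 define w where "w h = deriv (%t. h (inv_into U \<phi> ((\<phi> x)(k := t)))) (\<phi> x k)" for h :: "'p => real"
 have vd: "((%t. g (pt U \<phi> e (?z(k := t)))) has_real_derivative v g) (at (\<phi> x k))" if "g : smooth_funs M" for g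
  using dv[OF that] DERIV_imp_deriv[OF dv[OF that]] by (simp add: v_def)
 have wd: "((%t. h (inv_into U \<phi> ((\<phi> x)(k := t)))) has_real_derivative w h) (at (\<phi> x k))" if h: "h : smooth_funs S" for h
  using dw[OF h] DERIV_imp_deriv by (auto simp: w_def)
 have "v : tangent_space M (x, 0)"
  unfolding tangent_space_def
 proof (intro CollectI conjI ballI allI)
  fix g h a b assume gh: "g : smooth_funs M" "h : smooth_funs M"
  show "v (%q. a * g q + b * h q) = a * v g + b * v h"
   unfolding v_def[of "%q. a * g q + b * h q"]
   by (intro DERIV_imp_deriv DERIV_add DERIV_cmult vd gh)
  have "((%t. g (pt U \<phi> e (?z(k := t))) * h (pt U \<phi> e (?z(k := t)))) has_real_derivative v g * h (x, 0) + v h * g (x, 0)) (at (\<phi> x k))"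
   using DERIV_mult[OF vd[OF gh(1)] vd[OF gh(2)]] by (simp only: fx z(2))
  then show "v (%q. g q * h q) = v g * h (x, 0) + g (x, 0) * v h"
   unfolding v_def[of "%q. g q * h q"] by (simp add: DERIV_imp_deriv mult.commute)
 qed
 moreover have "w : tangent_space S x"
  unfolding tangent_space_def
 proof (intro CollectI conjI ballI allI)
  fix g h a b assume gh: "g : smooth_funs S" "h : smooth_funs S"
  show "w (%q. a * g q + b * h q) = a * w g + b * w h"
   unfolding w_def[of "%q. a * g q + b * h q"]
   by (intro DERIV_imp_deriv DERIV_add DERIV_cmult wd gh)
  have "((%t. g (inv_into U \<phi> ((\<phi> x)(k := t))) * h (inv_into U \<phi> ((\<phi> x)(k := t)))) has_real_derivative w g * h x + w h * g x) (at (\<phi> x k))"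
   using DERIV_mult[OF wd[OF gh(1)] wd[OF gh(2)]] by (simp only: hx)
  then show "w (%q. g q * h q) = w g * h x + g x * w h"
   unfolding w_def[of "%q. g q * h q"] by (simp add: DERIV_imp_deriv mult.commute)
 qed
 moreover have "v g = w (%y. g (y, 0))" for g
  unfolding v_def w_def horizontal(1)[OF U W x k] ..
 ultimately have "v : tangent_zero S N x" unfolding tangent_zero_def by blast
 then have "v f = 0" using f by (simp add: annihilating_def)
 then show ?thesis using vd[of f] f by (simp add: annihilating_def)
qed

lemma line_differentiable:
 assumes f: "f : smooth_funs M" and x: "x : pts S" and v: "v : fib N x"
 shows "((%t. f (x, t *\<^sub>R v)) has_real_derivative deriv (%t. f (x, t *\<^sub>R v)) 0) (at 0)"
proof -
 obtain U \<phi> W e W' b where P: "chart U \<phi>" "frameN W e" "frameL W' b" and xx: "fst (x, 0::'v) : U \<inter> W \<inter> W'"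
  by (rule patch_at[OF zero_M[OF x]], rule that)
 have A: "mfd_open S (U \<inter> W)" by (intro mfd_open_Int mfd_open_chart[OF P(1)] frame_open[OF P(2)])
 have fs: "smooth_on (n + r) (cyl n r (\<phi> ` (U \<inter> W))) (%z. f (pt U \<phi> e z))" using f P unfolding smooth_funs_M by blast
 have x': "fst (x, 0::'v) : U \<inter> W" and v': "v : fib N (fst (x, 0::'v))" using xx v by auto
 note fl = fibre_line[OF P(1,2) A subset_refl zero_M[OF x] x' v' fs]
 have "pt U \<phi> e (co \<phi> e (x, t *\<^sub>R v)) = (x, t *\<^sub>R v)" for t
  using fl(2)[of t] M_tot[of "(x, t *\<^sub>R v)"] x' by (simp add: co_in_cyl(2)[OF P(1,2) subset_refl])
 then show ?thesis using fl(1) DERIV_imp_deriv by fastforce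
qed

abbreviation fmj :: "'p => ('p \<times> 'v => real) => ('p \<times> 'v => 'w) => 'p \<times> 'v => 'w" where
 "fmj x f \<eta> \<equiv> %q. f q *\<^sub>R \<eta> q - f (x, 0) *\<^sub>R \<eta> q"

lemma fmj_section: "f : smooth_funs M ==> \<eta> : \<Gamma>L ==> fmj x f \<eta> : \<Gamma>L"
 by (intro TL.section_diff section_smult TL.section_scale)

lemma vert_der_fmj:
 assumes f: "f : smooth_funs M" and \<eta>: "\<eta> : \<Gamma>L" and x: "x : pts S" and v: "v : fib N x"
 shows "vert_der (fmj x f \<eta>) (x, 0) v = deriv (%t. f (x, t *\<^sub>R v)) 0 *\<^sub>R \<eta> (x, 0)"
proof (rule vert_der_eqI)
 have "((%t. f (x, t *\<^sub>R v) - f (x, 0)) has_real_derivative deriv (%t. f (x, t *\<^sub>R v)) 0) (at 0)"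
  using DERIV_diff[OF line_differentiable[OF f x v] DERIV_const] by simp
 from has_vector_derivative_scaleR[OF this, of "%t. \<eta> (x, t *\<^sub>R v)" "vert_der \<eta> (x, 0) v"]
 have "((%t. (f (x, t *\<^sub>R v) - f (x, 0)) *\<^sub>R \<eta> (x, t *\<^sub>R v)) has_vector_derivative deriv (%t. f (x, t *\<^sub>R v)) 0 *\<^sub>R \<eta> (x, 0)) (at 0)"
  using vert_der_has[OF zero_M[OF x] _ \<eta>, of v] v by simp
 then show "((%t. fmj x f \<eta> (fst (x, 0::'v), snd (x, 0::'v) + t *\<^sub>R v)) has_vector_derivative deriv (%t. f (x, t *\<^sub>R v)) 0 *\<^sub>R \<eta> (x, 0)) (at 0)"
  by (simp add: scaleR_diff_left)
qed

lemma fo_fmj: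
 assumes Q: "fo Q" and x: "x : pts S" and f: "f : annihilating S N x" and \<eta>: "\<eta> : \<Gamma>L"
  and \<mu>: "\<mu> : Z" and d: "!!v. v : fib N x ==> vert_der \<mu> (x, 0) v = deriv (%t. f (x, t *\<^sub>R v)) 0 *\<^sub>R \<eta> (x, 0)"
 shows "Q (fmj x f \<eta>) (x, 0) = Q \<mu> (x, 0)"
proof -
 let ?\<theta> = "fmj x f \<eta>" and ?p = "(x, 0::'v)"
 let ?\<zeta> = "%q. 1 *\<^sub>R ?\<theta> q + (-1) *\<^sub>R \<mu> q"
 have fs: "f : smooth_funs M" using f by (simp add: annihilating_def)
 have \<theta>: "?\<theta> : \<Gamma>L" by (rule fmj_section[OF fs \<eta>])
 note \<mu>s = Z_sec[OF \<mu>]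
 have \<zeta>: "?\<zeta> : \<Gamma>L" by (rule TL.section_lin[OF \<theta> \<mu>s])
 note p = zero_M[OF x]
 obtain U \<phi> W e W' b where P: "chart U \<phi>" "frameN W e" "frameL W' b" and xx: "fst ?p : U \<inter> W \<inter> W'"
  by (rule patch_at[OF p], rule that)
 have x': "x : U" "x : W" "x : W'" using xx by auto
 let ?D = "Om U \<phi> W W'" and ?z = "co \<phi> e ?p"
 have z: "?z : ?D" by (rule lc_co(1)[OF P p xx])
 have c0: "crd 1 b x 0 0 = 0" using Sl.crd_zero'[OF P(3) x'(3), of 0] rk_l by simp
 have "Q ?\<zeta> ?p = 0"
 proof (rule fo_vanish[OF Q P p xx \<zeta>])
  show "lc U \<phi> e b ?\<zeta> ?z = 0" unfolding lc_co(2)[OF P p xx] using \<mu> x c0 by (simp add: Z_def)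
  fix a assume a: "a < n + r"
  show "pd ?D a (lc U \<phi> e b ?\<zeta>) ?z = 0"
  proof (cases "a < n")
   case True
   note h = horizontal[OF P(1,2) x'(1,2) True]
   let ?g = "%t. f (pt U \<phi> e (?z(a := t)))" and ?h = "%t. lc U \<phi> e b \<eta> (?z(a := t))"
   have "(?h has_real_derivative pd ?D a (lc U \<phi> e b \<eta>) ?z) (at (\<phi> x a))"
    using pd_at[OF opn_Om[OF P] z a section_lc_smooth[OF \<eta> P]] h(2) by simp
   moreover have "((%t. ?g t - f ?p) has_real_derivative 0) (at (\<phi> x a))"
    using DERIV_diff[OF annihilating_horizontal[OF f P(1,2) x'(1,2) True] DERIV_const, of "f ?p"] by simp
   moreover have "?g (\<phi> x a) = f ?p" using inv_ch[OF P(1,2) x'(1)] unfolding h(1) by simp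
   ultimately have "((%t. (?g t - f ?p) * ?h t) has_real_derivative 0) (at (?z a))"
    using DERIV_mult[of "%t. ?g t - f ?p" 0 "\<phi> x a" UNIV ?h] h(2) by fastforce
   then have "((%t. (?g t - f ?p) * ?h t) has_real_derivative 0) (at (?z a) within {t. ?z(a := t) : ?D})"
    by (rule has_field_derivative_at_within)
   then have "((%t. lc U \<phi> e b ?\<zeta> (?z(a := t))) has_real_derivative 0) (at (?z a) within {t. ?z(a := t) : ?D})"
   proof (rule has_field_derivative_transform_within[where d=1])
    fix t assume "t : {t. ?z(a := t) : ?D}"
    then have zt: "?z(a := t) : ?D" by simp
    have m0: "lc U \<phi> e b \<mu> (?z(a := t)) = 0"
    proof -
     have sub: "U \<inter> W \<inter> W' <= U \<inter> W" by blast
     have "fst (pt U \<phi> e (?z(a := t))) : pts S" "fst (pt U \<phi> e (?z(a := t))) : W'"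
      using pt_M[OF P(1,2) sub zt] by (auto simp: pts_M_iff)
     then show ?thesis
      using \<mu> Sl.crd_zero'[OF P(3), of _ 0] rk_l unfolding lc_def h(1) by (simp add: Z_def)
    qed
    have "lc U \<phi> e b ?\<theta> (?z(a := t)) = (?g t - f ?p) * ?h t"
     using lc_lin[OF P zt section_smult[OF fs \<eta>] \<eta>, of 1 "- f ?p"] lc_smult(1)[OF P zt section_fibl[OF \<eta>], of f]
     by (simp add: algebra_simps)
    then show "(?g t - f ?p) * ?h t = lc U \<phi> e b ?\<zeta> (?z(a := t))"
     using lc_lin[OF P zt \<theta> \<mu>s, of 1 "-1"] m0 by simp
   qed (use z in auto)
   then show ?thesis by (rule pd_eqI[OF opn_ndom[OF opn_Om[OF P]] z a])
  next
   case False
   define i where "i = a - n"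
   have i: "i < r" "a = n + i" using False a by (auto simp: i_def)
   have ei: "e i x : fib N x" by (rule SN.frame_in[OF P(2) x'(2) i(1)])
   have "crd r e x (e i x) j = (if j = i then 1 else 0)" if "j < r" for j
    using SN.crd_comb[OF P(2) x'(2) that, of "%j. if j = i then 1 else 0"] i(1)
    by (simp add: if_distrib[of "%c. c *\<^sub>R _"] cong: if_cong)
   then have "vert_der ?\<zeta> ?p (e i x) = pd ?D a (lc U \<phi> e b ?\<zeta>) ?z *\<^sub>R b 0 x"
    using vert_der_local(2)[OF P p xx _ \<zeta>, of "e i x"] ei i
    by (simp add: if_distrib[of "%c. _ * c"] cong: if_cong)
   moreover have "vert_der ?\<zeta> ?p (e i x) = 0"
    using vert_der_lin[OF p _ \<theta> \<mu>s, of "e i x" 1 "-1"] ei vert_der_fmj[OF fs \<eta> x ei] d[OF ei] by simp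
   ultimately have 0: "pd ?D a (lc U \<phi> e b ?\<zeta>) ?z *\<^sub>R b 0 x = 0" by simp
   have "crd 1 b x (pd ?D a (lc U \<phi> e b ?\<zeta>) ?z *\<^sub>R b 0 x) 0 = pd ?D a (lc U \<phi> e b ?\<zeta>) ?z"
    using Sl.crd_comb[OF P(3) x'(3), of 0 "%_. pd ?D a (lc U \<phi> e b ?\<zeta>) ?z"] rk_l by simp
   then show ?thesis unfolding 0 c0 by simp
  qed
 qed
 then show ?thesis using fo_lin[OF Q \<theta> \<mu>s, of 1 "-1"] by simp
qed

lemma conormal_sum:
 assumes x: "x : pts S" and \<alpha>: "\<alpha> : conormal N l x" and f: "!!i. i : I ==> f i : fib N x" and fin: "finite I"
 shows "\<alpha> (\<Sum>i\<in>I. c i *\<^sub>R f i) = (\<Sum>i\<in>I. c i *\<^sub>R \<alpha> (f i))"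
 using fin f
proof (induction I)
 case empty
 have "\<alpha> (0 *\<^sub>R 0 + 0 *\<^sub>R 0) = 0 *\<^sub>R \<alpha> 0 + 0 *\<^sub>R \<alpha> 0" using \<alpha> zero_in_fib[OF x] unfolding conormal_def by blast
 then show ?case by simp
next
 case (insert i I)
 have s: "(\<Sum>i\<in>I. c i *\<^sub>R f i) : fib N x"
  using insert.prems by (intro subspace_sum subspace_scale SN.fib_subspace[OF x]) auto
 have "\<alpha> (c i *\<^sub>R f i + 1 *\<^sub>R (\<Sum>i\<in>I. c i *\<^sub>R f i)) = c i *\<^sub>R \<alpha> (f i) + 1 *\<^sub>R \<alpha> (\<Sum>i\<in>I. c i *\<^sub>R f i)"
  using \<alpha> s insert.prems unfolding conormal_def by blast
 then show ?case using insert by simp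
qed

lemma conormal_realised:
 assumes x: "x : pts S" and \<alpha>: "\<alpha> : conormal N l x"
 obtains f \<eta> where "f : annihilating S N x" "\<eta> : \<Gamma>L" "fmj x f \<eta> : Z"
  "\<forall>v\<in>fib N x. \<alpha> v = deriv (%t. f (x, t *\<^sub>R v)) 0 *\<^sub>R \<eta> (x, 0)"
proof -
 obtain U \<phi> W e W' b where P: "chart U \<phi>" "frameN W e" "frameL W' b" and xx: "fst (x, 0::'v) : U \<inter> W \<inter> W'"
  by (rule patch_at[OF zero_M[OF x]], rule that)
 have x': "x : U \<inter> W \<inter> W'" "x : W" "x : W'" using xx by auto
 have sub: "U \<inter> W \<inter> W' <= U" by blast
 obtain A0 K \<kappa> A1 where A: "mfd_open S A0" "A0 <= U \<inter> W \<inter> W'" "cutoff (\<phi> ` A0) K \<kappa>"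
   "mfd_open S A1" "A1 <= A0" "x : A1" "\<forall>y\<in>A1. \<kappa> (\<phi> y) = 1"
  by (rule plateau[OF P(1) patch_open(1)[OF P] sub x'(1)], rule that)
 have A0U: "A0 <= U \<inter> W" using A by auto
 define a where "a i = crd 1 b x (\<alpha> (e i x)) 0" for i
 let ?h = "%z. \<Sum>i<r. a i * z (n + i)"
 let ?f = "cutf \<phi> e A0 \<kappa> ?h" and ?\<eta> = "cuts \<phi> A0 b \<kappa>"
 have fs: "?f : smooth_funs M"
  by (intro cutf_smooth[OF P(1,2) A(1) A0U A(3)] smooth_on_sum smooth_on_cmult smooth_on_coord)
 have \<eta>s: "?\<eta> : \<Gamma>L" by (rule cuts_section[OF P A(1-3)])
 have f0: "?f (y, 0) = 0" for y
  using SN.crd_zero'[OF P(2), of y] A0U by (auto simp: cutf_def co_def)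
 have w0: "w (%y. 0) = 0" if "w : tangent_space S y" for w y
 proof -
  have m: "(%y. 0) : smooth_funs S" by (simp add: smooth_funs_def smooth_fun_on_def smooth_on_const split_beta)
  have "\<forall>f\<in>smooth_funs S. \<forall>g\<in>smooth_funs S. \<forall>a b. w (%q. a * f q + b * g q) = a * w f + b * w g"
   using that unfolding tangent_space_def by blast
  from this[rule_format, OF m m, of 0 0] show ?thesis by simp
 qed
 have "?f : annihilating S N x"
  unfolding annihilating_def
 proof (intro CollectI conjI fs ballI)
  fix v assume "v : tangent_zero S N x"
  then obtain w where w: "w : tangent_space S x" "\<forall>g\<in>smooth_funs M. v g = w (%y. g (y, 0))"
   unfolding tangent_zero_def by blast
  have "v ?f = w (%y. ?f (y, 0))" using w(2) fs by blast
  also have "\<dots> = w (%y. 0)" by (simp only: f0)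
  finally show "v ?f = 0" using w0[OF w(1)] by simp
 qed
 moreover have "fmj x ?f ?\<eta> : Z" using fmj_section[OF fs \<eta>s] by (simp add: Z_def f0)
 moreover have "\<alpha> v = deriv (%t. ?f (x, t *\<^sub>R v)) 0 *\<^sub>R ?\<eta> (x, 0)" if v: "v : fib N x" for v
 proof -
  have xA: "x : A0" "\<kappa> (\<phi> x) = 1" using A by auto
  have tv: "(x, t *\<^sub>R v) : pts M" for t using v x SN.fib_subspace[OF x] by (simp add: pts_M_iff subspace_scale)
  have "?f (x, t *\<^sub>R v) = t * (\<Sum>i<r. a i * crd r e x v i)" for t
   using SN.crd_lin[OF P(2) x'(2) v v, of t 0] tv xA by (simp add: cutf_def co_def sum_distrib_left mult_ac)
  then have "deriv (%t. ?f (x, t *\<^sub>R v)) 0 = (\<Sum>i<r. a i * crd r e x v i)" by (simp add: DERIV_imp_deriv)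
  moreover have "?\<eta> (x, 0) = b 0 x" using zero_M[OF x] xA by (simp add: cuts_def)
  moreover have "\<alpha> v = (\<Sum>i<r. crd r e x v i *\<^sub>R \<alpha> (e i x))"
  proof -
   have "\<alpha> (\<Sum>i<r. crd r e x v i *\<^sub>R e i x) = (\<Sum>i<r. crd r e x v i *\<^sub>R \<alpha> (e i x))"
    by (rule conormal_sum[OF x \<alpha>]) (use SN.frame_in[OF P(2) x'(2)] in auto)
   with arg_cong[OF SN.crd_sum[OF P(2) x'(2) v, symmetric], of \<alpha>] show ?thesis by (rule trans)
  qed
  moreover have "\<alpha> (e i x) = a i *\<^sub>R b 0 x" if "i < r" for i
  proof -
   have "\<alpha> (e i x) : fib l x" using \<alpha> SN.frame_in[OF P(2) x'(2) that] unfolding conormal_def by blast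
   from Sl.crd_sum[OF P(3) x'(3) this] show ?thesis by (simp add: a_def rk_l)
  qed
  ultimately show ?thesis by (simp add: scaleR_sum_left mult.commute)
 qed
 ultimately show thesis using that \<eta>s by blast
qed

definition rep :: "'p => ('v => 'w) => 'p \<times> 'v => 'w" where
 "rep x \<alpha> = (SOME \<mu>. \<mu> : gamma S N l x \<alpha>)"

lemma rep:
 assumes x: "x : pts S" and \<alpha>: "\<alpha> : conormal N l x"
 shows "rep x \<alpha> : \<Gamma>L"
  and "\<mu> : Z ==> (!!v. v : fib N x ==> vert_der \<mu> (x, 0) v = \<alpha> v) ==> fo Q ==> Q (rep x \<alpha>) (x, 0) = Q \<mu> (x, 0)"
proof -
 let ?P = "%j. \<exists>f\<in>annihilating S N x. \<exists>\<eta>\<in>\<Gamma>L.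
   (\<forall>v\<in>fib N x. \<alpha> v = deriv (%t. f (x, t *\<^sub>R v)) 0 *\<^sub>R \<eta> (x, 0)) \<and> j = jet1 M L (x, 0) (fmj x f \<eta>)"
 obtain f0 \<eta>0 where "f0 : annihilating S N x" "\<eta>0 : \<Gamma>L" "fmj x f0 \<eta>0 : Z"
  "\<forall>v\<in>fib N x. \<alpha> v = deriv (%t. f0 (x, t *\<^sub>R v)) 0 *\<^sub>R \<eta>0 (x, 0)" by (rule conormal_realised[OF x \<alpha>], rule that)
 then have "?P (jet1 M L (x, 0) (fmj x f0 \<eta>0))" by blast
 then have "?P (SOME j. ?P j)" by (rule someI)
 then have "?P (gamma S N l x \<alpha>)" unfolding gamma_def Let_def .
 then obtain f \<eta> where f: "f : annihilating S N x" and \<eta>: "\<eta> : \<Gamma>L"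
  and al: "\<forall>v\<in>fib N x. \<alpha> v = deriv (%t. f (x, t *\<^sub>R v)) 0 *\<^sub>R \<eta> (x, 0)"
  and g: "gamma S N l x \<alpha> = jet1 M L (x, 0) (fmj x f \<eta>)" by blast
 have fs: "f : smooth_funs M" using f by (simp add: annihilating_def)
 note \<theta> = fmj_section[OF fs \<eta>, of x]
 have "rep x \<alpha> : jet1 M L (x, 0) (fmj x f \<eta>)"
  unfolding rep_def g by (rule someI[where P="%\<mu>. \<mu> : jet1 M L (x, 0) (fmj x f \<eta>)"]) (rule jet1_refl[OF \<theta> zero_M[OF x]])
 then have r: "rep x \<alpha> : \<Gamma>L" "same_jet1 M L (x, 0) (fmj x f \<eta>) (rep x \<alpha>)" by (auto simp: jet1_def)
 then show "rep x \<alpha> : \<Gamma>L" by blast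
 assume \<mu>: "\<mu> : Z" and d: "!!v. v : fib N x ==> vert_der \<mu> (x, 0) v = \<alpha> v" and Q: "fo Q"
 have "Q (rep x \<alpha>) (x, 0) = Q (fmj x f \<eta>) (x, 0)" by (rule fo_same_jet1[OF Q \<theta> r(1) zero_M[OF x] r(2)])
 also have "\<dots> = Q \<mu> (x, 0)" by (rule fo_fmj[OF Q x f \<eta> \<mu>]) (use d al in auto)
 finally show "Q (rep x \<alpha>) (x, 0) = Q \<mu> (x, 0)" .
qed

lemma rep_Z:
 assumes x: "x : pts S" and \<alpha>: "\<alpha> : conormal N l x"
 obtains \<mu> where "\<mu> : Z" "\<forall>v\<in>fib N x. vert_der \<mu> (x, 0) v = \<alpha> v"
proof -
 obtain f \<eta> where f: "f : annihilating S N x" "\<eta> : \<Gamma>L" "fmj x f \<eta> : Z"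
  "\<forall>v\<in>fib N x. \<alpha> v = deriv (%t. f (x, t *\<^sub>R v)) 0 *\<^sub>R \<eta> (x, 0)" by (rule conormal_realised[OF x \<alpha>], rule that)
 have "f : smooth_funs M" using f(1) by (simp add: annihilating_def)
 then show thesis using that[OF f(3)] f vert_der_fmj[OF _ f(2) x] by simp
qed

lemma vert_der_conormal: "\<mu> : \<Gamma>L ==> x : pts S ==> vert_der \<mu> (x, 0) : conormal N l x"
 using vert_der_fib[OF zero_M, of x] vert_der_lin_dir[OF zero_M, of x] unfolding conormal_def by auto

end

lemma (in chart_bundle) family_cong:
 assumes s: "smooth_family M E s" and e: "!!t. t : {0..1} ==> s' t = s t"
 shows "smooth_family M E s'"
 unfolding family_iff
proof (intro conjI ballI allI impI)
 fix U \<phi> W f i assume a: "(U,\<phi>) : charts M" "(W,f) : frames E" "i < rk E"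
 show "smooth_on (Suc (mdim M)) (famd (mdim M) (\<phi> ` (U \<inter> W))) (%z. secc U \<phi> f (s' (z 0)) i (tail z))"
  by (rule smooth_on_cong[OF family_smooth[OF s a]]) (simp add: e famd_def)
qed (use s e in \<open>auto simp: family_iff\<close>)

context bundle_pair
begin

lemma P_rep: "P_map S N l Q x \<alpha>s = Q (map (rep x) \<alpha>s) (x, 0)"
 by (simp add: P_map_def mop_form_def rep_def[abs_def] comp_def)

lemma form_eq_1: "form_eq S N l 1 \<omega> \<omega>' \<longleftrightarrow> (\<forall>x\<in>pts S. \<forall>\<alpha>\<in>conormal N l x. \<omega> x [\<alpha>] = \<omega>' x [\<alpha>])"
 by (auto simp: form_eq_def length_Suc_conv)

lemma form_eq_2: "form_eq S N l 2 \<omega> \<omega>' \<longleftrightarrow>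
  (\<forall>x\<in>pts S. \<forall>\<alpha>\<in>conormal N l x. \<forall>\<beta>\<in>conormal N l x. \<omega> x [\<alpha>, \<beta>] = \<omega>' x [\<alpha>, \<beta>])"
 by (auto simp: form_eq_def length_Suc_conv numeral_2_eq_2)

definition res :: "('p \<times> 'v => 'w) => 'p => 'w" where
 "res \<mu> = (%x. if x : pts S then \<mu> (x, 0) else 0)"

lemma pb_family:
 assumes a: "smooth_family S l a" shows "famL (%t. pb (a t))"
 unfolding family_lc
proof (intro conjI ballI allI impI)
 show "pb (a t) p : fib l (fst p)" if "t : {0..1}" "p : pts M" for t p
  using Sl.family_fib[OF a that(1), of "fst p"] that(2) by (simp add: pb_def pts_M_iff)
 fix U \<phi> W e W' b assume P: "chart U \<phi>" "frameN W e" "frameL W' b"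
 let ?D = "\<phi> ` (U \<inter> W')" and ?D' = "\<phi> ` (U \<inter> W \<inter> W')"
 have sub: "U \<inter> W \<inter> W' <= U \<inter> W" by blast
 have "smooth_on (Suc n) (famd n ?D) (%z. Sl.secc U \<phi> b (a (z 0)) 0 (tail z))"
  using Sl.family_smooth[OF a P(1,3), of 0] rk_l by simp
 from smooth_on_famd_cyl[OF this Sl.dom_Rn[OF P(1,3)], of r]
 have "smooth_on (Suc (n + r)) (famd (n + r) (cyl n r ?D)) (%z. Sl.secc U \<phi> b (a (z 0)) 0 (trunc n (tail z)))"
  by (simp add: tail_trunc) (simp add: trunc_def)
 then have "smooth_on (Suc (n + r)) (famd (n + r) (cyl n r ?D')) (%z. Sl.secc U \<phi> b (a (z 0)) 0 (trunc n (tail z)))"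
  by (rule smooth_on_mono) (auto intro!: famd_mono cyl_mono)
 then show "smooth_on (Suc (n + r)) (famd (n + r) (cyl n r ?D')) (%z. lc U \<phi> e b (pb (a (z 0))) (tail z))"
 proof (rule smooth_on_cong)
  fix z assume "z : famd (n + r) (cyl n r ?D')"
  then have "tail z : cyl n r ?D'" by (simp add: famd_def tail_def)
  from pt_M(1)[OF P(1,2) sub this]
  show "Sl.secc U \<phi> b (a (z 0)) 0 (trunc n (tail z)) = lc U \<phi> e b (pb (a (z 0))) (tail z)"
   by (simp add: Sl.secc_def lc_def pb_def rk_l) (simp add: pt_def)
 qed
qed (simp add: pb_def)

lemma lc_zero_section:
 assumes P: "chart U \<phi>" "frameN W e" "frameL W' b" and y: "y : \<phi> ` (U \<inter> W \<inter> W')"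
 shows "y : Om U \<phi> W W'" "pt U \<phi> e y = (inv_into U \<phi> y, 0)" "lc U \<phi> e b \<mu> y = Sl.secc U \<phi> b (res \<mu>) 0 y"
  "inv_into U \<phi> y : U \<inter> W \<inter> W'"
proof -
 obtain x where x: "x : U \<inter> W \<inter> W'" "y = \<phi> x" using y by blast
 then have i: "inv_into U \<phi> y = x" using inv_ch[OF P(1,2)] by simp
 then show "inv_into U \<phi> y : U \<inter> W \<inter> W'" using x by simp
 have R: "\<phi> ` (U \<inter> W \<inter> W') <= Rn n" using opn_subset[OF S_charts(3)[OF P(1)]] by blast
 then have yR: "y : Rn n" using y by blast
 show "y : Om U \<phi> W W'" using cyl_sub[OF R] y by blast
 have p: "pt U \<phi> e y = (inv_into U \<phi> y, 0)" using yR by (simp add: pt_def trunc_id) (simp add: Rn_def)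
 then show "pt U \<phi> e y = (inv_into U \<phi> y, 0)" .
 have "x : pts S" using x S_charts(2)[OF P(1)] by blast
 then show "lc U \<phi> e b \<mu> y = Sl.secc U \<phi> b (res \<mu>) 0 y" by (simp add: lc_def p Sl.secc_def rk_l res_def i)
qed

lemma res_family:
 assumes a: "famL a" shows "smooth_family S l (%t. res (a t))"
 unfolding Sl.family_iff
proof (intro conjI ballI allI impI)
 show "res (a t) x : fib l x" if "t : {0..1}" "x : pts S" for t x
  using section_fibl[OF TL.family_section[OF a that(1)] zero_M[OF that(2)]] that by (simp add: res_def)
 fix U \<phi> W' b i assume P: "chart U \<phi>" "frameL W' b" and i: "i < rk l"
 have i0: "i = 0" using i rk_l by simp
 show "smooth_on (Suc n) (famd n (\<phi> ` (U \<inter> W'))) (%z. Sl.secc U \<phi> b (res (a (z 0))) i (tail z))"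
 proof (rule smooth_on_famd_cover[OF Sl.charts_open[OF P]])
  fix y assume "y : \<phi> ` (U \<inter> W')"
  then obtain x where x: "x : U" "x : W'" "y = \<phi> x" by blast
  then have "x : pts S" using S_charts(2)[OF P(1)] by blast
  from SN.frames_cover[OF this] obtain W e where W: "frameN W e" "x : W" by blast
  let ?D = "\<phi> ` (U \<inter> W \<inter> W')"
  have R: "?D <= Rn n" using opn_subset[OF S_charts(3)[OF P(1)]] by blast
  have "smooth_on (Suc n) (famd n ?D) (%z. lc U \<phi> e b (a (z 0)) (tail z))"
   by (rule smooth_on_mono[OF family_lc_smooth[OF a P(1) W(1) P(2)] _ famd_sub_cyl[OF R]]) simp
  then have "smooth_on (Suc n) (famd n ?D) (%z. Sl.secc U \<phi> b (res (a (z 0))) i (tail z))"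
   by (rule smooth_on_cong) (simp add: famd_iff[OF R] lc_zero_section(3)[OF P(1) W(1) P(2)] i0)
  moreover have "opn n ?D" by (rule opn_image[OF patch_open(1)[OF P(1) W(1) P(2)] P(1)]) blast
  ultimately show "\<exists>D'. opn n D' \<and> D' <= \<phi> ` (U \<inter> W') \<and> y : D' \<and>
    smooth_on (Suc n) (famd n D') (%z. Sl.secc U \<phi> b (res (a (z 0))) i (tail z))"
   using x W by blast
 qed
qed (simp add: res_def)

lemma pb_section: "a : sections S l ==> pb a : \<Gamma>L"
 using TL.family_section[OF pb_family[OF Sl.const_family], of a 0] by simp

lemma res_section: "\<mu> : \<Gamma>L ==> res \<mu> : sections S l"
 using Sl.family_section[OF res_family[OF TL.const_family], of \<mu> 0] by simp

lemma minus_pb_res: "\<mu> : \<Gamma>L ==> \<mu> - pb (res \<mu>) : Z"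
 using TL.section_diff[OF _ pb_section[OF res_section], of \<mu> \<mu>] zero_M
 by (auto simp: Z_def fun_diff_def pb_def res_def)

end

context deformed
begin

lemma fo_Js_right: assumes \<mu>: "\<mu> : \<Gamma>L" shows "fo (Js m \<mu>)"
proof (rule fo_cong[OF fo_comb[OF fo_Js[OF \<mu>] fo_Js[OF \<mu>], of "-1" _ 0]])
 show "Js m \<mu> \<nu> = (%p. (-1) *\<^sub>R Js m \<nu> \<mu> p + 0 *\<^sub>R Js m \<nu> \<mu> p)" if "\<nu> : \<Gamma>L" for \<nu>
  using fb.J_anti[OF \<mu> that, of m] by (simp add: fun_eq_iff)
qed

definition cois :: "nat => bool" where
 "cois m \<longleftrightarrow> (\<forall>x\<in>pts S. \<forall>\<mu>\<in>Z. \<forall>\<nu>\<in>Z. Js m \<mu> \<nu> (x, 0) = 0)"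

lemma rep_vert: assumes "x : pts S" "\<mu> : Z" "fo Q"
 shows "Q (rep x (vert_der \<mu> (x, 0))) (x, 0) = Q \<mu> (x, 0)"
 by (rule rep(2)[OF assms(1) vert_der_conormal[OF Z_sec[OF assms(2)] assms(1)] assms(2) _ assms(3)]) simp

lemma cois_iff: "cois m \<longleftrightarrow> (\<forall>x\<in>pts S. \<forall>\<alpha>\<in>conormal N l x. \<forall>\<beta>\<in>conormal N l x. Js m (rep x \<alpha>) (rep x \<beta>) (x, 0) = 0)"
 (is "_ \<longleftrightarrow> ?R")
proof
 assume c: "cois m"
 show ?R
 proof (intro ballI)
  fix x \<alpha> \<beta> assume x: "x : pts S" and \<alpha>: "\<alpha> : conormal N l x" and \<beta>: "\<beta> : conormal N l x"
  obtain \<mu> where \<mu>: "\<mu> : Z" "\<forall>v\<in>fib N x. vert_der \<mu> (x, 0) v = \<alpha> v" by (rule rep_Z[OF x \<alpha>], rule that)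
  obtain \<nu> where \<nu>: "\<nu> : Z" "\<forall>v\<in>fib N x. vert_der \<nu> (x, 0) v = \<beta> v" by (rule rep_Z[OF x \<beta>], rule that)
  have "Js m (rep x \<alpha>) (rep x \<beta>) (x, 0) = Js m \<mu> (rep x \<beta>) (x, 0)"
   by (rule rep(2)[OF x \<alpha> \<mu>(1) _ fo_Js[OF rep(1)[OF x \<beta>]]]) (use \<mu> in blast)
  also have "\<dots> = Js m \<mu> \<nu> (x, 0)"
   by (rule rep(2)[OF x \<beta> \<nu>(1) _ fo_Js_right[OF Z_sec[OF \<mu>(1)]]]) (use \<nu> in blast)
  finally show "Js m (rep x \<alpha>) (rep x \<beta>) (x, 0) = 0" using c x \<mu> \<nu> by (simp add: cois_def)
 qed
next
 assume R: ?R
 show "cois m"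
  unfolding cois_def
 proof (intro ballI)
  fix x \<mu> \<nu> assume x: "x : pts S" and \<mu>: "\<mu> : Z" and \<nu>: "\<nu> : Z"
  let ?\<nu> = "rep x (vert_der \<nu> (x, 0))"
  have "?\<nu> : \<Gamma>L" by (rule rep(1)[OF x vert_der_conormal[OF Z_sec[OF \<nu>] x]])
  then have "Js m (rep x (vert_der \<mu> (x, 0))) ?\<nu> (x, 0) = Js m \<mu> ?\<nu> (x, 0)" by (intro rep_vert x \<mu> fo_Js)
  also have "\<dots> = Js m \<mu> \<nu> (x, 0)" by (intro rep_vert x \<nu> fo_Js_right Z_sec \<mu>)
  finally show "Js m \<mu> \<nu> (x, 0) = 0"
   using R x vert_der_conormal[OF Z_sec[OF \<mu>] x] vert_der_conormal[OF Z_sec[OF \<nu>] x] by simp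
 qed
qed

lemma formal_coisotropic_iff: "formal_coisotropic S N l J s \<longleftrightarrow> (\<forall>m. cois m)"
 using fd by (simp add: formal_coisotropic_def cois_iff form_eq_2 P_rep Js_def)

lemma mbr_eps_series: "mbr_eps S N l J (replicate k (%i. (1, form1 (%x. - s i x)))) m x \<alpha>s =
  (\<Sum>js\<in>{js. length js = k \<and> sum_list js = m}. NBr js (map (rep x) \<alpha>s) (x, 0))"
 unfolding mbr_eps_def
proof (rule sum.cong)
 fix js assume "js : {js. length js = k \<and> sum_list js = m}"
 then have "map2 (%\<xi> j. \<xi> j) (replicate k (%i. (1::nat, form1 (%x. - s i x) :: ('p, 'v, 'w) nform))) js = map (%j. (1, form1 (%x. - s j x))) js"
  by (auto simp: zip_replicate1)
 then show "mbr S N l J (map2 (%\<xi> j. \<xi> j) (replicate k (%i. (1, form1 (%x. - s i x)))) js) x \<alpha>s = NBr js (map (rep x) \<alpha>s) (x, 0)"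
  by (simp only: mbr_def P_rep NBr_def)
qed simp

lemma MC_solution_of_cois:
 assumes "!!m. cois m" shows "MC_solution S N l J (%i x. - s i x)"
 unfolding MC_solution_def
proof (intro conjI allI)
 show "formal_deformation S N (%i x. - s i x)"
  using fd SN.section_uminus by (simp add: formal_deformation_def)
 fix m show "form_eq S N l 2 (MC S N l J (%i x. - s i x) m) (%x \<alpha>s. 0)"
  unfolding form_eq_2
 proof (intro ballI)
  fix x \<alpha> \<beta> assume a: "x : pts S" "\<alpha> : conormal N l x" "\<beta> : conormal N l x"
  show "MC S N l J (%i x. - s i x) m x [\<alpha>, \<beta>] = 0"
  proof (cases "m = 0")
   case False
   then show ?thesis
    using MC_series[OF rep(1)[OF a(1,2)] rep(1)[OF a(1,3)], of m "(x, 0)"] assms[of m] a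
    unfolding MC_def mbr_eps_series by (simp add: cois_iff)
  qed (simp add: MC_def)
 qed
qed

lemma gauge_rhs:
 assumes \<eta>: "!!j. \<eta> j : sections S l" and x: "x : pts S" and \<alpha>: "\<alpha> : conormal N l x"
 shows "(\<Sum>k\<le>m. (1 / fact k) *\<^sub>R mbr_eps S N l J (replicate k (%i. (1, form1 (%x. - s i x))) @ [%i. (0, form0 (\<eta> i))]) m x [\<alpha>]) =
  - (\<Sum>j\<le>m. Js (m - j) (pb (\<eta> j)) (rep x \<alpha>) (x, 0))"
proof -
 have "mbr_eps S N l J (replicate k (%i. (1, form1 (%x. - s i x))) @ [%i. (0, form0 (\<eta> i))]) m x [\<alpha>] =
   (\<Sum>j\<le>m. \<Sum>js\<in>{js. length js = k \<and> sum_list js = m - j}. - NBr js [pb (\<eta> j), rep x \<alpha>] (x, 0))" for k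
  unfolding mbr_eps_def length_append length_replicate list.size One_nat_def add_Suc_right add_0_right sum_lists_snoc
 proof (intro sum.cong refl)
  fix j js assume "js : {js. length js = k \<and> sum_list js = m - j}"
  then have "map2 (%\<xi> j. \<xi> j) (replicate k (%i. (1::nat, form1 (%x. - s i x) :: ('p, 'v, 'w) nform)) @ [%i. (0, form0 (\<eta> i))]) (js @ [j]) =
    map (%j. (1, form1 (%x. - s j x))) js @ [(0, form0 (\<eta> j))]"
   by (auto simp: zip_replicate1)
  then show "mbr S N l J (map2 (%\<xi> j. \<xi> j) (replicate k (%i. (Suc 0, form1 (%x. - s i x))) @ [%i. (0, form0 (\<eta> i))]) (js @ [j])) x [\<alpha>] =
    - NBr js [pb (\<eta> j), rep x \<alpha>] (x, 0)"
   by (simp only: mbr_def P_rep nested_snoc_0[unfolded One_nat_def] list.map One_nat_def)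
 qed
 then show ?thesis using gauge_series[OF pb_section[OF \<eta>] rep(1)[OF x \<alpha>], where m=m and p="(x, 0)"] by simp
qed

lemma ham_rhs:
 assumes \<eta>: "!!j. \<eta> j : \<Gamma>L" and x: "x : pts S" and \<alpha>: "\<alpha> : conormal N l x"
 shows "P_map S N l (exp_ad_eps 1 X (%i. ham_der J (\<eta> i)) m) x [\<alpha>] =
  (\<Sum>i\<le>m. Js (m - i) (expo (%i. Dv (s i)) \<eta> i) (rep x \<alpha>) (x, 0))"
 using exp_ham[OF \<eta> rep(1)[OF x \<alpha>], where m=m] by (simp add: P_rep sum_fun_apply)

text \<open>By coisotropy, only the values of a Hamiltonian on \<open>S\<close> matter for the conormal directions.\<close>

lemma Js_restrict:
 assumes c: "cois m" and x: "x : pts S" and \<alpha>: "\<alpha> : conormal N l x" and E: "E : \<Gamma>L"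
 shows "Js m E (rep x \<alpha>) (x, 0) = Js m (pb (res E)) (rep x \<alpha>) (x, 0)"
proof -
 obtain \<mu> where \<mu>: "\<mu> : Z" "\<forall>v\<in>fib N x. vert_der \<mu> (x, 0) v = \<alpha> v" by (rule rep_Z[OF x \<alpha>], rule that)
 have r: "Js m F (rep x \<alpha>) (x, 0) = Js m F \<mu> (x, 0)" if "F : \<Gamma>L" for F
  by (rule rep(2)[OF x \<alpha> \<mu>(1) _ fo_Js_right[OF that]]) (use \<mu> in blast)
 note p = pb_section[OF res_section[OF E]]
 have "Js m (E - pb (res E)) \<mu> (x, 0) = 0" using c x \<mu> minus_pb_res[OF E] by (simp add: cois_def)
 then show ?thesis unfolding r[OF E] r[OF p] using fb.J_diff_left[OF E p Z_sec[OF \<mu>(1)], of m] by simp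
qed

end

lemma sum_reverse: "(\<Sum>p\<le>k. f p (k - p)) = (\<Sum>p\<le>k. f (k - p) p :: 'a::comm_monoid_add)" for k :: nat
 by (rule sum.reindex_bij_witness[where i="%p. k - p" and j="%p. k - p"]) auto

lemma scaleR_fun_apply: "(c *\<^sub>R f) x = c *\<^sub>R f x"
 by (simp add: scaleR_fun_def)

context deformed
begin

lemma bracket_Js: "formal_bracket (\<Gamma>L) (%\<mu> \<nu>. J [\<mu>, \<nu>]) (%i. Dv (s i)) Js"
 by (rule fb.formal_bracket_axioms)

lemma bracket_action:
 assumes \<theta>: "!!j. \<theta> j : \<Gamma>L" and \<mu>: "\<mu> : \<Gamma>L" and \<nu>: "\<nu> : \<Gamma>L"
 defines "A \<equiv> %i \<kappa>. \<Sum>j\<le>i. Js (i - j) (\<theta> j) \<kappa>"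
 shows "(\<Sum>i\<le>m. A i (Js (m - i) \<mu> \<nu>) - Js (m - i) (A i \<mu>) \<nu> - Js (m - i) \<mu> (A i \<nu>)) = 0"
proof -
 define F where "F j p q = Js p (\<theta> j) (Js q \<mu> \<nu>) - Js q (Js p (\<theta> j) \<mu>) \<nu> - Js q \<mu> (Js p (\<theta> j) \<nu>)" for j p q
 note ins = fb.J_in \<theta> \<mu> \<nu>
 have "(\<Sum>i\<le>m. A i (Js (m - i) \<mu> \<nu>) - Js (m - i) (A i \<mu>) \<nu> - Js (m - i) \<mu> (A i \<nu>)) = (\<Sum>i\<le>m. \<Sum>j\<le>i. F j (i - j) (m - i))"
  unfolding A_def F_def by (simp add: fb.J_sum_left fb.J_sum_right ins sum_subtractf)
 also have "\<dots> = (\<Sum>j\<le>m. \<Sum>p\<le>m - j. F j p (m - j - p))" by (rule sum_triples_split_first[where f=F])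
 also have "\<dots> = 0"
 proof (rule sum.neutral, intro ballI)
  fix j
  have "(\<Sum>p\<le>k. F j p (k - p)) = 0" for k
  proof -
   have 1: "- Js q (Js p (\<theta> j) \<mu>) \<nu> = Js q \<nu> (Js p (\<theta> j) \<mu>)" for p q
    using fb.J_anti[OF \<nu> fb.J_in[OF \<theta> \<mu>], of q p j] by simp
   have 2: "- Js q \<mu> (Js p (\<theta> j) \<nu>) = Js q \<mu> (Js p \<nu> (\<theta> j))" for p q
    using fb.J_minus_right[OF fb.J_in[OF \<theta> \<nu>] \<mu>, of q p j] fb.J_anti[OF \<nu> \<theta>, of p j] by simp
   have "F j p q = Js p (\<theta> j) (Js q \<mu> \<nu>) + Js q \<nu> (Js p (\<theta> j) \<mu>) + Js q \<mu> (Js p \<nu> (\<theta> j))" for p q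
    unfolding F_def 1[symmetric] 2[symmetric] by simp
   then have "(\<Sum>p\<le>k. F j p (k - p)) = fb.G k (\<theta> j) \<mu> \<nu> + fb.G k \<nu> (\<theta> j) \<mu> + fb.G k \<mu> \<nu> (\<theta> j)"
    unfolding fb.G_def
    using sum_reverse[of "%p q. Js q \<nu> (Js p (\<theta> j) \<mu>)" k] sum_reverse[of "%p q. Js q \<mu> (Js p \<nu> (\<theta> j))" k]
    by (simp add: sum.distrib)
   also have "\<dots> = 0"
    using fb.jacobi[OF _ \<theta> \<mu> \<nu>, of k j] J_jacobi by (simp add: fun_eq_iff add_ac)
   finally show ?thesis .
  qed
  then show "(\<Sum>p\<le>m - j. F j p (m - j - p)) = 0" .
 qed
 finally show ?thesis .
qed

lemma transport_equation:
 assumes \<theta>: "!!j. \<theta> j : \<Gamma>L" and s': "!!i. s' i : sections S N" "s' 0 = (%x. 0)"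
  and gauge: "!!k x \<mu>. x : pts S ==> \<mu> : Z ==> Dv (s' k) \<mu> (x, 0) = (\<Sum>j\<le>k. Js (k - j) (\<theta> j) \<mu> (x, 0))"
  and IH: "!!k. k < m ==> cois k" and \<mu>: "\<mu> : Z" and \<nu>: "\<nu> : Z" and x: "x : pts S"
 shows "(\<Sum>i\<le>m. Dv (s' i) (Js (m - i) \<mu> \<nu>) - Js (m - i) (Dv (s' i) \<mu>) \<nu> - Js (m - i) \<mu> (Dv (s' i) \<nu>)) (x, 0) =
  - J [\<theta> 0, Js m \<mu> \<nu>] (x, 0) + Js m (J [\<theta> 0, \<mu>]) \<nu> (x, 0) + Js m \<mu> (J [\<theta> 0, \<nu>]) (x, 0)"
proof -
 note \<mu>s = Z_sec[OF \<mu>] and \<nu>s = Z_sec[OF \<nu>]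
 define A where "A i \<kappa> = (\<Sum>j\<le>i. Js (i - j) (\<theta> j) \<kappa>)" for i \<kappa>
 define Y where "Y i \<kappa> = Dv (s' i) \<kappa> - A i \<kappa>" for i \<kappa>
 have As: "A i \<kappa> : \<Gamma>L" if "\<kappa> : \<Gamma>L" for i \<kappa>
  unfolding A_def by (intro fb.V_ops fb.J_in \<theta> that)
 have Ds: "Dv (s' i) \<kappa> : \<Gamma>L" if "\<kappa> : \<Gamma>L" for i \<kappa> by (rule Dv_section[OF s'(1) that])
 have Ys: "Y i \<kappa> : \<Gamma>L" if "\<kappa> : \<Gamma>L" for i \<kappa>
  unfolding Y_def by (intro fb.V_ops As Ds that)
 have YZ: "Y i \<kappa> : Z" if "\<kappa> : Z" for i \<kappa>
  using Ys[OF Z_sec[OF that]] gauge[OF _ that] unfolding Z_def Y_def A_def by (simp add: sum_fun_apply)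
 have "(\<Sum>i\<le>m. Dv (s' i) (Js (m - i) \<mu> \<nu>) - Js (m - i) (Dv (s' i) \<mu>) \<nu> - Js (m - i) \<mu> (Dv (s' i) \<nu>)) =
  (\<Sum>i\<le>m. Dv (s' i) (Js (m - i) \<mu> \<nu>) - Js (m - i) (Dv (s' i) \<mu>) \<nu> - Js (m - i) \<mu> (Dv (s' i) \<nu>)) -
  (\<Sum>i\<le>m. A i (Js (m - i) \<mu> \<nu>) - Js (m - i) (A i \<mu>) \<nu> - Js (m - i) \<mu> (A i \<nu>))"
  using bracket_action[OF \<theta> \<mu>s \<nu>s, where m=m] unfolding A_def by simp
 also have "\<dots> = (\<Sum>i\<le>m. Y i (Js (m - i) \<mu> \<nu>) - Js (m - i) (Y i \<mu>) \<nu> - Js (m - i) \<mu> (Y i \<nu>))"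
  unfolding Y_def sum_subtractf[symmetric]
  by (intro sum.cong refl) (simp add: fb.J_diff_left fb.J_diff_right As Ds \<mu>s \<nu>s fb.J_in)
 finally have "(\<Sum>i\<le>m. Dv (s' i) (Js (m - i) \<mu> \<nu>) - Js (m - i) (Dv (s' i) \<mu>) \<nu> - Js (m - i) \<mu> (Dv (s' i) \<nu>)) (x, 0) =
  (\<Sum>i\<le>m. (Y i (Js (m - i) \<mu> \<nu>) - Js (m - i) (Y i \<mu>) \<nu> - Js (m - i) \<mu> (Y i \<nu>)) (x, 0))"
  by (simp only: sum_fun_apply)
 also have "\<dots> = (Y 0 (Js m \<mu> \<nu>) - Js m (Y 0 \<mu>) \<nu> - Js m \<mu> (Y 0 \<nu>)) (x, 0)"
 proof -
  have "(Y i (Js (m - i) \<mu> \<nu>) - Js (m - i) (Y i \<mu>) \<nu> - Js (m - i) \<mu> (Y i \<nu>)) (x, 0) = 0" if i: "i : {..m} - {0}" for i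
  proof -
   have c: "cois (m - i)" by (rule IH) (use i in auto)
   have "Js (m - i) \<mu> \<nu> : Z" using c \<mu> \<nu> fb.J_in[OF \<mu>s \<nu>s] by (simp add: Z_def cois_def)
   from YZ[OF this, of i] have "Y i (Js (m - i) \<mu> \<nu>) (x, 0) = 0" using x by (simp add: Z_def)
   moreover have "Js (m - i) (Y i \<mu>) \<nu> (x, 0) = 0" "Js (m - i) \<mu> (Y i \<nu>) (x, 0) = 0"
    using c x \<mu> \<nu> YZ unfolding cois_def by blast+
   ultimately show ?thesis by simp
  qed
  then have "(\<Sum>i\<in>{..m} - {0}. (Y i (Js (m - i) \<mu> \<nu>) - Js (m - i) (Y i \<mu>) \<nu> - Js (m - i) \<mu> (Y i \<nu>)) (x, 0)) = 0"
   by (intro sum.neutral) blast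
  then show ?thesis by (simp add: sum.remove[of "{..m}" 0])
 qed
 also have "\<dots> = - J [\<theta> 0, Js m \<mu> \<nu>] (x, 0) + Js m (J [\<theta> 0, \<mu>]) \<nu> (x, 0) + Js m \<mu> (J [\<theta> 0, \<nu>]) (x, 0)"
 proof -
  have "Dv (%x. 0) \<kappa> = 0" if "\<kappa> : \<Gamma>L" for \<kappa>
   using Dv_lin_dir[OF s'(1)[of 0] s'(1)[of 0] that, of 0 0] by (simp add: zero_fun_def)
  then have Y0: "Y 0 \<kappa> = - J [\<theta> 0, \<kappa>]" if "\<kappa> : \<Gamma>L" for \<kappa>
   using that by (simp add: Y_def A_def s'(2) fb.J_0[OF \<theta>])
  show ?thesis
   using fb.J_minus_left[OF J_ops(1)[OF \<theta> \<mu>s] \<nu>s, of m 0] fb.J_minus_right[OF J_ops(1)[OF \<theta> \<nu>s] \<mu>s, of m 0]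
   by (simp add: Y0 \<mu>s \<nu>s fb.J_in)
 qed
 finally show ?thesis .
qed

end

locale evolving = jacobi_bundle S N l J
 for S :: "'p mfd" and N :: "('p, 'v::real_normed_vector) vbun" and l :: "('p, 'w::real_normed_vector) vbun"
  and J :: "('p \<times> 'v, 'w) mop" +
 fixes s :: "real => nat => 'p => 'v"
 assumes fdt: "!!t. t : {0..1} ==> formal_deformation S N (s t)"
  and sf: "!!i. smooth_family S N (%t. s t i)"
begin

lemma at_time: "t : {0..1} ==> deformed S N l J (s t)"
 by unfold_locales (rule fdt)

definition JT :: "real => nat => ('p \<times> 'v => 'w) => ('p \<times> 'v => 'w) => 'p \<times> 'v => 'w" where
 "JT t m \<mu> \<nu> = exp_ad_eps 2 (%i. I_map S N (form1 (s t i))) (const_eps J) m [\<mu>, \<nu>]"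

lemma JT_Js: "t : {0..1} ==> deformed.Js S N J (s t) = JT t"
 using deformed.Js_def[OF at_time, of t] by (auto simp: JT_def fun_eq_iff)

lemma bracket_at_time: "t : {0..1} ==> formal_bracket (\<Gamma>L) (%\<mu> \<nu>. J [\<mu>, \<nu>]) (%i. Dv (s t i)) (JT t)"
 using deformed.bracket_Js[OF at_time, of t] JT_Js[of t] by simp

definition cutt :: "(real => 'p \<times> 'v => 'w) => real => 'p \<times> 'v => 'w" where
 "cutt a = (%t. if t : {0..1} then a t else 0)"

definition FV :: "(real => 'p \<times> 'v => 'w) set" where
 "FV = {a. famL a \<and> (\<forall>t. t \<notin> {0..1} --> a t = 0)}"

lemma cutt_in: "famL a ==> cutt a : FV"
 unfolding FV_def by (auto simp: cutt_def intro: TL.family_cong)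

lemma FV_D: "a : FV ==> famL a" "a : FV ==> t : {0..1} ==> a t : \<Gamma>L"
 "a : FV ==> t \<notin> {0..1} ==> a t = 0"
 unfolding FV_def using TL.family_section by blast+

lemma cutt_eqI: "(!!t. t : {0..1} ==> a t = b t) ==> (!!t. t \<notin> {0..1} ==> b t = 0) ==> cutt a = b"
 by (auto simp: cutt_def fun_eq_iff)

lemma cutt_at: "t : {0..1} ==> cutt a t = a t"
 by (simp add: cutt_def)

lemma FV_subspace: "subspace FV"
 unfolding subspace_def FV_def
 using TL.family_zero TL.family_add TL.family_scale
 by (auto simp: zero_fun_def plus_fun_def scaleR_fun_def)

sublocale ff: formal_bracket FV "%a b. cutt (%t. J [a t, b t])" "%i a. cutt (%t. Dv (s t i) (a t))"
 "%m a b. cutt (%t. JT t m (a t) (b t))"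
proof
 note fbt = bracket_at_time
 show "subspace FV" by (rule FV_subspace)
 fix a b assume a: "a : FV" and b: "b : FV"
 show "cutt (%t. J [a t, b t]) : FV" by (intro cutt_in J_family FV_D(1) a b)
 show "cutt (%t. J [a t, b t]) = - cutt (%t. J [b t, a t])"
  by (rule cutt_eqI) (auto simp: cutt_def formal_bracket.B_anti[OF fbt FV_D(2)[OF a] FV_D(2)[OF b]])
 show "cutt (%t. JT t 0 (a t) (b t)) = cutt (%t. J [a t, b t])"
  by (rule cutt_eqI) (auto simp: cutt_def formal_bracket.J_0[OF fbt FV_D(2)[OF a] FV_D(2)[OF b]])
 show "cutt (%t. J [(c *\<^sub>R a) t, b t]) = c *\<^sub>R cutt (%t. J [a t, b t])" for c
  by (rule cutt_eqI) (auto simp: cutt_def scaleR_fun_apply formal_bracket.B_scale[OF fbt FV_D(2)[OF a] FV_D(2)[OF b]])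
 show "cutt (%t. J [(a + b) t, c t]) = cutt (%t. J [a t, c t]) + cutt (%t. J [b t, c t])" if c: "c : FV" for c
  by (rule cutt_eqI) (auto simp: cutt_def formal_bracket.B_add[OF fbt FV_D(2)[OF a] FV_D(2)[OF b] FV_D(2)[OF c]])
 show "cutt (%t. Dv (s t i) (a t)) : FV" for i by (intro cutt_in Dv_family sf FV_D(1) a)
 show "cutt (%t. Dv (s t i) ((a + b) t)) = cutt (%t. Dv (s t i) (a t)) + cutt (%t. Dv (s t i) (b t))" for i
  by (rule cutt_eqI) (auto simp: cutt_def formal_bracket.D_add[OF fbt FV_D(2)[OF a] FV_D(2)[OF b]])
 show "cutt (%t. Dv (s t i) ((c *\<^sub>R a) t)) = c *\<^sub>R cutt (%t. Dv (s t i) (a t))" for i c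
  by (rule cutt_eqI) (auto simp: cutt_def scaleR_fun_apply formal_bracket.D_scale[OF fbt FV_D(2)[OF a]])
 show "cutt (%t. Dv (s t i) (cutt (%t. Dv (s t j) (a t)) t)) = cutt (%t. Dv (s t j) (cutt (%t. Dv (s t i) (a t)) t))" for i j
  by (rule cutt_eqI) (auto simp: cutt_def intro!: Dv_commute SN.family_section[OF sf] FV_D(2)[OF a])
 show "real m *\<^sub>R cutt (%t. JT t m (a t) (b t)) = (\<Sum>i\<le>m. real i *\<^sub>R (cutt (%t. Dv (s t i) (cutt (%t. JT t (m - i) (a t) (b t)) t)) -
  cutt (%t. JT t (m - i) (cutt (%t. Dv (s t i) (a t)) t) (b t)) - cutt (%t. JT t (m - i) (a t) (cutt (%t. Dv (s t i) (b t)) t))))" for m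
 proof
  fix t show "(real m *\<^sub>R cutt (%t. JT t m (a t) (b t))) t = (\<Sum>i\<le>m. real i *\<^sub>R (cutt (%t. Dv (s t i) (cutt (%t. JT t (m - i) (a t) (b t)) t)) -
  cutt (%t. JT t (m - i) (cutt (%t. Dv (s t i) (a t)) t) (b t)) - cutt (%t. JT t (m - i) (a t) (cutt (%t. Dv (s t i) (b t)) t)))) t"
  proof (cases "t : {0..1}")
   case True
   then show ?thesis
    by (simp only: sum_fun_apply[where x=t] scaleR_fun_apply[where x=t] fun_diff_def cutt_at[OF True]
     formal_bracket.J_rec[OF fbt[OF True] FV_D(2)[OF a True] FV_D(2)[OF b True]])
  next
   case False
   then show ?thesis by (auto simp: sum_fun_apply scaleR_fun_apply cutt_def)
  qed
 qed
qed

abbreviation s' where "s' t i \<equiv> SN.dfam (%t. s t i) t"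

lemma s'_section: "t : {0..1} ==> s' t i : sections S N"
 by (rule SN.family_section[OF SN.family_dfam[OF sf]])

lemma s'_0: "t : {0..1} ==> s' t 0 = (%x. 0)"
proof
 fix x assume t: "t : {0..1}"
 have "((%t. 0) has_vector_derivative (0::'v)) (at t within {0..1})" by simp
 then have "((%t. s t 0 x) has_vector_derivative 0) (at t within {0..1})"
  by (rule has_vector_derivative_transform_within[where d=1]) (use fdt t in \<open>auto simp: formal_deformation_def\<close>)
 then show "s' t 0 x = 0" unfolding SN.dfam_def by (rule SN.vd_within_unit[OF _ t])
qed

lemma dfam_cutt:
 assumes "((%t. a t p) has_vector_derivative d) (at t within {0..1})" "t : {0..1}"
 shows "TL.dfam (cutt a) t p = d"
proof -
 have "((%t. cutt a t p) has_vector_derivative d) (at t within {0..1})"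
  by (rule has_vector_derivative_transform_within[OF assms(1), where d=1]) (use assms(2) in \<open>auto simp: cutt_def\<close>)
 then show ?thesis unfolding TL.dfam_def by (rule TL.vd_within_unit[OF _ assms(2)])
qed

lemma JT_time:
 assumes \<mu>: "\<mu> : \<Gamma>L" and \<nu>: "\<nu> : \<Gamma>L"
 shows "famL (%t. JT t m \<mu> \<nu>)"
  and "t : {0..1} ==> ((%t. JT t m \<mu> \<nu> p) has_vector_derivative
   (\<Sum>i\<le>m. Dv (s' t i) (JT t (m - i) \<mu> \<nu>) - JT t (m - i) (Dv (s' t i) \<mu>) \<nu> - JT t (m - i) \<mu> (Dv (s' t i) \<nu>)) p) (at t within {0..1})"
proof -
 let ?a = "cutt (%t. \<mu>)" and ?b = "cutt (%t. \<nu>)"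
 let ?J = "%m a b. cutt (%t. JT t m (a t) (b t))"
 define T where "T a = cutt (TL.dfam a)" for a
 define D' where "D' i a = cutt (%t. Dv (s' t i) (a t))" for i a
 have ab: "?a : FV" "?b : FV" by (intro cutt_in TL.const_family \<mu> \<nu>)+
 have Jab: "?J k ?a ?b : FV" for k by (rule ff.J_in[OF ab])
 have Jt: "?J k ?a ?b t = JT t k \<mu> \<nu>" if "t : {0..1}" for k t using that by (simp add: cutt_def)
 show "famL (%t. JT t m \<mu> \<nu>)" by (rule TL.family_cong[OF FV_D(1)[OF Jab]]) (simp add: Jt)
 assume t: "t : {0..1}"
 have T0: "T (cutt (%t. \<kappa>)) = 0" for \<kappa>
  unfolding T_def by (rule cutt_eqI) (auto simp: fun_eq_iff dfam_cutt[OF has_vector_derivative_const])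
 have comm: "cutt (%t. Dv (s t i) (D' j a t)) = D' j (cutt (%t. Dv (s t i) (a t)))" if a: "a : FV" for i j a
  unfolding D'_def by (rule cutt_eqI) (auto simp: cutt_def Dv_commute s'_section SN.family_section[OF sf] FV_D(2)[OF a])
 have Dzero: "D' 0 a = 0" if a: "a : FV" for a
 proof -
  have "Dv (%x. 0) (a t) = 0" if t: "t : {0..1}" for t
   using Dv_lin_dir[OF s'_section[OF t] s'_section[OF t] FV_D(2)[OF a t], of 0 0 0 0] by (simp add: zero_fun_def)
  then show ?thesis unfolding D'_def by (intro cutt_eqI) (auto simp: s'_0)
 qed
 have e: "T (?J m ?a ?b) = ?J m (T ?a) ?b + ?J m ?a (T ?b) + (\<Sum>i\<le>m. D' i (?J (m - i) ?a ?b) - ?J (m - i) (D' i ?a) ?b - ?J (m - i) ?a (D' i ?b))"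
 proof (rule ff.time_derivative[where T=T and D'=D', OF _ _ _ _ _ _ comm Dzero _ _ ab])
  fix a b :: "real => 'p \<times> 'v => 'w" assume a: "a : FV" and b: "b : FV"
  note fa = TL.family_derivative[OF FV_D(1)[OF a]] and fb = TL.family_derivative[OF FV_D(1)[OF b]]
  show "T (a + b) = T a + T b"
   unfolding T_def
   by (rule cutt_eqI) (auto simp: cutt_def fun_eq_iff TL.dfam_def[of "a + b"] intro!: TL.vd_within_unit has_vector_derivative_add fa fb)
  show "T (cutt (%t. J [a t, b t])) = cutt (%t. J [T a t, b t]) + cutt (%t. J [a t, T b t])"
   unfolding T_def
  proof (rule cutt_eqI)
   show "TL.dfam (cutt (%t. J [a t, b t])) t = (cutt (%t. J [cutt (TL.dfam a) t, b t]) + cutt (%t. J [a t, cutt (TL.dfam b) t])) t"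
    if t: "t : {0..1}" for t
    using t by (simp only: cutt_at plus_fun_apply fun_eq_iff dfam_cutt[OF J_derivative[OF FV_D(1)[OF a] FV_D(1)[OF b] t] t] simp_thms)
  qed (auto simp: cutt_def)
  show "D' i (a + b) = D' i a + D' i b" for i
   unfolding D'_def by (rule cutt_eqI) (auto simp: cutt_def fo_add[OF fo_Dv[OF s'_section] FV_D(2)[OF a] FV_D(2)[OF b]] plus_fun_def)
 next
  fix a :: "real => 'p \<times> 'v => 'w" and c :: real and i assume a: "a : FV"
  note fa = TL.family_derivative[OF FV_D(1)[OF a]]
  show "T a : FV" unfolding T_def by (intro cutt_in TL.family_dfam FV_D(1) a)
  show "D' i a : FV" unfolding D'_def by (intro cutt_in Dv_family SN.family_dfam sf FV_D(1) a)
  show "T (c *\<^sub>R a) = c *\<^sub>R T a"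
   unfolding T_def
   by (rule cutt_eqI) (auto simp: cutt_def scaleR_fun_def fun_eq_iff TL.dfam_def[of "%t p. c *\<^sub>R a t p"]
    intro!: TL.vd_within_unit bounded_linear.has_vector_derivative[OF bounded_linear_scaleR_right] fa)
  show "D' i (c *\<^sub>R a) = c *\<^sub>R D' i a"
   unfolding D'_def by (rule cutt_eqI) (auto simp: cutt_def scaleR_fun_def fo_scale[OF fo_Dv[OF s'_section] FV_D(2)[OF a]])
  show "T (cutt (%t. Dv (s t i) (a t))) = D' i a + cutt (%t. Dv (s t i) (T a t))"
   unfolding T_def D'_def
  proof (rule cutt_eqI)
   show "TL.dfam (cutt (%t. Dv (s t i) (a t))) t = (cutt (%t. Dv (s' t i) (a t)) + cutt (%t. Dv (s t i) (cutt (TL.dfam a) t))) t"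
    if t: "t : {0..1}" for t
    using t by (simp only: cutt_at plus_fun_apply fun_eq_iff dfam_cutt[OF Dv_derivative[OF sf FV_D(1)[OF a] t] t] simp_thms)
  qed (auto simp: cutt_def)
 qed
 have J00: "?J m 0 ?b = 0" "?J m ?a 0 = 0"
  using ff.J_0_left[OF ab(2), of m] ff.J_scale_right[OF ff.V_ops(1) ab(1), of m 0] by auto
 have "TL.dfam (?J m ?a ?b) t p = T (?J m ?a ?b) t p" using t by (simp add: T_def cutt_def)
 also have "\<dots> = (\<Sum>i\<le>m. Dv (s' t i) (JT t (m - i) \<mu> \<nu>) - JT t (m - i) (Dv (s' t i) \<mu>) \<nu> - JT t (m - i) \<mu> (Dv (s' t i) \<nu>)) p"
  unfolding e T0 J00 using t by (simp add: sum_fun_apply D'_def cutt_def)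
 finally have "((%t. ?J m ?a ?b t p) has_vector_derivative (\<Sum>i\<le>m. Dv (s' t i) (JT t (m - i) \<mu> \<nu>) - JT t (m - i) (Dv (s' t i) \<mu>) \<nu> - JT t (m - i) \<mu> (Dv (s' t i) \<nu>)) p) (at t within {0..1})"
  using TL.family_derivative[OF FV_D(1)[OF Jab[of m]] t, of p] by simp
 then show "((%t. JT t m \<mu> \<nu> p) has_vector_derivative (\<Sum>i\<le>m. Dv (s' t i) (JT t (m - i) \<mu> \<nu>) - JT t (m - i) (Dv (s' t i) \<mu>) \<nu> - JT t (m - i) \<mu> (Dv (s' t i) \<nu>)) p) (at t within {0..1})"
  by (rule has_vector_derivative_transform_within[where d=1]) (use t Jt in auto)
qed

end

lemma continuous_famd:
 assumes g: "smooth_on (Suc k) (famd k D) g" and D: "D <= Rn k"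
 shows "continuous_on ({0..1} \<times> D) (%(t,y). g (case_nat t y))"
proof -
 have c: "continuous_on ({0..1} \<times> D) (%z. case_nat (fst z) (snd z) :: nat => real)"
 proof (rule continuous_on_coordinatewise_then_product)
  fix i show "continuous_on ({0..1} \<times> D) (%z. (case_nat (fst z) (snd z) :: nat => real) i)"
   using continuous_on_product_then_coordinatewise[OF continuous_on_snd[OF continuous_on_id], of "{0..1} \<times> D"]
   by (cases i) (simp_all add: continuous_on_fst)
 qed
 have "continuous_on ({0..1} \<times> D) (%z. g (case_nat (fst z) (snd z)))"
  by (rule continuous_on_compose2[OF smooth_on_continuous[OF g] c]) (auto simp: case_nat_famd[OF D])
 then show ?thesis by (simp add: case_prod_beta)
qed

context bundle_pair
begin

context
 fixes U \<phi> W e W' b A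
 assumes P: "chart U \<phi>" "frameN W e" "frameL W' b"
  and A: "mfd_open S A" "A <= U \<inter> W \<inter> W'"
begin

lemma slice:
 shows "\<phi> ` A <= Rn n" "opn n (\<phi> ` A)" "\<phi> ` A <= Om U \<phi> W W'" "famd n (\<phi> ` A) <= famd (n + r) (Om U \<phi> W W')"
proof -
 show o: "opn n (\<phi> ` A)" by (rule opn_image[OF A(1) P(1)]) (use A in blast)
 show R: "\<phi> ` A <= Rn n" by (rule opn_subset[OF o])
 have c: "\<phi> ` A <= cyl n r (\<phi> ` A)" by (rule cyl_sub[OF R])
 show "\<phi> ` A <= Om U \<phi> W W'" using c cyl_mono[OF A(2)] by blast
 show "famd n (\<phi> ` A) <= famd (n + r) (Om U \<phi> W W')"
  using famd_sub_cyl[OF R, of r] famd_mono[OF cyl_mono[OF A(2)]] by blast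
qed

lemma continuous_lc:
 assumes a: "famL a"
 shows "continuous_on ({0..1} \<times> \<phi> ` A) (%(t,y). lc U \<phi> e b (a t) y)"
  and "j < n + r ==> continuous_on ({0..1} \<times> \<phi> ` A) (%(t,y). pd (Om U \<phi> W W') j (lc U \<phi> e b (a t)) y)"
proof -
 let ?F = "famd (n + r) (Om U \<phi> W W')" and ?g = "%z. lc U \<phi> e b (a (z 0)) (tail z)"
 note g = family_lc_smooth[OF a P]
 show "continuous_on ({0..1} \<times> \<phi> ` A) (%(t,y). lc U \<phi> e b (a t) y)"
  using continuous_famd[OF smooth_on_mono[OF g _ slice(4)] slice(1)] by simp
 assume j: "j < n + r"
 have c: "continuous_on ({0..1} \<times> \<phi> ` A) (%(t,y). pd ?F (Suc j) ?g (case_nat t y))"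
  by (rule continuous_famd[OF smooth_on_mono[OF smooth_on_pd'[OF ndom_famd[OF opn_Om[OF P]] g] _ slice(4)] slice(1)]) (use j in auto)
 have "pd ?F (Suc j) ?g (case_nat t y) = pd (Om U \<phi> W W') j (lc U \<phi> e b (a t)) y" if "t : {0..1}" "y : \<phi> ` A" for t y
  using pd_family[OF a P j, of "case_nat t y"] that slice(3) by (auto simp: case_nat_famd[OF cyl_Rn])
 then show "continuous_on ({0..1} \<times> \<phi> ` A) (%(t,y). pd (Om U \<phi> W W') j (lc U \<phi> e b (a t)) y)"
  by (intro continuous_on_eq[OF c]) auto
qed

lemma lc_at:
 assumes y: "y : \<phi> ` A"
 shows "lc U \<phi> e b F y = crd 1 b (inv_into U \<phi> y) (F (inv_into U \<phi> y, 0)) 0" "inv_into U \<phi> y : A" "inv_into U \<phi> y : pts S"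
proof -
 have y': "y : \<phi> ` (U \<inter> W \<inter> W')" using y A by blast
 show "lc U \<phi> e b F y = crd 1 b (inv_into U \<phi> y) (F (inv_into U \<phi> y, 0)) 0"
  unfolding lc_def lc_zero_section(2)[OF P y'] by simp
 obtain x where x: "x : A" "y = \<phi> x" using y by blast
 then have "inv_into U \<phi> y = x" using inv_ch[OF P(1,2)] A by blast
 then show "inv_into U \<phi> y : A" "inv_into U \<phi> y : pts S" using x A S_charts(2)[OF P(1)] by auto
qed

lemma lc_Z: assumes \<kappa>: "\<kappa> : Z" and y: "y : \<phi> ` A" shows "lc U \<phi> e b \<kappa> y = 0"
proof -
 have "inv_into U \<phi> y : W'" using lc_at(2)[OF y] A by blast
 from Sl.crd_zero'[OF P(3) this, of 0] show ?thesis
  using \<kappa> lc_at(3)[OF y] rk_l unfolding lc_at(1)[OF y] by (simp add: Z_def)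
qed

lemma lc_zero_eq: assumes \<mu>: "\<mu> : \<Gamma>L" and y: "y : \<phi> ` A" and 0: "lc U \<phi> e b \<mu> y = 0"
 shows "\<mu> (inv_into U \<phi> y, 0) = 0"
proof -
 have y': "y : \<phi> ` (U \<inter> W \<inter> W')" using y A by blast
 have "lc U \<phi> e b \<mu> y *\<^sub>R b 0 (fst (pt U \<phi> e y)) = \<mu> (pt U \<phi> e y)"
  by (rule lc_smult(2)[OF P lc_zero_section(1)[OF P y'] section_fibl[OF \<mu>]])
 then show ?thesis unfolding 0 lc_zero_section(2)[OF P y'] by simp
qed

lemma pd_Z: assumes \<kappa>: "\<kappa> : Z" and y: "y : \<phi> ` A" and k: "k < n" shows "pd (Om U \<phi> W W') k (lc U \<phi> e b \<kappa>) y = 0"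
proof -
 note nD = opn_ndom[OF slice(2)]
 have "has_pd (\<phi> ` A) k (lc U \<phi> e b \<kappa>) (pd (Om U \<phi> W W') k (lc U \<phi> e b \<kappa>))"
  by (rule has_pd_mono[OF smooth_has_pd(1)[OF opn_ndom[OF opn_Om[OF P]] section_lc_smooth[OF Z_sec[OF \<kappa>] P]] slice(3)]) (use k in simp)
 from has_pd_unique[OF nD k this y] have "pd (Om U \<phi> W W') k (lc U \<phi> e b \<kappa>) y = pd (\<phi> ` A) k (lc U \<phi> e b \<kappa>) y" by simp
 also have "\<dots> = pd (\<phi> ` A) k (%_. 0) y" by (rule pd_cong[OF nD k smooth_on_const _ y, symmetric]) (simp add: lc_Z[OF \<kappa>])
 also have "\<dots> = 0" by (rule pd_eqI[OF nD y k]) simp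
 finally show ?thesis .
qed

context
 fixes \<kappa> K A1
 assumes \<kappa>: "cutoff (\<phi> ` A) K \<kappa>" and A1: "mfd_open S A1" "A1 <= A" "\<forall>x\<in>A1. \<kappa> (\<phi> x) = 1"
begin

lemma gen_section: "gen \<phi> e A b \<kappa> a : \<Gamma>L"
proof -
 have AU: "A <= U \<inter> W" using A by blast
 show ?thesis
  unfolding gen_def by (intro section_smult cutf_smooth[OF P(1,2) A(1) AU \<kappa>] smooth_on_coord cuts_section[OF P A \<kappa>])
qed

lemma gen_Z: "gen \<phi> e A b \<kappa> (n + i) : Z"
 unfolding Z_def using gen_section SN.crd_zero'[OF P(2)] A by (auto simp: gen_def cutf_def co_def)

lemma A1_cyl: "y : \<phi> ` A1 ==> y : cyl n r (\<phi> ` A1) \<and> y : \<phi> ` A \<and> (\<forall>i\<ge>n. y i = 0)"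
 using A1(2) slice(1) cyl_sub[of "\<phi> ` A1" n r] by (auto simp: Rn_def)

lemma fo_Z_expand:
 assumes Q: "fo Q" and \<mu>: "\<mu> : Z" and y: "y : \<phi> ` A1"
 shows "lc U \<phi> e b (Q \<mu>) y = (\<Sum>i<r. pd (Om U \<phi> W W') (n + i) (lc U \<phi> e b \<mu>) y * lc U \<phi> e b (Q (gen \<phi> e A b \<kappa> (n + i))) y)"
 using fo_lc[OF Q P A \<kappa> A1 _ Z_sec[OF \<mu>], of y] A1_cyl[OF y] lc_Z[OF \<mu>] pd_Z[OF \<mu>]
 by (simp add: sum_lessThan_add)

lemma fo_transport:
 assumes Q: "fo Q" and QZ: "!!\<mu>. \<mu> : Z ==> Q \<mu> : Z" and \<mu>: "\<mu> : \<Gamma>L" and y: "y : \<phi> ` A1"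
 shows "lc U \<phi> e b (Q \<mu>) y = lc U \<phi> e b \<mu> y * lc U \<phi> e b (Q (cuts \<phi> A b \<kappa>)) y +
  (\<Sum>k<n. pd (Om U \<phi> W W') k (lc U \<phi> e b \<mu>) y * (lc U \<phi> e b (Q (gen \<phi> e A b \<kappa> k)) y - y k * lc U \<phi> e b (Q (cuts \<phi> A b \<kappa>)) y))"
 using fo_lc[OF Q P A \<kappa> A1 _ \<mu>, of y] A1_cyl[OF y] lc_Z[OF QZ[OF gen_Z]]
 by (simp add: sum_lessThan_add)

end
end

end

lemma sum_matrix:
 fixes w :: "nat \<times> nat => real"
 assumes ij: "i < r" "j < r"
 shows "(\<Sum>k\<in>{..<r} \<times> {..<r}. ((if k = (i,j) then c else 0) + (if snd k = j then f (fst k) else 0) + (if fst k = i then g (snd k) else 0)) * w k) =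
  c * w (i,j) + (\<Sum>k<r. f k * w (k,j)) + (\<Sum>k<r. g k * w (i,k))"
proof -
 have 1: "(\<Sum>k\<in>{..<r} \<times> {..<r}. (if k = (i,j) then c else 0) * w k) = c * w (i,j)"
  using ij by (simp add: if_distrib[of "%c. c * _"] cong: if_cong)
 have 2: "(\<Sum>k\<in>{..<r} \<times> {..<r}. (if snd k = j then f (fst k) else 0) * w k) = (\<Sum>k<r. f k * w (k,j))"
 proof -
  have "(\<Sum>k\<in>{..<r} \<times> {..<r}. (if snd k = j then f (fst k) else 0) * w k) = (\<Sum>a<r. \<Sum>b<r. (if b = j then f a else 0) * w (a,b))"
   by (simp add: sum.cartesian_product case_prod_beta)
  also have "\<dots> = (\<Sum>a<r. \<Sum>b<r. if b = j then f a * w (a,b) else 0)" by (intro sum.cong) auto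
  finally show ?thesis using ij by simp
 qed
 have 3: "(\<Sum>k\<in>{..<r} \<times> {..<r}. (if fst k = i then g (snd k) else 0) * w k) = (\<Sum>k<r. g k * w (i,k))"
 proof -
  have "(\<Sum>k\<in>{..<r} \<times> {..<r}. (if fst k = i then g (snd k) else 0) * w k) = (\<Sum>a<r. \<Sum>b<r. (if a = i then g b else 0) * w (a,b))"
   by (simp add: sum.cartesian_product case_prod_beta)
  also have "\<dots> = (\<Sum>a<r. if a = i then \<Sum>b<r. g b * w (a,b) else 0)" by (rule sum.cong) auto
  finally show ?thesis using ij by simp
 qed
 show ?thesis unfolding distrib_right sum.distrib 1 2 3 ..
qed

context evolving
begin

definition COIS :: "real => nat => bool" where
 "COIS t m \<longleftrightarrow> (\<forall>x\<in>pts S. \<forall>\<mu>\<in>Z. \<forall>\<nu>\<in>Z. JT t m \<mu> \<nu> (x, 0) = 0)"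

lemma fo_JT: "t : {0..1} ==> \<nu> : \<Gamma>L ==> fo (%\<mu>. JT t m \<mu> \<nu>)" "t : {0..1} ==> \<nu> : \<Gamma>L ==> fo (JT t m \<nu>)"
 using deformed.fo_Js[OF at_time, of t] deformed.fo_Js_right[OF at_time, of t] JT_Js[of t] by simp_all

lemma local_propagation:
 assumes \<theta>: "famL \<theta>" and \<theta>Z: "!!t \<kappa>. t : {0..1} ==> \<kappa> : Z ==> J [\<theta> t, \<kappa>] : Z"
  and eqn: "!!t x \<mu> \<nu>. t : {0..1} ==> x : pts S ==> \<mu> : Z ==> \<nu> : Z ==>
   ((%t. JT t m \<mu> \<nu> (x, 0)) has_vector_derivative
    - J [\<theta> t, JT t m \<mu> \<nu>] (x, 0) + JT t m (J [\<theta> t, \<mu>]) \<nu> (x, 0) + JT t m \<mu> (J [\<theta> t, \<nu>]) (x, 0)) (at t within {0..1})"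
  and x: "x : pts S"
 shows "\<exists>A \<delta>. mfd_open S A \<and> x : A \<and> \<delta> > 0 \<and> (\<forall>t0\<in>{0..1}. COIS t0 m --> (\<forall>t\<in>{0..1}. t0 \<le> t --> t \<le> t0 + \<delta> -->
  (\<forall>y\<in>A. \<forall>\<mu>\<in>Z. \<forall>\<nu>\<in>Z. JT t m \<mu> \<nu> (y, 0) = 0)))"
proof -
 obtain U \<phi> W e W' b where P: "chart U \<phi>" "frameN W e" "frameL W' b" and xx: "fst (x, 0::'v) : U \<inter> W \<inter> W'"
  by (rule patch_at[OF zero_M[OF x]], rule that)
 have x': "x : U \<inter> W \<inter> W'" using xx by auto
 have sub: "U \<inter> W \<inter> W' <= U" by blast
 obtain A0 K \<kappa> A1 where A: "mfd_open S A0" "A0 <= U \<inter> W \<inter> W'" "cutoff (\<phi> ` A0) K \<kappa>"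
   "mfd_open S A1" "A1 <= A0" "x : A1" "\<forall>y\<in>A1. \<kappa> (\<phi> y) = 1"
  by (rule plateau[OF P(1) patch_open(1)[OF P] sub x'], rule that)
 note hyp = P A(1-5,7)
 let ?D = "\<phi> ` A1" and ?Om = "Om U \<phi> W W'" and ?lc = "lc U \<phi> e b" and ?th = "cuts \<phi> A0 b \<kappa>"
 define G where "G a = gen \<phi> e A0 b \<kappa> a" for a
 have Gs: "G a : \<Gamma>L" for a unfolding G_def by (rule gen_section[OF hyp])
 have GZ: "G (n + i) : Z" for i unfolding G_def by (rule gen_Z[OF hyp])
 have ths: "?th : \<Gamma>L" by (rule cuts_section[OF P A(1-3)])
 have A1': "A1 <= U \<inter> W \<inter> W'" using A by blast
 note sl = slice[OF P A(4) A1'] and cl = continuous_lc[OF P A(4) A1']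
 define I where "I = {..<r} \<times> {..<r}"
 define w where "w ij t y = ?lc (JT t m (G (n + fst ij)) (G (n + snd ij))) y" for ij t y
 define wk where "wk ij k t y = pd ?Om k (?lc (JT t m (G (n + fst ij)) (G (n + snd ij)))) y" for ij k t y
 define c0 where "c0 t y = ?lc (J [\<theta> t, ?th]) y" for t y
 define Y where "Y k t y = - (?lc (J [\<theta> t, G k]) y - y k * c0 t y)" for k t and y :: "nat => real"
 define B where "B i k t y = pd ?Om (n + k) (?lc (J [\<theta> t, G (n + i)])) y" for i k t y
 define AA where "AA ij k t y = (if k = ij then - c0 t y else 0) + (if snd k = snd ij then B (fst ij) (fst k) t y else 0)
  + (if fst k = fst ij then B (snd ij) (snd k) t y else 0)" for ij k t y
 have JTf: "famL (%t. JT t m (G a) (G c))" for a c by (rule JT_time(1)[OF Gs Gs])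
 have Jf: "famL (%t. J [\<theta> t, \<mu>])" if "\<mu> : \<Gamma>L" for \<mu> by (rule J_family[OF \<theta> TL.const_family[OF that]])
 have fJ: "fo (%\<mu>. J [\<theta> t, \<mu>])" if "t : {0..1}" for t using J_ops(3) TL.family_section[OF \<theta> that] by blast
 have ind: "continuous_on ({0..1} \<times> ?D) (%(t,y). if Q then f t y else (0::real))" if "continuous_on ({0..1} \<times> ?D) (%(t,y). f t y)" for Q f
  using that by (cases Q) (auto simp: case_prod_beta)
 have cY: "continuous_on ({0..1} \<times> ?D) (%(t,y). y k)" for k
  using continuous_on_product_then_coordinatewise[OF continuous_on_snd[OF continuous_on_id], of "{0..1} \<times> ?D"] by (simp add: case_prod_beta)
 have cc0: "continuous_on ({0..1} \<times> ?D) (%(t,y). c0 t y)" unfolding c0_def by (rule cl(1)[OF Jf[OF ths]])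
 have cB: "continuous_on ({0..1} \<times> ?D) (%(t,y). B i k t y)" if "k < r" for i k
  unfolding B_def by (rule cl(2)[OF Jf[OF Gs]]) (use that in simp)
 have "\<exists>\<delta>>0. \<exists>\<rho>>0. \<forall>t0\<in>{0..1}. (\<forall>i\<in>I. \<forall>y\<in>?D. w i t0 y = 0) -->
  (\<forall>t\<in>{0..1}. t0 \<le> t --> t \<le> t0 + \<delta> -->
   (\<forall>y\<in>Rn n. (\<forall>k<n. \<bar>y k - (\<phi> x) k\<bar> < \<rho>) --> (\<forall>i\<in>I. w i t y = 0)))"
 proof (rule transport_local_uniqueness[where Y=Y and A=AA and wk=wk])
  show "opn n ?D" by (rule sl(2))
  show "\<phi> x : ?D" using A(6) by blast
  show "finite I" by (simp add: I_def)
  show "continuous_on ({0..1} \<times> ?D) (%(t,y). w i t y)" for i unfolding w_def by (rule cl(1)[OF JTf])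
  show "continuous_on ({0..1} \<times> ?D) (%(t,y). Y k t y)" for k
   using cl(1)[OF Jf[OF Gs[of k]]] cY[of k] cc0 unfolding Y_def case_prod_beta
   by (intro continuous_on_minus continuous_on_diff continuous_on_mult)
  show "continuous_on ({0..1} \<times> ?D) (%(t,y). AA i j t y)" if "i : I" "j : I" for i j
  proof -
   have "continuous_on ({0..1} \<times> ?D) (%(t,y). - c0 t y)"
    using continuous_on_minus[OF cc0] by (simp add: case_prod_beta)
   from ind[OF this, of "j = i"] ind[OF cB[of "fst j" "fst i"], of "snd j = snd i"] ind[OF cB[of "snd j" "snd i"], of "fst j = fst i"]
   show ?thesis unfolding AA_def case_prod_beta using that by (intro continuous_on_add) (auto simp: I_def)
  qed
  show "has_pd ?D k (w i t) (wk i k t)" if "i : I" "k < n" "t : {0..1}" for i k t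
   unfolding w_def wk_def
   by (rule has_pd_mono[OF smooth_has_pd(1)[OF opn_ndom[OF opn_Om[OF P]] section_lc_smooth[OF TL.family_section[OF JTf that(3)] P]] sl(3)])
    (use that in simp)
  fix ij t y assume ij: "ij : I" and t: "t : {0..1::real}" and y: "y : ?D"
  obtain i j where e: "ij = (i,j)" "i < r" "j < r" using ij by (auto simp: I_def)
  let ?X = "G (n + i)" and ?X' = "G (n + j)" and ?x = "inv_into U \<phi> y"
  let ?F = "JT t m ?X ?X'"
  note at = lc_at[OF P A(4) A1' y]
  have yO: "y : ?Om" using y sl(3) by blast
  have Fs: "?F : \<Gamma>L" by (rule TL.family_section[OF JTf t])
  define R1 where "R1 = J [\<theta> t, ?F]"
  define R2 where "R2 = JT t m (J [\<theta> t, ?X]) ?X'"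
  define R3 where "R3 = JT t m ?X (J [\<theta> t, ?X'])"
  have Rs: "R1 : \<Gamma>L" "R2 : \<Gamma>L" "R3 : \<Gamma>L"
   unfolding R1_def R2_def R3_def
   by (intro fo_in[OF fJ[OF t] Fs] fo_in[OF fo_JT(1)[OF t Gs]] fo_in[OF fo_JT(2)[OF t Gs]] fo_in[OF fJ[OF t]] Gs)+
  have d: "TL.dfam (%t. JT t m ?X ?X') t (?x, 0) = - R1 (?x, 0) + R2 (?x, 0) + R3 (?x, 0)"
   unfolding TL.dfam_def R1_def R2_def R3_def by (rule TL.vd_within_unit[OF eqn[OF t at(3) GZ GZ] t])
  have "?lc (TL.dfam (%t. JT t m ?X ?X') t) y = ?lc (%p. 1 *\<^sub>R ((-1) *\<^sub>R R1 p + 1 *\<^sub>R R2 p) + 1 *\<^sub>R R3 p) y"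
   unfolding at(1) d by simp
  also have "\<dots> = - ?lc R1 y + ?lc R2 y + ?lc R3 y"
   unfolding lc_lin[OF P yO TL.section_lin[OF Rs(1,2)] Rs(3)] lc_lin[OF P yO Rs(1,2)] by simp
  finally have der: "((%t. w ij t y) has_real_derivative - ?lc R1 y + ?lc R2 y + ?lc R3 y) (at t within {0..1})"
   using lc_dfam(1)[OF JTf P yO t, of "n + i" "n + j"] by (simp add: w_def e)
  have 1: "?lc R1 y = w ij t y * c0 t y + (\<Sum>k<n. - Y k t y * wk ij k t y)"
   unfolding R1_def using fo_transport[OF hyp fJ[OF t] \<theta>Z[OF t] Fs y]
   by (simp add: w_def c0_def Y_def wk_def e G_def mult.commute)
  have 2: "?lc R2 y = (\<Sum>k<r. B i k t y * w (k,j) t y)"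
   unfolding R2_def using fo_Z_expand[OF hyp fo_JT(1)[OF t Gs[of "n + j"], where m=m] \<theta>Z[OF t GZ[of i]] y]
   by (simp add: B_def w_def G_def)
  have 3: "?lc R3 y = (\<Sum>k<r. B j k t y * w (i,k) t y)"
   unfolding R3_def using fo_Z_expand[OF hyp fo_JT(2)[OF t Gs[of "n + i"], where m=m] \<theta>Z[OF t GZ[of j]] y]
   by (simp add: B_def w_def G_def)
  have 4: "(\<Sum>k\<in>I. AA ij k t y * w k t y) = - c0 t y * w (i,j) t y + (\<Sum>k<r. B i k t y * w (k,j) t y) + (\<Sum>k<r. B j k t y * w (i,k) t y)"
   using sum_matrix[OF e(2,3), of "- c0 t y" "%k. B i k t y" "%k. B j k t y" "%k. w k t y"]
   unfolding AA_def I_def e fst_conv snd_conv .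
  show "((%t. w ij t y) has_real_derivative (\<Sum>k<n. Y k t y * wk ij k t y) + (\<Sum>k\<in>I. AA ij k t y * w k t y)) (at t within {0..1})"
   by (rule DERIV_cong[OF der]) (unfold 1 2 3 4, simp add: e sum_negf mult.commute)
 qed
 then obtain \<delta> \<rho> where \<delta>: "\<delta> > 0" "\<rho> > 0" and un: "\<forall>t0\<in>{0..1}. (\<forall>i\<in>I. \<forall>y\<in>?D. w i t0 y = 0) -->
  (\<forall>t\<in>{0..1}. t0 \<le> t --> t \<le> t0 + \<delta> -->
   (\<forall>y\<in>Rn n. (\<forall>k<n. \<bar>y k - (\<phi> x) k\<bar> < \<rho>) --> (\<forall>i\<in>I. w i t y = 0)))" by blast
 define D2 where "D2 = ?D \<inter> {y \<in> Rn n. \<forall>i<n. \<bar>y i - (\<phi> x) i\<bar> < \<rho>}"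
 define A2 where "A2 = {a \<in> U. \<phi> a : D2}"
 have D2: "opn n D2" unfolding D2_def by (intro openin_Int sl(2) opn_box_set)
 have "mfd_open S A2" unfolding A2_def by (rule mfd_open_vimage[OF P(1) D2]) (use A1' in \<open>auto simp: D2_def\<close>)
 moreover have "x : A2" using x' A(6) sl(1) \<delta>(2) by (auto simp: A2_def D2_def)
 moreover have "JT t m \<mu> \<nu> (y, 0) = 0"
  if t0: "t0 : {0..1}" "COIS t0 m" and t: "t : {0..1}" "t0 \<le> t" "t \<le> t0 + \<delta>" and y: "y : A2" and \<mu>: "\<mu> : Z" and \<nu>: "\<nu> : Z" for t0 t y \<mu> \<nu>
 proof -
  have "w i t0 z = 0" if "z : ?D" for i z
  proof -
   have "JT t0 m (G (n + fst i)) (G (n + snd i)) : Z"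
    using t0(2) GZ TL.family_section[OF JTf t0(1)] by (simp add: Z_def[of] COIS_def)
   from lc_Z[OF P A(4) A1' this that] show ?thesis by (simp add: w_def)
  qed
  then have w00: "\<forall>i\<in>I. \<forall>z\<in>?D. w i t0 z = 0" by blast
  have yb: "\<phi> y : Rn n" "\<forall>k<n. \<bar>\<phi> y k - \<phi> x k\<bar> < \<rho>" using y by (auto simp: A2_def D2_def)
  have w0: "w i t (\<phi> y) = 0" if "i : I" for i
   using un[THEN bspec, OF t0(1), THEN mp, OF w00, THEN bspec, OF t(1), THEN mp, OF t(2), THEN mp, OF t(3), THEN bspec, OF yb(1), THEN mp, OF yb(2)]
    that by blast
  have yD: "\<phi> y : ?D" using y by (auto simp: A2_def D2_def)
  have iy: "inv_into U \<phi> (\<phi> y) = y" using y inv_ch[OF P(1,2)] by (simp add: A2_def)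
  have G0: "?lc (JT t m (G (n + k)) \<nu>) (\<phi> y) = 0" if "k < r" for k
   unfolding fo_Z_expand[OF hyp fo_JT(2)[OF t(1) Gs] \<nu> yD]
  proof (rule sum.neutral, intro ballI)
   fix i assume "i : {..<r}"
   then show "pd ?Om (n + i) (?lc \<nu>) (\<phi> y) * ?lc (JT t m (G (n + k)) (gen \<phi> e A0 b \<kappa> (n + i))) (\<phi> y) = 0"
    using w0[of "(k,i)"] that by (simp add: w_def I_def G_def)
  qed
  have "?lc (JT t m \<mu> \<nu>) (\<phi> y) = 0"
   unfolding fo_Z_expand[OF hyp fo_JT(1)[OF t(1) Z_sec[OF \<nu>]] \<mu> yD]
   by (rule sum.neutral) (use G0 in \<open>auto simp: G_def\<close>)
  from lc_zero_eq[OF P A(4) A1' fo_in[OF fo_JT(2)[OF t(1) Z_sec[OF \<mu>]] Z_sec[OF \<nu>]] yD this]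
  show ?thesis unfolding iy .
 qed
 ultimately show ?thesis using \<delta>(1) by blast
qed

lemma propagation:
 assumes cS: "compact_space (mfd_topology S)"
  and loc: "!!x. x : pts S ==> \<exists>A \<delta>. mfd_open S A \<and> x : A \<and> \<delta> > 0 \<and> (\<forall>t0\<in>{0..1}. COIS t0 m --> (\<forall>t\<in>{0..1}. t0 \<le> t --> t \<le> t0 + \<delta> -->
  (\<forall>y\<in>A. \<forall>\<mu>\<in>Z. \<forall>\<nu>\<in>Z. JT t m \<mu> \<nu> (y, 0) = 0)))"
  and 0: "COIS 0 m" and t: "t : {0..1}"
 shows "COIS t m"
proof -
 obtain A \<delta> where A: "!!x. x : pts S ==> mfd_open S (A x) \<and> x : A x \<and> \<delta> x > 0 \<and> (\<forall>t0\<in>{0..1}. COIS t0 m --> (\<forall>t\<in>{0..1}. t0 \<le> t --> t \<le> t0 + \<delta> x -->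
  (\<forall>y\<in>A x. \<forall>\<mu>\<in>Z. \<forall>\<nu>\<in>Z. JT t m \<mu> \<nu> (y, 0) = 0)))" using loc by metis
 have "compactin (mfd_topology S) (pts S)" using cS by (simp add: compact_space_def topspace_S)
 then have "\<exists>\<F>. finite \<F> \<and> \<F> <= A ` pts S \<and> pts S <= \<Union>\<F>"
  by (rule compactinD) (use A in \<open>auto simp: openin_S\<close>)
 then obtain F where F: "finite F" "F <= pts S" "pts S <= \<Union>(A ` F)" by (metis finite_subset_image)
 define d where "d = Min (insert 1 (\<delta> ` F))"
 have d: "d > 0" "!!x. x : F ==> d \<le> \<delta> x" using F A by (auto simp: d_def)
 have step: "COIS t m" if "t0 : {0..1}" "COIS t0 m" "t : {0..1}" "t0 \<le> t" "t \<le> t0 + d" for t0 t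
  unfolding COIS_def
 proof (intro ballI)
  fix y \<mu> \<nu> assume y: "y : pts S" and Z: "\<mu> : Z" "\<nu> : Z"
  obtain x where x: "x : F" "y : A x" using y F(3) by blast
  then have xS: "x : pts S" using F(2) by blast
  have "t \<le> t0 + \<delta> x" using that(5) d(2)[OF x(1)] by simp
  then show "JT t m \<mu> \<nu> (y, 0) = 0" using A[OF xS] that(1-4) x(2) Z by blast
 qed
 have all: "\<forall>t\<in>{0..1}. t \<le> real k * d --> COIS t m" for k
 proof (induction k)
  case 0
  then show ?case using assms(3) by auto
 next
  case (Suc k)
  show ?case
  proof (intro ballI impI)
   fix t assume t: "t : {0..1::real}" and le: "t \<le> real (Suc k) * d"
   let ?t0 = "max 0 (t - d)"
   have t0: "?t0 : {0..1}" "?t0 \<le> real k * d" using t le d(1) by (auto simp: algebra_simps)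
   then have "COIS ?t0 m" using Suc by blast
   then show "COIS t m" by (rule step[OF t0(1) _ t]) (use t d(1) in auto)
  qed
 qed
 obtain k where "1 \<le> real k * d" using reals_Archimedean3[OF d(1)] by (meson less_imp_le)
 then have "t \<le> real k * d" using t by simp
 then show ?thesis using all t by blast
qed

end

context bundle_pair
begin

lemma Dv_pb:
 assumes \<nu>: "\<nu> : sections S N" shows "Dv \<nu> (pb a) = 0"
proof
 fix p :: "'p \<times> 'v"
 have "vert_der (pb a) p (\<nu> (fst p)) = 0" if p: "p : pts M"
 proof (rule vert_der_eqI)
  have "(fst p, snd p + t *\<^sub>R \<nu> (fst p)) : pts M" for t
   using p fib_at[OF \<nu> p] SN.fib_subspace[of "fst p"] by (simp add: pts_M_iff subspace_add subspace_scale)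
  then have "(%t. pb a (fst p, snd p + t *\<^sub>R \<nu> (fst p))) = (%t. a (fst p))" by (simp add: pb_def)
  then show "((%t. pb a (fst p, snd p + t *\<^sub>R \<nu> (fst p))) has_vector_derivative 0) (at 0)" by simp
 qed
 then show "Dv \<nu> (pb a) p = 0 p" by (simp add: Dv_def)
qed

lemma conormal_minus: "\<alpha> : conormal N l x ==> v : fib N x ==> \<alpha> (- v) = - \<alpha> v"
proof -
 assume a: "\<alpha> : conormal N l x" "v : fib N x"
 then have "\<alpha> ((-1) *\<^sub>R v + 0 *\<^sub>R v) = (-1) *\<^sub>R \<alpha> v + 0 *\<^sub>R \<alpha> v" unfolding conormal_def by blast
 then show "\<alpha> (- v) = - \<alpha> v" by simp
qed

end

lemma (in deformed) expo_pb:
 "expo (%i. Dv (s i)) (%i. pb (\<eta> i)) m = pb (\<eta> m)"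
proof -
 let ?a = "adp (%i. Dv (s i)) (%i. pb (\<eta> i))"
 have a0: "?a (Suc k) i = 0" for k i
 proof (induction k arbitrary: i)
  case 0 show ?case by (simp add: Dv_pb s_sec)
 next
  case (Suc k)
  then show ?case unfolding adp.simps(2)[of _ _ "Suc k"] by (simp only: cd.D_0 sum.neutral_const)
 qed
 have "expo (%i. Dv (s i)) (%i. pb (\<eta> i)) m = (\<Sum>k\<in>{0}. (1 / fact k) *\<^sub>R ?a k m)"
  unfolding expo_def
 proof (rule sum.mono_neutral_right)
  show "\<forall>i\<in>{..m} - {0}. (1 / fact i) *\<^sub>R ?a i m = 0"
  proof
   fix i assume "i : {..m} - {0}"
   then obtain k where "i = Suc k" by (auto simp: gr0_conv_Suc)
   then show "(1 / fact i) *\<^sub>R ?a i m = 0" by (simp only: a0 scaleR_zero_right)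
  qed
 qed auto
 then show ?thesis by simp
qed

context evolving
begin

lemma COIS_iff: "t : {0..1} ==> formal_coisotropic S N l J (s t) \<longleftrightarrow> (\<forall>m. COIS t m)"
 using deformed.formal_coisotropic_iff[OF at_time, of t] deformed.cois_def[OF at_time, of t] JT_Js[of t]
 by (simp add: COIS_def)

lemma expo_family:
 assumes \<eta>: "!!i. famL (%t. \<eta> t i)"
 shows "famL (%t. expo (%i. Dv (s t i)) (\<eta> t) m)"
proof -
 have "famL (%t. adp (%i. Dv (s t i)) (\<eta> t) k m)" for k m
 proof (induction k arbitrary: m)
  case (Suc k)
  have "famL (%t p. \<Sum>i\<in>{..m}. Dv (s t i) (adp (%i. Dv (s t i)) (\<eta> t) k (m - i)) p)"
   by (intro TL.family_sum Dv_family sf Suc)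
  moreover have "(%t p. \<Sum>i\<in>{..m}. Dv (s t i) (adp (%i. Dv (s t i)) (\<eta> t) k (m - i)) p) = (%t. adp (%i. Dv (s t i)) (\<eta> t) (Suc k) m)"
   by (simp add: fun_eq_iff sum_fun_apply)
  ultimately show ?case by simp
 qed (simp add: \<eta>)
 then have "famL (%t p. \<Sum>k\<in>{..m}. (1 / fact k) *\<^sub>R adp (%i. Dv (s t i)) (\<eta> t) k m p)"
  by (intro TL.family_sum TL.family_scale)
 moreover have "(%t p. \<Sum>k\<in>{..m}. (1 / fact k) *\<^sub>R adp (%i. Dv (s t i)) (\<eta> t) k m p) = (%t. expo (%i. Dv (s t i)) (\<eta> t) m)"
  by (simp add: fun_eq_iff expo_def sum_fun_apply scaleR_fun_apply)
 ultimately show ?thesis by simp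
qed

lemma s'_fib: "t : {0..1} ==> x : pts S ==> s' t m x : fib N x"
 by (rule SN.section_fib[OF s'_section])

lemma gauge_of_hamiltonian:
 assumes c: "!!t. t : {0..1} ==> formal_coisotropic S N l J (s t)"
  and \<eta>: "!!i. famL (%t. \<eta> t i)"
  and h: "!!t m. t : {0..1} ==> form_eq S N l 1
     (form1 (%x. vector_derivative (%t. s t m x) (at t within {0..1})))
     (P_map S N l (exp_ad_eps 1 (%i. I_map S N (form1 (s t i))) (%i. ham_der J (\<eta> t i)) m))"
 shows "gauge_equivalent S N l J (%i x. - s 0 i x) (%i x. - s 1 i x)"
 unfolding gauge_equivalent_def
proof (intro exI conjI ballI allI)
 let ?\<eta> = "%t i. res (expo (%i. Dv (s t i)) (\<eta> t) i)"
 show "smooth_family S N (%t. (%t i x. - s t i x) t i)" for i by (simp add: SN.family_uminus sf)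
 show fam: "smooth_family S l (%t. ?\<eta> t i)" for i by (rule res_family[OF expo_family[OF \<eta>]])
 fix t assume t: "t : {0..1::real}"
 show "formal_deformation S N ((%t i x. - s t i x) t)"
  using fdt[OF t] SN.section_uminus by (simp add: formal_deformation_def)
 fix m
 interpret d: deformed S N l J "s t" by (rule at_time[OF t])
 show "form_eq S N l 1
     (form1 (%x. vector_derivative (%t. (%t i x. - s t i x) t m x) (at t within {0..1})))
     (%x \<alpha>s. \<Sum>k\<le>m. (1 / fact k) *\<^sub>R
       mbr_eps S N l J (replicate k (%i. (1, form1 ((%t i x. - s t i x) t i))) @ [%i. (0, form0 (?\<eta> t i))]) m x \<alpha>s)"
  unfolding form_eq_1
 proof (intro ballI)
  fix x \<alpha> assume x: "x : pts S" and \<alpha>: "\<alpha> : conormal N l x"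
  have "vector_derivative (%t. - s t m x) (at t within {0..1}) = - s' t m x"
   by (rule SN.vd_within_unit[OF has_vector_derivative_minus[OF SN.family_derivative[OF sf t]] t])
  then have "form1 (%x. vector_derivative (%t. - s t m x) (at t within {0..1})) x [\<alpha>] = - \<alpha> (s' t m x)"
   by (simp add: form1_def conormal_minus[OF \<alpha> s'_fib[OF t x]])
  also have "\<alpha> (s' t m x) = P_map S N l (exp_ad_eps 1 (%i. I_map S N (form1 (s t i))) (%i. ham_der J (\<eta> t i)) m) x [\<alpha>]"
   using h[OF t, of m] x \<alpha> unfolding form_eq_1 by (simp add: form1_def SN.dfam_def)
  also have "\<dots> = (\<Sum>i\<le>m. d.Js (m - i) (expo (%i. Dv (s t i)) (\<eta> t) i) (rep x \<alpha>) (x, 0))"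
   by (rule d.ham_rhs[OF TL.family_section[OF \<eta> t] x \<alpha>])
  also have "\<dots> = (\<Sum>i\<le>m. d.Js (m - i) (pb (?\<eta> t i)) (rep x \<alpha>) (x, 0))"
   using c[OF t] d.formal_coisotropic_iff
   by (intro sum.cong refl d.Js_restrict x \<alpha> TL.family_section[OF expo_family[OF \<eta>] t]) blast
  also have "- \<dots> = (\<Sum>k\<le>m. (1 / fact k) *\<^sub>R
    mbr_eps S N l J (replicate k (%i. (1, form1 (%x. - s t i x))) @ [%i. (0, form0 (?\<eta> t i))]) m x [\<alpha>])"
   by (rule d.gauge_rhs[OF Sl.family_section[OF fam t] x \<alpha>, symmetric])
  finally show "form1 (%x. vector_derivative (%t. (%t i x. - s t i x) t m x) (at t within {0..1})) x [\<alpha>] =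
   (\<Sum>k\<le>m. (1 / fact k) *\<^sub>R
    mbr_eps S N l J (replicate k (%i. (1, form1 ((%t i x. - s t i x) t i))) @ [%i. (0, form0 (?\<eta> t i))]) m x [\<alpha>])" .
 qed
qed simp_all

context
 fixes \<eta> :: "real => nat => 'p => 'w"
 assumes \<eta>: "!!i. smooth_family S l (%t. \<eta> t i)"
  and gauge: "!!t m. t : {0..1} ==> form_eq S N l 1
     (form1 (%x. vector_derivative (%t. - s t m x) (at t within {0..1})))
     (%x \<alpha>s. \<Sum>k\<le>m. (1 / fact k) *\<^sub>R
       mbr_eps S N l J (replicate k (%i. (1, form1 (%x. - s t i x))) @ [%i. (0, form0 (\<eta> t i))]) m x \<alpha>s)"
begin

lemma gauge_flow:
 assumes t: "t : {0..1}" and x: "x : pts S" and \<alpha>: "\<alpha> : conormal N l x"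
 shows "\<alpha> (s' t m x) = (\<Sum>j\<le>m. JT t (m - j) (pb (\<eta> t j)) (rep x \<alpha>) (x, 0))"
proof -
 interpret d: deformed S N l J "s t" by (rule at_time[OF t])
 have "vector_derivative (%t. - s t m x) (at t within {0..1}) = - s' t m x"
  by (rule SN.vd_within_unit[OF has_vector_derivative_minus[OF SN.family_derivative[OF sf t]] t])
 then have "- \<alpha> (s' t m x) = form1 (%x. vector_derivative (%t. - s t m x) (at t within {0..1})) x [\<alpha>]"
  by (simp add: form1_def conormal_minus[OF \<alpha> s'_fib[OF t x]])
 also have "\<dots> = (\<Sum>k\<le>m. (1 / fact k) *\<^sub>R
   mbr_eps S N l J (replicate k (%i. (1, form1 (%x. - s t i x))) @ [%i. (0, form0 (\<eta> t i))]) m x [\<alpha>])"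
  using gauge[OF t, of m] x \<alpha> unfolding form_eq_1 by blast
 also have "\<dots> = - (\<Sum>j\<le>m. d.Js (m - j) (pb (\<eta> t j)) (rep x \<alpha>) (x, 0))"
  by (rule d.gauge_rhs[OF Sl.family_section[OF \<eta> t] x \<alpha>])
 finally show ?thesis using JT_Js[OF t] by simp
qed

lemma coisotropy_preserved:
 assumes cS: "compact_space (mfd_topology S)" and c0: "!!m. COIS 0 m" and t: "t : {0..1}"
 shows "COIS t m"
 using t
proof (induction m arbitrary: t rule: less_induct)
 case (less m)
 let ?\<theta> = "%t j. pb (\<eta> t j)"
 have \<theta>s: "?\<theta> t j : \<Gamma>L" if "t : {0..1}" for t j by (rule pb_section[OF Sl.family_section[OF \<eta> that]])
 have flow: "Dv (s' t k) \<mu> (x, 0) = (\<Sum>j\<le>k. JT t (k - j) (?\<theta> t j) \<mu> (x, 0))"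
  if t: "t : {0..1}" and x: "x : pts S" and \<mu>: "\<mu> : Z" for t k x \<mu>
 proof -
  interpret d: deformed S N l J "s t" by (rule at_time[OF t])
  have "Dv (s' t k) \<mu> (x, 0) = vert_der \<mu> (x, 0) (s' t k x)" using zero_M[OF x] by (simp add: Dv_def)
  also have "\<dots> = (\<Sum>j\<le>k. JT t (k - j) (?\<theta> t j) (rep x (vert_der \<mu> (x, 0))) (x, 0))"
   by (rule gauge_flow[OF t x vert_der_conormal[OF Z_sec[OF \<mu>] x]])
  also have "\<dots> = (\<Sum>j\<le>k. JT t (k - j) (?\<theta> t j) \<mu> (x, 0))"
   by (intro sum.cong refl d.rep_vert x \<mu> fo_JT(2) t \<theta>s)
  finally show ?thesis .
 qed
 have \<theta>Z: "J [?\<theta> t 0, \<kappa>] : Z" if t: "t : {0..1}" and \<kappa>: "\<kappa> : Z" for t \<kappa>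
 proof -
  have "Dv (%x. 0) \<kappa> (x, 0) = 0" for x
   using fun_cong[OF Dv_lin_dir[OF s'_section[OF t, of 0] s'_section[OF t, of 0] Z_sec[OF \<kappa>], of 0 0], of "(x, 0)"] by simp
  then have "J [?\<theta> t 0, \<kappa>] (x, 0) = 0" if "x : pts S" for x
   using flow[OF t that \<kappa>, of 0] formal_bracket.J_0[OF bracket_at_time[OF t] \<theta>s[OF t] Z_sec[OF \<kappa>]] by (simp add: s'_0[OF t])
  then show ?thesis using J_ops(1)[OF \<theta>s[OF t] Z_sec[OF \<kappa>]] by (simp add: Z_def)
 qed
 have eqn: "((%t. JT t m \<mu> \<nu> (x, 0)) has_vector_derivative
    - J [?\<theta> t 0, JT t m \<mu> \<nu>] (x, 0) + JT t m (J [?\<theta> t 0, \<mu>]) \<nu> (x, 0) + JT t m \<mu> (J [?\<theta> t 0, \<nu>]) (x, 0)) (at t within {0..1})"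
  if t: "t : {0..1}" and x: "x : pts S" and \<mu>: "\<mu> : Z" and \<nu>: "\<nu> : Z" for t x \<mu> \<nu>
 proof -
  interpret d: deformed S N l J "s t" by (rule at_time[OF t])
  note Jd = JT_Js[OF t]
  have c: "d.cois k" if "k < m" for k using less.IH[OF that t] unfolding d.cois_def COIS_def Jd .
  have "Dv (s' t k) \<mu> (x, 0) = (\<Sum>j\<le>k. d.Js (k - j) (?\<theta> t j) \<mu> (x, 0))" if "x : pts S" "\<mu> : Z" for k x \<mu>
   unfolding Jd by (rule flow[OF t that])
  from d.transport_equation[OF \<theta>s[OF t] s'_section[OF t] s'_0[OF t] this c \<mu> \<nu> x]
  show ?thesis using JT_time(2)[OF Z_sec[OF \<mu>] Z_sec[OF \<nu>] t, of m "(x, 0)"] unfolding Jd by simp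
 qed
 show ?case
  by (rule propagation[OF cS local_propagation[OF pb_family[OF \<eta>] \<theta>Z eqn] c0 less.prems])
qed

lemma hamiltonian_of_gauge:
 assumes cS: "compact_space (mfd_topology S)" and c0: "formal_coisotropic S N l J (s 0)"
 shows "hamiltonian_equivalent S N l J (s 0) (s 1)"
 unfolding hamiltonian_equivalent_def
proof (intro exI conjI ballI allI)
 show "smooth_family S N (%t. s t i)" for i by (rule sf)
 show "famL (%t. (%t i. pb (\<eta> t i)) t i)" for i by (rule pb_family[OF \<eta>])
 fix t assume t: "t : {0..1::real}"
 have "COIS 0 m" for m using c0 COIS_iff[of 0] by simp
 then show "formal_coisotropic S N l J (s t)" using COIS_iff[OF t] coisotropy_preserved[OF cS _ t] by blast
 fix m
 interpret d: deformed S N l J "s t" by (rule at_time[OF t])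
 show "form_eq S N l 1
     (form1 (%x. vector_derivative (%t. s t m x) (at t within {0..1})))
     (P_map S N l (exp_ad_eps 1 (%i. I_map S N (form1 (s t i))) (%i. ham_der J ((%t i. pb (\<eta> t i)) t i)) m))"
  unfolding form_eq_1
 proof (intro ballI)
  fix x \<alpha> assume x: "x : pts S" and \<alpha>: "\<alpha> : conormal N l x"
  have "form1 (%x. vector_derivative (%t. s t m x) (at t within {0..1})) x [\<alpha>] = \<alpha> (s' t m x)"
   by (simp add: form1_def SN.dfam_def)
  also have "\<dots> = (\<Sum>i\<le>m. d.Js (m - i) (pb (\<eta> t i)) (rep x \<alpha>) (x, 0))"
   unfolding JT_Js[OF t] by (rule gauge_flow[OF t x \<alpha>])
  also have "\<dots> = P_map S N l (exp_ad_eps 1 (%i. I_map S N (form1 (s t i))) (%i. ham_der J (pb (\<eta> t i))) m) x [\<alpha>]"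
   unfolding d.ham_rhs[of "%i. pb (\<eta> t i)", OF pb_section[OF Sl.family_section[OF \<eta> t]] x \<alpha>] d.expo_pb ..
  finally show "form1 (%x. vector_derivative (%t. s t m x) (at t within {0..1})) x [\<alpha>] =
   P_map S N l (exp_ad_eps 1 (%i. I_map S N (form1 (s t i))) (%i. ham_der J ((%t i. pb (\<eta> t i)) t i)) m) x [\<alpha>]" .
 qed
qed simp_all

end

end

theorem proposition4p20:
  fixes S :: "'p mfd"
    and N :: "('p, 'v::real_normed_vector) vbun"
    and l :: "('p, 'w::real_normed_vector) vbun"
    and J :: "('p \<times> 'v, 'w) mop"
    and s0 s1 :: "nat \<Rightarrow> 'p \<Rightarrow> 'v"
  assumes "smooth_manifold S" and "compact_space (mfd_topology S)"
    and "vector_bundle S N" and "line_bundle S l"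
    and "jacobi_structure (total_space S N) (pullback N l) J"
    and "coisotropic_zero_section S N l J"
    and "formal_coisotropic S N l J s0" and "formal_coisotropic S N l J s1"
  shows "hamiltonian_equivalent S N l J s0 s1 \<longleftrightarrow>
     MC_solution S N l J (\<lambda>i x. - s0 i x) \<and> MC_solution S N l J (\<lambda>i x. - s1 i x) \<and>
     gauge_equivalent S N l J (\<lambda>i x. - s0 i x) (\<lambda>i x. - s1 i x)"
proof -
  interpret jacobi_bundle S N l J by unfold_locales (fact assms)+
  have MC: "MC_solution S N l J (\<lambda>i x. - s i x)" if "formal_coisotropic S N l J s" for s
  proof -
    interpret d: deformed S N l J s by unfold_locales (use that in \<open>simp add: formal_coisotropic_def\<close>)
    show ?thesis using that d.formal_coisotropic_iff by (intro d.MC_solution_of_cois) blast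
  qed
  have "gauge_equivalent S N l J (\<lambda>i x. - s0 i x) (\<lambda>i x. - s1 i x)" if h: "hamiltonian_equivalent S N l J s0 s1"
  proof -
    obtain s \<eta> where s: "\<forall>t\<in>{0..1}. formal_coisotropic S N l J (s t)" "\<forall>i. smooth_family S N (\<lambda>t. s t i)"
      and e: "s 0 = s0" "s 1 = s1" and \<eta>: "\<forall>i. smooth_family M L (\<lambda>t. \<eta> t i)"
      and f: "\<forall>t\<in>{0..1}. \<forall>m. form_eq S N l 1
           (form1 (\<lambda>x. vector_derivative (\<lambda>t. s t m x) (at t within {0..1})))
           (P_map S N l (exp_ad_eps 1 (\<lambda>i. I_map S N (form1 (s t i))) (\<lambda>i. ham_der J (\<eta> t i)) m))"
      using h unfolding hamiltonian_equivalent_def by blast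
    interpret ev: evolving S N l J s by unfold_locales (use s in \<open>auto simp: formal_coisotropic_def\<close>)
    have "gauge_equivalent S N l J (\<lambda>i x. - s 0 i x) (\<lambda>i x. - s 1 i x)"
      by (rule ev.gauge_of_hamiltonian[where \<eta>=\<eta>]) (use s \<eta> f in blast)+
    then show ?thesis by (simp add: e)
  qed
  moreover have "hamiltonian_equivalent S N l J s0 s1" if g: "gauge_equivalent S N l J (\<lambda>i x. - s0 i x) (\<lambda>i x. - s1 i x)"
  proof -
    obtain \<xi> \<eta> where x: "\<forall>t\<in>{0..1}. formal_deformation S N (\<xi> t)" "\<forall>i. smooth_family S N (\<lambda>t. \<xi> t i)"
      and e: "\<xi> 0 = (\<lambda>i x. - s0 i x)" "\<xi> 1 = (\<lambda>i x. - s1 i x)" and \<eta>: "\<forall>i. smooth_family S l (\<lambda>t. \<eta> t i)"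
      and f: "\<forall>t\<in>{0..1}. \<forall>m. form_eq S N l 1
           (form1 (\<lambda>x. vector_derivative (\<lambda>t. \<xi> t m x) (at t within {0..1})))
           (\<lambda>x \<alpha>s. \<Sum>k\<le>m. (1 / fact k) *\<^sub>R
              mbr_eps S N l J (replicate k (\<lambda>i. (1, form1 (\<xi> t i))) @ [\<lambda>i. (0, form0 (\<eta> t i))]) m x \<alpha>s)"
      using g unfolding gauge_equivalent_def by blast
    define s where "s t i x = - \<xi> t i x" for t i x
    have sx: "(\<lambda>x. - s t i x) = \<xi> t i" "- s t i x = \<xi> t i x" for t i x by (simp_all add: s_def)
    have se: "s 0 = s0" "s 1 = s1" using e by (auto simp: s_def fun_eq_iff)
    interpret ev: evolving S N l J s
    proof
      show "formal_deformation S N (s t)" if "t \<in> {0..1}" for t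
        using bspec[OF x(1) that] SN.section_uminus by (simp add: formal_deformation_def s_def[abs_def])
      show "smooth_family S N (\<lambda>t. s t i)" for i
        using SN.family_uminus[OF x(2)[THEN spec, of i]] by (simp add: s_def[abs_def])
    qed
    have "hamiltonian_equivalent S N l J (s 0) (s 1)"
    proof (rule ev.hamiltonian_of_gauge[where \<eta>=\<eta>, OF _ _ assms(2)])
      show "smooth_family S l (\<lambda>t. \<eta> t i)" for i using \<eta> by blast
      show "formal_coisotropic S N l J (s 0)" using assms(7) by (simp add: se)
      show "form_eq S N l 1
           (form1 (\<lambda>x. vector_derivative (\<lambda>t. - s t m x) (at t within {0..1})))
           (\<lambda>x \<alpha>s. \<Sum>k\<le>m. (1 / fact k) *\<^sub>R
              mbr_eps S N l J (replicate k (\<lambda>i. (1, form1 (\<lambda>x. - s t i x))) @ [\<lambda>i. (0, form0 (\<eta> t i))]) m x \<alpha>s)"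
        if "t \<in> {0..1}" for t m
        using f that unfolding sx by blast
    qed
    then show ?thesis by (simp add: se)
  qed
  ultimately show ?thesis using MC assms(7,8) by blast
qed

end
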